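(* Let $F$ be a finite field of characteristic $p$ with $|F| = q = p^k$, let $F_2$ denote the extension field of $F$ of degree $2$ (so $|F_2| = q^2$), and let $G = C_3 \times D_{10}$, where $D_{10}$ is the dihedral group of order $10$. Let $U(FG)$ be the unit group of the group algebra $FG$, and let $V = 1 + J(FG)$, where $J(FG)$ is the Jacobson radical of $FG$. (1) If $p = 2$, then $$U(FG) \cong \begin{cases} C_2^{3k} \rtimes \big( C_{2^k-1}^{3} \times GL(2,F)^6 \big), & \text{if } q \equiv 1, 4 \pmod{15};\\ C_2^{3k} \rtimes \big( C_{2^k-1} \times C_{2^{2k}-1} \times GL(2,F_2)^3 \big), & \text{if } q \equiv 2, -7 \pmod{15}. \end{cases}$$ (2) If $p = 5$, then $$U(FG) \cong V \rtimes \begin{cases} C_{5^k-1}^6, & \text{if } q \equiv 1 \pmod 6;\\ C_{5^k-1}^2 \times C_{5^{2k}-1}^2, & \text{if } q \equiv -1 \pmod 6, \end{cases}$$ where $V \cong (C_5^{15k} \rtimes C_5^{6k}) \rtimes C_5^{3k}$ and the center of $V$ satisfies $Z(V) \cong C_5^{9k}$. (3) If $p > 5$, then $$U(FG) \cong \begin{cases} C_{p^k-1}^{6} \times GL(2,F)^6, & \text{if } q \equiv 1, -11 \pmod{30};\\ C_{p^k-1}^2 \times C_{p^{2k}-1}^2 \times GL(2,F)^2 \times GL(2,F_2)^2, & \text{if } q \equiv -1, 11 \pmod{30};\\ C_{p^k-1}^6 \times GL(2,F_2)^3, & \text{if } q \equiv 7, 13 \pmod{30};\\ C_{p^k-1}^2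 \times C_{p^{2k}-1}^2 \times GL(2,F_2)^3, & \text{if } q \equiv -7, -13 \pmod{30}. \end{cases}$$
   Context: $C_n$ denotes the cyclic group of order $n$, and for a group $H$ and a positive integer $m$, $H^m$ denotes the direct product of $m$ copies of $H$. The subscript in $D_{10}$ is the order of the group, so $G = C_3 \times D_{10}$ has order $30$, with presentation $G = \langle x, y, z \mid x^2 = y^5 = z^3 = 1,\ xy = y^4x,\ xz = zx,\ yz = zy \rangle$. $GL(2,K)$ is the group of invertible $2\times 2$ matrices over a field $K$. $F_2$ is the degree-$2$ extension of $F$ (not the field with two elements). $N \rtimes H$ denotes a semidirect product with normal subgroup $N$ and complement $H$; an isomorphism with $N \rtimes H$ asserts that the group is isomorphic to the semidirect product of $N$ by $H$ for some action of $H$ on $N$ (the action is not specified). *)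

theory Defs
  imports "HOL-Algebra.Algebra" "HOL-Number_Theory.Cong"
begin

abbreviation Cyc :: "nat \<Rightarrow> int monoid" where
  "Cyc n \<equiv> integer_mod_group n"

abbreviation direct_power ::
    "('a, 'm) monoid_scheme \<Rightarrow> nat \<Rightarrow> (nat \<Rightarrow> 'a) monoid" (infixr "\<^bold>^" 85) where
  "H \<^bold>^ m \<equiv> product_group {..<m} (\<lambda>_. H)"

definition semidirect_product ::
    "('a, 'm) monoid_scheme \<Rightarrow> ('b, 'n) monoid_scheme \<Rightarrow> ('b \<Rightarrow> 'a \<Rightarrow> 'a) \<Rightarrow> ('a \<times> 'b) monoid" where
  "semidirect_product N H \<phi> =
     \<lparr>carrier = carrier N \<times> carrier H,
      monoid.mult = (\<lambda>(a, h) (b, k). (a \<otimes>\<^bsub>N\<^esub> \<phi> h b, h \<otimes>\<^bsub>H\<^esub> k)),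
      one = (\<one>\<^bsub>N\<^esub>, \<one>\<^bsub>H\<^esub>)\<rparr>"

definition iso_semidirect ::
    "('c, 'l) monoid_scheme \<Rightarrow> ('a, 'm) monoid_scheme \<Rightarrow> ('b, 'n) monoid_scheme \<Rightarrow> bool" where
  "iso_semidirect U N H \<longleftrightarrow> (\<exists>\<phi> \<in> hom H (AutoGroup N). U \<cong> semidirect_product N H \<phi>)"

text \<open>The dihedral group of order \<open>2 * n\<close>: the generator of \<open>C\<^sub>2\<close> acts on \<open>C\<^sub>n\<close> by inversion.\<close>

definition dihedral_group :: "nat \<Rightarrow> (int \<times> int) monoid" where
  "dihedral_group n = semidirect_product (Cyc n) (Cyc 2)
     (\<lambda>s\<in>carrier (Cyc 2). \<lambda>a\<in>carrier (Cyc n). if s = 0 then a else inv\<^bsub>Cyc n\<^esub> a)"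

definition group_algebra ::
    "('a, 'm) ring_scheme \<Rightarrow> ('g, 'n) monoid_scheme \<Rightarrow> ('g \<Rightarrow> 'a) ring" where
  "group_algebra R G =
     \<lparr>carrier = {f \<in> carrier G \<rightarrow>\<^sub>E carrier R. finite {g \<in> carrier G. f g \<noteq> \<zero>\<^bsub>R\<^esub>}},
      monoid.mult = (\<lambda>f h. \<lambda>g\<in>carrier G.
        (\<Oplus>\<^bsub>R\<^esub> a \<in> {a \<in> carrier G. f a \<noteq> \<zero>\<^bsub>R\<^esub>}. f a \<otimes>\<^bsub>R\<^esub> h (inv\<^bsub>G\<^esub> a \<otimes>\<^bsub>G\<^esub> g))),
      one = (\<lambda>g\<in>carrier G. if g = \<one>\<^bsub>G\<^esub> then \<one>\<^bsub>R\<^esub> else \<zero>\<^bsub>R\<^esub>),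
      ring.zero = (\<lambda>g\<in>carrier G. \<zero>\<^bsub>R\<^esub>),
      ring.add = (\<lambda>f h. \<lambda>g\<in>carrier G. f g \<oplus>\<^bsub>R\<^esub> h g)\<rparr>"

definition left_ideal :: "'a set \<Rightarrow> ('a, 'm) ring_scheme \<Rightarrow> bool" where
  "left_ideal I R \<longleftrightarrow>
     additive_subgroup I R \<and> (\<forall>x \<in> carrier R. \<forall>a \<in> I. x \<otimes>\<^bsub>R\<^esub> a \<in> I)"

definition maximal_left_ideal :: "'a set \<Rightarrow> ('a, 'm) ring_scheme \<Rightarrow> bool" where
  "maximal_left_ideal I R \<longleftrightarrow>
     left_ideal I R \<and> I \<noteq> carrier R \<and>
     (\<forall>L. left_ideal L R \<and> I \<subseteq> L \<longrightarrow> L = I \<or> L = carrier R)"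

text \<open>Intersecting with the carrier matters only if there is no maximal left ideal.\<close>

definition jacobson_radical :: "('a, 'm) ring_scheme \<Rightarrow> 'a set" where
  "jacobson_radical R = carrier R \<inter> \<Inter> {I. maximal_left_ideal I R}"

definition center_group :: "('a, 'm) monoid_scheme \<Rightarrow> ('a, 'm) monoid_scheme" where
  "center_group G =
     G\<lparr>carrier := {z \<in> carrier G. \<forall>g \<in> carrier G. z \<otimes>\<^bsub>G\<^esub> g = g \<otimes>\<^bsub>G\<^esub> z}\<rparr>"

definition matrix_monoid :: "nat \<Rightarrow> ('a, 'm) ring_scheme \<Rightarrow> (nat \<times> nat \<Rightarrow> 'a) monoid" where
  "matrix_monoid n R =
     \<lparr>carrier = {..<n} \<times> {..<n} \<rightarrow>\<^sub>E carrier R,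
      monoid.mult = (\<lambda>A B. \<lambda>(i, j) \<in> {..<n} \<times> {..<n}. (\<Oplus>\<^bsub>R\<^esub> l \<in> {..<n}. A (i, l) \<otimes>\<^bsub>R\<^esub> B (l, j))),
      one = (\<lambda>(i, j) \<in> {..<n} \<times> {..<n}. if i = j then \<one>\<^bsub>R\<^esub> else \<zero>\<^bsub>R\<^esub>)\<rparr>"

definition GL :: "nat \<Rightarrow> ('a, 'm) ring_scheme \<Rightarrow> (nat \<times> nat \<Rightarrow> 'a) monoid" where
  "GL n R = units_of (matrix_monoid n R)"

text \<open>The library's additive order of an element is \<open>0\<close> if that order is infinite, as required.\<close>

definition ring_char :: "('a, 'm) ring_scheme \<Rightarrow> nat" where
  "ring_char R = group.ord (add_monoid R) \<one>\<^bsub>R\<^esub>"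

text \<open>The embedding need not be an inclusion, so the two fields may live on different types.\<close>

definition field_extension_of_degree ::
    "nat \<Rightarrow> ('a, 'm) ring_scheme \<Rightarrow> ('b, 'n) ring_scheme \<Rightarrow> bool" where
  "field_extension_of_degree d F K \<longleftrightarrow>
     field F \<and> field K \<and>
     (\<exists>\<iota> \<in> ring_hom F K. ring.dimension K d (\<iota> ` carrier F) (carrier K))"

end

theory Submission
  imports Defs "HOL-Decision_Procs.Algebra_Aux"
begin

text \<open>
  Evaluating the generator of \<open>C\<^sub>3\<close> at a cube root of unity \<open>\<zeta>\<close> maps \<open>FG\<close> to the group algebra of \<open>D\<^sub>1\<^sub>0\<close>
  over \<open>F(\<zeta>)\<close>. If \<open>5\<close> is invertible, \<open>L D\<^sub>1\<^sub>0\<close> is the direct product of \<open>L C\<^sub>2\<close> and of the algebras generated by the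
  companion matrix of \<open>T\<^sup>2 - \<tau> T + 1\<close> and a reflection, where \<open>\<tau>\<close> runs through the roots of \<open>\<tau>\<^sup>2 + \<tau> = 1\<close>, the sums of a
  primitive fifth root of unity and its inverse. So everything depends on whether \<open>\<zeta>\<close> and \<open>\<tau>\<close> lie in \<open>F\<close> or only in its quadratic extension.
  In every case the map from \<open>FG\<close> to the product of the components is injective, and bijective by counting.

  In characteristic \<open>5\<close> let \<open>R\<close> be the group algebra of \<open>C\<^sub>3\<close>, a product of fields, and \<open>B = R \<times> R\<close> that of
  \<open>C\<^sub>3 \<times> C\<^sub>2\<close>. Sending the rotation \<open>y\<close> to the truncated exponential of \<open>w\<close> identifies \<open>FG\<close> with the skew polynomials
  \<open>B[w]/(w\<^sup>5)\<close>, where moving \<open>w\<close> past a coefficient swaps the two factors of \<open>B\<close>. The radical is generated by \<open>w\<close>, so \<open>V\<close> is the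
  explicit group of one-units of this ring, in which subgroups, complements and the centre can be read off coefficientwise.
\<close>

section \<open>Direct, iterated and semidirect products\<close>

text \<open>Counting replaces central idempotents: an injective multiplicative map from
  \<open>FG\<close> into a structure with \<open>q^30\<close> elements is bijective, so no
  decomposition theory enters. What remains is the computation of kernels, which are small linear
  systems solved by hand. In characteristic 2 only the units of \<open>L C_2\<close> change: they
  become the additive group times the units of \<open>L\<close>, so the semidirect product is there
  even direct. Moreover T^2 + T - 1 = T^2 + T + 1, hence \<tau> can be taken to be a cube root of
  unity and only \<open>q\<close> modulo 3 matters. For odd \<open>q\<close> prime to 5, \<tau> lies
  in \<open>F\<close> exactly when \<open>q\<close> is 1 or -1 modulo 5. This is decided without
  automorphisms: the conjugate of an element is the other root of its quadratic equation, and the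
  multiplicative group of the extension is cyclic. In characteristic 5 the reflection inverts
  \<open>y\<close>, hence negates \<open>w\<close>, the logarithm of \<open>y\<close>; this is the
  source of the swap. The exponential makes sense because the denominators 2, 6, 24 are invertible
  modulo 5, and \<open>w^5 = 0\<close> cuts it off.\<close>

lemma DirProd_assoc_iso: "(G \<times>\<times> H) \<times>\<times> I \<cong> G \<times>\<times> (H \<times>\<times> I)"
proof (rule is_isoI)
  show "(\<lambda>((x, y), z). (x, (y, z))) \<in> iso ((G \<times>\<times> H) \<times>\<times> I) (G \<times>\<times> (H \<times>\<times> I))"
    by (rule isoI, force simp: hom_def, rule bij_betw_byWitness[where f' = "\<lambda>(x, (y, z)). ((x, y), z)"]) auto
qed

lemma DirProd_cong_iso:
  assumes "G \<cong> G'" "H \<cong> H'"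
  shows "G \<times>\<times> H \<cong> G' \<times>\<times> H'"
proof -
  obtain f g where fg: "f \<in> iso G G'" "g \<in> iso H H'"
    using assms by (auto simp: is_iso_def)
  have hom: "(\<lambda>(x, y). (f x, g y)) \<in> hom (G \<times>\<times> H) (G' \<times>\<times> H')"
    using fg by (auto simp: hom_def iso_def)
  have "bij_betw (\<lambda>(x, y). (f x, g y)) (carrier (G \<times>\<times> H)) (carrier (G' \<times>\<times> H'))"
    using fg bij_betw_map_prod[of f "carrier G" "carrier G'" g "carrier H" "carrier H'"]
    by (simp add: iso_def map_prod_def)
  with hom have "(\<lambda>(x, y). (f x, g y)) \<in> iso (G \<times>\<times> H) (G' \<times>\<times> H')"
    by (simp add: iso_def)
  then show ?thesis by (rule is_isoI)
qed

lemma DirProd_interchange_iso: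
  "(A \<times>\<times> B) \<times>\<times> (C \<times>\<times> D) \<cong> (A \<times>\<times> C) \<times>\<times> (B \<times>\<times> D)"
proof (rule is_isoI)
  show "(\<lambda>((a, b), (c, d)). ((a, c), (b, d))) \<in>
      iso ((A \<times>\<times> B) \<times>\<times> (C \<times>\<times> D)) ((A \<times>\<times> C) \<times>\<times> (B \<times>\<times> D))"
    by (rule isoI, force simp: hom_def, rule bij_betw_byWitness[where f' = "\<lambda>((a, b), (c, d)). ((a, c), (b, d))"]) auto
qed

lemma power_one_iso: "H \<cong> H \<^bold>^ 1"
proof (rule is_isoI)
  show "(\<lambda>x. \<lambda>i\<in>{..<1::nat}. x) \<in> iso H (H \<^bold>^ 1)"
  proof (rule isoI)
    show "bij_betw (\<lambda>x. \<lambda>i\<in>{..<1::nat}. x) (carrier H) (carrier (H \<^bold>^ 1))"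
    proof (rule bij_betw_byWitness[where f' = "\<lambda>f. f 0"])
      show "\<forall>f\<in>carrier (H \<^bold>^ 1). (\<lambda>i\<in>{..<1}. f 0) = f"
      proof
        fix f assume "f \<in> carrier (H \<^bold>^ 1)"
        then show "(\<lambda>i\<in>{..<1}. f 0) = f"
          by (intro extensionalityI[where A = "{..<1}"]) (auto simp: PiE_iff)
      qed
    qed (auto simp: PiE_iff extensional_def split: if_splits)
    show "(\<lambda>x. \<lambda>i\<in>{..<1::nat}. x) \<in> hom H (H \<^bold>^ 1)"
      by (rule homI) auto
  qed
qed

lemma power_add_iso: "H \<^bold>^ m \<times>\<times> H \<^bold>^ n \<cong> H \<^bold>^ (m + n)"
proof (rule is_isoI)
  define f :: "(nat \<Rightarrow> 'a) \<times> (nat \<Rightarrow> 'a) \<Rightarrow> nat \<Rightarrow> 'a" where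
    "f = (\<lambda>a. \<lambda>i\<in>{..<m + n}. if i < m then fst a i else snd a (i - m))"
  define g :: "(nat \<Rightarrow> 'a) \<Rightarrow> (nat \<Rightarrow> 'a) \<times> (nat \<Rightarrow> 'a)" where
    "g = (\<lambda>v. (\<lambda>i\<in>{..<m}. v i, \<lambda>i\<in>{..<n}. v (i + m)))"
  have f_in: "f a \<in> carrier (H \<^bold>^ (m + n))" if "a \<in> carrier (H \<^bold>^ m \<times>\<times> H \<^bold>^ n)" for a
    using that by (cases a) (simp add: PiE_iff f_def)
  have f_apply: "f a i = (if i < m then fst a i else snd a (i - m))" if "i < m + n" for a i
    using that by (simp add: f_def)
  have f_ext: "f a \<in> extensional {..<m + n}" for a by (simp add: f_def)
  show "f \<in> iso (H \<^bold>^ m \<times>\<times> H \<^bold>^ n) (H \<^bold>^ (m + n))"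
  proof (rule isoI)
    show "bij_betw f (carrier (H \<^bold>^ m \<times>\<times> H \<^bold>^ n)) (carrier (H \<^bold>^ (m + n)))"
    proof (rule bij_betw_byWitness[where f' = g])
      show "\<forall>a\<in>carrier (H \<^bold>^ m \<times>\<times> H \<^bold>^ n). g (f a) = a"
      proof
        fix a assume a: "a \<in> carrier (H \<^bold>^ m \<times>\<times> H \<^bold>^ n)"
        then have ext: "fst a \<in> extensional {..<m}" "snd a \<in> extensional {..<n}"
          by (cases a, simp add: PiE_iff)+
        have "fst (g (f a)) = fst a"
          by (rule extensionalityI[where A = "{..<m}"]) (simp_all add: g_def f_apply ext)
        moreover have "snd (g (f a)) = snd a"
          by (rule extensionalityI[where A = "{..<n}"]) (simp_all add: g_def f_apply ext)
        ultimately show "g (f a) = a" by (simp only: prod_eq_iff)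
      qed
      show "\<forall>v\<in>carrier (H \<^bold>^ (m + n)). f (g v) = v"
      proof
        fix v assume v: "v \<in> carrier (H \<^bold>^ (m + n))"
        show "f (g v) = v"
          by (rule extensionalityI[where A = "{..<m + n}"])
             (use v in \<open>auto simp: PiE_iff f_apply f_ext g_def\<close>)
      qed
      show "f ` carrier (H \<^bold>^ m \<times>\<times> H \<^bold>^ n) \<subseteq> carrier (H \<^bold>^ (m + n))"
        using f_in by (rule image_subsetI)
      show "g ` carrier (H \<^bold>^ (m + n)) \<subseteq> carrier (H \<^bold>^ m \<times>\<times> H \<^bold>^ n)"
        by (rule image_subsetI) (simp add: PiE_iff g_def)
    qed
    show "f \<in> hom (H \<^bold>^ m \<times>\<times> H \<^bold>^ n) (H \<^bold>^ (m + n))"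
    proof (rule homI)
      fix a b
      show "f (a \<otimes>\<^bsub>H \<^bold>^ m \<times>\<times> H \<^bold>^ n\<^esub> b) = f a \<otimes>\<^bsub>H \<^bold>^ (m + n)\<^esub> f b"
        by (rule extensionalityI[where A = "{..<m + n}"])
           (auto simp: mult_DirProd' f_apply f_ext)
    qed (rule f_in)
  qed
qed

lemma power_two_iso: "H \<times>\<times> H \<cong> H \<^bold>^ 2"
  using iso_trans[OF DirProd_cong_iso[OF power_one_iso power_one_iso] power_add_iso]
  by (simp only: one_add_one)

lemma power_three_iso: "H \<times>\<times> H \<times>\<times> H \<cong> H \<^bold>^ 3"
  using iso_trans[OF DirProd_cong_iso[OF power_one_iso power_two_iso] power_add_iso, of H]
  by (simp only: one_plus_numeral semiring_norm)

section \<open>Unit groups under products and multiplicative bijections\<close>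

lemma Units_DirProd:
  shows "Units (G \<times>\<times> H) = Units G \<times> Units H"
proof -
  have "(\<exists>z \<in> carrier (G \<times>\<times> H). z \<otimes>\<^bsub>G \<times>\<times> H\<^esub> (x, y) = \<one>\<^bsub>G \<times>\<times> H\<^esub> \<and> (x, y) \<otimes>\<^bsub>G \<times>\<times> H\<^esub> z = \<one>\<^bsub>G \<times>\<times> H\<^esub>) \<longleftrightarrow>
      (\<exists>z \<in> carrier G. z \<otimes>\<^bsub>G\<^esub> x = \<one>\<^bsub>G\<^esub> \<and> x \<otimes>\<^bsub>G\<^esub> z = \<one>\<^bsub>G\<^esub>) \<and>
      (\<exists>z \<in> carrier H. z \<otimes>\<^bsub>H\<^esub> y = \<one>\<^bsub>H\<^esub> \<and> y \<otimes>\<^bsub>H\<^esub> z = \<one>\<^bsub>H\<^esub>)" for x y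
    by (simp add: mult_DirProd' Bex_def) blast
  then show ?thesis unfolding Units_def by (auto simp: set_eq_iff)
qed

lemma units_of_DirProd:
  shows "units_of (G \<times>\<times> H) = units_of G \<times>\<times> units_of H"
  using Units_DirProd by (simp add: units_of_def DirProd_def)

text \<open>Injectivity lets \<open>h x * h y = 1\<close> be pulled back to
  \<open>x * y = 1\<close>, so inverses correspond. Only the multiplication appears, because the
  target is usually a \<open>DirProd\<close> of rings, which carries no addition.\<close>

lemma units_of_iso:
  assumes h: "h \<in> hom G H" "bij_betw h (carrier G) (carrier H)" "h \<one>\<^bsub>G\<^esub> = \<one>\<^bsub>H\<^esub>"
    and G: "\<one>\<^bsub>G\<^esub> \<in> carrier G" "\<And>x y. x \<in> carrier G \<Longrightarrow> y \<in> carrier G \<Longrightarrow> x \<otimes>\<^bsub>G\<^esub> y \<in> carrier G"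
  shows "h \<in> iso (units_of G) (units_of H)" "h ` Units G = Units H"
proof -
  have inj: "inj_on h (carrier G)" and surj: "h ` carrier G = carrier H"
    using h(2) by (auto simp: bij_betw_def)
  have hm: "h (x \<otimes>\<^bsub>G\<^esub> y) = h x \<otimes>\<^bsub>H\<^esub> h y" if "x \<in> carrier G" "y \<in> carrier G" for x y
    using h(1) that by (auto simp: hom_def)
  have iff: "h x \<otimes>\<^bsub>H\<^esub> h y = \<one>\<^bsub>H\<^esub> \<longleftrightarrow> x \<otimes>\<^bsub>G\<^esub> y = \<one>\<^bsub>G\<^esub>"
    if "x \<in> carrier G" "y \<in> carrier G" for x y
    using that inj_onD[OF inj, of "x \<otimes>\<^bsub>G\<^esub> y" "\<one>\<^bsub>G\<^esub>"] G by (auto simp flip: hm h(3))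
  show eq: "h ` Units G = Units H"
  proof
    show "h ` Units G \<subseteq> Units H"
      unfolding Units_def using surj iff by blast
    show "Units H \<subseteq> h ` Units G"
    proof
      fix z assume z: "z \<in> Units H"
      then obtain y where y: "y \<in> carrier H" "y \<otimes>\<^bsub>H\<^esub> z = \<one>\<^bsub>H\<^esub>" "z \<otimes>\<^bsub>H\<^esub> y = \<one>\<^bsub>H\<^esub>" "z \<in> carrier H"
        unfolding Units_def by auto
      then obtain x x' where "x \<in> carrier G" "x' \<in> carrier G" "z = h x" "y = h x'"
        using surj by (metis imageE)
      then show "z \<in> h ` Units G"
        using y iff unfolding Units_def by blast
    qed
  qed
  have sub: "Units G \<subseteq> carrier G" by (auto simp: Units_def)
  show "h \<in> iso (units_of G) (units_of H)"
    unfolding iso_def hom_def bij_betw_def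
    using eq hm sub inj_on_subset[OF inj sub] by (auto simp: units_of_def)
qed

text \<open>Induction on \<open>m\<close>: as long as the image of the embedding is smaller than the
  group, an element \<open>g\<close> outside it supplies one more cyclic factor. Since
  \<open>p\<close> is prime, every nontrivial power of \<open>g\<close> generates \<open>g\<close>
  again, so the powers of \<open>g\<close> meet the image only in the identity.\<close>

lemma (in comm_group) elementary_abelian_partial:
  assumes fin: "finite (carrier G)" and p: "Factorial_Ring.prime p"
    and exp: "\<And>x. x \<in> carrier G \<Longrightarrow> x [^] p = \<one>" and ord: "card (carrier G) = p ^ n"
  shows "m \<le> n \<Longrightarrow> \<exists>h \<in> hom (Cyc p \<^bold>^ m) G. inj_on h (carrier (Cyc p \<^bold>^ m))"
proof (induction m)
  case 0
  have "(\<lambda>_. \<one>) \<in> hom (Cyc p \<^bold>^ 0) G" by (auto simp: hom_def)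
  then show ?case by (rule bexI[rotated]) auto
next
  case (Suc m)
  then obtain h where h: "h \<in> hom (Cyc p \<^bold>^ m) G" "inj_on h (carrier (Cyc p \<^bold>^ m))"
    by auto
  have p0: "p > 0" "p > 1" using p prime_gt_0_nat prime_gt_1_nat by auto
  have gC: "group (Cyc p \<^bold>^ m)" by simp
  interpret h: group_hom "Cyc p \<^bold>^ m" G h
    using h(1) gC by (simp add: group_hom_def group_hom_axioms_def is_group)
  let ?I = "h ` carrier (Cyc p \<^bold>^ m)"
  have cardC: "card (carrier (Cyc p \<^bold>^ m)) = p ^ m"
    using p0 by (simp add: card_PiE carrier_integer_mod_group)
  have cardI: "card ?I = p ^ m" using card_image[OF h(2)] cardC by simp
  have "p ^ m < p ^ n" using Suc.prems p0 by (intro power_strict_increasing) auto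
  then have "?I \<noteq> carrier G" using cardI ord by auto
  moreover have "?I \<subseteq> carrier G" by (rule h.hom_closed [THEN image_subsetI])
  ultimately obtain g where g: "g \<in> carrier G" "g \<notin> ?I" by auto
  have sI: "subgroup ?I G" using h.img_is_subgroup .
  \<comment> \<open>Exponents of \<open>g\<close> may be reduced modulo \<open>p\<close>, so the new
    coordinate, which is added modulo \<open>p\<close>, is respected.\<close>
  have gp: "g [^] nat (a mod int p) = g [^] a" for a :: int
  proof -
    have "g [^] a = g [^] (int p * (a div int p) + a mod int p)" by simp
    also have "\<dots> = (g [^] int p) [^] (a div int p) \<otimes> g [^] (a mod int p)"
      using g(1) by (simp only: int_pow_mult int_pow_pow)
    also have "g [^] int p = \<one>" using exp[OF g(1)] by (simp add: int_pow_int)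
    finally show ?thesis using g(1) p0 by (simp add: pow_nat)
  qed
  define f where "f = (\<lambda>v. h (\<lambda>i\<in>{..<m}. v i) \<otimes> g [^] (v m :: int))"
  let ?S = "Cyc p \<^bold>^ Suc m"
  have rC: "(\<lambda>i\<in>{..<m}. v i) \<in> carrier (Cyc p \<^bold>^ m)" if "v \<in> carrier ?S" for v
    using that by (auto simp: PiE_iff)
  have gpi: "g [^] (a mod int p) = g [^] a" for a :: int
    using gp[of a] gp[of "a mod int p"] by simp
  have fhom: "f \<in> hom ?S G"
  proof (rule homI)
    fix v w assume v: "v \<in> carrier ?S" and w: "w \<in> carrier ?S"
    show "f v \<in> carrier G" using v rC g(1) by (simp add: f_def)
    have "(\<lambda>i\<in>{..<m}. (v \<otimes>\<^bsub>?S\<^esub> w) i) =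
        (\<lambda>i\<in>{..<m}. v i) \<otimes>\<^bsub>Cyc p \<^bold>^ m\<^esub> (\<lambda>i\<in>{..<m}. w i)"
      by auto
    moreover have "(v \<otimes>\<^bsub>?S\<^esub> w) m = (v m + w m) mod int p" by simp
    moreover have "h ((\<lambda>i\<in>{..<m}. v i) \<otimes>\<^bsub>Cyc p \<^bold>^ m\<^esub> (\<lambda>i\<in>{..<m}. w i))
        = h (\<lambda>i\<in>{..<m}. v i) \<otimes> h (\<lambda>i\<in>{..<m}. w i)"
      by (rule h.hom_mult[OF rC[OF v] rC[OF w]])
    ultimately have "f (v \<otimes>\<^bsub>?S\<^esub> w) =
        (h (\<lambda>i\<in>{..<m}. v i) \<otimes> h (\<lambda>i\<in>{..<m}. w i)) \<otimes> (g [^] v m \<otimes> g [^] w m)"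
      unfolding f_def using g(1) by (simp only: gpi int_pow_mult)
    then show "f (v \<otimes>\<^bsub>?S\<^esub> w) = f v \<otimes> f w"
      unfolding f_def using h.hom_closed[OF rC[OF v]] h.hom_closed[OF rC[OF w]] g(1)
      by (simp add: m_ac)
  qed
  interpret f: group_hom ?S G f
    using fhom by (simp add: group_hom_def group_hom_axioms_def is_group)
  have "v = \<one>\<^bsub>?S\<^esub>" if v: "v \<in> carrier ?S" "f v = \<one>" for v
  proof -
    have vm: "0 \<le> v m" "v m < int p"
      using v(1) p0 by (auto simp: PiE_iff carrier_integer_mod_group)
    let ?r = "\<lambda>i\<in>{..<m}. v i"
    have hr: "h ?r \<in> carrier G" using h.hom_closed[OF rC[OF v(1)]] .
    have e: "g [^] v m = inv (h ?r)"
    proof (rule inv_equality[symmetric])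
      show "g [^] v m \<otimes> h ?r = \<one>"
        using v(2) inv_comm[OF _ hr int_pow_closed[OF g(1)]] by (simp add: f_def)
    qed (use hr g(1) in simp_all)
    then have inI: "g [^] v m \<in> ?I"
      using rC[OF v(1)] subgroup.m_inv_closed[OF sI] by auto
    \<comment> \<open>A nonzero last coordinate would be prime to \<open>p\<close>; Bezout then
      writes \<open>g\<close> as a power of \<open>g [^] v m\<close>, which lies in the image,
      against the choice of \<open>g\<close>.\<close>
    have v0: "v m = 0"
    proof (rule ccontr)
      assume "v m \<noteq> 0"
      then have "\<not> int p dvd v m" using vm zdvd_not_zless[of "v m" "int p"] by simp
      then have "coprime (v m) (int p)"
        using p prime_imp_coprime[of "int p" "v m"] by (simp add: coprime_commute)
      then obtain a b where ab: "a * v m + b * int p = 1"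
        using bezout_int[of "v m" "int p"] by (auto simp: coprime_iff_gcd_eq_1)
      have "g = g [^] (a * v m + b * int p)" using ab g(1) by simp
      also have "\<dots> = (g [^] v m) [^] a \<otimes> (g [^] int p) [^] b"
        using g(1) by (simp only: int_pow_mult int_pow_pow mult.commute int_pow_closed)
      also have "g [^] int p = \<one>" using exp[OF g(1)] by (simp add: int_pow_int)
      finally have "g = (g [^] v m) [^] a" using g(1) by simp
      moreover have "(g [^] v m) [^] a \<in> ?I"
        by (rule subgroup_int_pow_closed[OF sI inI])
      ultimately show False using g(2) by simp
    qed
    then have "h ?r = \<one>" using v(2) hr by (simp add: f_def)
    then have "?r = \<one>\<^bsub>Cyc p \<^bold>^ m\<^esub>"
      using h.inj_on_one_iff h(2) rC[OF v(1)] by blast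
    then have r0: "v i = 0" if "i < m" for i
      using that by (metis lessThan_iff one_integer_mod_group one_product_group restrict_apply')
    show ?thesis
    proof (rule extensionalityI[where A = "{..<Suc m}"])
      show "v \<in> extensional {..<Suc m}" using v(1) by (simp add: PiE_iff)
      show "v i = \<one>\<^bsub>?S\<^esub> i" if "i \<in> {..<Suc m}" for i
        using that v0 r0[of i] by (cases "i = m") auto
    qed simp
  qed
  then have "inj_on f (carrier ?S)" by (simp only: f.inj_on_one_iff) blast
  with fhom show ?case by blast
qed

text \<open>The partial embedding with \<open>m = n\<close> is onto because both sides have
  \<open>p ^ n\<close> elements.\<close>

lemma (in comm_group) elementary_abelian_iso:
  assumes fin: "finite (carrier G)" and p: "Factorial_Ring.prime p"
    and exp: "\<And>x. x \<in> carrier G \<Longrightarrow> x [^] p = \<one>" and ord: "card (carrier G) = p ^ n"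
  shows "G \<cong> Cyc p \<^bold>^ n"
proof -
  obtain h where h: "h \<in> hom (Cyc p \<^bold>^ n) G" "inj_on h (carrier (Cyc p \<^bold>^ n))"
    using elementary_abelian_partial[OF assms, of n] by auto
  have "p > 0" using p prime_gt_0_nat by auto
  then have "card (carrier (Cyc p \<^bold>^ n)) = p ^ n"
    by (simp add: card_PiE carrier_integer_mod_group)
  then have "card (h ` carrier (Cyc p \<^bold>^ n)) = card (carrier G)"
    using card_image[OF h(2)] ord by simp
  moreover have "h ` carrier (Cyc p \<^bold>^ n) \<subseteq> carrier G" using h(1) by (auto simp: hom_def)
  ultimately have "h ` carrier (Cyc p \<^bold>^ n) = carrier G"
    using fin card_subset_eq by blast
  then have "h \<in> iso (Cyc p \<^bold>^ n) G" using h by (simp add: iso_iff)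
  then have "Cyc p \<^bold>^ n \<cong> G" by (rule is_isoI)
  then show ?thesis by (simp add: group.iso_sym)
qed

lemma (in field) units_of_finite_field_iso:
  assumes "finite (carrier R)"
  shows "units_of R \<cong> Cyc (card (carrier R) - 1)"
proof -
  interpret M: group "Multiplicative_Group.mult_of R" by (rule field_mult_group)
  obtain a where a: "a \<in> carrier (Multiplicative_Group.mult_of R)" "carrier (Multiplicative_Group.mult_of R) = {a [^] i | i::nat. i \<in> UNIV}"
    using finite_field_mult_group_has_gen[OF assms] by blast
  let ?n = "card (carrier R) - 1"
  have fin: "finite (carrier (Multiplicative_Group.mult_of R))" using assms by simp
  have cn: "card (carrier (Multiplicative_Group.mult_of R)) = ?n"
    using order_mult_of[OF assms] by (simp add: order_def)
  have n0: "?n > 0" using cn fin a(1) by (metis card_gt_0_iff empty_iff)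
  have ord: "M.ord a = ?n"
  proof -
    have "carrier (Multiplicative_Group.mult_of R) = generate (Multiplicative_Group.mult_of R) {a}"
      using a(2) M.generate_pow_on_finite_carrier[OF fin a(1)] by (simp add: Multiplicative_Group.nat_pow_mult_of)
    then show ?thesis using M.generate_pow_card[OF a(1)] cn by simp
  qed
  let ?f = "\<lambda>i::int. a [^]\<^bsub>Multiplicative_Group.mult_of R\<^esub> i"
  have eq: "?f i = ?f j \<longleftrightarrow> int ?n dvd (j - i)" for i j
    using M.int_pow_eq[OF a(1)] ord by metis
  have C: "carrier (Cyc ?n) = {0..<int ?n}" using n0 by (simp add: carrier_integer_mod_group)
  have hom: "?f \<in> hom (Cyc ?n) (Multiplicative_Group.mult_of R)"
  proof (rule homI)
    fix i j assume "i \<in> carrier (Cyc ?n)" "j \<in> carrier (Cyc ?n)"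
    have "?f ((i + j) mod int ?n) = ?f (i + j)"
      by (subst eq) (simp add: mod_eq_dvd_iff [symmetric] mod_mod_trivial)
    then show "?f (i \<otimes>\<^bsub>Cyc ?n\<^esub> j) = ?f i \<otimes>\<^bsub>Multiplicative_Group.mult_of R\<^esub> ?f j"
      using a(1) by (simp only: mult_integer_mod_group M.int_pow_mult)
  qed (use a(1) in \<open>simp only: M.int_pow_closed\<close>)
  have "inj_on ?f {0..<int ?n}"
  proof (rule inj_onI)
    fix i j assume ij: "i \<in> {0..<int ?n}" "j \<in> {0..<int ?n}" "?f i = ?f j"
    then have "int ?n dvd j - i" using eq by simp
    then have "j mod int ?n = i mod int ?n" by (simp add: mod_eq_dvd_iff)
    then show "i = j" using ij(1,2) by simp
  qed
  moreover have "?f ` {0..<int ?n} \<subseteq> carrier (Multiplicative_Group.mult_of R)" using a(1) by (auto simp only: M.int_pow_closed)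
  ultimately have "?f ` {0..<int ?n} = carrier (Multiplicative_Group.mult_of R)"
    using card_subset_eq[OF fin] card_image[of ?f "{0..<int ?n}"] cn by simp
  then have "?f \<in> iso (Cyc ?n) (Multiplicative_Group.mult_of R)"
    using hom \<open>inj_on ?f _\<close> C by (simp add: iso_iff)
  then have "Cyc ?n \<cong> Multiplicative_Group.mult_of R" by (rule is_isoI)
  then show ?thesis by (simp add: group.iso_sym flip: mult_of_is_Units)
qed


section \<open>Semidirect products, external and internal, and centres\<close>

lemma semidirect_simps [simp]:
  "carrier (semidirect_product N H \<phi>) = carrier N \<times> carrier H"
  "(a, h) \<otimes>\<^bsub>semidirect_product N H \<phi>\<^esub> (b, k) = (a \<otimes>\<^bsub>N\<^esub> \<phi> h b, h \<otimes>\<^bsub>H\<^esub> k)"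
  "\<one>\<^bsub>semidirect_product N H \<phi>\<^esub> = (\<one>\<^bsub>N\<^esub>, \<one>\<^bsub>H\<^esub>)"
  by (simp_all add: semidirect_product_def)

text \<open>Elements of \<open>AutoGroup N\<close> have a fixed default value outside
  \<open>carrier N\<close>, which is why each \<open>\<phi> h\<close> must be extensional and why
  equality of automorphisms reduces to equality on the carrier.\<close>

lemma hom_AutoGroupI:
  assumes "\<And>h. h \<in> carrier H \<Longrightarrow> \<phi> h \<in> hom N N"
    and "\<And>h. h \<in> carrier H \<Longrightarrow> \<phi> h \<in> extensional (carrier N)"
    and "\<And>h. h \<in> carrier H \<Longrightarrow> bij_betw (\<phi> h) (carrier N) (carrier N)"
    and "\<And>h k a. h \<in> carrier H \<Longrightarrow> k \<in> carrier H \<Longrightarrow> a \<in> carrier N \<Longrightarrow> \<phi> (h \<otimes>\<^bsub>H\<^esub> k) a = \<phi> h (\<phi> k a)"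
    and "\<And>h k. h \<in> carrier H \<Longrightarrow> k \<in> carrier H \<Longrightarrow> h \<otimes>\<^bsub>H\<^esub> k \<in> carrier H"
  shows "\<phi> \<in> hom H (AutoGroup N)"
proof (rule homI)
  fix h assume h: "h \<in> carrier H"
  show "\<phi> h \<in> carrier (AutoGroup N)"
    using assms(1-3)[OF h] by (simp add: AutoGroup_def auto_def Bij_def)
  fix k assume k: "k \<in> carrier H"
  have "\<phi> (h \<otimes>\<^bsub>H\<^esub> k) = compose (carrier N) (\<phi> h) (\<phi> k)"
    by (rule extensionalityI[where A = "carrier N"])
       (use assms h k in \<open>auto simp: compose_eq\<close>)
  then show "\<phi> (h \<otimes>\<^bsub>H\<^esub> k) = \<phi> h \<otimes>\<^bsub>AutoGroup N\<^esub> \<phi> k"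
    using assms(1-3)[OF h] assms(1-3)[OF k] by (simp add: AutoGroup_def BijGroup_def Bij_def)
qed

lemma hom_AutoGroupD:
  assumes "\<phi> \<in> hom H (AutoGroup N)" "h \<in> carrier H"
  shows "\<phi> h \<in> hom N N" "\<phi> h \<in> extensional (carrier N)" "bij_betw (\<phi> h) (carrier N) (carrier N)"
    "k \<in> carrier H \<Longrightarrow> a \<in> carrier N \<Longrightarrow> \<phi> (h \<otimes>\<^bsub>H\<^esub> k) a = \<phi> h (\<phi> k a)"
proof -
  have c: "\<phi> l \<in> hom N N \<inter> Bij (carrier N)" if "l \<in> carrier H" for l
    using assms(1) that by (auto simp: hom_def AutoGroup_def auto_def)
  show "\<phi> h \<in> hom N N" "\<phi> h \<in> extensional (carrier N)" "bij_betw (\<phi> h) (carrier N) (carrier N)"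
    using c[OF assms(2)] by (auto simp: Bij_def)
  assume k: "k \<in> carrier H" "a \<in> carrier N"
  have "\<phi> (h \<otimes>\<^bsub>H\<^esub> k) = compose (carrier N) (\<phi> h) (\<phi> k)"
    using hom_mult[OF assms k(1)] c[OF assms(2)] c[OF k(1)]
    by (simp add: AutoGroup_def BijGroup_def)
  then show "\<phi> (h \<otimes>\<^bsub>H\<^esub> k) a = \<phi> h (\<phi> k a)" using k(2) by (simp add: compose_eq)
qed

lemma semidirect_group:
  assumes N: "group N" and H: "group H" and \<phi>: "\<phi> \<in> hom H (AutoGroup N)"
  shows "group (semidirect_product N H \<phi>)"
proof -
  interpret N: group N by fact
  interpret H: group H by fact
  note D = hom_AutoGroupD[OF \<phi>]
  have cl [simp]: "\<phi> h a \<in> carrier N" if "h \<in> carrier H" "a \<in> carrier N" for h a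
    using D(1)[OF that(1)] that(2) by (auto simp: hom_def)
  have mult [simp]: "\<phi> h (a \<otimes>\<^bsub>N\<^esub> b) = \<phi> h a \<otimes>\<^bsub>N\<^esub> \<phi> h b"
    if "h \<in> carrier H" "a \<in> carrier N" "b \<in> carrier N" for h a b
    using D(1)[OF that(1)] that(2,3) by (auto simp: hom_def)
  \<comment> \<open>An idempotent injective map is the identity, and \<open>\<phi> \<one>\<close> is
    both.\<close>
  have one [simp]: "\<phi> \<one>\<^bsub>H\<^esub> a = a" if a: "a \<in> carrier N" for a
  proof -
    have "\<phi> \<one>\<^bsub>H\<^esub> (\<phi> \<one>\<^bsub>H\<^esub> a) = \<phi> \<one>\<^bsub>H\<^esub> a" using D(4)[of "\<one>\<^bsub>H\<^esub>" "\<one>\<^bsub>H\<^esub>" a] a by simp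
    then show ?thesis
      using D(3)[of "\<one>\<^bsub>H\<^esub>"] a by (auto simp: bij_betw_def inj_on_def)
  qed
  have oneN [simp]: "\<phi> h \<one>\<^bsub>N\<^esub> = \<one>\<^bsub>N\<^esub>" if "h \<in> carrier H" for h
    using hom_one[OF D(1)[OF that] N N] .
  show ?thesis
  proof (rule groupI)
    fix x assume "x \<in> carrier (semidirect_product N H \<phi>)"
    then obtain a h where x: "x = (a, h)" "a \<in> carrier N" "h \<in> carrier H" by auto
    have "(\<phi> (inv\<^bsub>H\<^esub> h) (inv\<^bsub>N\<^esub> a), inv\<^bsub>H\<^esub> h) \<otimes>\<^bsub>semidirect_product N H \<phi>\<^esub> x = \<one>\<^bsub>semidirect_product N H \<phi>\<^esub>"
      using x by (simp add: mult[symmetric] del: mult)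
    then show "\<exists>y\<in>carrier (semidirect_product N H \<phi>). y \<otimes>\<^bsub>semidirect_product N H \<phi>\<^esub> x = \<one>\<^bsub>semidirect_product N H \<phi>\<^esub>"
      using x by (intro bexI[of _ "(\<phi> (inv\<^bsub>H\<^esub> h) (inv\<^bsub>N\<^esub> a), inv\<^bsub>H\<^esub> h)"]) simp_all
  qed (auto simp: N.m_assoc H.m_assoc D(4))
qed

text \<open>\<open>H\<close> acts on \<open>N\<close> by conjugation and \<open>(a, h)\<close> goes
  to the product \<open>a h\<close>. The trivial intersection makes this injective; surjectivity,
  that is \<open>G = N H\<close>, comes from the cardinality.\<close>

lemma (in group) iso_semidirect_internal:
  assumes fin: "finite (carrier G)" and N: "N \<lhd> G" and H: "subgroup H G"
    and NH: "N \<inter> H \<subseteq> {\<one>}" and card: "card (carrier G) = card N * card H"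
  shows "iso_semidirect G (G\<lparr>carrier := N\<rparr>) (G\<lparr>carrier := H\<rparr>)"
proof -
  let ?N = "G\<lparr>carrier := N\<rparr>" and ?H = "G\<lparr>carrier := H\<rparr>"
  interpret N: normal N G by fact
  have Nsub: "N \<subseteq> carrier G" and Hsub: "H \<subseteq> carrier G"
    using N.subset subgroup.subset[OF H] by auto
  have Nc [simp]: "a \<in> carrier G" if "a \<in> N" for a using that Nsub by auto
  have Hc [simp]: "a \<in> carrier G" if "a \<in> H" for a using that Hsub by auto
  define \<phi> where "\<phi> = (\<lambda>h. \<lambda>a\<in>N. h \<otimes> a \<otimes> inv h)"
  have cl: "h \<otimes> a \<otimes> inv h \<in> N" if "h \<in> H" "a \<in> N" for h a
    using N.inv_op_closed2 that by simp
  have \<phi>: "\<phi> \<in> hom ?H (AutoGroup ?N)"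
  proof (rule hom_AutoGroupI)
    fix h assume "h \<in> carrier ?H" then have h: "h \<in> H" by simp
    then have hi: "inv h \<in> H" using subgroup.m_inv_closed[OF H] by simp
    show "\<phi> h \<in> hom ?N ?N"
      by (rule homI) (use h cl in \<open>auto simp: \<phi>_def m_assoc inv_solve_left\<close>)
    show "\<phi> h \<in> extensional (carrier ?N)" by (simp add: \<phi>_def)
    have canc: "inv h \<otimes> (h \<otimes> a) = a" "h \<otimes> (inv h \<otimes> a) = a" if "a \<in> carrier G" for a
      using h that by (simp_all flip: m_assoc)
    have cl': "inv h \<otimes> a \<otimes> h \<in> N" if "a \<in> N" for a
      using cl[OF hi that] h by simp
    show "bij_betw (\<phi> h) (carrier ?N) (carrier ?N)"
      by (rule bij_betw_byWitness[where f' = "\<phi> (inv h)"])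
         (use h hi cl cl' canc in \<open>auto simp: \<phi>_def m_assoc\<close>)
    fix k a assume "k \<in> carrier ?H" "a \<in> carrier ?N"
    then show "\<phi> (h \<otimes>\<^bsub>?H\<^esub> k) a = \<phi> h (\<phi> k a)"
      using h cl by (simp add: \<phi>_def m_assoc inv_mult_group)
  next
    show "h \<otimes>\<^bsub>?H\<^esub> k \<in> carrier ?H" if "h \<in> carrier ?H" "k \<in> carrier ?H" for h k
      using that subgroup.m_closed[OF H] by simp
  qed
  let ?S = "semidirect_product ?N ?H \<phi>"
  let ?f = "\<lambda>(a, h). a \<otimes> h"
  have hom: "?f \<in> hom ?S G"
  proof (rule homI)
    fix u v assume "u \<in> carrier ?S" "v \<in> carrier ?S"
    then obtain a h b k where uv: "u = (a, h)" "v = (b, k)" "a \<in> N" "h \<in> H" "b \<in> N" "k \<in> H" by auto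
    then show "?f u \<in> carrier G" by simp
    have "inv h \<otimes> (h \<otimes> k) = k" using uv by (simp flip: m_assoc)
    then show "?f (u \<otimes>\<^bsub>?S\<^esub> v) = ?f u \<otimes> ?f v" using uv by (simp add: \<phi>_def m_assoc)
  qed
  have "inj_on ?f (N \<times> H)"
  proof (rule inj_onI, clarify)
    fix a h b k assume *: "a \<in> N" "h \<in> H" "b \<in> N" "k \<in> H" "a \<otimes> h = b \<otimes> k"
    have "inv b \<otimes> a = inv b \<otimes> (a \<otimes> h) \<otimes> inv h" using *(1-4) by (simp add: m_assoc)
    also have "\<dots> = inv b \<otimes> (b \<otimes> k) \<otimes> inv h" by (simp only: *(5))
    also have "\<dots> = (inv b \<otimes> b) \<otimes> k \<otimes> inv h" using *(1-4) by (simp only: m_assoc m_closed inv_closed Nc Hc)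
    also have "\<dots> = k \<otimes> inv h" using *(1-4) by simp
    finally have "inv b \<otimes> a = k \<otimes> inv h" .
    moreover have "inv b \<otimes> a \<in> N" "k \<otimes> inv h \<in> H"
      using * N.m_closed N.m_inv_closed subgroup.m_closed[OF H] subgroup.m_inv_closed[OF H] by auto
    ultimately have "inv b \<otimes> a = \<one>" "k \<otimes> inv h = \<one>" using NH by auto
    then show "a = b \<and> h = k"
      using * inv_solve_left'[of "\<one>" b a] inv_solve_right'[of "\<one>" k h] by auto
  qed
  moreover have "?f ` (N \<times> H) \<subseteq> carrier G" by auto
  ultimately have "?f ` (N \<times> H) = carrier G"
    using card_subset_eq[OF fin] card_image[of ?f "N \<times> H"] card by (simp add: card_cartesian_product)
  then have "?f \<in> iso ?S G" using hom \<open>inj_on ?f _\<close> by (simp add: iso_iff)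
  then have "?S \<cong> G" by (rule is_isoI)
  moreover have "group ?S"
    using \<phi> N.subgroup_is_group subgroup.subgroup_is_group[OF H] is_group by (intro semidirect_group) auto
  ultimately show ?thesis
    unfolding iso_semidirect_def using \<phi> group.iso_sym by blast
qed

text \<open>The action is transported: \<open>h\<close> in \<open>H'\<close> acts on
  \<open>N'\<close> as the conjugate by \<open>f\<close> of the action of \<open>g' h\<close> on
  \<open>N\<close>.\<close>

lemma iso_semidirect_cong:
  assumes "iso_semidirect U N H" "group N" "group H" "N \<cong> N'" "H \<cong> H'"
  shows "iso_semidirect U N' H'"
proof -
  interpret N: group N by fact
  interpret H: group H by fact
  obtain \<phi> where \<phi>: "\<phi> \<in> hom H (AutoGroup N)" and U: "U \<cong> semidirect_product N H \<phi>"
    using assms(1) by (auto simp: iso_semidirect_def)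
  obtain f g where f: "f \<in> iso N N'" and g: "g \<in> iso H H'"
    using assms(4,5) by (auto simp: is_iso_def)
  define f' where "f' = inv_into (carrier N) f"
  define g' where "g' = inv_into (carrier H) g"
  have f': "f' \<in> iso N' N" and g': "g' \<in> iso H' H"
    using N.iso_set_sym[OF f] H.iso_set_sym[OF g] by (simp_all add: f'_def g'_def)
  have fb: "bij_betw f (carrier N) (carrier N')" and gb: "bij_betw g (carrier H) (carrier H')"
    and f'b: "bij_betw f' (carrier N') (carrier N)" and g'b: "bij_betw g' (carrier H') (carrier H)"
    using f g f' g' by (auto simp: iso_def)
  have fc: "f a \<in> carrier N'" if "a \<in> carrier N" for a
    using f that by (auto simp: iso_def hom_def)
  have fm: "f (a \<otimes>\<^bsub>N\<^esub> b) = f a \<otimes>\<^bsub>N'\<^esub> f b" if "a \<in> carrier N" "b \<in> carrier N" for a b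
    using f that by (auto simp: iso_def hom_def)
  have gc: "g a \<in> carrier H'" if "a \<in> carrier H" for a
    using g that by (auto simp: iso_def hom_def)
  have gm: "g (a \<otimes>\<^bsub>H\<^esub> b) = g a \<otimes>\<^bsub>H'\<^esub> g b" if "a \<in> carrier H" "b \<in> carrier H" for a b
    using g that by (auto simp: iso_def hom_def)
  have f'c: "f' a \<in> carrier N" if "a \<in> carrier N'" for a
    using f' that by (auto simp: iso_def hom_def)
  have f'm: "f' (a \<otimes>\<^bsub>N'\<^esub> b) = f' a \<otimes>\<^bsub>N\<^esub> f' b" if "a \<in> carrier N'" "b \<in> carrier N'" for a b
    using f' that by (auto simp: iso_def hom_def)
  have g'c: "g' a \<in> carrier H" if "a \<in> carrier H'" for a
    using g' that by (auto simp: iso_def hom_def)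
  have g'm: "g' (a \<otimes>\<^bsub>H'\<^esub> b) = g' a \<otimes>\<^bsub>H\<^esub> g' b" if "a \<in> carrier H'" "b \<in> carrier H'" for a b
    using g' that by (auto simp: iso_def hom_def)
  have f'f: "f' (f a) = a" if "a \<in> carrier N" for a
    using fb that by (simp add: f'_def bij_betw_def)
  have g'g: "g' (g a) = a" if "a \<in> carrier H" for a
    using gb that by (simp add: g'_def bij_betw_def)
  have ff': "f (f' a) = a" if "a \<in> carrier N'" for a
    using bij_betw_inv_into_right[OF fb that] by (simp add: f'_def)
  have gg': "g (g' a) = a" if "a \<in> carrier H'" for a
    using bij_betw_inv_into_right[OF gb that] by (simp add: g'_def)
  note D = hom_AutoGroupD[OF \<phi>]
  have \<phi>c: "\<phi> h a \<in> carrier N" if "h \<in> carrier H" "a \<in> carrier N" for h a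
    using D(1)[OF that(1)] that(2) by (auto simp: hom_def)
  have \<phi>m: "\<phi> h (a \<otimes>\<^bsub>N\<^esub> b) = \<phi> h a \<otimes>\<^bsub>N\<^esub> \<phi> h b"
    if "h \<in> carrier H" "a \<in> carrier N" "b \<in> carrier N" for h a b
    using D(1)[OF that(1)] that(2,3) by (auto simp: hom_def)
  define \<psi> where "\<psi> = (\<lambda>h. \<lambda>a\<in>carrier N'. f (\<phi> (g' h) (f' a)))"
  have \<psi>: "\<psi> \<in> hom H' (AutoGroup N')"
  proof (rule hom_AutoGroupI)
    fix h assume h: "h \<in> carrier H'"
    \<comment> \<open>\<open>N'\<close> is only known to be isomorphic to a group; its closure under
      products is read off through \<open>f\<close>.\<close>
    have Nm: "a \<otimes>\<^bsub>N'\<^esub> b \<in> carrier N'" if "a \<in> carrier N'" "b \<in> carrier N'" for a b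
      using fm[of "f' a" "f' b"] fc[of "f' a \<otimes>\<^bsub>N\<^esub> f' b"] f'c that by (simp add: ff')
    show "\<psi> h \<in> hom N' N'"
      by (rule homI) (use h g'c f'c fc f'm fm \<phi>c \<phi>m Nm in \<open>auto simp: \<psi>_def\<close>)
    show "\<psi> h \<in> extensional (carrier N')" by (simp add: \<psi>_def)
    have "bij_betw (f \<circ> (\<phi> (g' h) \<circ> f')) (carrier N') (carrier N')"
      by (rule bij_betw_trans[OF bij_betw_trans[OF f'b D(3)] fb]) (use h g'c in auto)
    then show "bij_betw (\<psi> h) (carrier N') (carrier N')"
      by (rule bij_betw_cong[THEN iffD1, rotated]) (simp add: \<psi>_def)
    fix k a assume k: "k \<in> carrier H'" "a \<in> carrier N'"
    then show "\<psi> (h \<otimes>\<^bsub>H'\<^esub> k) a = \<psi> h (\<psi> k a)"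
      using h by (simp add: \<psi>_def g'm g'c f'c fc \<phi>c D(4) f'f)
  next
    show "h \<otimes>\<^bsub>H'\<^esub> k \<in> carrier H'" if "h \<in> carrier H'" "k \<in> carrier H'" for h k
      using gm[of "g' h" "g' k"] gc[of "g' h \<otimes>\<^bsub>H\<^esub> g' k"] g'c that by (simp add: gg')
  qed
  have "(\<lambda>(a, h). (f a, g h)) \<in> iso (semidirect_product N H \<phi>) (semidirect_product N' H' \<psi>)"
  proof (rule isoI)
    show "(\<lambda>(a, h). (f a, g h)) \<in> hom (semidirect_product N H \<phi>) (semidirect_product N' H' \<psi>)"
      by (rule homI) (auto simp: fm gm fc gc \<psi>_def f'f g'g \<phi>c)
    show "bij_betw (\<lambda>(a, h). (f a, g h)) (carrier (semidirect_product N H \<phi>)) (carrier (semidirect_product N' H' \<psi>))"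
      using bij_betw_map_prod[OF fb gb] by (simp add: map_prod_def)
  qed
  then have "U \<cong> semidirect_product N' H' \<psi>"
    using U iso_trans is_isoI by blast
  then show ?thesis using \<psi> by (auto simp: iso_semidirect_def)
qed

lemma iso_semidirect_trans:
  assumes "U \<cong> U'" "iso_semidirect U' N H"
  shows "iso_semidirect U N H"
  using assms iso_trans by (auto simp: iso_semidirect_def)

text \<open>The trivial action. In characteristic 2 the unit group is found as a direct product and
  put into semidirect form by this.\<close>

lemma iso_semidirect_DirProd:
  assumes "group N" "group H"
  shows "iso_semidirect (N \<times>\<times> H) N H"
proof -
  have "(\<lambda>_. \<lambda>a\<in>carrier N. a) \<in> hom H (AutoGroup N)"
    using assms by (intro hom_AutoGroupI homI)
      (auto simp: bij_betw_def group_def monoid.m_closed intro!: inj_onI)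
  moreover have "(\<lambda>x. x) \<in> iso (N \<times>\<times> H) (semidirect_product N H (\<lambda>_. \<lambda>a\<in>carrier N. a))"
    using assms by (auto simp: iso_def hom_def bij_betw_def group_def monoid.m_closed)
  ultimately show ?thesis by (auto simp: iso_semidirect_def is_iso_def)
qed

text \<open>An injective homomorphism both preserves and reflects the relation of commuting. Closure
  of \<open>G\<close> is enough here, so this applies before \<open>V\<close> is known to be a
  group.\<close>

lemma center_group_iso:
  assumes "h \<in> iso G H" "\<And>x y. x \<in> carrier G \<Longrightarrow> y \<in> carrier G \<Longrightarrow> x \<otimes>\<^bsub>G\<^esub> y \<in> carrier G"
  shows "h \<in> iso (center_group G) (center_group H)"
proof -
  have inj: "inj_on h (carrier G)" and surj: "h ` carrier G = carrier H"
    and hm: "\<And>x y. x \<in> carrier G \<Longrightarrow> y \<in> carrier G \<Longrightarrow> h (x \<otimes>\<^bsub>G\<^esub> y) = h x \<otimes>\<^bsub>H\<^esub> h y"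
    using assms(1) by (auto simp: iso_def bij_betw_def hom_def)
  have iff: "h x \<otimes>\<^bsub>H\<^esub> h y = h y \<otimes>\<^bsub>H\<^esub> h x \<longleftrightarrow> x \<otimes>\<^bsub>G\<^esub> y = y \<otimes>\<^bsub>G\<^esub> x"
    if "x \<in> carrier G" "y \<in> carrier G" for x y
    using inj_on_eq_iff[OF inj] assms(2) that by (simp flip: hm)
  have eq: "h ` carrier (center_group G) = carrier (center_group H)"
  proof
    show "h ` carrier (center_group G) \<subseteq> carrier (center_group H)"
      using iff by (auto simp: center_group_def simp flip: surj)
    show "carrier (center_group H) \<subseteq> h ` carrier (center_group G)"
      using iff by (fastforce simp: center_group_def simp flip: surj)
  qed
  have sub: "carrier (center_group G) \<subseteq> carrier G" by (auto simp: center_group_def)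
  show ?thesis
  proof (rule isoI)
    show "bij_betw h (carrier (center_group G)) (carrier (center_group H))"
      using eq inj_on_subset[OF inj sub] by (simp add: bij_betw_def)
    show "h \<in> hom (center_group G) (center_group H)"
    proof (rule homI)
      fix x y assume xy: "x \<in> carrier (center_group G)" "y \<in> carrier (center_group G)"
      show "h x \<in> carrier (center_group H)" using imageI[OF xy(1), of h] by (simp only: eq)
      show "h (x \<otimes>\<^bsub>center_group G\<^esub> y) = h x \<otimes>\<^bsub>center_group H\<^esub> h y"
        using hm[OF subsetD[OF sub xy(1)] subsetD[OF sub xy(2)]] by (simp add: center_group_def)
    qed
  qed
qed

section \<open>Group algebras and representations of \<open>C\<^sub>3 \<times> D\<^sub>1\<^sub>0\<close>\<close>

declare pow_nat [simp del]

lemma (in abelian_monoid) finsum_swap: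
  assumes "finite A" "finite B" "\<And>a b. a \<in> A \<Longrightarrow> b \<in> B \<Longrightarrow> f a b \<in> carrier G"
  shows "(\<Oplus>a\<in>A. \<Oplus>b\<in>B. f a b) = (\<Oplus>b\<in>B. \<Oplus>a\<in>A. f a b)"
  using assms(1,3)
proof (induction A rule: finite_induct)
  case empty
  then show ?case by simp
next
  case (insert x F)
  have "(\<Oplus>a\<in>insert x F. \<Oplus>b\<in>B. f a b) = (\<Oplus>b\<in>B. f x b) \<oplus> (\<Oplus>b\<in>B. \<Oplus>a\<in>F. f a b)"
    using insert by (simp add: Pi_iff)
  also have "\<dots> = (\<Oplus>b\<in>B. f x b \<oplus> (\<Oplus>a\<in>F. f a b))"
    using insert by (subst finsum_addf) (auto simp: Pi_iff)
  also have "\<dots> = (\<Oplus>b\<in>B. \<Oplus>a\<in>insert x F. f a b)"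
    using insert by (intro finsum_cong') (auto simp: Pi_iff)
  finally show ?case .
qed

lemma (in abelian_monoid) finsum_Times:
  assumes "finite A" "finite B" "\<And>a b. a \<in> A \<Longrightarrow> b \<in> B \<Longrightarrow> f (a, b) \<in> carrier G"
  shows "finsum G f (A \<times> B) = (\<Oplus>a\<in>A. \<Oplus>b\<in>B. f (a, b))"
  using assms(1,3)
proof (induction A rule: finite_induct)
  case empty
  then show ?case by simp
next
  case (insert x F)
  have "finsum G f (insert x F \<times> B) = finsum G f (({x} \<times> B) \<union> (F \<times> B))"
    by (rule arg_cong[where f = "finsum G f"]) auto
  also have "\<dots> = finsum G f ({x} \<times> B) \<oplus> finsum G f (F \<times> B)"
    using insert assms(2) by (intro finsum_Un_disjoint) (auto simp: Pi_iff)
  also have "finsum G f ({x} \<times> B) = (\<Oplus>b\<in>B. f (x, b))"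
  proof -
    have "{x} \<times> B = Pair x ` B" by auto
    then show ?thesis
      using insert.prems by (simp add: finsum_reindex[of f "Pair x" B] inj_on_def Pi_iff)
  qed
  also have "finsum G f (F \<times> B) = (\<Oplus>a\<in>F. \<Oplus>b\<in>B. f (a, b))"
    using insert by auto
  finally show ?case
    using insert by (simp add: Pi_iff)
qed

lemma ring_hom_finsum:
  assumes "ring R" "ring S" "h \<in> ring_hom R S" "f \<in> A \<rightarrow> carrier R"
  shows "h (finsum R f A) = finsum S (h \<circ> f) A"
proof -
  interpret ring_hom_ring R S h
    using assms by (intro ring_hom_ringI2) auto
  show ?thesis using hom_finsum[OF assms(4)] .
qed

section \<open>Finite group algebras and linear extension of representations\<close>

locale finite_group_algebra = R: cring R + G: group G
  for R :: "('a, 'm) ring_scheme" and G :: "('g, 'n) monoid_scheme" +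
  assumes finG: "finite (carrier G)"
begin

abbreviation RG :: "('g \<Rightarrow> 'a) ring" where "RG \<equiv> group_algebra R G"

lemma carrier_RG: "carrier RG = (carrier G \<rightarrow>\<^sub>E carrier R)"
  using finG by (auto simp: group_algebra_def)

lemma RG_val [simp]: "f \<in> carrier RG \<Longrightarrow> g \<in> carrier G \<Longrightarrow> f g \<in> carrier R"
  by (auto simp: carrier_RG)

lemma RG_add: "f \<oplus>\<^bsub>RG\<^esub> h = (\<lambda>g\<in>carrier G. f g \<oplus>\<^bsub>R\<^esub> h g)"
  and RG_zero: "\<zero>\<^bsub>RG\<^esub> = (\<lambda>g\<in>carrier G. \<zero>\<^bsub>R\<^esub>)"
  and RG_one: "\<one>\<^bsub>RG\<^esub> = (\<lambda>g\<in>carrier G. if g = \<one>\<^bsub>G\<^esub> then \<one>\<^bsub>R\<^esub> else \<zero>\<^bsub>R\<^esub>)"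
  by (simp_all add: group_algebra_def)

text \<open>The sum over the support of \<open>f\<close> may run over the whole finite group, since
  the additional summands vanish; a fixed index set is what allows sums to be swapped later.\<close>

lemma RG_mult:
  assumes "f \<in> carrier RG" "h \<in> carrier RG"
  shows "f \<otimes>\<^bsub>RG\<^esub> h =
    (\<lambda>g\<in>carrier G. \<Oplus>\<^bsub>R\<^esub>a\<in>carrier G. f a \<otimes>\<^bsub>R\<^esub> h (inv\<^bsub>G\<^esub> a \<otimes>\<^bsub>G\<^esub> g))"
proof -
  have "(\<Oplus>\<^bsub>R\<^esub>a\<in>{a \<in> carrier G. f a \<noteq> \<zero>\<^bsub>R\<^esub>}. f a \<otimes>\<^bsub>R\<^esub> h (inv\<^bsub>G\<^esub> a \<otimes>\<^bsub>G\<^esub> g)) =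
      (\<Oplus>\<^bsub>R\<^esub>a\<in>carrier G. f a \<otimes>\<^bsub>R\<^esub> h (inv\<^bsub>G\<^esub> a \<otimes>\<^bsub>G\<^esub> g))" if "g \<in> carrier G" for g
    using assms that finG by (intro R.add.finprod_mono_neutral_cong_left) (auto simp: Pi_iff)
  then show ?thesis
    by (auto simp: group_algebra_def intro!: restrict_ext)
qed

lemma RG_one_closed: "\<one>\<^bsub>RG\<^esub> \<in> carrier RG"
  by (auto simp: RG_one carrier_RG)

lemma RG_mult_closed: "f \<in> carrier RG \<Longrightarrow> h \<in> carrier RG \<Longrightarrow> f \<otimes>\<^bsub>RG\<^esub> h \<in> carrier RG"
  unfolding RG_mult by (auto simp: carrier_RG intro!: R.finsum_closed)

text \<open>Only the additive laws are checked directly. The multiplication is accessed through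
  representations, and in characteristic 5 the ring laws are transported back from the skew
  polynomials.\<close>

lemma RG_abelian_group: "abelian_group RG"
proof (rule abelian_groupI)
  fix f assume f: "f \<in> carrier RG"
  have "(\<lambda>g\<in>carrier G. \<ominus>\<^bsub>R\<^esub> f g) \<in> carrier RG" using f by (auto simp: carrier_RG)
  moreover have "(\<lambda>g\<in>carrier G. \<ominus>\<^bsub>R\<^esub> f g) \<oplus>\<^bsub>RG\<^esub> f = \<zero>\<^bsub>RG\<^esub>"
    unfolding RG_add RG_zero using f by (intro restrict_ext) (simp add: R.l_neg)
  ultimately show "\<exists>h\<in>carrier RG. h \<oplus>\<^bsub>RG\<^esub> f = \<zero>\<^bsub>RG\<^esub>" by blast
next
  fix f assume f: "f \<in> carrier RG"
  show "\<zero>\<^bsub>RG\<^esub> \<oplus>\<^bsub>RG\<^esub> f = f"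
    by (rule extensionalityI[where A = "carrier G"])
       (use f in \<open>simp_all add: RG_add RG_zero carrier_RG PiE_iff\<close>)
qed (simp_all add: RG_add RG_zero carrier_RG PiE_iff R.a_ac cong: restrict_cong)

lemma card_RG: "card (carrier RG) = card (carrier R) ^ card (carrier G)"
  using finG by (simp add: carrier_RG card_PiE)

end

text \<open>The data of the universal property of a group algebra. \<open>A\<close> may be
  noncommutative, so scalars have to commute with the image of the group; \<open>lift\<close> is the
  resulting linear extension.\<close>

locale group_algebra_rep = finite_group_algebra R G + A: ring A
  for R :: "('a, 'm) ring_scheme" and G :: "('g, 'n) monoid_scheme" and A :: "('c, 'k) ring_scheme" +
  fixes \<iota> :: "'a \<Rightarrow> 'c" and \<rho> :: "'g \<Rightarrow> 'c"
  assumes \<iota>: "\<iota> \<in> ring_hom R A" and \<rho>: "\<rho> \<in> hom G A" and \<rho>_one: "\<rho> \<one>\<^bsub>G\<^esub> = \<one>\<^bsub>A\<^esub>"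
    and central: "\<And>a g. a \<in> carrier R \<Longrightarrow> g \<in> carrier G \<Longrightarrow> \<rho> g \<otimes>\<^bsub>A\<^esub> \<iota> a = \<iota> a \<otimes>\<^bsub>A\<^esub> \<rho> g"
begin

definition lift :: "('g \<Rightarrow> 'a) \<Rightarrow> 'c" where
  "lift f = (\<Oplus>\<^bsub>A\<^esub>g\<in>carrier G. \<iota> (f g) \<otimes>\<^bsub>A\<^esub> \<rho> g)"

lemma iota_closed [simp]: "a \<in> carrier R \<Longrightarrow> \<iota> a \<in> carrier A"
  using \<iota> by (simp add: ring_hom_closed)

lemma rho_closed [simp]: "g \<in> carrier G \<Longrightarrow> \<rho> g \<in> carrier A"
  using \<rho> by (auto simp: hom_def)

lemma lift_closed [simp]: "f \<in> carrier RG \<Longrightarrow> lift f \<in> carrier A"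
  unfolding lift_def by (intro A.finsum_closed) auto

lemma lift_add:
  assumes "f \<in> carrier RG" "h \<in> carrier RG"
  shows "lift (f \<oplus>\<^bsub>RG\<^esub> h) = lift f \<oplus>\<^bsub>A\<^esub> lift h"
proof -
  have "lift (f \<oplus>\<^bsub>RG\<^esub> h) = (\<Oplus>\<^bsub>A\<^esub>g\<in>carrier G. \<iota> (f g) \<otimes>\<^bsub>A\<^esub> \<rho> g \<oplus>\<^bsub>A\<^esub> \<iota> (h g) \<otimes>\<^bsub>A\<^esub> \<rho> g)"
    unfolding lift_def using assms
    by (intro A.finsum_cong') (auto simp: RG_add ring_hom_add[OF \<iota>] A.l_distr)
  also have "\<dots> = lift f \<oplus>\<^bsub>A\<^esub> lift h"
    unfolding lift_def using assms by (intro A.finsum_addf) auto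
  finally show ?thesis .
qed

lemma lift_one: "lift \<one>\<^bsub>RG\<^esub> = \<one>\<^bsub>A\<^esub>"
proof -
  have "lift \<one>\<^bsub>RG\<^esub> = (\<Oplus>\<^bsub>A\<^esub>g\<in>carrier G. if \<one>\<^bsub>G\<^esub> = g then \<one>\<^bsub>A\<^esub> else \<zero>\<^bsub>A\<^esub>)"
    unfolding lift_def
    by (intro A.finsum_cong')
       (auto simp: RG_one ring_hom_one[OF \<iota>] ring_hom_zero[OF \<iota> R.ring_axioms A.ring_axioms] \<rho>_one)
  then show ?thesis
    using A.finsum_singleton[of "\<one>\<^bsub>G\<^esub>" "carrier G" "\<lambda>_. \<one>\<^bsub>A\<^esub>"] finG by simp
qed

text \<open>The image of a convolution is a double sum over \<open>g\<close> and \<open>a\<close>.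
  After exchanging the two sums, the substitution \<open>b = inv a * g\<close> for fixed
  \<open>a\<close> makes the summand a product of a term in \<open>a\<close> and a term in
  \<open>b\<close>.\<close>

lemma lift_mult:
  assumes f: "f \<in> carrier RG" and h: "h \<in> carrier RG"
  shows "lift (f \<otimes>\<^bsub>RG\<^esub> h) = lift f \<otimes>\<^bsub>A\<^esub> lift h"
proof -
  let ?t = "\<lambda>a g. (\<iota> (f a) \<otimes>\<^bsub>A\<^esub> \<rho> a) \<otimes>\<^bsub>A\<^esub> (\<iota> (h g) \<otimes>\<^bsub>A\<^esub> \<rho> g)"
  have summand: "\<iota> (f a \<otimes>\<^bsub>R\<^esub> h (inv\<^bsub>G\<^esub> a \<otimes>\<^bsub>G\<^esub> g)) \<otimes>\<^bsub>A\<^esub> \<rho> g = ?t a (inv\<^bsub>G\<^esub> a \<otimes>\<^bsub>G\<^esub> g)"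
    if ag: "a \<in> carrier G" "g \<in> carrier G" for a g
  proof -
    let ?b = "inv\<^bsub>G\<^esub> a \<otimes>\<^bsub>G\<^esub> g"
    have b: "?b \<in> carrier G" using ag by simp
    have "\<rho> g = \<rho> (a \<otimes>\<^bsub>G\<^esub> ?b)" using ag by (simp flip: G.m_assoc)
    also have "\<dots> = \<rho> a \<otimes>\<^bsub>A\<^esub> \<rho> ?b" using \<rho> ag(1) b by (simp add: hom_mult)
    finally have "\<iota> (f a \<otimes>\<^bsub>R\<^esub> h ?b) \<otimes>\<^bsub>A\<^esub> \<rho> g =
        \<iota> (f a) \<otimes>\<^bsub>A\<^esub> ((\<iota> (h ?b) \<otimes>\<^bsub>A\<^esub> \<rho> a) \<otimes>\<^bsub>A\<^esub> \<rho> ?b)"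
      using f h ag b by (simp add: ring_hom_mult[OF \<iota>] A.m_assoc)
    also have "\<iota> (h ?b) \<otimes>\<^bsub>A\<^esub> \<rho> a = \<rho> a \<otimes>\<^bsub>A\<^esub> \<iota> (h ?b)" using central h ag b by simp
    finally show ?thesis using f h ag b by (simp add: A.m_assoc)
  qed
  have "lift (f \<otimes>\<^bsub>RG\<^esub> h) =
      (\<Oplus>\<^bsub>A\<^esub>g\<in>carrier G. \<Oplus>\<^bsub>A\<^esub>a\<in>carrier G. ?t a (inv\<^bsub>G\<^esub> a \<otimes>\<^bsub>G\<^esub> g))"
    unfolding lift_def
  proof (rule A.finsum_cong')
    fix g assume g: "g \<in> carrier G"
    have "(f \<otimes>\<^bsub>RG\<^esub> h) g = (\<Oplus>\<^bsub>R\<^esub>a\<in>carrier G. f a \<otimes>\<^bsub>R\<^esub> h (inv\<^bsub>G\<^esub> a \<otimes>\<^bsub>G\<^esub> g))"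
      using g by (simp add: RG_mult[OF f h])
    also have "\<iota> \<dots> = (\<Oplus>\<^bsub>A\<^esub>a\<in>carrier G. \<iota> (f a \<otimes>\<^bsub>R\<^esub> h (inv\<^bsub>G\<^esub> a \<otimes>\<^bsub>G\<^esub> g)))"
      using f h g by (subst ring_hom_finsum[OF R.ring_axioms A.ring_axioms \<iota>]) (auto simp: o_def)
    finally have "\<iota> ((f \<otimes>\<^bsub>RG\<^esub> h) g) \<otimes>\<^bsub>A\<^esub> \<rho> g =
        (\<Oplus>\<^bsub>A\<^esub>a\<in>carrier G. \<iota> (f a \<otimes>\<^bsub>R\<^esub> h (inv\<^bsub>G\<^esub> a \<otimes>\<^bsub>G\<^esub> g)) \<otimes>\<^bsub>A\<^esub> \<rho> g)"
      using f h g finG by (simp add: A.finsum_ldistr Pi_iff)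
    also have "\<dots> = (\<Oplus>\<^bsub>A\<^esub>a\<in>carrier G. ?t a (inv\<^bsub>G\<^esub> a \<otimes>\<^bsub>G\<^esub> g))"
      using f h g by (intro A.finsum_cong') (auto simp: summand)
    finally show "\<iota> ((f \<otimes>\<^bsub>RG\<^esub> h) g) \<otimes>\<^bsub>A\<^esub> \<rho> g = (\<Oplus>\<^bsub>A\<^esub>a\<in>carrier G. ?t a (inv\<^bsub>G\<^esub> a \<otimes>\<^bsub>G\<^esub> g))" .
  qed (use f h in \<open>auto intro!: A.finsum_closed\<close>)
  also have "\<dots> = (\<Oplus>\<^bsub>A\<^esub>a\<in>carrier G. \<Oplus>\<^bsub>A\<^esub>g\<in>carrier G. ?t a (inv\<^bsub>G\<^esub> a \<otimes>\<^bsub>G\<^esub> g))"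
    using f h finG by (intro A.finsum_swap) auto
  also have "\<dots> = (\<Oplus>\<^bsub>A\<^esub>a\<in>carrier G. \<Oplus>\<^bsub>A\<^esub>b\<in>carrier G. ?t a b)"
  proof (rule A.finsum_cong')
    fix a assume a: "a \<in> carrier G"
    \<comment> \<open>Left translation permutes the group, so the inner sum can be
      reindexed.\<close>
    let ?m = "\<lambda>g. inv\<^bsub>G\<^esub> a \<otimes>\<^bsub>G\<^esub> g"
    have inj: "inj_on ?m (carrier G)" using a by (intro inj_onI) simp
    have im: "?m ` carrier G = carrier G"
    proof
      show "carrier G \<subseteq> ?m ` carrier G"
      proof
        fix g assume g: "g \<in> carrier G"
        have "g = ?m (a \<otimes>\<^bsub>G\<^esub> g)" using a g by (simp flip: G.m_assoc)
        then show "g \<in> ?m ` carrier G" using a g by blast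
      qed
    qed (use a in auto)
    have "finsum A (?t a) (?m ` carrier G) = (\<Oplus>\<^bsub>A\<^esub>g\<in>carrier G. ?t a (?m g))"
      using f h a inj im by (intro A.finsum_reindex) (auto simp: im)
    then show "(\<Oplus>\<^bsub>A\<^esub>g\<in>carrier G. ?t a (?m g)) = (\<Oplus>\<^bsub>A\<^esub>b\<in>carrier G. ?t a b)"
      by (simp add: im)
  qed (use f h in \<open>auto intro!: A.finsum_closed\<close>)
  also have "\<dots> = (\<Oplus>\<^bsub>A\<^esub>a\<in>carrier G. (\<iota> (f a) \<otimes>\<^bsub>A\<^esub> \<rho> a) \<otimes>\<^bsub>A\<^esub> lift h)"
    unfolding lift_def using f h finG
    by (intro A.finsum_cong') (auto simp: A.finsum_rdistr Pi_iff intro!: A.finsum_closed)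
  also have "\<dots> = lift f \<otimes>\<^bsub>A\<^esub> lift h"
    unfolding lift_def[of f] using f h finG by (subst A.finsum_ldistr) (auto simp: Pi_iff)
  finally show ?thesis .
qed

end


section \<open>The group of order 30 and the shape of its representations\<close>

lemma group_dihedral_group:
  assumes n: "n > 0"
  shows "group (dihedral_group n)"
  unfolding dihedral_group_def
proof (rule semidirect_group)
  interpret C: group "Cyc n" by simp
  interpret comm_group "Cyc n" by simp
  let ?\<phi> = "\<lambda>s\<in>carrier (Cyc 2). \<lambda>a\<in>carrier (Cyc n). if s = 0 then a else inv\<^bsub>Cyc n\<^esub> a"
  have inv_hom: "inv\<^bsub>Cyc n\<^esub> (a \<otimes>\<^bsub>Cyc n\<^esub> b) = inv\<^bsub>Cyc n\<^esub> a \<otimes>\<^bsub>Cyc n\<^esub> inv\<^bsub>Cyc n\<^esub> b"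
    if "a \<in> carrier (Cyc n)" "b \<in> carrier (Cyc n)" for a b
    using that by (rule inv_mult)
  have C2: "carrier (Cyc 2) = {0, 1}" by (auto simp: carrier_integer_mod_group)
  have restr: "bij_betw (\<lambda>a\<in>A. h a) A A \<longleftrightarrow> bij_betw h A A" for h :: "int \<Rightarrow> int" and A
    by (rule bij_betw_cong) simp
  have bij_inv: "bij_betw (\<lambda>a. inv\<^bsub>Cyc n\<^esub> a) (carrier (Cyc n)) (carrier (Cyc n))"
    by (rule bij_betw_byWitness[where f' = "\<lambda>a. inv\<^bsub>Cyc n\<^esub> a"])
       (simp_all add: image_subset_iff C.inv_closed del: inv_integer_mod_group)
  have bij_id: "bij_betw (\<lambda>a. a) (carrier (Cyc n)) (carrier (Cyc n))"
    by (simp add: bij_betw_def)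
  show "?\<phi> \<in> hom (Cyc 2) (AutoGroup (Cyc n))"
  proof (rule hom_AutoGroupI)
    fix s assume s: "s \<in> carrier (Cyc 2)"
    have s01: "s = 0 \<or> s = 1" using s C2 by auto
    show "?\<phi> s \<in> extensional (carrier (Cyc n))" using s by simp
    show "bij_betw (?\<phi> s) (carrier (Cyc n)) (carrier (Cyc n))"
      using s s01 bij_inv bij_id restr by (auto simp del: inv_integer_mod_group)
    show "?\<phi> s \<in> hom (Cyc n) (Cyc n)"
    proof (rule homI)
      fix a b assume ab: "a \<in> carrier (Cyc n)" "b \<in> carrier (Cyc n)"
      show "?\<phi> s a \<in> carrier (Cyc n)" using s ab C.inv_closed by (simp del: inv_integer_mod_group)
      have "a \<otimes>\<^bsub>Cyc n\<^esub> b \<in> carrier (Cyc n)" using ab by (rule C.m_closed)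
      then show "?\<phi> s (a \<otimes>\<^bsub>Cyc n\<^esub> b) = ?\<phi> s a \<otimes>\<^bsub>Cyc n\<^esub> ?\<phi> s b"
        using s ab inv_hom by (simp del: inv_integer_mod_group mult_integer_mod_group)
    qed
    fix t a assume t: "t \<in> carrier (Cyc 2)" and a: "a \<in> carrier (Cyc n)"
    have t01: "t = 0 \<or> t = 1" using t C2 by auto
    have ai: "inv\<^bsub>Cyc n\<^esub> a \<in> carrier (Cyc n)" "inv\<^bsub>Cyc n\<^esub> (inv\<^bsub>Cyc n\<^esub> a) = a"
      using a C.inv_closed C.inv_inv by auto
    show "?\<phi> (s \<otimes>\<^bsub>Cyc 2\<^esub> t) a = ?\<phi> s (?\<phi> t a)"
      using s01 t01 a ai C2 by (auto simp del: inv_integer_mod_group)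
  next
    show "h \<otimes>\<^bsub>Cyc 2\<^esub> k \<in> carrier (Cyc 2)" if "h \<in> carrier (Cyc 2)" "k \<in> carrier (Cyc 2)" for h k
      using that by (auto simp: C2)
  qed
qed simp_all

abbreviation C3D10 :: "(int \<times> int \<times> int) monoid" where
  "C3D10 \<equiv> Cyc 3 \<times>\<times> dihedral_group 5"

lemma carrier_C3D10: "carrier C3D10 = {0, 1, 2} \<times> {0, 1, 2, 3, 4} \<times> {0, 1}"
proof -
  have "{0..<3} = {0, 1, 2 :: int}" "{0..<5} = {0, 1, 2, 3, 4 :: int}" "{0..<2} = {0, 1 :: int}"
    by auto
  then show ?thesis by (simp add: dihedral_group_def carrier_integer_mod_group)
qed

lemma group_C3D10: "group C3D10"
  by (intro DirProd_group group_dihedral_group) simp_all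

lemma mult_C3D10:
  assumes "(i, j, k) \<in> carrier C3D10" "(i', j', k') \<in> carrier C3D10"
  shows "(i, j, k) \<otimes>\<^bsub>C3D10\<^esub> (i', j', k') =
    ((i + i') mod 3, (j + (if k = 0 then j' else (- j') mod 5)) mod 5, (k + k') mod 2)"
proof -
  have "j' \<in> carrier (Cyc 5)" "k \<in> carrier (Cyc 2)"
    using assms by (simp_all add: dihedral_group_def)
  then show ?thesis by (simp add: dihedral_group_def)
qed

lemma one_C3D10: "\<one>\<^bsub>C3D10\<^esub> = (0, 0, 0)"
  by (simp add: dihedral_group_def)

lemma (in monoid) pow_mod_order:
  assumes "u \<in> carrier G" "u [^] (n::nat) = \<one>"
  shows "u [^] (m mod n) = u [^] m"
proof -
  have "u [^] m = u [^] (n * (m div n) + m mod n)" by simp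
  also have "\<dots> = (u [^] n) [^] (m div n) \<otimes> u [^] (m mod n)"
    using assms(1) by (simp only: nat_pow_mult nat_pow_pow)
  finally show ?thesis using assms by simp
qed

lemma (in monoid) pow_add_mod:
  assumes "u \<in> carrier G" "u [^] (nat m) = \<one>" "m > 0" "a \<ge> 0" "b \<ge> 0"
  shows "u [^] nat ((a + b) mod m) = u [^] nat a \<otimes> u [^] nat b"
proof -
  have "nat ((a + b) mod m) = (nat a + nat b) mod nat m"
    using assms by (simp add: nat_mod_distrib nat_add_distrib)
  then show ?thesis using assms by (simp add: pow_mod_order nat_pow_mult)
qed

text \<open>A representation of \<open>C\<^sub>3 \<times> D\<^sub>1\<^sub>0\<close> over \<open>F\<close> in an \<open>L\<close>-algebra \<open>A\<close> with structure map \<open>s\<close>: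
  the generator of \<open>C\<^sub>3\<close> acts by the scalar \<open>\<zeta>\<close>, those of \<open>D\<^sub>1\<^sub>0\<close> by \<open>y\<close> and \<open>x\<close>.\<close>

locale dihedral_rep = F: cring F + L: cring L + A: ring A
  for F :: "('a, 'm) ring_scheme" and L :: "('b, 'n) ring_scheme" and A :: "('c, 'k) ring_scheme" +
  fixes \<iota> \<zeta> s y x
  assumes \<iota>: "\<iota> \<in> ring_hom F L" and \<zeta> [simp]: "\<zeta> \<in> carrier L" and \<zeta>3: "\<zeta> [^]\<^bsub>L\<^esub> (3::nat) = \<one>\<^bsub>L\<^esub>"
    and s: "s \<in> ring_hom L A"
    and s_central: "\<And>l a. l \<in> carrier L \<Longrightarrow> a \<in> carrier A \<Longrightarrow> a \<otimes>\<^bsub>A\<^esub> s l = s l \<otimes>\<^bsub>A\<^esub> a"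
    and y [simp]: "y \<in> carrier A" and x [simp]: "x \<in> carrier A"
    and y5: "y [^]\<^bsub>A\<^esub> (5::nat) = \<one>\<^bsub>A\<^esub>" and x2: "x \<otimes>\<^bsub>A\<^esub> x = \<one>\<^bsub>A\<^esub>"
    and xy: "x \<otimes>\<^bsub>A\<^esub> y = y [^]\<^bsub>A\<^esub> (4::nat) \<otimes>\<^bsub>A\<^esub> x"

text \<open>The coefficient of \<open>y^j x^k\<close> after the generator of \<open>C_3\<close> has
  been evaluated at \<zeta>. It does not refer to \<open>A\<close>, so kernel conditions from
  several representations with the same \<zeta> can be combined.\<close>

definition twist ::
    "('b, 'n) ring_scheme \<Rightarrow> ('a \<Rightarrow> 'b) \<Rightarrow> 'b \<Rightarrow> (int \<times> int \<times> int \<Rightarrow> 'a) \<Rightarrow> int \<Rightarrow> int \<Rightarrow> 'b" where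
  "twist L \<iota> \<zeta> f j k = \<iota> (f (0, j, k)) \<oplus>\<^bsub>L\<^esub> (\<iota> (f (1, j, k)) \<otimes>\<^bsub>L\<^esub> \<zeta> \<oplus>\<^bsub>L\<^esub> \<iota> (f (2, j, k)) \<otimes>\<^bsub>L\<^esub> (\<zeta> \<otimes>\<^bsub>L\<^esub> \<zeta>))"

context dihedral_rep
begin

definition \<rho> :: "int \<times> int \<times> int \<Rightarrow> 'c" where
  "\<rho> = (\<lambda>(i, j, k). s (\<zeta> [^]\<^bsub>L\<^esub> nat i) \<otimes>\<^bsub>A\<^esub> (y [^]\<^bsub>A\<^esub> nat j \<otimes>\<^bsub>A\<^esub> x [^]\<^bsub>A\<^esub> nat k))"

lemma s_closed [simp]: "l \<in> carrier L \<Longrightarrow> s l \<in> carrier A"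
  using s by (simp add: ring_hom_closed)

lemma iota_closed [simp]: "a \<in> carrier F \<Longrightarrow> \<iota> a \<in> carrier L"
  using \<iota> by (simp add: ring_hom_closed)

lemma x_pow_y: "x \<otimes>\<^bsub>A\<^esub> y [^]\<^bsub>A\<^esub> (n::nat) = y [^]\<^bsub>A\<^esub> (4 * n) \<otimes>\<^bsub>A\<^esub> x"
proof (induction n)
  case (Suc n)
  have "x \<otimes>\<^bsub>A\<^esub> y [^]\<^bsub>A\<^esub> Suc n = (x \<otimes>\<^bsub>A\<^esub> y [^]\<^bsub>A\<^esub> n) \<otimes>\<^bsub>A\<^esub> y" by (simp add: A.m_assoc)
  also have "\<dots> = y [^]\<^bsub>A\<^esub> (4 * n) \<otimes>\<^bsub>A\<^esub> (x \<otimes>\<^bsub>A\<^esub> y)" unfolding Suc by (simp add: A.m_assoc)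
  also have "\<dots> = y [^]\<^bsub>A\<^esub> (4 * n + 4) \<otimes>\<^bsub>A\<^esub> x" by (simp add: xy A.m_assoc A.nat_pow_mult [symmetric])
  finally show ?case by (simp add: add.commute)
qed simp

lemma rho_mult_dihedral:
  assumes j: "j \<in> {0, 1, 2, 3, 4}" "j' \<in> {0, 1, 2, 3, 4}" and k: "k \<in> {0, 1}" "k' \<in> {0, 1}"
  shows "(y [^]\<^bsub>A\<^esub> nat j \<otimes>\<^bsub>A\<^esub> x [^]\<^bsub>A\<^esub> nat k) \<otimes>\<^bsub>A\<^esub> (y [^]\<^bsub>A\<^esub> nat j' \<otimes>\<^bsub>A\<^esub> x [^]\<^bsub>A\<^esub> nat k') =
    y [^]\<^bsub>A\<^esub> nat ((j + (if k = 0 then j' else (- j') mod 5)) mod 5) \<otimes>\<^bsub>A\<^esub> x [^]\<^bsub>A\<^esub> nat ((k + k') mod 2)"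
proof -
  have x2': "x [^]\<^bsub>A\<^esub> nat 2 = \<one>\<^bsub>A\<^esub>" using x2 by (simp add: numeral_2_eq_2)
  have y5': "y [^]\<^bsub>A\<^esub> nat 5 = \<one>\<^bsub>A\<^esub>" using y5 by simp
  have X: "x [^]\<^bsub>A\<^esub> nat ((k + k') mod 2) = x [^]\<^bsub>A\<^esub> nat k \<otimes>\<^bsub>A\<^esub> x [^]\<^bsub>A\<^esub> nat k'"
    using k by (intro A.pow_add_mod[OF x x2']) auto
  have Y: "y [^]\<^bsub>A\<^esub> nat ((j + b) mod 5) = y [^]\<^bsub>A\<^esub> nat j \<otimes>\<^bsub>A\<^esub> y [^]\<^bsub>A\<^esub> nat b" if "b \<ge> 0" for b
    using j that by (intro A.pow_add_mod[OF y y5']) auto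
  \<comment> \<open>The group law of \<open>C3D10\<close> produces the exponent \<open>- j'\<close>
    modulo 5, the relation \<open>x y = y^4 x\<close> produces \<open>4 j'\<close>; these agree
    modulo 5.\<close>
  have neg: "y [^]\<^bsub>A\<^esub> nat ((- j') mod 5) = y [^]\<^bsub>A\<^esub> (4 * nat j')"
  proof -
    have "nat ((- j') mod 5) = (4 * nat j') mod 5" using j(2) by auto
    then show ?thesis using A.pow_mod_order[OF y y5] by simp
  qed
  show ?thesis
  proof (cases "k = 0")
    case True
    have "0 \<le> j'" using j(2) by auto
    then show ?thesis using X[unfolded True] by (simp add: True Y A.m_assoc)
  next
    case False
    then have k1: "k = 1" using k by simp
    have "(y [^]\<^bsub>A\<^esub> nat j \<otimes>\<^bsub>A\<^esub> x) \<otimes>\<^bsub>A\<^esub> (y [^]\<^bsub>A\<^esub> nat j' \<otimes>\<^bsub>A\<^esub> x [^]\<^bsub>A\<^esub> nat k') =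
        y [^]\<^bsub>A\<^esub> nat j \<otimes>\<^bsub>A\<^esub> ((x \<otimes>\<^bsub>A\<^esub> y [^]\<^bsub>A\<^esub> nat j') \<otimes>\<^bsub>A\<^esub> x [^]\<^bsub>A\<^esub> nat k')"
      by (simp add: A.m_assoc)
    also have "\<dots> = (y [^]\<^bsub>A\<^esub> nat j \<otimes>\<^bsub>A\<^esub> y [^]\<^bsub>A\<^esub> nat ((- j') mod 5)) \<otimes>\<^bsub>A\<^esub> (x \<otimes>\<^bsub>A\<^esub> x [^]\<^bsub>A\<^esub> nat k')"
      unfolding x_pow_y neg by (simp add: A.m_assoc)
    also have "\<dots> = y [^]\<^bsub>A\<^esub> nat ((j + (- j') mod 5) mod 5) \<otimes>\<^bsub>A\<^esub> x [^]\<^bsub>A\<^esub> nat ((k + k') mod 2)"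
      using X[unfolded k1] by (simp add: k1 Y)
    finally show ?thesis using k1 by simp
  qed
qed

sublocale rep: group_algebra_rep F C3D10 A "s \<circ> \<iota>" \<rho>
proof -
  have 1: "group_algebra_rep_axioms F C3D10 A (s \<circ> \<iota>) \<rho>"
  proof
    show "s \<circ> \<iota> \<in> ring_hom F A" using \<iota> s by (rule ring_hom_trans)
    show "\<rho> \<one>\<^bsub>C3D10\<^esub> = \<one>\<^bsub>A\<^esub>" unfolding one_C3D10 \<rho>_def using ring_hom_one[OF s] by simp
    show "\<rho> \<in> hom C3D10 A"
    proof (rule homI)
      fix g h assume g: "g \<in> carrier C3D10" and h: "h \<in> carrier C3D10"
      obtain i j k i' j' k' where gh: "g = (i, j, k)" "h = (i', j', k')"
        by (cases g, cases h) auto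
      show "\<rho> g \<in> carrier A" using gh by (simp add: \<rho>_def)
      have mem: "i \<in> {0, 1, 2}" "i' \<in> {0, 1, 2}" "j \<in> {0, 1, 2, 3, 4}" "j' \<in> {0, 1, 2, 3, 4}" "k \<in> {0, 1}" "k' \<in> {0, 1}"
        using g h by (simp_all only: gh carrier_C3D10 mem_Sigma_iff)
      have nonneg: "0 \<le> i" "0 \<le> i'" using mem(1,2) by auto
      have Z: "\<zeta> [^]\<^bsub>L\<^esub> nat ((i + i') mod 3) = \<zeta> [^]\<^bsub>L\<^esub> nat i \<otimes>\<^bsub>L\<^esub> \<zeta> [^]\<^bsub>L\<^esub> nat i'"
        using \<zeta>3 nonneg by (intro L.pow_add_mod) auto
      let ?a = "y [^]\<^bsub>A\<^esub> nat j \<otimes>\<^bsub>A\<^esub> x [^]\<^bsub>A\<^esub> nat k" and ?b = "y [^]\<^bsub>A\<^esub> nat j' \<otimes>\<^bsub>A\<^esub> x [^]\<^bsub>A\<^esub> nat k'"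
      let ?z = "s (\<zeta> [^]\<^bsub>L\<^esub> nat i)" and ?z' = "s (\<zeta> [^]\<^bsub>L\<^esub> nat i')"
      have ab: "?a \<in> carrier A" "?b \<in> carrier A" by auto
      have z: "?z \<in> carrier A" "?z' \<in> carrier A" by auto
      have "\<rho> (g \<otimes>\<^bsub>C3D10\<^esub> h) = (?z \<otimes>\<^bsub>A\<^esub> ?z') \<otimes>\<^bsub>A\<^esub> (?a \<otimes>\<^bsub>A\<^esub> ?b)"
        unfolding gh mult_C3D10[OF g[unfolded gh] h[unfolded gh]] rho_mult_dihedral[OF mem(3-6)]
        by (simp add: \<rho>_def Z ring_hom_mult[OF s])
      also have "\<dots> = ?z \<otimes>\<^bsub>A\<^esub> ((?z' \<otimes>\<^bsub>A\<^esub> ?a) \<otimes>\<^bsub>A\<^esub> ?b)"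
        using ab z by (simp only: A.m_assoc A.m_closed)
      also have "?z' \<otimes>\<^bsub>A\<^esub> ?a = ?a \<otimes>\<^bsub>A\<^esub> ?z'" using ab(1) by (subst s_central) auto
      also have "?z \<otimes>\<^bsub>A\<^esub> ((?a \<otimes>\<^bsub>A\<^esub> ?z') \<otimes>\<^bsub>A\<^esub> ?b) = \<rho> g \<otimes>\<^bsub>A\<^esub> \<rho> h"
        unfolding gh \<rho>_def using ab z by (simp only: A.m_assoc A.m_closed prod.case)
      finally show "\<rho> (g \<otimes>\<^bsub>C3D10\<^esub> h) = \<rho> g \<otimes>\<^bsub>A\<^esub> \<rho> h" .
    qed
    fix a g assume "a \<in> carrier F" "g \<in> carrier C3D10"
    then show "\<rho> g \<otimes>\<^bsub>A\<^esub> (s \<circ> \<iota>) a = (s \<circ> \<iota>) a \<otimes>\<^bsub>A\<^esub> \<rho> g"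
      by (cases g) (simp add: s_central \<rho>_def)
  qed
  have "finite_group_algebra F C3D10"
    by (intro finite_group_algebra.intro finite_group_algebra_axioms.intro group_C3D10 F.cring_axioms)
       (simp add: carrier_C3D10 del: carrier_DirProd)
  then show "group_algebra_rep F C3D10 A (s \<circ> \<iota>) \<rho>"
    using 1 by (intro group_algebra_rep.intro A.ring_axioms)
qed

lemma twist_closed [simp]:
  assumes "f \<in> carrier rep.RG" "j \<in> {0, 1, 2, 3, 4}" "k \<in> {0, 1}"
  shows "twist L \<iota> \<zeta> f j k \<in> carrier L"
proof -
  have "f (i, j, k) \<in> carrier F" if "i \<in> {0, 1, 2}" for i
    by (rule rep.RG_val[OF assms(1)]) (use assms(2,3) that in \<open>simp only: carrier_C3D10 mem_Sigma_iff\<close>)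
  from this[of 0] this[of 1] this[of 2] show ?thesis by (simp add: twist_def)
qed

text \<open>Summing over \<open>C_3\<close> first collects three terms into one scalar
  \<open>twist\<close>, because \<open>C_3\<close> acts by powers of \<zeta>. The ten remaining
  terms are written out so that they can be evaluated in a concrete algebra.\<close>

lemma lift_eq_twist:
  assumes f: "f \<in> carrier rep.RG"
  defines "t \<equiv> \<lambda>j::int. s (twist L \<iota> \<zeta> f j 0) \<otimes>\<^bsub>A\<^esub> y [^]\<^bsub>A\<^esub> nat j \<oplus>\<^bsub>A\<^esub>
      s (twist L \<iota> \<zeta> f j 1) \<otimes>\<^bsub>A\<^esub> (y [^]\<^bsub>A\<^esub> nat j \<otimes>\<^bsub>A\<^esub> x)"
  shows "rep.lift f = t 0 \<oplus>\<^bsub>A\<^esub> (t 1 \<oplus>\<^bsub>A\<^esub> (t 2 \<oplus>\<^bsub>A\<^esub> (t 3 \<oplus>\<^bsub>A\<^esub> t 4)))"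
proof -
  let ?c = "\<lambda>i d. (s \<circ> \<iota>) (f (i, d)) \<otimes>\<^bsub>A\<^esub> \<rho> (i, d)"
  let ?D = "{0, 1, 2, 3, 4} \<times> {0, 1} :: (int \<times> int) set"
  have cl: "?c i d \<in> carrier A" if "i \<in> {0, 1, 2}" "d \<in> ?D" for i d
  proof -
    have "(i, d) \<in> carrier C3D10" using that by (simp only: carrier_C3D10 mem_Sigma_iff)
    then show ?thesis using f rep.rho_closed[of "(i, d)"] rep.RG_val[OF f, of "(i, d)"] by simp
  qed
  have fc: "f (i, d) \<in> carrier F" if "i \<in> {0, 1, 2}" "d \<in> ?D" for i d
    using that by (intro rep.RG_val[OF f]) (simp only: carrier_C3D10 mem_Sigma_iff)
  have in_d: "(\<Oplus>\<^bsub>A\<^esub>i\<in>{0, 1, 2}. ?c i (j, k)) =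
      s (twist L \<iota> \<zeta> f j k) \<otimes>\<^bsub>A\<^esub> (y [^]\<^bsub>A\<^esub> nat j \<otimes>\<^bsub>A\<^esub> x [^]\<^bsub>A\<^esub> nat k)"
    if d: "(j, k) \<in> ?D" for j k
  proof -
    let ?m = "y [^]\<^bsub>A\<^esub> nat j \<otimes>\<^bsub>A\<^esub> x [^]\<^bsub>A\<^esub> nat k"
    note fcs = fc[of 0, OF _ d] fc[of 1, OF _ d] fc[of 2, OF _ d]
    have "(\<Oplus>\<^bsub>A\<^esub>i\<in>{0, 1, 2}. ?c i (j, k)) = ?c 0 (j, k) \<oplus>\<^bsub>A\<^esub> (?c 1 (j, k) \<oplus>\<^bsub>A\<^esub> ?c 2 (j, k))"
      using cl[OF _ d] by (simp add: A.finsum_insert)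
    also have "\<dots> = s (twist L \<iota> \<zeta> f j k) \<otimes>\<^bsub>A\<^esub> ?m"
      using fcs by (simp add: twist_def \<rho>_def ring_hom_add[OF s] ring_hom_mult[OF s] ring_hom_one[OF s]
          A.l_distr numeral_2_eq_2 A.m_assoc)
    finally show ?thesis .
  qed
  have tcl: "s (twist L \<iota> \<zeta> f j k) \<otimes>\<^bsub>A\<^esub> (y [^]\<^bsub>A\<^esub> nat j \<otimes>\<^bsub>A\<^esub> x [^]\<^bsub>A\<^esub> nat k) \<in> carrier A"
    if "j \<in> {0, 1, 2, 3, 4}" "k \<in> {0, 1}" for j k
    using twist_closed[OF f that] by simp
  have tj: "t j \<in> carrier A" if "j \<in> {0, 1, 2, 3, 4}" for j
    unfolding t_def using twist_closed[OF f that, of 0] twist_closed[OF f that, of 1] by simp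
  have "rep.lift f = finsum A (\<lambda>(i, d). ?c i d) ({0, 1, 2} \<times> ?D)"
    unfolding rep.lift_def carrier_C3D10
    by (intro A.finsum_cong' refl Pi_I) (use cl in \<open>simp_all only: split_paired_all prod.case mem_Sigma_iff\<close>)
  also have "\<dots> = (\<Oplus>\<^bsub>A\<^esub>i\<in>{0, 1, 2}. \<Oplus>\<^bsub>A\<^esub>d\<in>?D. ?c i d)"
    using cl by (subst A.finsum_Times) (simp_all only: prod.case finite_insert finite.emptyI finite_cartesian_product)
  also have "\<dots> = (\<Oplus>\<^bsub>A\<^esub>d\<in>?D. \<Oplus>\<^bsub>A\<^esub>i\<in>{0, 1, 2}. ?c i d)"
    using cl by (intro A.finsum_swap) (simp_all only: finite_insert finite.emptyI finite_cartesian_product)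
  also have "\<dots> = (\<Oplus>\<^bsub>A\<^esub>d\<in>?D. case d of (j, k) \<Rightarrow> s (twist L \<iota> \<zeta> f j k) \<otimes>\<^bsub>A\<^esub> (y [^]\<^bsub>A\<^esub> nat j \<otimes>\<^bsub>A\<^esub> x [^]\<^bsub>A\<^esub> nat k))"
    by (intro A.finsum_cong' refl Pi_I)
       (use in_d tcl in \<open>simp_all only: split_paired_all prod.case mem_Sigma_iff\<close>)
  also have "\<dots> = (\<Oplus>\<^bsub>A\<^esub>j\<in>{0, 1, 2, 3, 4}. \<Oplus>\<^bsub>A\<^esub>k\<in>{0, 1}.
      s (twist L \<iota> \<zeta> f j k) \<otimes>\<^bsub>A\<^esub> (y [^]\<^bsub>A\<^esub> nat j \<otimes>\<^bsub>A\<^esub> x [^]\<^bsub>A\<^esub> nat k))"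
    using tcl by (subst A.finsum_Times) (simp_all only: prod.case finite_insert finite.emptyI)
  also have "\<dots> = (\<Oplus>\<^bsub>A\<^esub>j\<in>{0, 1, 2, 3, 4}. t j)"
  proof (intro A.finsum_cong' refl Pi_I tj)
    fix j :: int assume j: "j \<in> {0, 1, 2, 3, 4}"
    have c: "twist L \<iota> \<zeta> f j 0 \<in> carrier L" "twist L \<iota> \<zeta> f j 1 \<in> carrier L"
      using j by (intro twist_closed[OF f]; simp)+
    then show "(\<Oplus>\<^bsub>A\<^esub>k\<in>{0, 1}. s (twist L \<iota> \<zeta> f j k) \<otimes>\<^bsub>A\<^esub> (y [^]\<^bsub>A\<^esub> nat j \<otimes>\<^bsub>A\<^esub> x [^]\<^bsub>A\<^esub> nat k)) = t j"
      by (simp add: t_def A.finsum_insert)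
  qed
  also have "\<dots> = t 0 \<oplus>\<^bsub>A\<^esub> (t 1 \<oplus>\<^bsub>A\<^esub> (t 2 \<oplus>\<^bsub>A\<^esub> (t 3 \<oplus>\<^bsub>A\<^esub> t 4)))"
    using tj[of 0] tj[of 1] tj[of 2] tj[of 3] tj[of 4] by (simp add: A.finsum_insert)
  finally show ?thesis .
qed

end

section \<open>Matrix components\<close>

text \<open>The group algebra of \<open>C_2\<close> over \<open>L\<close>: the pair
  \<open>(a, b)\<close> stands for \<open>a + b x\<close> with \<open>x^2 = 1\<close>.\<close>

definition C2_algebra :: "('a, 'm) ring_scheme \<Rightarrow> ('a \<times> 'a) ring" where
  "C2_algebra L = \<lparr>carrier = carrier L \<times> carrier L,
     monoid.mult = (\<lambda>(a, b) (c, d). (a \<otimes>\<^bsub>L\<^esub> c \<oplus>\<^bsub>L\<^esub> b \<otimes>\<^bsub>L\<^esub> d, a \<otimes>\<^bsub>L\<^esub> d \<oplus>\<^bsub>L\<^esub> b \<otimes>\<^bsub>L\<^esub> c)),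
     one = (\<one>\<^bsub>L\<^esub>, \<zero>\<^bsub>L\<^esub>), ring.zero = (\<zero>\<^bsub>L\<^esub>, \<zero>\<^bsub>L\<^esub>),
     ring.add = (\<lambda>(a, b) (c, d). (a \<oplus>\<^bsub>L\<^esub> c, b \<oplus>\<^bsub>L\<^esub> d))\<rparr>"

lemma C2_algebra_simps [simp]:
  "carrier (C2_algebra L) = carrier L \<times> carrier L"
  "(a, b) \<otimes>\<^bsub>C2_algebra L\<^esub> (c, d) = (a \<otimes>\<^bsub>L\<^esub> c \<oplus>\<^bsub>L\<^esub> b \<otimes>\<^bsub>L\<^esub> d, a \<otimes>\<^bsub>L\<^esub> d \<oplus>\<^bsub>L\<^esub> b \<otimes>\<^bsub>L\<^esub> c)"
  "(a, b) \<oplus>\<^bsub>C2_algebra L\<^esub> (c, d) = (a \<oplus>\<^bsub>L\<^esub> c, b \<oplus>\<^bsub>L\<^esub> d)"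
  "\<one>\<^bsub>C2_algebra L\<^esub> = (\<one>\<^bsub>L\<^esub>, \<zero>\<^bsub>L\<^esub>)" "\<zero>\<^bsub>C2_algebra L\<^esub> = (\<zero>\<^bsub>L\<^esub>, \<zero>\<^bsub>L\<^esub>)"
  by (simp_all add: C2_algebra_def)

lemma (in cring) C2_algebra_ring: "ring (C2_algebra R)"
proof (intro ringI abelian_groupI monoidI)
  fix u assume "u \<in> carrier (C2_algebra R)"
  then obtain a b where "u = (a, b)" "a \<in> carrier R" "b \<in> carrier R" by auto
  then show "\<exists>v\<in>carrier (C2_algebra R). v \<oplus>\<^bsub>C2_algebra R\<^esub> u = \<zero>\<^bsub>C2_algebra R\<^esub>"
    by (intro bexI[of _ "(\<ominus> a, \<ominus> b)"]) (auto simp: l_neg)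
qed (auto simp: l_distr r_distr a_ac m_ac)

definition mat2 :: "'a \<Rightarrow> 'a \<Rightarrow> 'a \<Rightarrow> 'a \<Rightarrow> nat \<times> nat \<Rightarrow> 'a" where
  "mat2 a b c d = (\<lambda>(i, j)\<in>{..<2} \<times> {..<2}. if i = 0 then (if j = 0 then a else b) else (if j = 0 then c else d))"

text \<open>Multiplication and unit are taken over from \<open>matrix_monoid 2\<close>, so that the
  unit group is literally \<open>GL 2 R\<close>.\<close>

definition mat2_ring :: "('a, 'm) ring_scheme \<Rightarrow> (nat \<times> nat \<Rightarrow> 'a) ring" where
  "mat2_ring R = \<lparr>carrier = carrier (matrix_monoid 2 R), monoid.mult = monoid.mult (matrix_monoid 2 R),
     one = one (matrix_monoid 2 R), ring.zero = mat2 \<zero>\<^bsub>R\<^esub> \<zero>\<^bsub>R\<^esub> \<zero>\<^bsub>R\<^esub> \<zero>\<^bsub>R\<^esub>,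
     ring.add = (\<lambda>A B. \<lambda>ij\<in>{..<2} \<times> {..<2}. A ij \<oplus>\<^bsub>R\<^esub> B ij)\<rparr>"

lemma units_of_mat2_ring: "units_of (mat2_ring R) = GL 2 R"
  by (simp add: GL_def units_of_def Units_def mat2_ring_def)

lemma idx2: "{..<2} \<times> {..<2} = {(0, 0), (0, 1), (1, 0), (1, 1) :: nat \<times> nat}"
  by (auto simp: numeral_2_eq_2 lessThan_Suc)

lemma mat2_apply [simp]:
  "mat2 a b c d (0, 0) = a" "mat2 a b c d (0, Suc 0) = b" "mat2 a b c d (Suc 0, 0) = c" "mat2 a b c d (Suc 0, Suc 0) = d"
  by (simp_all add: mat2_def)

lemma mat2_ext: "mat2 a b c d \<in> extensional ({..<2} \<times> {..<2})"
  by (simp add: mat2_def)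

lemma mat2_eqI:
  assumes "A \<in> extensional ({..<2} \<times> {..<2})" "A (0, 0) = a" "A (0, Suc 0) = b" "A (Suc 0, 0) = c" "A (Suc 0, Suc 0) = d"
  shows "A = mat2 a b c d"
  by (rule extensionalityI[OF assms(1) mat2_ext]) (use assms(2-) in \<open>auto simp: idx2\<close>)

lemma mat2_eq_iff [simp]: "mat2 a b c d = mat2 a' b' c' d' \<longleftrightarrow> a = a' \<and> b = b' \<and> c = c' \<and> d = d'"
  by (metis mat2_apply)

lemma mat2_in_iff [simp]:
  "mat2 a b c d \<in> carrier (mat2_ring R) \<longleftrightarrow> a \<in> carrier R \<and> b \<in> carrier R \<and> c \<in> carrier R \<and> d \<in> carrier R"
  using mat2_ext[of a b c d] by (simp add: mat2_ring_def matrix_monoid_def PiE_iff idx2)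

lemma mat2_cases:
  assumes "A \<in> carrier (mat2_ring R)"
  obtains a b c d where "A = mat2 a b c d" "a \<in> carrier R" "b \<in> carrier R" "c \<in> carrier R" "d \<in> carrier R"
proof
  show "A = mat2 (A (0, 0)) (A (0, Suc 0)) (A (Suc 0, 0)) (A (Suc 0, Suc 0))"
    using assms by (intro mat2_eqI) (auto simp: mat2_ring_def matrix_monoid_def PiE_iff)
qed (use assms in \<open>auto simp: mat2_ring_def matrix_monoid_def PiE_iff idx2\<close>)

lemma mat2_add [simp]: "mat2 a b c d \<oplus>\<^bsub>mat2_ring R\<^esub> mat2 a' b' c' d' =
    mat2 (a \<oplus>\<^bsub>R\<^esub> a') (b \<oplus>\<^bsub>R\<^esub> b') (c \<oplus>\<^bsub>R\<^esub> c') (d \<oplus>\<^bsub>R\<^esub> d')"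
  by (rule mat2_eqI) (auto simp: mat2_ring_def)

lemma mat2_zero: "\<zero>\<^bsub>mat2_ring R\<^esub> = mat2 \<zero>\<^bsub>R\<^esub> \<zero>\<^bsub>R\<^esub> \<zero>\<^bsub>R\<^esub> \<zero>\<^bsub>R\<^esub>"
  by (simp add: mat2_ring_def)

lemma mat2_one: "\<one>\<^bsub>mat2_ring R\<^esub> = mat2 \<one>\<^bsub>R\<^esub> \<zero>\<^bsub>R\<^esub> \<zero>\<^bsub>R\<^esub> \<one>\<^bsub>R\<^esub>"
  by (rule mat2_eqI) (auto simp: mat2_ring_def matrix_monoid_def)

context cring
begin

lemma mat2_mult [simp]:
  assumes "a \<in> carrier R" "b \<in> carrier R" "c \<in> carrier R" "d \<in> carrier R"
    "a' \<in> carrier R" "b' \<in> carrier R" "c' \<in> carrier R" "d' \<in> carrier R"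
  shows "mat2 a b c d \<otimes>\<^bsub>mat2_ring R\<^esub> mat2 a' b' c' d' =
    mat2 (a \<otimes> a' \<oplus> b \<otimes> c') (a \<otimes> b' \<oplus> b \<otimes> d') (c \<otimes> a' \<oplus> d \<otimes> c') (c \<otimes> b' \<oplus> d \<otimes> d')"
proof -
  have *: "{..<2} = {0, Suc 0}" by auto
  show ?thesis
    by (rule mat2_eqI)
       (use assms in \<open>simp_all add: mat2_ring_def matrix_monoid_def * finsum_insert\<close>)
qed

lemma mat2_ring_ring: "ring (mat2_ring R)"
proof (intro ringI abelian_groupI monoidI)
  fix A assume "A \<in> carrier (mat2_ring R)"
  then show "\<exists>B\<in>carrier (mat2_ring R). B \<oplus>\<^bsub>mat2_ring R\<^esub> A = \<zero>\<^bsub>mat2_ring R\<^esub>"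
  proof (cases rule: mat2_cases)
    case (1 a b c d)
    then show ?thesis
      by (intro bexI[of _ "mat2 (\<ominus> a) (\<ominus> b) (\<ominus> c) (\<ominus> d)"]) (simp_all add: mat2_zero l_neg)
  qed
next
  fix A B C assume "A \<in> carrier (mat2_ring R)" "B \<in> carrier (mat2_ring R)" "C \<in> carrier (mat2_ring R)"
  then show "(A \<otimes>\<^bsub>mat2_ring R\<^esub> B) \<otimes>\<^bsub>mat2_ring R\<^esub> C = A \<otimes>\<^bsub>mat2_ring R\<^esub> (B \<otimes>\<^bsub>mat2_ring R\<^esub> C)"
    "(A \<oplus>\<^bsub>mat2_ring R\<^esub> B) \<otimes>\<^bsub>mat2_ring R\<^esub> C = A \<otimes>\<^bsub>mat2_ring R\<^esub> C \<oplus>\<^bsub>mat2_ring R\<^esub> B \<otimes>\<^bsub>mat2_ring R\<^esub> C"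
    "C \<otimes>\<^bsub>mat2_ring R\<^esub> (A \<oplus>\<^bsub>mat2_ring R\<^esub> B) = C \<otimes>\<^bsub>mat2_ring R\<^esub> A \<oplus>\<^bsub>mat2_ring R\<^esub> C \<otimes>\<^bsub>mat2_ring R\<^esub> B"
    "(A \<oplus>\<^bsub>mat2_ring R\<^esub> B) \<oplus>\<^bsub>mat2_ring R\<^esub> C = A \<oplus>\<^bsub>mat2_ring R\<^esub> (B \<oplus>\<^bsub>mat2_ring R\<^esub> C)"
    by (elim mat2_cases; simp add: l_distr r_distr a_ac m_assoc)+
next
  fix A B assume "A \<in> carrier (mat2_ring R)" "B \<in> carrier (mat2_ring R)"
  then show "A \<otimes>\<^bsub>mat2_ring R\<^esub> B \<in> carrier (mat2_ring R)" "A \<oplus>\<^bsub>mat2_ring R\<^esub> B \<in> carrier (mat2_ring R)"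
    "A \<oplus>\<^bsub>mat2_ring R\<^esub> B = B \<oplus>\<^bsub>mat2_ring R\<^esub> A"
    by (elim mat2_cases; simp add: a_comm)+
next
  fix A assume "A \<in> carrier (mat2_ring R)"
  then show "\<zero>\<^bsub>mat2_ring R\<^esub> \<oplus>\<^bsub>mat2_ring R\<^esub> A = A" "\<one>\<^bsub>mat2_ring R\<^esub> \<otimes>\<^bsub>mat2_ring R\<^esub> A = A"
    "A \<otimes>\<^bsub>mat2_ring R\<^esub> \<one>\<^bsub>mat2_ring R\<^esub> = A"
    by (elim mat2_cases; simp add: mat2_zero mat2_one)+
qed (simp_all add: mat2_zero mat2_one)

end

lemma card_mat2_ring: "card (carrier (mat2_ring R)) = card (carrier R) ^ 4"
  by (simp add: mat2_ring_def matrix_monoid_def card_PiE)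

lemma finite_mat2_ring: "finite (carrier R) \<Longrightarrow> finite (carrier (mat2_ring R))"
  by (simp add: mat2_ring_def matrix_monoid_def finite_PiE)

text \<open>\<open>\<tau>\<close> stands for \<open>\<xi> + \<xi>\<inverse>\<close> with a primitive fifth root of unity \<open>\<xi>\<close>, and \<open>y\<close> is the companion matrix
  of \<open>(T - \<xi>) (T - \<xi>\<inverse>)\<close>.\<close>

lemma (in cring) mat2_pow_companion:
  assumes \<tau>: "\<tau> \<in> carrier R" and \<tau>2: "\<tau> \<otimes> \<tau> = \<one> \<ominus> \<tau>"
  defines "y \<equiv> mat2 \<zero> (\<ominus> \<one>) \<one> \<tau>"
  shows "y [^]\<^bsub>mat2_ring R\<^esub> (2::nat) = mat2 (\<ominus> \<one>) (\<ominus> \<tau>) \<tau> (\<ominus> \<tau>)"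
    "y [^]\<^bsub>mat2_ring R\<^esub> (3::nat) = mat2 (\<ominus> \<tau>) \<tau> (\<ominus> \<tau>) (\<ominus> \<one>)"
    "y [^]\<^bsub>mat2_ring R\<^esub> (4::nat) = mat2 \<tau> \<one> (\<ominus> \<one>) \<zero>"
    "y [^]\<^bsub>mat2_ring R\<^esub> (5::nat) = \<one>\<^bsub>mat2_ring R\<^esub>"
proof -
  interpret M: ring "mat2_ring R" by (rule mat2_ring_ring)
  have y: "y \<in> carrier (mat2_ring R)" by (simp add: y_def \<tau>)
  have S: "2 = Suc 1" "3 = Suc 2" "4 = Suc 3" "5 = Suc 4" by simp_all
  \<comment> \<open>The equation for \<tau>, in each of the forms in which it occurs among the
    matrix entries.\<close>
  have e: "\<ominus> \<one> \<oplus> \<tau> \<otimes> \<tau> = \<ominus> \<tau>" "\<ominus> (\<tau> \<otimes> \<tau>) \<oplus> \<ominus> \<tau> = \<ominus> \<one>" "\<ominus> \<tau> \<oplus> \<ominus> (\<tau> \<otimes> \<tau>) = \<ominus> \<one>"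
    "\<one> \<oplus> \<ominus> (\<tau> \<otimes> \<tau>) = \<tau>" "\<tau> \<oplus> \<tau> \<otimes> \<tau> = \<one>"
    using \<tau> unfolding \<tau>2 by algebra+
  show y2: "y [^]\<^bsub>mat2_ring R\<^esub> (2::nat) = mat2 (\<ominus> \<one>) (\<ominus> \<tau>) \<tau> (\<ominus> \<tau>)"
    unfolding S(1) using y by (simp add: y_def \<tau> l_minus r_minus e)
  show y3: "y [^]\<^bsub>mat2_ring R\<^esub> (3::nat) = mat2 (\<ominus> \<tau>) \<tau> (\<ominus> \<tau>) (\<ominus> \<one>)"
    unfolding S(2) M.nat_pow_Suc y2 by (simp add: y_def \<tau> l_minus r_minus e)
  show y4: "y [^]\<^bsub>mat2_ring R\<^esub> (4::nat) = mat2 \<tau> \<one> (\<ominus> \<one>) \<zero>"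
    unfolding S(3) M.nat_pow_Suc y3 by (simp add: y_def \<tau> l_minus r_minus e r_neg l_neg)
  show "y [^]\<^bsub>mat2_ring R\<^esub> (5::nat) = \<one>\<^bsub>mat2_ring R\<^esub>"
    unfolding S(4) M.nat_pow_Suc y4 by (simp add: y_def \<tau> l_minus r_minus mat2_one e r_neg l_neg)
qed


section \<open>Kernels of the companion matrix and \<open>C_2\<close> representations\<close>

lemma (in ring) of_int_comb:
  assumes "a \<in> carrier R"
  shows "\<guillemotleft>i\<guillemotright> \<otimes> a \<oplus> \<guillemotleft>j\<guillemotright> \<otimes> a = \<guillemotleft>i + j\<guillemotright> \<otimes> a" "\<guillemotleft>i\<guillemotright> \<otimes> (\<guillemotleft>j\<guillemotright> \<otimes> a) = \<guillemotleft>i * j\<guillemotright> \<otimes> a"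
  using assms by (simp_all add: l_distr m_assoc)

lemma (in ring) five_times:
  assumes "a \<in> carrier R"
  shows "a \<oplus> (a \<oplus> (a \<oplus> (a \<oplus> a))) = \<guillemotleft>5\<guillemotright> \<otimes> a"
proof -
  have "\<guillemotleft>5\<guillemotright> = \<one> \<oplus> (\<one> \<oplus> (\<one> \<oplus> (\<one> \<oplus> \<one>)))"
    using of_int_add[of 1 4] of_int_add[of 1 3] of_int_add[of 1 2] of_int_add[of 1 1] by simp
  then show ?thesis using assms by (simp add: l_distr)
qed

lemma (in ring) three_times:
  assumes "a \<in> carrier R"
  shows "a \<oplus> (a \<oplus> a) = \<guillemotleft>3\<guillemotright> \<otimes> a"
proof -
  have "\<guillemotleft>3\<guillemotright> = \<one> \<oplus> (\<one> \<oplus> \<one>)"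
    using of_int_add[of 1 2] of_int_add[of 1 1] by simp
  then show ?thesis using assms by (simp add: l_distr)
qed

text \<open>The determinant of the system is \<open>4 - \<tau>\<^sup>2 = 3 + \<tau>\<close>, and \<open>(3 + \<tau>) (2 - \<tau>) = 5\<close>.\<close>

lemma (in field) companion_span_kernel_aux:
  assumes \<tau>: "\<tau> \<in> carrier R" "\<tau> \<otimes> \<tau> = \<one> \<ominus> \<tau>" and five: "\<guillemotleft>5\<guillemotright> \<noteq> \<zero>"
    and AB: "A \<in> carrier R" "B \<in> carrier R"
    and eq: "A \<oplus> A \<oplus> \<tau> \<otimes> B = \<zero>" "B \<oplus> B \<oplus> \<tau> \<otimes> A = \<zero>"
  shows "B = \<zero>"
proof -
  let ?c = "\<tau> \<otimes> B"
  note cl = \<tau>(1) AB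
  have "\<guillemotleft>2\<guillemotright> \<otimes> B = B \<oplus> B" using cl by (simp add: of_int_2 l_distr)
  then have h1: "\<tau> \<otimes> A = \<guillemotleft>-2\<guillemotright> \<otimes> B"
    using eq(2) cl by (simp add: l_minus) (metis a_comm add.inv_equality add.m_closed m_closed)
  \<comment> \<open>Multiplying the first equation by \<tau> and inserting
    \<open>\<tau> A = -2 B\<close> yields \<open>\<tau> B = -3 B\<close>. Then
    \<open>\<tau>^2 B\<close> is \<open>9 B\<close>, but also \<open>B - \<tau> B = 4 B\<close>,
    whence \<open>5 B = 0\<close>.\<close>
  have "\<tau> \<otimes> (A \<oplus> A \<oplus> \<tau> \<otimes> B) = \<tau> \<otimes> A \<oplus> \<tau> \<otimes> A \<oplus> (\<tau> \<otimes> \<tau>) \<otimes> B"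
    using cl by (simp add: r_distr m_assoc)
  also have "\<dots> = \<guillemotleft>-4\<guillemotright> \<otimes> B \<oplus> (B \<ominus> ?c)"
    unfolding h1 \<tau>(2) using cl of_int_comb(1)[of B "-2" "-2"] by (simp add: minus_eq l_distr l_minus)
  also have "\<dots> = \<guillemotleft>-3\<guillemotright> \<otimes> B \<ominus> ?c"
    using of_int_comb(1)[of B "-4" 1] cl by (simp add: minus_eq a_assoc [symmetric])
  finally have "\<guillemotleft>-3\<guillemotright> \<otimes> B \<ominus> ?c = \<zero>" using eq(1) cl by simp
  then have c: "?c = \<guillemotleft>-3\<guillemotright> \<otimes> B" using cl by (metis eq_diff0 m_closed of_int_closed)
  have "\<tau> \<otimes> ?c = \<guillemotleft>-3\<guillemotright> \<otimes> ?c" unfolding c using cl by (metis c m_lcomm of_int_closed)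
  then have "\<tau> \<otimes> ?c = \<guillemotleft>9\<guillemotright> \<otimes> B" unfolding c using of_int_comb(2)[of B "-3" "-3"] cl by simp
  moreover have "\<tau> \<otimes> ?c = B \<ominus> ?c"
    using cl by (simp add: m_assoc [symmetric] \<tau>(2)) (simp add: minus_eq l_distr l_minus)
  moreover have "B \<ominus> ?c = \<guillemotleft>4\<guillemotright> \<otimes> B"
    unfolding c using cl of_int_comb(1)[of B 1 3] by (simp add: minus_eq l_minus)
  ultimately have e94: "\<guillemotleft>9\<guillemotright> \<otimes> B = \<guillemotleft>4\<guillemotright> \<otimes> B" by simp
  have "\<guillemotleft>5\<guillemotright> \<otimes> B = \<guillemotleft>9\<guillemotright> \<otimes> B \<oplus> \<guillemotleft>-4\<guillemotright> \<otimes> B" using of_int_comb(1)[of B 9 "-4"] cl by simp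
  also have "\<dots> = \<zero>" unfolding e94 using of_int_comb(1)[of B 4 "-4"] cl by simp
  finally show "B = \<zero>" using five cl integral_iff by simp
qed

text \<open>The four equations are the entries of the matrix
  \<open>A0 + A1 y + B0 x + B1 y x\<close>, with \<open>y\<close> the companion matrix and
  \<open>x\<close> the coordinate swap. So this is the linear independence of 1, \<open>y\<close>,
  \<open>x\<close>, \<open>y x\<close>, which span all 2 by 2 matrices.\<close>

lemma (in field) companion_span_kernel:
  assumes \<tau>: "\<tau> \<in> carrier R" "\<tau> \<otimes> \<tau> = \<one> \<ominus> \<tau>" and five: "\<guillemotleft>5\<guillemotright> \<noteq> \<zero>"
    and cl: "A0 \<in> carrier R" "A1 \<in> carrier R" "B0 \<in> carrier R" "B1 \<in> carrier R"
    and eq: "A0 \<ominus> B1 = \<zero>" "B0 \<ominus> A1 = \<zero>" "A1 \<oplus> B0 \<oplus> \<tau> \<otimes> B1 = \<zero>" "A0 \<oplus> \<tau> \<otimes> A1 \<oplus> B1 = \<zero>"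
  shows "A0 = \<zero> \<and> A1 = \<zero> \<and> B0 = \<zero> \<and> B1 = \<zero>"
proof -
  have e: "A0 = B1" "B0 = A1" using eq(1,2) cl eq_diff0 by auto
  have 1: "A1 \<oplus> A1 \<oplus> \<tau> \<otimes> B1 = \<zero>" using eq(3) e by simp
  have 2: "B1 \<oplus> B1 \<oplus> \<tau> \<otimes> A1 = \<zero>" using eq(4) e cl \<tau>(1) by (simp add: a_ac)
  show ?thesis
    using companion_span_kernel_aux[OF \<tau> five cl(2,4) 1 2]
      companion_span_kernel_aux[OF \<tau> five cl(4,2) 2 1] e by simp
qed

definition scalar2 :: "('b, 'n) ring_scheme \<Rightarrow> ('a \<Rightarrow> 'b) \<Rightarrow> 'a \<Rightarrow> nat \<times> nat \<Rightarrow> 'b" where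
  "scalar2 K \<kappa> l = mat2 (\<kappa> l) \<zero>\<^bsub>K\<^esub> \<zero>\<^bsub>K\<^esub> (\<kappa> l)"

lemma companion_rep:
  assumes "cring F" "cring L" "cring K" "\<iota> \<in> ring_hom F L" "\<zeta> \<in> carrier L" "\<zeta> [^]\<^bsub>L\<^esub> (3::nat) = \<one>\<^bsub>L\<^esub>"
    and \<kappa>: "\<kappa> \<in> ring_hom L K" and \<tau>: "\<tau> \<in> carrier K" "\<tau> \<otimes>\<^bsub>K\<^esub> \<tau> = \<one>\<^bsub>K\<^esub> \<ominus>\<^bsub>K\<^esub> \<tau>"
  shows "dihedral_rep F L (mat2_ring K) \<iota> \<zeta> (scalar2 K \<kappa>)
    (mat2 \<zero>\<^bsub>K\<^esub> (\<ominus>\<^bsub>K\<^esub> \<one>\<^bsub>K\<^esub>) \<one>\<^bsub>K\<^esub> \<tau>) (mat2 \<zero>\<^bsub>K\<^esub> \<one>\<^bsub>K\<^esub> \<one>\<^bsub>K\<^esub> \<zero>\<^bsub>K\<^esub>)"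
proof -
  interpret F: cring F by fact
  interpret L: cring L by fact
  interpret K: cring K by fact
  interpret M: ring "mat2_ring K" by (rule K.mat2_ring_ring)
  have \<kappa>c [simp]: "\<kappa> l \<in> carrier K" if "l \<in> carrier L" for l
    using \<kappa> that by (simp add: ring_hom_closed)
  show ?thesis
  proof
    show "scalar2 K \<kappa> \<in> ring_hom L (mat2_ring K)"
      by (rule ring_hom_memI)
         (simp_all add: scalar2_def ring_hom_add[OF \<kappa>] ring_hom_mult[OF \<kappa>] ring_hom_one[OF \<kappa>] mat2_one)
    fix l a assume "l \<in> carrier L" "a \<in> carrier (mat2_ring K)"
    then show "a \<otimes>\<^bsub>mat2_ring K\<^esub> scalar2 K \<kappa> l = scalar2 K \<kappa> l \<otimes>\<^bsub>mat2_ring K\<^esub> a"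
      by (elim mat2_cases) (simp add: scalar2_def K.m_comm)
  qed (use assms in \<open>simp_all add: K.mat2_pow_companion K.l_minus K.r_minus mat2_one\<close>)
qed

text \<open>With \<open>y^2 = \<tau> y - 1\<close>, \<open>y^3 = - \<tau> y - \<tau>\<close> and
  \<open>y^4 = \<tau> - y\<close> the image reduces to a combination of 1, \<open>y\<close>,
  \<open>x\<close>, \<open>y x\<close>, whose coefficients must vanish. They are left in the form
  \<open>u + \<tau> v\<close> with \<open>u\<close>, \<open>v\<close> from \<open>L\<close>, to be
  separated later by a second root or by \<tau> lying outside the image of \<open>L\<close>.\<close>

lemma companion_rep_kernel:
  assumes "cring F" "field L" "field K" "\<iota> \<in> ring_hom F L" "\<zeta> \<in> carrier L" "\<zeta> [^]\<^bsub>L\<^esub> (3::nat) = \<one>\<^bsub>L\<^esub>"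
    and \<kappa>: "\<kappa> \<in> ring_hom L K" and \<tau>: "\<tau> \<in> carrier K" "\<tau> \<otimes>\<^bsub>K\<^esub> \<tau> = \<one>\<^bsub>K\<^esub> \<ominus>\<^bsub>K\<^esub> \<tau>"
    and five: "\<guillemotleft>5\<guillemotright>\<^bsub>K\<^esub> \<noteq> \<zero>\<^bsub>K\<^esub>"
    and f: "f \<in> carrier (group_algebra F C3D10)"
  defines "\<alpha> \<equiv> twist L \<iota> \<zeta> f"
  defines "rep \<equiv> dihedral_rep.\<rho> L (mat2_ring K) \<zeta> (scalar2 K \<kappa>)
    (mat2 \<zero>\<^bsub>K\<^esub> (\<ominus>\<^bsub>K\<^esub> \<one>\<^bsub>K\<^esub>) \<one>\<^bsub>K\<^esub> \<tau>) (mat2 \<zero>\<^bsub>K\<^esub> \<one>\<^bsub>K\<^esub> \<one>\<^bsub>K\<^esub> \<zero>\<^bsub>K\<^esub>)"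
  assumes zero: "group_algebra_rep.lift C3D10 (mat2_ring K) (scalar2 K \<kappa> \<circ> \<iota>) rep f = \<zero>\<^bsub>mat2_ring K\<^esub>"
    and k: "k \<in> {0, 1}"
  shows "\<kappa> (\<alpha> 0 k \<ominus>\<^bsub>L\<^esub> \<alpha> 2 k) \<oplus>\<^bsub>K\<^esub> \<tau> \<otimes>\<^bsub>K\<^esub> \<kappa> (\<alpha> 4 k \<ominus>\<^bsub>L\<^esub> \<alpha> 3 k) = \<zero>\<^bsub>K\<^esub>"
    "\<kappa> (\<alpha> 1 k \<ominus>\<^bsub>L\<^esub> \<alpha> 4 k) \<oplus>\<^bsub>K\<^esub> \<tau> \<otimes>\<^bsub>K\<^esub> \<kappa> (\<alpha> 2 k \<ominus>\<^bsub>L\<^esub> \<alpha> 3 k) = \<zero>\<^bsub>K\<^esub>"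
proof -
  interpret F: cring F by fact
  interpret L: field L by fact
  interpret K: field K by fact
  interpret M: ring "mat2_ring K" by (rule K.mat2_ring_ring)
  let ?y = "mat2 \<zero>\<^bsub>K\<^esub> (\<ominus>\<^bsub>K\<^esub> \<one>\<^bsub>K\<^esub>) \<one>\<^bsub>K\<^esub> \<tau>" and ?x = "mat2 \<zero>\<^bsub>K\<^esub> \<one>\<^bsub>K\<^esub> \<one>\<^bsub>K\<^esub> \<zero>\<^bsub>K\<^esub>"
  interpret D: dihedral_rep F L "mat2_ring K" \<iota> \<zeta> "scalar2 K \<kappa>" ?y ?x
    using assms by (intro companion_rep) (auto intro: L.cring_axioms K.cring_axioms)
  have \<alpha>c [simp]: "\<alpha> j k \<in> carrier L" if "j \<in> {0, 1, 2, 3, 4}" "k \<in> {0, 1}" for j k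
    unfolding \<alpha>_def using D.twist_closed[OF f that] .
  have \<kappa>c: "\<kappa> l \<in> carrier K" if "l \<in> carrier L" for l
    using \<kappa> that by (simp add: ring_hom_closed)
  have \<kappa>m: "\<kappa> (a \<ominus>\<^bsub>L\<^esub> b) = \<kappa> a \<ominus>\<^bsub>K\<^esub> \<kappa> b" if "a \<in> carrier L" "b \<in> carrier L" for a b
  proof -
    interpret ring_hom_ring L K \<kappa>
      using \<kappa> by (intro ring_hom_ringI2 L.ring_axioms K.ring_axioms)
    show ?thesis using that by (simp add: L.minus_eq K.minus_eq)
  qed
  define a where "a j = \<kappa> (\<alpha> j 0)" for j
  define b where "b j = \<kappa> (\<alpha> j 1)" for j
  have ac [simp]: "a 0 \<in> carrier K" "a 1 \<in> carrier K" "a 2 \<in> carrier K" "a 3 \<in> carrier K" "a 4 \<in> carrier K"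
    by (simp_all add: a_def \<kappa>c)
  have bc [simp]: "b 0 \<in> carrier K" "b 1 \<in> carrier K" "b 2 \<in> carrier K" "b 3 \<in> carrier K" "b 4 \<in> carrier K"
    by (simp_all add: b_def \<kappa>c)
  note \<tau>(1) [simp]
  have n: "nat 2 = 2" "nat 3 = 3" "nat 4 = 4" by simp_all
  define A0 where "A0 = (a 0 \<ominus>\<^bsub>K\<^esub> a 2) \<oplus>\<^bsub>K\<^esub> \<tau> \<otimes>\<^bsub>K\<^esub> (a 4 \<ominus>\<^bsub>K\<^esub> a 3)"
  define A1 where "A1 = (a 1 \<ominus>\<^bsub>K\<^esub> a 4) \<oplus>\<^bsub>K\<^esub> \<tau> \<otimes>\<^bsub>K\<^esub> (a 2 \<ominus>\<^bsub>K\<^esub> a 3)"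
  define B0 where "B0 = (b 0 \<ominus>\<^bsub>K\<^esub> b 2) \<oplus>\<^bsub>K\<^esub> \<tau> \<otimes>\<^bsub>K\<^esub> (b 4 \<ominus>\<^bsub>K\<^esub> b 3)"
  define B1 where "B1 = (b 1 \<ominus>\<^bsub>K\<^esub> b 4) \<oplus>\<^bsub>K\<^esub> \<tau> \<otimes>\<^bsub>K\<^esub> (b 2 \<ominus>\<^bsub>K\<^esub> b 3)"
  have AB: "A0 \<in> carrier K" "A1 \<in> carrier K" "B0 \<in> carrier K" "B1 \<in> carrier K"
    by (simp_all add: A0_def A1_def B0_def B1_def)
  have \<tau>\<tau>: "\<tau> \<otimes>\<^bsub>K\<^esub> (\<tau> \<otimes>\<^bsub>K\<^esub> c) = c \<ominus>\<^bsub>K\<^esub> \<tau> \<otimes>\<^bsub>K\<^esub> c" if "c \<in> carrier K" for c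
    using that by (simp add: K.m_assoc [symmetric] \<tau>(2)) (simp add: K.minus_eq K.l_distr K.l_minus)
  \<comment> \<open>Lower row entries contain \<open>A0 + \<tau> A1\<close> (or the same with
    \<open>B\<close>), where \<open>\<tau>^2\<close> cancels several terms. The cancellation is
    proved for free variables, the products of \<tau> with a coefficient being treated as
    atoms.\<close>
  have cancel: "(c0 \<ominus>\<^bsub>K\<^esub> c2 \<oplus>\<^bsub>K\<^esub> (t4 \<ominus>\<^bsub>K\<^esub> t3)) \<oplus>\<^bsub>K\<^esub> ((t1 \<ominus>\<^bsub>K\<^esub> t4) \<oplus>\<^bsub>K\<^esub> ((c2 \<ominus>\<^bsub>K\<^esub> c3) \<ominus>\<^bsub>K\<^esub> (t2 \<ominus>\<^bsub>K\<^esub> t3))) =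
      c0 \<oplus>\<^bsub>K\<^esub> (t1 \<oplus>\<^bsub>K\<^esub> (\<ominus>\<^bsub>K\<^esub> c3 \<oplus>\<^bsub>K\<^esub> \<ominus>\<^bsub>K\<^esub> t2))"
    if "c0 \<in> carrier K" "c2 \<in> carrier K" "c3 \<in> carrier K" "t1 \<in> carrier K" "t2 \<in> carrier K" "t3 \<in> carrier K" "t4 \<in> carrier K"
    for c0 c2 c3 t1 t2 t3 t4
    using that by algebra
  have BB: "B0 \<oplus>\<^bsub>K\<^esub> \<tau> \<otimes>\<^bsub>K\<^esub> B1 = b 0 \<oplus>\<^bsub>K\<^esub> (\<tau> \<otimes>\<^bsub>K\<^esub> b 1 \<oplus>\<^bsub>K\<^esub> (\<ominus>\<^bsub>K\<^esub> b 3 \<oplus>\<^bsub>K\<^esub> \<ominus>\<^bsub>K\<^esub> (\<tau> \<otimes>\<^bsub>K\<^esub> b 2)))"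
    using cancel[of "b 0" "b 2" "b 3" "\<tau> \<otimes>\<^bsub>K\<^esub> b 1" "\<tau> \<otimes>\<^bsub>K\<^esub> b 2" "\<tau> \<otimes>\<^bsub>K\<^esub> b 3" "\<tau> \<otimes>\<^bsub>K\<^esub> b 4"]
    by (simp add: B0_def B1_def K.r_distr \<tau>\<tau>) (simp add: K.minus_eq K.r_distr K.r_minus)
  have AA: "A0 \<oplus>\<^bsub>K\<^esub> \<tau> \<otimes>\<^bsub>K\<^esub> A1 = a 0 \<oplus>\<^bsub>K\<^esub> (\<tau> \<otimes>\<^bsub>K\<^esub> a 1 \<oplus>\<^bsub>K\<^esub> (\<ominus>\<^bsub>K\<^esub> a 3 \<oplus>\<^bsub>K\<^esub> \<ominus>\<^bsub>K\<^esub> (\<tau> \<otimes>\<^bsub>K\<^esub> a 2)))"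
    using cancel[of "a 0" "a 2" "a 3" "\<tau> \<otimes>\<^bsub>K\<^esub> a 1" "\<tau> \<otimes>\<^bsub>K\<^esub> a 2" "\<tau> \<otimes>\<^bsub>K\<^esub> a 3" "\<tau> \<otimes>\<^bsub>K\<^esub> a 4"]
    by (simp add: A0_def A1_def K.r_distr \<tau>\<tau>) (simp add: K.minus_eq K.r_distr K.r_minus)
  have E21: "A1 \<oplus>\<^bsub>K\<^esub> B0 \<oplus>\<^bsub>K\<^esub> \<tau> \<otimes>\<^bsub>K\<^esub> B1 = A1 \<oplus>\<^bsub>K\<^esub> (b 0 \<oplus>\<^bsub>K\<^esub> (\<tau> \<otimes>\<^bsub>K\<^esub> b 1 \<oplus>\<^bsub>K\<^esub> (\<ominus>\<^bsub>K\<^esub> b 3 \<oplus>\<^bsub>K\<^esub> \<ominus>\<^bsub>K\<^esub> (\<tau> \<otimes>\<^bsub>K\<^esub> b 2))))"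
    using AB by (simp add: K.a_assoc flip: BB)
  have lift: "D.rep.lift f = mat2 (A0 \<ominus>\<^bsub>K\<^esub> B1) (B0 \<ominus>\<^bsub>K\<^esub> A1) (A1 \<oplus>\<^bsub>K\<^esub> B0 \<oplus>\<^bsub>K\<^esub> \<tau> \<otimes>\<^bsub>K\<^esub> B1) (A0 \<oplus>\<^bsub>K\<^esub> \<tau> \<otimes>\<^bsub>K\<^esub> A1 \<oplus>\<^bsub>K\<^esub> B1)"
    unfolding D.lift_eq_twist[OF f, folded \<alpha>_def] scalar2_def a_def[symmetric] b_def[symmetric] n E21 AA
    by (simp add: K.mat2_pow_companion[OF \<tau>] mat2_one K.l_minus K.r_minus)
       (simp add: A0_def A1_def B0_def B1_def K.minus_eq K.r_distr K.l_distr K.l_minus K.r_minus K.minus_add K.a_ac K.m_ac)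
  have "A0 = \<zero>\<^bsub>K\<^esub> \<and> A1 = \<zero>\<^bsub>K\<^esub> \<and> B0 = \<zero>\<^bsub>K\<^esub> \<and> B1 = \<zero>\<^bsub>K\<^esub>"
    using zero[unfolded rep_def] lift
    by (intro K.companion_span_kernel[OF \<tau> five AB]) (simp_all add: mat2_zero)
  then show "\<kappa> (\<alpha> 0 k \<ominus>\<^bsub>L\<^esub> \<alpha> 2 k) \<oplus>\<^bsub>K\<^esub> \<tau> \<otimes>\<^bsub>K\<^esub> \<kappa> (\<alpha> 4 k \<ominus>\<^bsub>L\<^esub> \<alpha> 3 k) = \<zero>\<^bsub>K\<^esub>"
    "\<kappa> (\<alpha> 1 k \<ominus>\<^bsub>L\<^esub> \<alpha> 4 k) \<oplus>\<^bsub>K\<^esub> \<tau> \<otimes>\<^bsub>K\<^esub> \<kappa> (\<alpha> 2 k \<ominus>\<^bsub>L\<^esub> \<alpha> 3 k) = \<zero>\<^bsub>K\<^esub>"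
    using k by (auto simp: \<kappa>m A0_def A1_def B0_def B1_def a_def b_def)
qed


section \<open>Components of the group algebra at a fixed character of \<open>C_3\<close>\<close>

context group_algebra_rep
begin

lemma lift_minus_eq_zero:
  assumes f: "f \<in> carrier RG" and g: "g \<in> carrier RG" and eq: "lift f = lift g"
  shows "lift (f \<ominus>\<^bsub>RG\<^esub> g) = \<zero>\<^bsub>A\<^esub>"
proof -
  interpret RG: abelian_group RG by (rule RG_abelian_group)
  have fg: "f \<ominus>\<^bsub>RG\<^esub> g \<in> carrier RG" using f g by simp
  have "(f \<ominus>\<^bsub>RG\<^esub> g) \<oplus>\<^bsub>RG\<^esub> g = f"
    using f g by (simp add: RG.minus_eq RG.a_assoc RG.l_neg)
  then have "lift (f \<ominus>\<^bsub>RG\<^esub> g) \<oplus>\<^bsub>A\<^esub> lift g = lift g"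
    using lift_add[OF fg g] eq by simp
  then show ?thesis
    using lift_closed[OF fg] lift_closed[OF g] A.add.r_cancel_one by simp
qed

lemma lift_hom: "lift \<in> hom RG A"
  using lift_mult by (auto simp: hom_def)

end

text \<open>The coefficient of \<open>x^k\<close> once \<open>y\<close> is set to 1, hence the two
  coordinates of the image in \<open>L C_2\<close>.\<close>

definition dihedral_sum ::
    "('b, 'n) ring_scheme \<Rightarrow> ('a \<Rightarrow> 'b) \<Rightarrow> 'b \<Rightarrow> (int \<times> int \<times> int \<Rightarrow> 'a) \<Rightarrow> int \<Rightarrow> 'b" where
  "dihedral_sum L \<iota> \<zeta> f k = twist L \<iota> \<zeta> f 0 k \<oplus>\<^bsub>L\<^esub> (twist L \<iota> \<zeta> f 1 k \<oplus>\<^bsub>L\<^esub> (twist L \<iota> \<zeta> f 2 k \<oplus>\<^bsub>L\<^esub>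
     (twist L \<iota> \<zeta> f 3 k \<oplus>\<^bsub>L\<^esub> twist L \<iota> \<zeta> f 4 k)))"

lemma C2_rep:
  assumes "cring F" "cring L" "\<iota> \<in> ring_hom F L" "\<zeta> \<in> carrier L" "\<zeta> [^]\<^bsub>L\<^esub> (3::nat) = \<one>\<^bsub>L\<^esub>"
  shows "dihedral_rep F L (C2_algebra L) \<iota> \<zeta> (\<lambda>l. (l, \<zero>\<^bsub>L\<^esub>)) \<one>\<^bsub>C2_algebra L\<^esub> (\<zero>\<^bsub>L\<^esub>, \<one>\<^bsub>L\<^esub>)"
proof -
  interpret F: cring F by fact
  interpret L: cring L by fact
  interpret M: ring "C2_algebra L" by (rule L.C2_algebra_ring)
  show ?thesis
  proof
    show "(\<lambda>l. (l, \<zero>\<^bsub>L\<^esub>)) \<in> ring_hom L (C2_algebra L)"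
      by (rule ring_hom_memI) simp_all
    fix l a assume "l \<in> carrier L" "a \<in> carrier (C2_algebra L)"
    then show "a \<otimes>\<^bsub>C2_algebra L\<^esub> (l, \<zero>\<^bsub>L\<^esub>) = (l, \<zero>\<^bsub>L\<^esub>) \<otimes>\<^bsub>C2_algebra L\<^esub> a"
      by (cases a) (simp add: L.m_comm)
  qed (use assms M.nat_pow_one in \<open>simp_all del: C2_algebra_simps(4)\<close>, simp_all)
qed

lemma C2_rep_kernel:
  assumes "cring F" "cring L" "\<iota> \<in> ring_hom F L" "\<zeta> \<in> carrier L" "\<zeta> [^]\<^bsub>L\<^esub> (3::nat) = \<one>\<^bsub>L\<^esub>"
    and f: "f \<in> carrier (group_algebra F C3D10)"
  defines "rep \<equiv> dihedral_rep.\<rho> L (C2_algebra L) \<zeta> (\<lambda>l. (l, \<zero>\<^bsub>L\<^esub>)) \<one>\<^bsub>C2_algebra L\<^esub> (\<zero>\<^bsub>L\<^esub>, \<one>\<^bsub>L\<^esub>)"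
  assumes zero: "group_algebra_rep.lift C3D10 (C2_algebra L) ((\<lambda>l. (l, \<zero>\<^bsub>L\<^esub>)) \<circ> \<iota>) rep f = \<zero>\<^bsub>C2_algebra L\<^esub>"
    and k: "k \<in> {0, 1}"
  shows "dihedral_sum L \<iota> \<zeta> f k = \<zero>\<^bsub>L\<^esub>"
proof -
  interpret F: cring F by fact
  interpret L: cring L by fact
  interpret M: ring "C2_algebra L" by (rule L.C2_algebra_ring)
  interpret D: dihedral_rep F L "C2_algebra L" \<iota> \<zeta> "\<lambda>l. (l, \<zero>\<^bsub>L\<^esub>)" "\<one>\<^bsub>C2_algebra L\<^esub>" "(\<zero>\<^bsub>L\<^esub>, \<one>\<^bsub>L\<^esub>)"
    using assms by (intro C2_rep)
  have "D.rep.lift f = (dihedral_sum L \<iota> \<zeta> f 0, dihedral_sum L \<iota> \<zeta> f 1)"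
    unfolding D.lift_eq_twist[OF f] M.nat_pow_one
    using D.twist_closed[OF f] by (simp add: dihedral_sum_def)
  then show ?thesis using zero[unfolded rep_def] k by auto
qed

text \<open>The differences make all five coefficients equal, and their sum is then five times one
  of them.\<close>

lemma (in field) dihedral_coords_zero:
  assumes five: "\<guillemotleft>5\<guillemotright> \<noteq> \<zero>"
    and cl: "a0 \<in> carrier R" "a1 \<in> carrier R" "a2 \<in> carrier R" "a3 \<in> carrier R" "a4 \<in> carrier R"
    and eq: "a0 \<ominus> a2 = \<zero>" "a4 \<ominus> a3 = \<zero>" "a1 \<ominus> a4 = \<zero>" "a2 \<ominus> a3 = \<zero>"
    and sum: "a0 \<oplus> (a1 \<oplus> (a2 \<oplus> (a3 \<oplus> a4))) = \<zero>"
  shows "a0 = \<zero> \<and> a1 = \<zero> \<and> a2 = \<zero> \<and> a3 = \<zero> \<and> a4 = \<zero>"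
proof -
  have e: "a0 = a3" "a1 = a3" "a2 = a3" "a4 = a3" using eq cl eq_diff0 by auto
  have "\<guillemotleft>5\<guillemotright> \<otimes> a3 = \<zero>" using sum five_times[OF cl(4)] unfolding e by simp
  then show ?thesis using five cl(4) integral_iff e by simp
qed

text \<open>\<open>\<Psi>\<close> is a multiplicative map whose fibres determine \<open>f\<close> evaluated at the character
  \<open>\<zeta>\<close> of \<open>C\<^sub>3\<close>, as an element of the group algebra of \<open>D\<^sub>1\<^sub>0\<close> over \<open>L\<close>.\<close>

definition dihedral_component where
  "dihedral_component F L \<iota> \<zeta> E \<Psi> \<longleftrightarrow>
     \<Psi> \<in> hom (group_algebra F C3D10) E \<and> \<Psi> \<one>\<^bsub>group_algebra F C3D10\<^esub> = \<one>\<^bsub>E\<^esub> \<and>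
     (\<forall>f \<in> carrier (group_algebra F C3D10). \<forall>g \<in> carrier (group_algebra F C3D10). \<Psi> f = \<Psi> g \<longrightarrow>
        (\<forall>j \<in> {0, 1, 2, 3, 4}. \<forall>k \<in> {0, 1}. twist L \<iota> \<zeta> (f \<ominus>\<^bsub>group_algebra F C3D10\<^esub> g) j k = \<zero>\<^bsub>L\<^esub>))"

lemma (in field) two_roots_independent:
  assumes "t \<in> carrier R" "t' \<in> carrier R" "t \<noteq> t'" "u \<in> carrier R" "v \<in> carrier R"
    and "u \<oplus> t \<otimes> v = \<zero>" "u \<oplus> t' \<otimes> v = \<zero>"
  shows "u = \<zero> \<and> v = \<zero>"
proof -
  have "(t \<ominus> t') \<otimes> v = (u \<oplus> t \<otimes> v) \<ominus> (u \<oplus> t' \<otimes> v)"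
    using assms(1-5) by algebra
  also have "\<dots> = \<zero>" by (simp add: assms(6,7))
  finally have "v = \<zero>" using assms(1-5) integral_iff eq_diff0 by (metis minus_closed)
  then show ?thesis using assms by simp
qed

lemma field_hom_inj:
  assumes "field L" "field K" "\<kappa> \<in> ring_hom L K"
  shows "inj_on \<kappa> (carrier L)"
proof -
  interpret L: field L by fact
  interpret K: field K by fact
  interpret h: ring_hom_ring L K \<kappa>
    using assms(3) by (intro ring_hom_ringI2 L.ring_axioms K.ring_axioms)
  have "\<one>\<^bsub>K\<^esub> \<in> \<kappa> ` carrier L" using imageI[OF L.one_closed, of \<kappa>] by simp
  then have "\<kappa> ` carrier L \<noteq> {\<zero>\<^bsub>K\<^esub>}" using K.one_not_zero by (metis singletonD)
  then show ?thesis using h.non_trivial_field_hom_imp_inj[OF L.field_axioms] by simp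
qed

text \<open>A nontrivial relation would give \<open>t = - u / v\<close>, an element of the
  image.\<close>

lemma outside_image_independent:
  assumes "field L" "field K" and \<kappa>: "\<kappa> \<in> ring_hom L K"
    and t: "t \<in> carrier K" "t \<notin> \<kappa> ` carrier L" and uv: "u \<in> carrier L" "v \<in> carrier L"
    and eq: "\<kappa> u \<oplus>\<^bsub>K\<^esub> t \<otimes>\<^bsub>K\<^esub> \<kappa> v = \<zero>\<^bsub>K\<^esub>"
  shows "u = \<zero>\<^bsub>L\<^esub> \<and> v = \<zero>\<^bsub>L\<^esub>"
proof -
  interpret L: field L by fact
  interpret K: field K by fact
  interpret h: ring_hom_ring L K \<kappa>
    using \<kappa> by (intro ring_hom_ringI2 L.ring_axioms K.ring_axioms)
  have v: "v = \<zero>\<^bsub>L\<^esub>"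
  proof (rule ccontr)
    assume "v \<noteq> \<zero>\<^bsub>L\<^esub>"
    then have vi: "inv\<^bsub>L\<^esub> v \<in> carrier L" "v \<otimes>\<^bsub>L\<^esub> inv\<^bsub>L\<^esub> v = \<one>\<^bsub>L\<^esub>" using uv by auto
    have "t = t \<otimes>\<^bsub>K\<^esub> \<kappa> (v \<otimes>\<^bsub>L\<^esub> inv\<^bsub>L\<^esub> v)" using t by (simp only: vi h.hom_one K.r_one)
    also have "\<dots> = (t \<otimes>\<^bsub>K\<^esub> \<kappa> v) \<otimes>\<^bsub>K\<^esub> \<kappa> (inv\<^bsub>L\<^esub> v)" using t uv vi(1) by (simp add: K.m_assoc)
    also have "t \<otimes>\<^bsub>K\<^esub> \<kappa> v = \<ominus>\<^bsub>K\<^esub> \<kappa> u"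
      using eq t uv K.minus_equality[of "t \<otimes>\<^bsub>K\<^esub> \<kappa> v" "\<kappa> u"] by (simp add: K.a_comm)
    also have "\<dots> \<otimes>\<^bsub>K\<^esub> \<kappa> (inv\<^bsub>L\<^esub> v) = \<kappa> ((\<ominus>\<^bsub>L\<^esub> u) \<otimes>\<^bsub>L\<^esub> inv\<^bsub>L\<^esub> v)" using uv vi by simp
    finally have "t \<in> \<kappa> ` carrier L" using uv vi by blast
    then show False using t by simp
  qed
  then have "\<kappa> u = \<zero>\<^bsub>K\<^esub>" using eq t uv by simp
  moreover have "inj_on \<kappa> (carrier L)"
    by (rule field_hom_inj[OF assms(1-3)])
  ultimately have "u = \<zero>\<^bsub>L\<^esub>" using uv h.hom_zero by (metis L.zero_closed inj_onD)
  with v show ?thesis by simp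
qed

text \<open>Both roots lie in \<open>L\<close>: each kernel condition
  \<open>u + \<tau> v = 0\<close> also holds with \<open>\<tau>'\<close>, so
  \<open>u = v = 0\<close>. The dimensions over \<open>L\<close> are 2 + 4 + 4 = 10, that of
  \<open>L D_10\<close>.\<close>

lemma component_two_roots:
  assumes "cring F" "field L" "\<iota> \<in> ring_hom F L" "\<zeta> \<in> carrier L" "\<zeta> [^]\<^bsub>L\<^esub> (3::nat) = \<one>\<^bsub>L\<^esub>"
    and \<tau>: "\<tau> \<in> carrier L" "\<tau> \<otimes>\<^bsub>L\<^esub> \<tau> = \<one>\<^bsub>L\<^esub> \<ominus>\<^bsub>L\<^esub> \<tau>"
    and \<tau>': "\<tau>' \<in> carrier L" "\<tau>' \<otimes>\<^bsub>L\<^esub> \<tau>' = \<one>\<^bsub>L\<^esub> \<ominus>\<^bsub>L\<^esub> \<tau>'" and ne: "\<tau> \<noteq> \<tau>'"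
    and five: "\<guillemotleft>5\<guillemotright>\<^bsub>L\<^esub> \<noteq> \<zero>\<^bsub>L\<^esub>"
  shows "\<exists>\<Psi>. dihedral_component F L \<iota> \<zeta> (C2_algebra L \<times>\<times> mat2_ring L \<times>\<times> mat2_ring L) \<Psi>"
proof -
  interpret F: cring F by fact
  interpret L: field L by fact
  have id: "id \<in> ring_hom L L" by (simp add: ring_hom_def)
  let ?x = "mat2 \<zero>\<^bsub>L\<^esub> \<one>\<^bsub>L\<^esub> \<one>\<^bsub>L\<^esub> \<zero>\<^bsub>L\<^esub>"
  interpret C: dihedral_rep F L "C2_algebra L" \<iota> \<zeta> "\<lambda>l. (l, \<zero>\<^bsub>L\<^esub>)" "\<one>\<^bsub>C2_algebra L\<^esub>" "(\<zero>\<^bsub>L\<^esub>, \<one>\<^bsub>L\<^esub>)"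
    using assms L.cring_axioms by (intro C2_rep)
  interpret D: dihedral_rep F L "mat2_ring L" \<iota> \<zeta> "scalar2 L id" "mat2 \<zero>\<^bsub>L\<^esub> (\<ominus>\<^bsub>L\<^esub> \<one>\<^bsub>L\<^esub>) \<one>\<^bsub>L\<^esub> \<tau>" ?x
    using assms id L.cring_axioms by (intro companion_rep)
  interpret D': dihedral_rep F L "mat2_ring L" \<iota> \<zeta> "scalar2 L id" "mat2 \<zero>\<^bsub>L\<^esub> (\<ominus>\<^bsub>L\<^esub> \<one>\<^bsub>L\<^esub>) \<one>\<^bsub>L\<^esub> \<tau>'" ?x
    using assms id L.cring_axioms by (intro companion_rep)
  interpret FG: abelian_group "group_algebra F C3D10" by (rule C.rep.RG_abelian_group)
  let ?\<Psi> = "\<lambda>f. (C.rep.lift f, D.rep.lift f, D'.rep.lift f)"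
  have "twist L \<iota> \<zeta> (f \<ominus>\<^bsub>group_algebra F C3D10\<^esub> g) j k = \<zero>\<^bsub>L\<^esub>"
    if f: "f \<in> carrier (group_algebra F C3D10)" and g: "g \<in> carrier (group_algebra F C3D10)"
      and eq: "?\<Psi> f = ?\<Psi> g" and j: "j \<in> {0, 1, 2, 3, 4}" and k: "k \<in> {0, 1}" for f g j k
  proof -
    let ?h = "f \<ominus>\<^bsub>group_algebra F C3D10\<^esub> g"
    have h: "?h \<in> carrier (group_algebra F C3D10)" using f g by simp
    let ?\<alpha> = "\<lambda>j. twist L \<iota> \<zeta> ?h j k"
    have cl: "?\<alpha> 0 \<in> carrier L" "?\<alpha> 1 \<in> carrier L" "?\<alpha> 2 \<in> carrier L" "?\<alpha> 3 \<in> carrier L" "?\<alpha> 4 \<in> carrier L"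
      using C.twist_closed[OF h _ k] by simp_all
    have S: "dihedral_sum L \<iota> \<zeta> ?h k = \<zero>\<^bsub>L\<^esub>"
      using C2_rep_kernel[OF assms(1) L.cring_axioms assms(3-5) h C.rep.lift_minus_eq_zero[OF f g] k] eq by simp
    have z: "D.rep.lift ?h = \<zero>\<^bsub>mat2_ring L\<^esub>" and z': "D'.rep.lift ?h = \<zero>\<^bsub>mat2_ring L\<^esub>"
      using D.rep.lift_minus_eq_zero[OF f g] D'.rep.lift_minus_eq_zero[OF f g] eq by simp_all
    note ker = companion_rep_kernel[OF assms(1,2,2,3-5) id _ _ five h _ k]
    note K = ker[OF \<tau> z, unfolded id_apply] and K' = ker[OF \<tau>' z', unfolded id_apply]
    have 1: "?\<alpha> 0 \<ominus>\<^bsub>L\<^esub> ?\<alpha> 2 = \<zero>\<^bsub>L\<^esub> \<and> ?\<alpha> 4 \<ominus>\<^bsub>L\<^esub> ?\<alpha> 3 = \<zero>\<^bsub>L\<^esub>"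
      using eq cl by (intro L.two_roots_independent[OF \<tau>(1) \<tau>'(1) ne _ _ K(1) K'(1)]) simp_all
    have 2: "?\<alpha> 1 \<ominus>\<^bsub>L\<^esub> ?\<alpha> 4 = \<zero>\<^bsub>L\<^esub> \<and> ?\<alpha> 2 \<ominus>\<^bsub>L\<^esub> ?\<alpha> 3 = \<zero>\<^bsub>L\<^esub>"
      using eq cl by (intro L.two_roots_independent[OF \<tau>(1) \<tau>'(1) ne _ _ K(2) K'(2)]) simp_all
    show ?thesis
      using L.dihedral_coords_zero[OF five cl] 1 2 S[unfolded dihedral_sum_def] j by blast
  qed
  moreover have "?\<Psi> \<in> hom (group_algebra F C3D10) (C2_algebra L \<times>\<times> mat2_ring L \<times>\<times> mat2_ring L)"
    unfolding hom_paired using C.rep.lift_hom D.rep.lift_hom D'.rep.lift_hom by blast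
  moreover have "?\<Psi> \<one>\<^bsub>group_algebra F C3D10\<^esub> = \<one>\<^bsub>C2_algebra L \<times>\<times> mat2_ring L \<times>\<times> mat2_ring L\<^esub>"
    using C.rep.lift_one D.rep.lift_one D'.rep.lift_one by simp
  ultimately show ?thesis unfolding dihedral_component_def by blast
qed

text \<open>One root outside \<open>L\<close> does the work of two, because 1 and \<tau> are
  independent over \<open>L\<close>. If \<open>K\<close> is quadratic over \<open>L\<close>, the
  dimensions over \<open>L\<close> are 2 + 8 = 10.\<close>

lemma component_nonroot:
  assumes "cring F" "field L" "field K" "\<iota> \<in> ring_hom F L" "\<zeta> \<in> carrier L" "\<zeta> [^]\<^bsub>L\<^esub> (3::nat) = \<one>\<^bsub>L\<^esub>"
    and \<kappa>: "\<kappa> \<in> ring_hom L K"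
    and \<tau>: "\<tau> \<in> carrier K" "\<tau> \<otimes>\<^bsub>K\<^esub> \<tau> = \<one>\<^bsub>K\<^esub> \<ominus>\<^bsub>K\<^esub> \<tau>" "\<tau> \<notin> \<kappa> ` carrier L"
    and five: "\<guillemotleft>5\<guillemotright>\<^bsub>L\<^esub> \<noteq> \<zero>\<^bsub>L\<^esub>" "\<guillemotleft>5\<guillemotright>\<^bsub>K\<^esub> \<noteq> \<zero>\<^bsub>K\<^esub>"
  shows "\<exists>\<Psi>. dihedral_component F L \<iota> \<zeta> (C2_algebra L \<times>\<times> mat2_ring K) \<Psi>"
proof -
  interpret F: cring F by fact
  interpret L: field L by fact
  interpret K: field K by fact
  let ?x = "mat2 \<zero>\<^bsub>K\<^esub> \<one>\<^bsub>K\<^esub> \<one>\<^bsub>K\<^esub> \<zero>\<^bsub>K\<^esub>"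
  interpret C: dihedral_rep F L "C2_algebra L" \<iota> \<zeta> "\<lambda>l. (l, \<zero>\<^bsub>L\<^esub>)" "\<one>\<^bsub>C2_algebra L\<^esub>" "(\<zero>\<^bsub>L\<^esub>, \<one>\<^bsub>L\<^esub>)"
    using assms L.cring_axioms by (intro C2_rep)
  interpret D: dihedral_rep F L "mat2_ring K" \<iota> \<zeta> "scalar2 K \<kappa>" "mat2 \<zero>\<^bsub>K\<^esub> (\<ominus>\<^bsub>K\<^esub> \<one>\<^bsub>K\<^esub>) \<one>\<^bsub>K\<^esub> \<tau>" ?x
    using assms L.cring_axioms K.cring_axioms by (intro companion_rep)
  interpret FG: abelian_group "group_algebra F C3D10" by (rule C.rep.RG_abelian_group)
  let ?\<Psi> = "\<lambda>f. (C.rep.lift f, D.rep.lift f)"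
  have "twist L \<iota> \<zeta> (f \<ominus>\<^bsub>group_algebra F C3D10\<^esub> g) j k = \<zero>\<^bsub>L\<^esub>"
    if f: "f \<in> carrier (group_algebra F C3D10)" and g: "g \<in> carrier (group_algebra F C3D10)"
      and eq: "?\<Psi> f = ?\<Psi> g" and j: "j \<in> {0, 1, 2, 3, 4}" and k: "k \<in> {0, 1}" for f g j k
  proof -
    let ?h = "f \<ominus>\<^bsub>group_algebra F C3D10\<^esub> g"
    have h: "?h \<in> carrier (group_algebra F C3D10)" using f g by simp
    let ?\<alpha> = "\<lambda>j. twist L \<iota> \<zeta> ?h j k"
    have cl: "?\<alpha> 0 \<in> carrier L" "?\<alpha> 1 \<in> carrier L" "?\<alpha> 2 \<in> carrier L" "?\<alpha> 3 \<in> carrier L" "?\<alpha> 4 \<in> carrier L"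
      using C.twist_closed[OF h _ k] by simp_all
    have S: "dihedral_sum L \<iota> \<zeta> ?h k = \<zero>\<^bsub>L\<^esub>"
      using C2_rep_kernel[OF assms(1) L.cring_axioms assms(4-6) h C.rep.lift_minus_eq_zero[OF f g] k] eq by simp
    note K = companion_rep_kernel[OF assms(1-6) \<kappa> \<tau>(1,2) five(2) h D.rep.lift_minus_eq_zero[OF f g] k]
    have 1: "?\<alpha> 0 \<ominus>\<^bsub>L\<^esub> ?\<alpha> 2 = \<zero>\<^bsub>L\<^esub> \<and> ?\<alpha> 4 \<ominus>\<^bsub>L\<^esub> ?\<alpha> 3 = \<zero>\<^bsub>L\<^esub>"
      using eq cl by (intro outside_image_independent[OF assms(2,3) \<kappa> \<tau>(1,3) _ _ K(1)]) simp_all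
    have 2: "?\<alpha> 1 \<ominus>\<^bsub>L\<^esub> ?\<alpha> 4 = \<zero>\<^bsub>L\<^esub> \<and> ?\<alpha> 2 \<ominus>\<^bsub>L\<^esub> ?\<alpha> 3 = \<zero>\<^bsub>L\<^esub>"
      using eq cl by (intro outside_image_independent[OF assms(2,3) \<kappa> \<tau>(1,3) _ _ K(2)]) simp_all
    show ?thesis
      using L.dihedral_coords_zero[OF five(1) cl] 1 2 S[unfolded dihedral_sum_def] j by blast
  qed
  moreover have "?\<Psi> \<in> hom (group_algebra F C3D10) (C2_algebra L \<times>\<times> mat2_ring K)"
    unfolding hom_paired using C.rep.lift_hom D.rep.lift_hom by blast
  moreover have "?\<Psi> \<one>\<^bsub>group_algebra F C3D10\<^esub> = \<one>\<^bsub>C2_algebra L \<times>\<times> mat2_ring K\<^esub>"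
    using C.rep.lift_one D.rep.lift_one by simp
  ultimately show ?thesis unfolding dihedral_component_def by blast
qed

section \<open>Splitting the group algebra\<close>

text \<open>The two characters of \<open>C_2\<close> send \<open>x\<close> to 1 and to -1; dividing
  by 2 recovers \<open>a\<close> and \<open>b\<close> from \<open>a + b\<close> and
  \<open>a - b\<close>.\<close>

lemma (in field) units_C2_algebra_odd:
  assumes fin: "finite (carrier R)" and two: "\<guillemotleft>2\<guillemotright> \<noteq> \<zero>"
  shows "units_of (C2_algebra R) \<cong> units_of R \<times>\<times> units_of R"
proof -
  let ?h = "\<lambda>(a, b). (a \<oplus> b, a \<ominus> b)"
  have hom: "?h \<in> hom (C2_algebra R) (R \<times>\<times> R)"
  proof (rule homI)
    fix u v assume "u \<in> carrier (C2_algebra R)" "v \<in> carrier (C2_algebra R)"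
    then obtain a b c d where uv: "u = (a, b)" "v = (c, d)"
      and cl: "a \<in> carrier R" "b \<in> carrier R" "c \<in> carrier R" "d \<in> carrier R" by auto
    show "?h u \<in> carrier (R \<times>\<times> R)" using uv cl by simp
    have "a \<otimes> c \<oplus> b \<otimes> d \<oplus> (a \<otimes> d \<oplus> b \<otimes> c) = (a \<oplus> b) \<otimes> (c \<oplus> d)"
      "a \<otimes> c \<oplus> b \<otimes> d \<ominus> (a \<otimes> d \<oplus> b \<otimes> c) = (a \<ominus> b) \<otimes> (c \<ominus> d)"
      using cl by algebra+
    then show "?h (u \<otimes>\<^bsub>C2_algebra R\<^esub> v) = ?h u \<otimes>\<^bsub>R \<times>\<times> R\<^esub> ?h v" using uv by simp
  qed
  have "inj_on ?h (carrier R \<times> carrier R)"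
  proof (rule inj_on_inverseI)
    fix u assume "u \<in> carrier R \<times> carrier R"
    then obtain a b where u: "u = (a, b)" and cl: "a \<in> carrier R" "b \<in> carrier R" by auto
    have "(a \<oplus> b) \<oplus> (a \<ominus> b) = a \<oplus> a" "(a \<oplus> b) \<ominus> (a \<ominus> b) = b \<oplus> b" using cl by algebra+
    then have "(a \<oplus> b) \<oplus> (a \<ominus> b) = \<guillemotleft>2\<guillemotright> \<otimes> a" "(a \<oplus> b) \<ominus> (a \<ominus> b) = \<guillemotleft>2\<guillemotright> \<otimes> b"
      using cl by (simp_all add: mult2)
    then show "(\<lambda>(s, t). (inv \<guillemotleft>2\<guillemotright> \<otimes> (s \<oplus> t), inv \<guillemotleft>2\<guillemotright> \<otimes> (s \<ominus> t))) (?h u) = u"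
      using u cl two by (simp add: m_assoc [symmetric])
  qed
  moreover have "?h ` (carrier R \<times> carrier R) \<subseteq> carrier R \<times> carrier R" by auto
  ultimately have bij: "bij_betw ?h (carrier (C2_algebra R)) (carrier (R \<times>\<times> R))"
    using fin endo_inj_surj[of "carrier R \<times> carrier R" ?h] by (simp add: bij_betw_def)
  interpret C: ring "C2_algebra R" by (rule C2_algebra_ring)
  have "?h \<in> iso (units_of (C2_algebra R)) (units_of (R \<times>\<times> R))"
    by (rule units_of_iso(1)[OF hom bij _ C.one_closed C.m_closed]) simp_all
  then show ?thesis by (auto simp: is_iso_def units_of_DirProd)
qed

text \<open>For a unit, \<open>a + b x = (a + b) (1 + t (1 + x))\<close> with
  \<open>t = b / (a + b)\<close>. Since \<open>(1 + x)^2 = 0\<close>, the factors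
  \<open>1 + t (1 + x)\<close> multiply by adding their parameters \<open>t\<close>.\<close>

lemma (in field) units_C2_algebra_char2:
  assumes two: "\<one> \<oplus> \<one> = \<zero>"
  shows "units_of (C2_algebra R) \<cong> add_monoid R \<times>\<times> units_of R"
proof -
  have dbl: "a \<oplus> a = \<zero>" if "a \<in> carrier R" for a
    using that l_distr[of \<one> \<one> a] two by simp
  have dbl': "a \<oplus> (a \<oplus> c) = c" if "a \<in> carrier R" "c \<in> carrier R" for a c
    using that dbl by (simp add: a_assoc [symmetric])
  interpret C: ring "C2_algebra R" by (rule C2_algebra_ring)
  have U: "Units (C2_algebra R) = {(a, b). a \<in> carrier R \<and> b \<in> carrier R \<and> a \<oplus> b \<noteq> \<zero>}"
  proof (intro equalityI subsetI)
    fix u assume "u \<in> Units (C2_algebra R)"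
    then obtain v where uv: "v \<in> carrier (C2_algebra R)" "u \<otimes>\<^bsub>C2_algebra R\<^esub> v = \<one>\<^bsub>C2_algebra R\<^esub>" "u \<in> carrier (C2_algebra R)"
      unfolding Units_def by blast
    then obtain a b c d where e: "u = (a, b)" "v = (c, d)"
      and cl: "a \<in> carrier R" "b \<in> carrier R" "c \<in> carrier R" "d \<in> carrier R" by auto
    have "(a \<oplus> b) \<otimes> (c \<oplus> d) = (a \<otimes> c \<oplus> b \<otimes> d) \<oplus> (a \<otimes> d \<oplus> b \<otimes> c)"
      using cl by algebra
    also have "\<dots> = \<one>" using uv(2) e by simp
    finally have "a \<oplus> b \<noteq> \<zero>" using cl by auto
    then show "u \<in> {(a, b). a \<in> carrier R \<and> b \<in> carrier R \<and> a \<oplus> b \<noteq> \<zero>}" using e cl by simp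
  next
    fix u assume "u \<in> {(a, b). a \<in> carrier R \<and> b \<in> carrier R \<and> a \<oplus> b \<noteq> \<zero>}"
    then obtain a b where u: "u = (a, b)" and cl: "a \<in> carrier R" "b \<in> carrier R" and nz: "a \<oplus> b \<noteq> \<zero>" by auto
    let ?n = "(a \<oplus> b) \<otimes> (a \<oplus> b)"
    have n: "?n \<in> carrier R" "?n \<noteq> \<zero>" using cl nz integral_iff by auto
    have "a \<otimes> a \<oplus> b \<otimes> b \<oplus> (a \<otimes> b \<oplus> a \<otimes> b) = ?n" using cl by algebra
    then have sq: "a \<otimes> a \<oplus> b \<otimes> b = ?n" using cl dbl[of "a \<otimes> b"] by simp
    \<comment> \<open>In characteristic 2 the square of \<open>a + b x\<close> is the scalar
      \<open>(a + b)^2\<close>, so the inverse is the element itself divided by that scalar.\<close>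
    let ?v = "(a \<otimes> inv ?n, b \<otimes> inv ?n)"
    have i: "inv ?n \<in> carrier R" using n by simp
    have 1: "a \<otimes> (a \<otimes> inv ?n) \<oplus> b \<otimes> (b \<otimes> inv ?n) = (a \<otimes> a \<oplus> b \<otimes> b) \<otimes> inv ?n"
      using cl i by (simp add: l_distr m_assoc)
    have 2: "a \<otimes> (b \<otimes> inv ?n) \<oplus> b \<otimes> (a \<otimes> inv ?n) = \<zero>"
      using cl i dbl[of "a \<otimes> (b \<otimes> inv ?n)"] by (simp add: m_lcomm)
    have "u \<otimes>\<^bsub>C2_algebra R\<^esub> ?v = \<one>\<^bsub>C2_algebra R\<^esub>" using u 1 2 sq n by simp
    moreover have "?v \<otimes>\<^bsub>C2_algebra R\<^esub> u = u \<otimes>\<^bsub>C2_algebra R\<^esub> ?v"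
      using u cl i by (simp add: m_comm a_comm)
    ultimately show "u \<in> Units (C2_algebra R)"
      unfolding Units_def using u cl i by auto
  qed
  let ?h = "\<lambda>(a, b). (b \<otimes> inv (a \<oplus> b), a \<oplus> b)"
  let ?g = "\<lambda>(t, u). (u \<ominus> t \<otimes> u, t \<otimes> u)"
  have "?h \<in> iso (units_of (C2_algebra R)) (add_monoid R \<times>\<times> units_of R)"
  proof (rule isoI)
    show "?h \<in> hom (units_of (C2_algebra R)) (add_monoid R \<times>\<times> units_of R)"
    proof (rule homI)
      fix u v assume "u \<in> carrier (units_of (C2_algebra R))" "v \<in> carrier (units_of (C2_algebra R))"
      then obtain a b c d where uv: "u = (a, b)" "v = (c, d)"
        and cl: "a \<in> carrier R" "b \<in> carrier R" "c \<in> carrier R" "d \<in> carrier R"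
        and nz: "a \<oplus> b \<noteq> \<zero>" "c \<oplus> d \<noteq> \<zero>" by (auto simp: units_of_carrier U)
      show "?h u \<in> carrier (add_monoid R \<times>\<times> units_of R)"
        using uv cl nz by (simp add: units_of_carrier field_Units)
      let ?s = "a \<oplus> b" and ?t = "c \<oplus> d"
      have i: "inv ?s \<in> carrier R" "inv ?t \<in> carrier R" using cl nz by auto
      have 1: "(a \<otimes> c \<oplus> b \<otimes> d) \<oplus> (a \<otimes> d \<oplus> b \<otimes> c) = ?s \<otimes> ?t" using cl by algebra
      have inv: "inv (?s \<otimes> ?t) = inv ?s \<otimes> inv ?t"
        using cl nz by (intro inverse_unique) (auto simp: m_ac)
      have "(a \<otimes> d \<oplus> b \<otimes> c) \<oplus> (b \<otimes> d \<oplus> b \<otimes> d) = b \<otimes> ?t \<oplus> d \<otimes> ?s" using cl by algebra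
      then have 2: "a \<otimes> d \<oplus> b \<otimes> c = b \<otimes> ?t \<oplus> d \<otimes> ?s" using cl dbl[of "b \<otimes> d"] by simp
      have dist: "(b \<otimes> t \<oplus> d \<otimes> s) \<otimes> (s' \<otimes> t') = b \<otimes> (t \<otimes> t') \<otimes> s' \<oplus> d \<otimes> (s \<otimes> s') \<otimes> t'"
        if "s \<in> carrier R" "t \<in> carrier R" "s' \<in> carrier R" "t' \<in> carrier R" for s t s' t'
        using cl that by algebra
      have "(a \<otimes> d \<oplus> b \<otimes> c) \<otimes> (inv ?s \<otimes> inv ?t) = b \<otimes> (?t \<otimes> inv ?t) \<otimes> inv ?s \<oplus> d \<otimes> (?s \<otimes> inv ?s) \<otimes> inv ?t"
        unfolding 2 using cl i by (intro dist) simp_all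
      also have "\<dots> = b \<otimes> inv ?s \<oplus> d \<otimes> inv ?t" using cl nz by simp
      finally show "?h (u \<otimes>\<^bsub>units_of (C2_algebra R)\<^esub> v) = ?h u \<otimes>\<^bsub>add_monoid R \<times>\<times> units_of R\<^esub> ?h v"
        using uv 1 inv by (simp add: units_of_mult)
    qed
    show "bij_betw ?h (carrier (units_of (C2_algebra R))) (carrier (add_monoid R \<times>\<times> units_of R))"
    proof (rule bij_betw_byWitness[where f' = ?g])
      have cancel: "a \<oplus> b \<ominus> b = a" if "a \<in> carrier R" "b \<in> carrier R" for a b
        using that by algebra
      show "\<forall>u\<in>carrier (units_of (C2_algebra R)). ?g (?h u) = u"
        by (auto simp: units_of_carrier U cancel m_assoc)
      have g: "(u \<ominus> t \<otimes> u) \<oplus> t \<otimes> u = u" if "t \<in> carrier R" "u \<in> carrier R" for t u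
        using that by algebra
      show "\<forall>v\<in>carrier (add_monoid R \<times>\<times> units_of R). ?h (?g v) = v"
        using g by (auto simp: units_of_carrier field_Units m_assoc)
      show "?h ` carrier (units_of (C2_algebra R)) \<subseteq> carrier (add_monoid R \<times>\<times> units_of R)"
        by (auto simp: units_of_carrier U field_Units)
      show "?g ` carrier (add_monoid R \<times>\<times> units_of R) \<subseteq> carrier (units_of (C2_algebra R))"
        using g by (auto simp: units_of_carrier U field_Units)
    qed
  qed
  then show ?thesis by (rule is_isoI)
qed

text \<open>Dividing the difference of two equations by the difference of the roots leaves
  \<open>x1 + (t + s) x2 = 0\<close>; two such equations have distinct slopes.\<close>

lemma (in field) quadratic_three_roots:
  assumes t: "t1 \<in> carrier R" "t2 \<in> carrier R" "t3 \<in> carrier R" "t1 \<noteq> t2" "t1 \<noteq> t3" "t2 \<noteq> t3"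
    and x: "x0 \<in> carrier R" "x1 \<in> carrier R" "x2 \<in> carrier R"
    and eq: "x0 \<oplus> (x1 \<otimes> t1 \<oplus> x2 \<otimes> (t1 \<otimes> t1)) = \<zero>" "x0 \<oplus> (x1 \<otimes> t2 \<oplus> x2 \<otimes> (t2 \<otimes> t2)) = \<zero>"
      "x0 \<oplus> (x1 \<otimes> t3 \<oplus> x2 \<otimes> (t3 \<otimes> t3)) = \<zero>"
  shows "x0 = \<zero> \<and> x1 = \<zero> \<and> x2 = \<zero>"
proof -
  have lin: "x1 \<oplus> (t \<oplus> s) \<otimes> x2 = \<zero>"
    if ts: "t \<in> carrier R" "s \<in> carrier R" "t \<noteq> s" "x0 \<oplus> (x1 \<otimes> t \<oplus> x2 \<otimes> (t \<otimes> t)) = \<zero>" "x0 \<oplus> (x1 \<otimes> s \<oplus> x2 \<otimes> (s \<otimes> s)) = \<zero>" for t s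
  proof -
    have "(t \<ominus> s) \<otimes> (x1 \<oplus> (t \<oplus> s) \<otimes> x2) = (x0 \<oplus> (x1 \<otimes> t \<oplus> x2 \<otimes> (t \<otimes> t))) \<ominus> (x0 \<oplus> (x1 \<otimes> s \<oplus> x2 \<otimes> (s \<otimes> s)))"
      using ts(1,2) x by algebra
    also have "\<dots> = \<zero>" by (simp add: ts(4,5))
    moreover have "t \<ominus> s \<noteq> \<zero>" using ts(1-3) eq_diff0 by simp
    ultimately show ?thesis using ts(1,2) x by (simp add: integral_iff)
  qed
  have ne: "t1 \<oplus> t2 \<noteq> t1 \<oplus> t3" using t by simp
  have 0: "x1 = \<zero> \<and> x2 = \<zero>"
    by (rule two_roots_independent[OF _ _ ne x(2,3) lin[OF t(1,2,4) eq(1,2)] lin[OF t(1,3,5) eq(1,3)]]) (use t in simp_all)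
  then show ?thesis using eq(1) t x by simp
qed

text \<open>The counting argument shared by all cases. \<open>E\<close> need only carry a
  multiplication, so the kernel condition is phrased through the difference \<open>f - g\<close> of
  two elements with the same image.\<close>

lemma group_algebra_units_iso:
  assumes F: "cring F" "finite (carrier F)"
    and \<Psi>: "\<Psi> \<in> hom (group_algebra F C3D10) E" "\<Psi> \<one>\<^bsub>group_algebra F C3D10\<^esub> = \<one>\<^bsub>E\<^esub>"
    and ker: "\<And>f g. f \<in> carrier (group_algebra F C3D10) \<Longrightarrow> g \<in> carrier (group_algebra F C3D10) \<Longrightarrow> \<Psi> f = \<Psi> g \<Longrightarrow>
      \<forall>j \<in> {0, 1, 2, 3, 4}. \<forall>k \<in> {0, 1}. \<forall>i \<in> {0, 1, 2}. (f \<ominus>\<^bsub>group_algebra F C3D10\<^esub> g) (i, j, k) = \<zero>\<^bsub>F\<^esub>"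
    and E: "finite (carrier E)" "card (carrier E) = card (carrier F) ^ 30"
  shows "\<Psi> \<in> iso (units_of (group_algebra F C3D10)) (units_of E)"
    "bij_betw \<Psi> (carrier (group_algebra F C3D10)) (carrier E)"
proof -
  interpret F: cring F by fact
  interpret finite_group_algebra F C3D10
    by (intro finite_group_algebra.intro finite_group_algebra_axioms.intro group_C3D10 F.cring_axioms)
       (simp add: carrier_C3D10 del: carrier_DirProd)
  interpret RG: abelian_group RG by (rule RG_abelian_group)
  have inj: "inj_on \<Psi> (carrier RG)"
  proof (rule inj_onI)
    fix f g assume fg: "f \<in> carrier RG" "g \<in> carrier RG" "\<Psi> f = \<Psi> g"
    have d: "f \<ominus>\<^bsub>RG\<^esub> g \<in> carrier RG" using fg by simp
    have "f \<ominus>\<^bsub>RG\<^esub> g = \<zero>\<^bsub>RG\<^esub>"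
    proof (rule extensionalityI[where A = "carrier C3D10"])
      show "f \<ominus>\<^bsub>RG\<^esub> g \<in> extensional (carrier C3D10)" using d by (simp add: carrier_RG PiE_iff)
      show "\<zero>\<^bsub>RG\<^esub> \<in> extensional (carrier C3D10)" by (simp add: RG_zero)
      fix h assume h: "h \<in> carrier C3D10"
      then obtain i j k where ijk: "h = (i, j, k)" "i \<in> {0, 1, 2}" "j \<in> {0, 1, 2, 3, 4}" "k \<in> {0, 1}"
        unfolding carrier_C3D10 by blast
      then have "(f \<ominus>\<^bsub>RG\<^esub> g) h = \<zero>\<^bsub>F\<^esub>" using ker[OF fg] by blast
      then show "(f \<ominus>\<^bsub>RG\<^esub> g) h = \<zero>\<^bsub>RG\<^esub> h" using h by (simp add: RG_zero del: carrier_DirProd)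
    qed
    moreover have "(f \<ominus>\<^bsub>RG\<^esub> g) \<oplus>\<^bsub>RG\<^esub> g = f"
      using fg by (simp add: RG.minus_eq RG.a_assoc RG.l_neg)
    ultimately show "f = g" using fg by simp
  qed
  have "card (carrier C3D10) = 30"
    unfolding carrier_C3D10 by (simp add: card_cartesian_product)
  then have "card (carrier RG) = card (carrier E)" using E card_RG by simp
  moreover have sub: "\<Psi> ` carrier RG \<subseteq> carrier E" using \<Psi>(1) by (auto simp: hom_def)
  ultimately have "\<Psi> ` carrier RG = carrier E"
    using card_subset_eq[OF E(1) sub] card_image[OF inj] by simp
  then show bij: "bij_betw \<Psi> (carrier RG) (carrier E)" using inj by (simp add: bij_betw_def)
  show "\<Psi> \<in> iso (units_of RG) (units_of E)"
    by (rule units_of_iso(1)[OF \<Psi>(1) bij \<Psi>(2) RG_one_closed RG_mult_closed])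
qed

text \<open>The points 1, \<omega>, \<omega>^2 are distinct. The products with \<open>\<one>\<close>
  are left unsimplified in order to match the shape of \<open>twist\<close>.\<close>

lemma (in field) three_characters:
  assumes \<omega>: "\<omega> \<in> carrier R" "\<omega> [^] (3::nat) = \<one>" "\<omega> \<noteq> \<one>"
    and x: "x0 \<in> carrier R" "x1 \<in> carrier R" "x2 \<in> carrier R"
    and eq: "x0 \<oplus> (x1 \<otimes> \<one> \<oplus> x2 \<otimes> (\<one> \<otimes> \<one>)) = \<zero>" "x0 \<oplus> (x1 \<otimes> \<omega> \<oplus> x2 \<otimes> (\<omega> \<otimes> \<omega>)) = \<zero>"
      "x0 \<oplus> (x1 \<otimes> (\<omega> \<otimes> \<omega>) \<oplus> x2 \<otimes> ((\<omega> \<otimes> \<omega>) \<otimes> (\<omega> \<otimes> \<omega>))) = \<zero>"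
  shows "x0 = \<zero> \<and> x1 = \<zero> \<and> x2 = \<zero>"
proof -
  have \<omega>3: "\<omega> \<otimes> (\<omega> \<otimes> \<omega>) = \<one>" using \<omega> by (simp add: numeral_3_eq_3 m_assoc)
  have nz: "\<omega> \<noteq> \<zero>" using \<omega>3 by auto
  have 1: "\<one> \<noteq> \<omega> \<otimes> \<omega>" using \<omega>3 \<omega> by (metis r_one)
  have "\<omega> \<otimes> \<omega> \<noteq> \<omega> \<otimes> \<one>" using \<omega> nz m_lcancel by blast
  then have 2: "\<omega> \<noteq> \<omega> \<otimes> \<omega>" using \<omega> by simp
  show ?thesis
    using quadratic_three_roots[OF one_closed \<omega>(1) _ \<omega>(3)[symmetric] 1 2 x eq] \<omega>(1) by simp
qed

text \<open>If \<open>F\<close> contains \<omega>, all three characters of \<open>C_3\<close> are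
  defined over \<open>F\<close> and each contributes a component with \<open>q^10\<close>
  elements.\<close>

lemma units_split_three:
  assumes "field F" "finite (carrier F)"
    and \<omega>: "\<omega> \<in> carrier F" "\<omega> [^]\<^bsub>F\<^esub> (3::nat) = \<one>\<^bsub>F\<^esub>" "\<omega> \<noteq> \<one>\<^bsub>F\<^esub>"
    and E: "finite (carrier E)" "card (carrier E) = card (carrier F) ^ 10"
    and comp: "\<And>\<zeta>. \<zeta> \<in> carrier F \<Longrightarrow> \<zeta> [^]\<^bsub>F\<^esub> (3::nat) = \<one>\<^bsub>F\<^esub> \<Longrightarrow> \<exists>\<Psi>. dihedral_component F F id \<zeta> E \<Psi>"
  shows "units_of (group_algebra F C3D10) \<cong> units_of E \<times>\<times> units_of E \<times>\<times> units_of E"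
proof -
  interpret F: field F by fact
  have \<omega>\<omega>: "(\<omega> \<otimes>\<^bsub>F\<^esub> \<omega>) [^]\<^bsub>F\<^esub> (3::nat) = \<one>\<^bsub>F\<^esub>" using \<omega> by (simp add: F.nat_pow_distrib)
  obtain \<Psi>1 \<Psi>2 \<Psi>3 where \<Psi>: "dihedral_component F F id \<one>\<^bsub>F\<^esub> E \<Psi>1" "dihedral_component F F id \<omega> E \<Psi>2"
    "dihedral_component F F id (\<omega> \<otimes>\<^bsub>F\<^esub> \<omega>) E \<Psi>3"
    using comp[of "\<one>\<^bsub>F\<^esub>"] comp[OF \<omega>(1,2)] comp[OF _ \<omega>\<omega>] \<omega>(1) by auto
  note D = \<Psi>[unfolded dihedral_component_def]
  let ?\<Psi> = "\<lambda>f. (\<Psi>1 f, \<Psi>2 f, \<Psi>3 f)"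
  interpret finite_group_algebra F C3D10
    by (intro finite_group_algebra.intro finite_group_algebra_axioms.intro group_C3D10 F.cring_axioms)
       (simp add: carrier_C3D10 del: carrier_DirProd)
  interpret RG: abelian_group RG by (rule RG_abelian_group)
  have "?\<Psi> \<in> iso (units_of (group_algebra F C3D10)) (units_of (E \<times>\<times> E \<times>\<times> E))"
  proof (rule group_algebra_units_iso(1)[OF F.cring_axioms assms(2)])
    show "?\<Psi> \<in> hom RG (E \<times>\<times> E \<times>\<times> E)" unfolding hom_paired using D by blast
    show "?\<Psi> \<one>\<^bsub>RG\<^esub> = \<one>\<^bsub>E \<times>\<times> E \<times>\<times> E\<^esub>" using D by simp
    show "finite (carrier (E \<times>\<times> E \<times>\<times> E))" using E by simp
    show "card (carrier (E \<times>\<times> E \<times>\<times> E)) = card (carrier F) ^ 30"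
      using E by (simp add: card_cartesian_product flip: power_add)
    fix f g assume fg: "f \<in> carrier RG" "g \<in> carrier RG" "?\<Psi> f = ?\<Psi> g"
    let ?d = "f \<ominus>\<^bsub>RG\<^esub> g"
    show "\<forall>j\<in>{0, 1, 2, 3, 4}. \<forall>k\<in>{0, 1}. \<forall>i\<in>{0, 1, 2}. ?d (i, j, k) = \<zero>\<^bsub>F\<^esub>"
    proof (intro ballI)
      fix j k i :: int assume j: "j \<in> {0, 1, 2, 3, 4}" and k: "k \<in> {0, 1}" and i: "i \<in> {0, 1, 2}"
      have cl: "?d (i, j, k) \<in> carrier F" if "i \<in> {0, 1, 2}" for i
        by (rule RG_val) (use fg j k that in \<open>simp_all only: carrier_C3D10 mem_Sigma_iff RG.minus_closed\<close>)
      have "twist F id \<one>\<^bsub>F\<^esub> ?d j k = \<zero>\<^bsub>F\<^esub>" "twist F id \<omega> ?d j k = \<zero>\<^bsub>F\<^esub>" "twist F id (\<omega> \<otimes>\<^bsub>F\<^esub> \<omega>) ?d j k = \<zero>\<^bsub>F\<^esub>"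
        using D fg j k by blast+
      then have "?d (0, j, k) = \<zero>\<^bsub>F\<^esub> \<and> ?d (1, j, k) = \<zero>\<^bsub>F\<^esub> \<and> ?d (2, j, k) = \<zero>\<^bsub>F\<^esub>"
        unfolding twist_def id_apply using cl by (intro F.three_characters[OF \<omega>]) simp_all
      then show "?d (i, j, k) = \<zero>\<^bsub>F\<^esub>" using i by auto
    qed
  qed
  then show ?thesis by (auto simp: is_iso_def units_of_DirProd)
qed

text \<open>As 1 + \<omega> + \<omega>^2 = 0, the second equation becomes
  \<open>(x0 - x2) + \<omega> (x1 - x2) = 0\<close>, so all three coefficients are equal; the
  trivial character then gives \<open>3 x2 = 0\<close>.\<close>

lemma character_pair:
  assumes "field F" "field K" and \<iota>: "\<iota> \<in> ring_hom F K"
    and \<omega>: "\<omega> \<in> carrier K" "\<omega> [^]\<^bsub>K\<^esub> (3::nat) = \<one>\<^bsub>K\<^esub>" "\<omega> \<notin> \<iota> ` carrier F"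
    and three: "\<guillemotleft>3\<guillemotright>\<^bsub>F\<^esub> \<noteq> \<zero>\<^bsub>F\<^esub>"
    and x: "x0 \<in> carrier F" "x1 \<in> carrier F" "x2 \<in> carrier F"
    and eq: "x0 \<oplus>\<^bsub>F\<^esub> (x1 \<otimes>\<^bsub>F\<^esub> \<one>\<^bsub>F\<^esub> \<oplus>\<^bsub>F\<^esub> x2 \<otimes>\<^bsub>F\<^esub> (\<one>\<^bsub>F\<^esub> \<otimes>\<^bsub>F\<^esub> \<one>\<^bsub>F\<^esub>)) = \<zero>\<^bsub>F\<^esub>"
      "\<iota> x0 \<oplus>\<^bsub>K\<^esub> (\<iota> x1 \<otimes>\<^bsub>K\<^esub> \<omega> \<oplus>\<^bsub>K\<^esub> \<iota> x2 \<otimes>\<^bsub>K\<^esub> (\<omega> \<otimes>\<^bsub>K\<^esub> \<omega>)) = \<zero>\<^bsub>K\<^esub>"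
  shows "x0 = \<zero>\<^bsub>F\<^esub> \<and> x1 = \<zero>\<^bsub>F\<^esub> \<and> x2 = \<zero>\<^bsub>F\<^esub>"
proof -
  interpret F: field F by fact
  interpret K: field K by fact
  interpret h: ring_hom_ring F K \<iota>
    using \<iota> by (intro ring_hom_ringI2 F.ring_axioms K.ring_axioms)
  have \<omega>3: "\<omega> \<otimes>\<^bsub>K\<^esub> (\<omega> \<otimes>\<^bsub>K\<^esub> \<omega>) = \<one>\<^bsub>K\<^esub>" using \<omega> by (simp add: numeral_3_eq_3 K.m_assoc)
  have ne: "\<omega> \<ominus>\<^bsub>K\<^esub> \<one>\<^bsub>K\<^esub> \<noteq> \<zero>\<^bsub>K\<^esub>" using \<omega>(1,3) imageI[OF F.one_closed, of \<iota>] K.eq_diff0 by auto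
  have "(\<omega> \<ominus>\<^bsub>K\<^esub> \<one>\<^bsub>K\<^esub>) \<otimes>\<^bsub>K\<^esub> (\<one>\<^bsub>K\<^esub> \<oplus>\<^bsub>K\<^esub> \<omega> \<oplus>\<^bsub>K\<^esub> \<omega> \<otimes>\<^bsub>K\<^esub> \<omega>) = \<omega> \<otimes>\<^bsub>K\<^esub> (\<omega> \<otimes>\<^bsub>K\<^esub> \<omega>) \<ominus>\<^bsub>K\<^esub> \<one>\<^bsub>K\<^esub>"
    using \<omega>(1) by algebra
  also have "\<dots> = \<zero>\<^bsub>K\<^esub>" by (simp add: \<omega>3)
  finally have cyc: "\<one>\<^bsub>K\<^esub> \<oplus>\<^bsub>K\<^esub> \<omega> \<oplus>\<^bsub>K\<^esub> \<omega> \<otimes>\<^bsub>K\<^esub> \<omega> = \<zero>\<^bsub>K\<^esub>"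
    using ne \<omega>(1) K.integral_iff by simp
  let ?s = "\<one>\<^bsub>K\<^esub> \<oplus>\<^bsub>K\<^esub> \<omega> \<oplus>\<^bsub>K\<^esub> \<omega> \<otimes>\<^bsub>K\<^esub> \<omega>"
  have xk: "\<iota> x0 \<in> carrier K" "\<iota> x1 \<in> carrier K" "\<iota> x2 \<in> carrier K" using x by auto
  have "(\<iota> x0 \<ominus>\<^bsub>K\<^esub> \<iota> x2) \<oplus>\<^bsub>K\<^esub> \<omega> \<otimes>\<^bsub>K\<^esub> (\<iota> x1 \<ominus>\<^bsub>K\<^esub> \<iota> x2) =
      (\<iota> x0 \<oplus>\<^bsub>K\<^esub> (\<iota> x1 \<otimes>\<^bsub>K\<^esub> \<omega> \<oplus>\<^bsub>K\<^esub> \<iota> x2 \<otimes>\<^bsub>K\<^esub> (\<omega> \<otimes>\<^bsub>K\<^esub> \<omega>))) \<ominus>\<^bsub>K\<^esub> ?s \<otimes>\<^bsub>K\<^esub> \<iota> x2"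
    using xk \<omega>(1) by algebra
  also have "\<dots> = \<zero>\<^bsub>K\<^esub>" unfolding eq(2) cyc using xk by simp
  finally have "\<iota> (x0 \<ominus>\<^bsub>F\<^esub> x2) \<oplus>\<^bsub>K\<^esub> \<omega> \<otimes>\<^bsub>K\<^esub> \<iota> (x1 \<ominus>\<^bsub>F\<^esub> x2) = \<zero>\<^bsub>K\<^esub>"
    using x by (simp add: F.minus_eq K.minus_eq)
  then have "x0 \<ominus>\<^bsub>F\<^esub> x2 = \<zero>\<^bsub>F\<^esub> \<and> x1 \<ominus>\<^bsub>F\<^esub> x2 = \<zero>\<^bsub>F\<^esub>"
    using x by (intro outside_image_independent[OF assms(1,2) \<iota> \<omega>(1,3)]) simp_all
  then have e: "x0 = x2" "x1 = x2" using x F.eq_diff0 by auto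
  have "\<guillemotleft>3\<guillemotright>\<^bsub>F\<^esub> \<otimes>\<^bsub>F\<^esub> x2 = \<zero>\<^bsub>F\<^esub>" using eq(1) x F.three_times[OF x(3)] unfolding e by simp
  then show ?thesis using three x e F.integral_iff by simp
qed

text \<open>A cube root of unity outside \<open>F\<close> accounts for itself and its conjugate at
  once: over a quadratic \<open>K\<close> its component has \<open>q^20\<close> elements.\<close>

lemma units_split_two:
  assumes "field F" "finite (carrier F)" "field K" and \<iota>: "\<iota> \<in> ring_hom F K"
    and \<omega>: "\<omega> \<in> carrier K" "\<omega> [^]\<^bsub>K\<^esub> (3::nat) = \<one>\<^bsub>K\<^esub>" "\<omega> \<notin> \<iota> ` carrier F"
    and three: "\<guillemotleft>3\<guillemotright>\<^bsub>F\<^esub> \<noteq> \<zero>\<^bsub>F\<^esub>"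
    and E: "finite (carrier E1)" "finite (carrier E2)" "card (carrier E1) * card (carrier E2) = card (carrier F) ^ 30"
    and comp: "dihedral_component F F id \<one>\<^bsub>F\<^esub> E1 \<Psi>1" "dihedral_component F K \<iota> \<omega> E2 \<Psi>2"
  shows "units_of (group_algebra F C3D10) \<cong> units_of E1 \<times>\<times> units_of E2"
proof -
  interpret F: field F by fact
  note D = comp[unfolded dihedral_component_def]
  let ?\<Psi> = "\<lambda>f. (\<Psi>1 f, \<Psi>2 f)"
  interpret finite_group_algebra F C3D10
    by (intro finite_group_algebra.intro finite_group_algebra_axioms.intro group_C3D10 F.cring_axioms)
       (simp add: carrier_C3D10 del: carrier_DirProd)
  interpret RG: abelian_group RG by (rule RG_abelian_group)
  have "?\<Psi> \<in> iso (units_of (group_algebra F C3D10)) (units_of (E1 \<times>\<times> E2))"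
  proof (rule group_algebra_units_iso(1)[OF F.cring_axioms assms(2)])
    show "?\<Psi> \<in> hom RG (E1 \<times>\<times> E2)" unfolding hom_paired using D by blast
    show "?\<Psi> \<one>\<^bsub>RG\<^esub> = \<one>\<^bsub>E1 \<times>\<times> E2\<^esub>" using D by simp
    show "finite (carrier (E1 \<times>\<times> E2))" using E by simp
    show "card (carrier (E1 \<times>\<times> E2)) = card (carrier F) ^ 30"
      using E by (simp add: card_cartesian_product)
    fix f g assume fg: "f \<in> carrier RG" "g \<in> carrier RG" "?\<Psi> f = ?\<Psi> g"
    let ?d = "f \<ominus>\<^bsub>RG\<^esub> g"
    show "\<forall>j\<in>{0, 1, 2, 3, 4}. \<forall>k\<in>{0, 1}. \<forall>i\<in>{0, 1, 2}. ?d (i, j, k) = \<zero>\<^bsub>F\<^esub>"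
    proof (intro ballI)
      fix j k i :: int assume j: "j \<in> {0, 1, 2, 3, 4}" and k: "k \<in> {0, 1}" and i: "i \<in> {0, 1, 2}"
      have cl: "?d (i, j, k) \<in> carrier F" if "i \<in> {0, 1, 2}" for i
        by (rule RG_val) (use fg j k that in \<open>simp_all only: carrier_C3D10 mem_Sigma_iff RG.minus_closed\<close>)
      have "twist F id \<one>\<^bsub>F\<^esub> ?d j k = \<zero>\<^bsub>F\<^esub>" "twist K \<iota> \<omega> ?d j k = \<zero>\<^bsub>K\<^esub>"
        using D fg j k by blast+
      then have "?d (0, j, k) = \<zero>\<^bsub>F\<^esub> \<and> ?d (1, j, k) = \<zero>\<^bsub>F\<^esub> \<and> ?d (2, j, k) = \<zero>\<^bsub>F\<^esub>"
        unfolding twist_def id_apply using cl by (intro character_pair[OF assms(1,3) \<iota> \<omega> three]) simp_all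
      then show "?d (i, j, k) = \<zero>\<^bsub>F\<^esub>" using i by auto
    qed
  qed
  then show ?thesis by (auto simp: is_iso_def units_of_DirProd)
qed


section \<open>Characteristic, dimension and cardinality\<close>

lemma (in ring) of_int_eq_zero_iff: "\<guillemotleft>int n\<guillemotright> = \<zero> \<longleftrightarrow> ring_char R dvd n"
proof -
  have "\<guillemotleft>int n\<guillemotright> = [n] \<cdot> \<one>"
    by (induction n) (simp_all add: a_comm)
  then show ?thesis
    using add.pow_eq_id[of \<one> n] by (simp add: ring_char_def add_pow_def)
qed

lemma ring_hom_of_int:
  assumes "ring R" "ring S" "h \<in> ring_hom R S"
  shows "h \<guillemotleft>i\<guillemotright>\<^bsub>R\<^esub> = \<guillemotleft>i\<guillemotright>\<^bsub>S\<^esub>"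
proof -
  interpret ring_hom_ring R S h using assms by (intro ring_hom_ringI2) auto
  have "h \<guillemotleft>int n\<guillemotright>\<^bsub>R\<^esub> = \<guillemotleft>int n\<guillemotright>\<^bsub>S\<^esub>" for n by (induction n) simp_all
  from this[of "nat i"] this[of "nat (- i)"] show ?thesis
    by (cases "i \<ge> 0") (simp_all add: of_integer_def)
qed

text \<open>Adjoining \<open>v\<close> outside \<open>E'\<close> multiplies the cardinality by that
  of \<open>K\<close>, because \<open>(k, e)\<close> is determined by
  \<open>k v + e\<close>.\<close>

lemma (in ring) dimension_card:
  assumes K: "subfield K R" and fin: "finite K" and dim: "dimension n K E"
  shows "finite E \<and> card E = card K ^ n"
  using dim
proof (induction n arbitrary: E)
  case 0
  then show ?case using dimension_zero[OF K 0] by simp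
next
  case (Suc n)
  from Suc.prems obtain v E' where E: "E = line_extension K v E'"
    and v: "v \<in> carrier R" "v \<notin> E'" "dimension n K E'"
    by (cases rule: dimension.cases) auto
  have IH: "finite E'" "card E' = card K ^ n" using Suc.IH[OF v(3)] by auto
  note P = space_subgroup_props[OF K v(3)]
  have Kc: "K \<subseteq> carrier R" using subfieldE(3)[OF K] .
  have sub: "a \<ominus> b \<in> K" if "a \<in> K" "b \<in> K" for a b
    using that subringE(5,7)[OF subfieldE(1)[OF K]] by (simp add: minus_eq)
  let ?f = "\<lambda>(k, e). k \<otimes> v \<oplus> e"
  have im: "?f ` (K \<times> E') = E"
  proof (intro equalityI subsetI)
    show "u \<in> E" if "u \<in> ?f ` (K \<times> E')" for u
      using that line_extension_mem_iff[of u K v E'] unfolding E by auto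
    show "u \<in> ?f ` (K \<times> E')" if "u \<in> E" for u
    proof -
      obtain k e where "k \<in> K" "e \<in> E'" "u = k \<otimes> v \<oplus> e"
        using \<open>u \<in> E\<close> line_extension_mem_iff[of u K v E'] unfolding E by blast
      then show ?thesis by (intro image_eqI[of _ _ "(k, e)"]) auto
    qed
  qed
  have inj: "inj_on ?f (K \<times> E')"
  proof (rule inj_onI, clarify)
    fix k e k' e' assume *: "k \<in> K" "e \<in> E'" "k' \<in> K" "e' \<in> E'" "k \<otimes> v \<oplus> e = k' \<otimes> v \<oplus> e'"
    then have c: "k \<in> carrier R" "e \<in> carrier R" "k' \<in> carrier R" "e' \<in> carrier R" using Kc P(1) by auto
    have "(k \<ominus> k') \<otimes> v = (k \<otimes> v \<oplus> e) \<ominus> (k' \<otimes> v \<oplus> e') \<oplus> (e' \<ominus> e)"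
      using c v(1) by algebra
    then have d: "(k \<ominus> k') \<otimes> v = e' \<ominus> e" using *(5) c v(1) by (simp add: r_neg minus_eq)
    have "e' \<ominus> e \<in> E'" using * P by (simp add: minus_eq)
    then have "k \<ominus> k' = \<zero>" using P(6)[of "k \<ominus> k'" v] d v sub * by auto
    then have kk: "k = k'" using c eq_diff0 by simp
    then show "k = k' \<and> e = e'" using *(5) c v(1) by simp
  qed
  have "finite (K \<times> E')" using fin IH by simp
  then show ?case
    using card_image[OF inj] im IH by (auto simp: card_cartesian_product dest: finite_imageI[of _ ?f])
qed

text \<open>Reduces the extension to two facts, an embedding of \<open>F\<close> and the
  cardinality; everything later rests on these.\<close>

lemma quadratic_extension_card:
  assumes "finite (carrier F)" "field_extension_of_degree 2 F K"
  obtains \<iota> where "\<iota> \<in> ring_hom F K" "finite (carrier K)" "card (carrier K) = card (carrier F) ^ 2"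
proof -
  obtain \<iota> where \<iota>: "field F" "field K" "\<iota> \<in> ring_hom F K" "ring.dimension K 2 (\<iota> ` carrier F) (carrier K)"
    using assms(2) by (auto simp: field_extension_of_degree_def)
  interpret F: field F by fact
  interpret K: field K by fact
  interpret h: ring_hom_ring F K \<iota>
    using \<iota>(3) by (intro ring_hom_ringI2 F.ring_axioms K.ring_axioms)
  have "subfield (\<iota> ` carrier F) K"
    using h.img_is_subfield(2)[OF F.carrier_is_subfield] by simp
  then have "finite (carrier K) \<and> card (carrier K) = card (\<iota> ` carrier F) ^ 2"
    using K.dimension_card[OF _ _ \<iota>(4)] assms(1) by simp
  then show ?thesis
    using that[OF \<iota>(3)] card_image[OF field_hom_inj[OF \<iota>(1-3)]] by simp
qed

section \<open>Roots of unity in a finite field and the equation of the golden ratio\<close>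

context field
begin

lemma generator_exists:
  assumes fin: "finite (carrier R)"
  obtains a where "a \<in> carrier R" "a \<noteq> \<zero>" "\<And>x. x \<in> carrier R \<Longrightarrow> x \<noteq> \<zero> \<Longrightarrow> \<exists>i::nat. x = a [^] i"
    "\<And>i::nat. a [^] i = \<one> \<longleftrightarrow> card (carrier R) - 1 dvd i"
proof -
  interpret M: group "Multiplicative_Group.mult_of R" by (rule field_mult_group)
  obtain a where a: "a \<in> carrier (Multiplicative_Group.mult_of R)"
      "carrier (Multiplicative_Group.mult_of R) = {a [^] i | i::nat. i \<in> UNIV}"
    using finite_field_mult_group_has_gen[OF fin] by blast
  have fin': "finite (carrier (Multiplicative_Group.mult_of R))" using fin by simp
  have "carrier (Multiplicative_Group.mult_of R) = generate (Multiplicative_Group.mult_of R) {a}"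
    using a(2) M.generate_pow_on_finite_carrier[OF fin' a(1)] by (simp add: Multiplicative_Group.nat_pow_mult_of)
  then have ord: "M.ord a = card (carrier R) - 1"
    using M.generate_pow_card[OF a(1)] order_mult_of[OF fin] by (simp add: order_def)
  show ?thesis
  proof
    show "a [^] i = \<one> \<longleftrightarrow> card (carrier R) - 1 dvd i" for i :: nat
      using M.pow_eq_id[OF a(1), of i] ord by (simp add: Multiplicative_Group.nat_pow_mult_of)
  qed (use a in auto)
qed

text \<open>For a generator \<open>a\<close> of the multiplicative group the root is
  \<open>a^m\<close>, where \<open>m\<close> is the quotient of the group order by
  \<open>n\<close>.\<close>

lemma prime_root_exists:
  assumes fin: "finite (carrier R)" and n: "n dvd card (carrier R) - 1" "n > 1"
  obtains z where "z \<in> carrier R" "z [^] n = \<one>" "z \<noteq> \<one>"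
proof -
  obtain a where a: "a \<in> carrier R" and ord: "\<And>i::nat. a [^] i = \<one> \<longleftrightarrow> card (carrier R) - 1 dvd i"
    using generator_exists[OF fin] by metis
  have "card (carrier R) \<ge> 2" using card_mono[OF fin, of "{\<zero>, \<one>}"] by simp
  then have N: "card (carrier R) - 1 > 0" by simp
  obtain m where m: "card (carrier R) - 1 = n * m" using n by blast
  then have "m > 0" using N by (cases m) auto
  then have "\<not> n * m dvd m" using n(2) by (auto dest!: dvd_imp_le)
  then have "a [^] m \<noteq> \<one>" using ord m by simp
  moreover have "(a [^] m) [^] n = \<one>" using ord[of "m * n"] m a by (simp add: nat_pow_pow mult.commute)
  ultimately show ?thesis using that[of "a [^] m"] a by simp
qed

lemma pow_card_minus_one:
  assumes fin: "finite (carrier R)" and "x \<in> carrier R" "x \<noteq> \<zero>"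
  shows "x [^] (card (carrier R) - 1) = \<one>"
proof -
  obtain a where a: "a \<in> carrier R" "\<And>x. x \<in> carrier R \<Longrightarrow> x \<noteq> \<zero> \<Longrightarrow> \<exists>i::nat. x = a [^] i"
      and ord: "\<And>i::nat. a [^] i = \<one> \<longleftrightarrow> card (carrier R) - 1 dvd i"
    using generator_exists[OF fin] by metis
  obtain i :: nat where "x = a [^] i" using a(2) assms(2,3) by blast
  then show ?thesis using a(1) ord by (simp add: nat_pow_pow)
qed

lemma root_trivial:
  assumes fin: "finite (carrier R)" and z: "z \<in> carrier R" "z [^] n = \<one>"
    and cop: "coprime n (card (carrier R) - 1)" and n: "n > 0"
  shows "z = \<one>"
proof -
  have nz: "z \<noteq> \<zero>" using z n by (auto simp: nat_pow_zero)
  obtain a where a: "a \<in> carrier R" "\<And>x. x \<in> carrier R \<Longrightarrow> x \<noteq> \<zero> \<Longrightarrow> \<exists>i::nat. x = a [^] i"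
      and ord: "\<And>i::nat. a [^] i = \<one> \<longleftrightarrow> card (carrier R) - 1 dvd i"
    using generator_exists[OF fin] by metis
  obtain i :: nat where i: "z = a [^] i" using a(2) z(1) nz by blast
  have "card (carrier R) - 1 dvd i * n" using z(2) i a(1) ord by (simp add: nat_pow_pow)
  then have "card (carrier R) - 1 dvd i" using cop by (simp add: coprime_commute coprime_dvd_mult_left_iff)
  then show ?thesis using i ord by simp
qed

lemma cube_root_quadratic:
  assumes \<omega>: "\<omega> \<in> carrier R" "\<omega> [^] (3::nat) = \<one>" "\<omega> \<noteq> \<one>"
  shows "\<one> \<oplus> \<omega> \<oplus> \<omega> \<otimes> \<omega> = \<zero>"
proof -
  have \<omega>3: "\<omega> \<otimes> (\<omega> \<otimes> \<omega>) = \<one>" using \<omega> by (simp add: numeral_3_eq_3 m_assoc)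
  have ne: "\<omega> \<ominus> \<one> \<noteq> \<zero>" using \<omega>(1,3) eq_diff0 by simp
  have "(\<omega> \<ominus> \<one>) \<otimes> (\<one> \<oplus> \<omega> \<oplus> \<omega> \<otimes> \<omega>) = \<omega> \<otimes> (\<omega> \<otimes> \<omega>) \<ominus> \<one>"
    using \<omega>(1) by algebra
  also have "\<dots> = \<zero>" by (simp add: \<omega>3)
  finally show ?thesis using ne \<omega>(1) integral_iff by simp
qed

text \<open>In characteristic 2 the equations of \<omega> and \<tau> coincide. Hence
  \<open>q\<close> modulo 3 decides about both at once.\<close>

lemma cube_root_golden_char2:
  assumes "\<one> \<oplus> \<one> = \<zero>" "\<omega> \<in> carrier R" "\<omega> [^] (3::nat) = \<one>" "\<omega> \<noteq> \<one>"
  shows "\<omega> \<otimes> \<omega> = \<one> \<ominus> \<omega>"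
proof -
  have dbl: "a \<oplus> a = \<zero>" if "a \<in> carrier R" for a
    using that l_distr[of \<one> \<one> a] assms(1) by simp
  have "\<omega> \<otimes> \<omega> \<ominus> (\<one> \<ominus> \<omega>) = (\<one> \<oplus> \<omega> \<oplus> \<omega> \<otimes> \<omega>) \<ominus> (\<one> \<oplus> \<one>)"
    using assms(2) by algebra
  also have "\<dots> = \<zero>" unfolding cube_root_quadratic[OF assms(2-4)] assms(1) by simp
  finally show ?thesis using assms(2) eq_diff0 by simp
qed

lemma fifth_root_quartic:
  assumes z: "z \<in> carrier R" "z [^] (5::nat) = \<one>" "z \<noteq> \<one>"
  shows "\<one> \<oplus> (z \<oplus> (z \<otimes> z \<oplus> (z \<otimes> (z \<otimes> z) \<oplus> z \<otimes> (z \<otimes> (z \<otimes> z))))) = \<zero>"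
proof -
  have z5: "z \<otimes> (z \<otimes> (z \<otimes> (z \<otimes> z))) = \<one>" using z by (simp add: numeral_eq_Suc m_assoc)
  let ?t = "z \<oplus> (z \<otimes> z \<oplus> (z \<otimes> (z \<otimes> z) \<oplus> z \<otimes> (z \<otimes> (z \<otimes> z))))"
  have ne: "z \<ominus> \<one> \<noteq> \<zero>" using z(1,3) eq_diff0 by simp
  have t: "?t \<in> carrier R" using z(1) by simp
  have "z \<otimes> (\<one> \<oplus> ?t) = \<one> \<oplus> ?t"
    using z(1) by (simp add: r_distr z5 a_ac)
  then have "(z \<ominus> \<one>) \<otimes> (\<one> \<oplus> ?t) = \<zero>"
    using z(1) t by (simp add: minus_eq l_distr l_minus r_neg)
  then show ?thesis using ne z(1) t integral_iff by simp
qed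

text \<open>The second summand of \<tau> is \<open>z^4\<close>, the inverse of \<open>z\<close>.
  Expanding, \<open>\<tau>^2 + \<tau> - 1\<close> is \<open>1 + z + z^2 + z^3 + z^4\<close>, which
  vanishes.\<close>

lemma fifth_root_golden:
  assumes z: "z \<in> carrier R" "z [^] (5::nat) = \<one>" "z \<noteq> \<one>"
  defines "\<tau> \<equiv> z \<oplus> z \<otimes> (z \<otimes> (z \<otimes> z))"
  shows "\<tau> \<otimes> \<tau> = \<one> \<ominus> \<tau>"
proof -
  define w where "w = z \<otimes> (z \<otimes> (z \<otimes> z))"
  have w: "w \<in> carrier R" using z(1) by (simp add: w_def)
  have zw: "z \<otimes> w = \<one>" using z by (simp add: numeral_eq_Suc m_assoc w_def)
  have "w \<otimes> w = (z \<otimes> w) \<otimes> (z \<otimes> (z \<otimes> z))" using z(1) by (simp add: w_def m_ac)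
  then have ww: "w \<otimes> w = z \<otimes> (z \<otimes> z)" using zw z(1) by simp
  have c: "z \<otimes> (z \<otimes> z) \<in> carrier R" "z \<otimes> z \<in> carrier R" using z(1) by auto
  have "\<tau> \<otimes> \<tau> = z \<otimes> z \<oplus> (\<one> \<oplus> (\<one> \<oplus> z \<otimes> (z \<otimes> z)))"
    unfolding \<tau>_def w_def[symmetric] using z(1) w zw ww by (simp add: l_distr r_distr a_ac m_comm[of w z])
  then have "\<tau> \<otimes> \<tau> \<ominus> (\<one> \<ominus> \<tau>) = \<one> \<oplus> (z \<oplus> (z \<otimes> z \<oplus> (z \<otimes> (z \<otimes> z) \<oplus> w)))"
    unfolding \<tau>_def w_def[symmetric] using z(1) w c by algebra
  also have "\<dots> = \<zero>" using fifth_root_quartic[OF z] by (simp add: w_def)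
  finally show ?thesis using z(1) eq_diff0 unfolding \<tau>_def by simp
qed

text \<open>The other root is \<open>- 1 - \<tau>\<close>. Equality would mean
  \<open>2 \<tau> + 1 = 0\<close>; multiplied by \<tau> this is \<open>2 - \<tau> = 0\<close>, so
  \<tau> = 2 and \<open>5 = 0\<close>.\<close>

lemma golden_conjugate:
  assumes \<tau>: "\<tau> \<in> carrier R" "\<tau> \<otimes> \<tau> = \<one> \<ominus> \<tau>" and five: "\<guillemotleft>5\<guillemotright> \<noteq> \<zero>"
  obtains \<tau>' where "\<tau>' \<in> carrier R" "\<tau>' \<otimes> \<tau>' = \<one> \<ominus> \<tau>'" "\<tau> \<noteq> \<tau>'"
proof
  let ?t = "\<ominus> \<one> \<ominus> \<tau>"
  show "?t \<in> carrier R" using \<tau> by simp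
  have "?t \<otimes> ?t = \<one> \<oplus> \<tau> \<oplus> \<tau> \<oplus> \<tau> \<otimes> \<tau>" using \<tau>(1) by algebra
  also have "\<dots> = \<one> \<ominus> ?t" unfolding \<tau>(2) using \<tau>(1) by algebra
  finally show "?t \<otimes> ?t = \<one> \<ominus> ?t" .
  show "\<tau> \<noteq> ?t"
  proof
    assume eq: "\<tau> = ?t"
    have "\<tau> \<oplus> \<tau> \<oplus> \<one> = \<tau> \<ominus> ?t" using \<tau>(1) by algebra
    also have "\<dots> = \<zero>" by (subst eq[symmetric]) (use \<tau> in \<open>simp add: minus_eq r_neg\<close>)
    finally have z: "\<tau> \<oplus> \<tau> \<oplus> \<one> = \<zero>" .
    have "\<tau> \<otimes> (\<tau> \<oplus> \<tau> \<oplus> \<one>) = (\<one> \<ominus> \<tau>) \<oplus> (\<one> \<ominus> \<tau>) \<oplus> \<tau>"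
      using \<tau>(1) by (simp add: r_distr \<tau>(2))
    also have "\<dots> = \<one> \<oplus> \<one> \<ominus> \<tau>" using \<tau>(1) by algebra
    finally have \<tau>_eq: "\<tau> = \<one> \<oplus> \<one>" using z \<tau>(1) eq_diff0[of "\<one> \<oplus> \<one>" \<tau>] by simp
    have "\<guillemotleft>5\<guillemotright> \<otimes> \<one> = \<one> \<oplus> (\<one> \<oplus> (\<one> \<oplus> (\<one> \<oplus> \<one>)))" by (rule five_times[symmetric]) simp
    also have "\<dots> = \<zero>" using z unfolding \<tau>_eq by (simp add: a_assoc)
    finally show False using five by simp
  qed
qed

end

section \<open>Quadratic extensions of finite fields\<close>

locale quadratic_extension = F: field F + K: field K
  for F :: "('a, 'm) ring_scheme" and K :: "('b, 'n) ring_scheme" +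
  fixes \<iota> :: "'a \<Rightarrow> 'b"
  assumes \<iota>: "\<iota> \<in> ring_hom F K" and finF: "finite (carrier F)" and finK: "finite (carrier K)"
    and cardK: "card (carrier K) = card (carrier F) ^ 2"
begin

sublocale h: ring_hom_ring F K \<iota>
  using \<iota> by (intro ring_hom_ringI2 F.ring_axioms K.ring_axioms)

lemma inj: "inj_on \<iota> (carrier F)"
  by (rule field_hom_inj[OF F.field_axioms K.field_axioms \<iota>])

lemma iota_minus: "a \<in> carrier F \<Longrightarrow> b \<in> carrier F \<Longrightarrow> \<iota> (a \<ominus>\<^bsub>F\<^esub> b) = \<iota> a \<ominus>\<^bsub>K\<^esub> \<iota> b"
  by (simp add: F.minus_eq K.minus_eq)

lemma iota_of_int: "\<iota> \<guillemotleft>i\<guillemotright>\<^bsub>F\<^esub> = \<guillemotleft>i\<guillemotright>\<^bsub>K\<^esub>"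
  by (rule ring_hom_of_int[OF F.ring_axioms K.ring_axioms \<iota>])

lemma of_int_nonzero: "\<guillemotleft>i\<guillemotright>\<^bsub>F\<^esub> \<noteq> \<zero>\<^bsub>F\<^esub> \<Longrightarrow> \<guillemotleft>i\<guillemotright>\<^bsub>K\<^esub> \<noteq> \<zero>\<^bsub>K\<^esub>"
  using inj_onD[OF inj, of "\<guillemotleft>i\<guillemotright>\<^bsub>F\<^esub>" "\<zero>\<^bsub>F\<^esub>"] iota_of_int by auto

lemma cardF_ge: "card (carrier F) \<ge> 2"
  using card_mono[OF finF, of "{\<zero>\<^bsub>F\<^esub>, \<one>\<^bsub>F\<^esub>}"] by simp

lemma cardK_factor: "card (carrier K) - 1 = (card (carrier F) + 1) * (card (carrier F) - 1)"
  using cardF_ge by (simp add: cardK power2_eq_square algebra_simps)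

text \<open>The map \<open>(u, v)\<close> to \<open>u + z v\<close> is injective and both sides have
  \<open>q^2\<close> elements, so it reaches \<open>z^2\<close>.\<close>

lemma quadratic_relation:
  assumes z: "z \<in> carrier K" "z \<notin> \<iota> ` carrier F"
  obtains u v where "u \<in> carrier F" "v \<in> carrier F" "z \<otimes>\<^bsub>K\<^esub> z = \<iota> u \<oplus>\<^bsub>K\<^esub> z \<otimes>\<^bsub>K\<^esub> \<iota> v"
proof -
  let ?f = "\<lambda>(u, v). \<iota> u \<oplus>\<^bsub>K\<^esub> z \<otimes>\<^bsub>K\<^esub> \<iota> v"
  have inj: "inj_on ?f (carrier F \<times> carrier F)"
  proof (rule inj_onI, clarify)
    fix u v u' v' assume c: "u \<in> carrier F" "v \<in> carrier F" "u' \<in> carrier F" "v' \<in> carrier F"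
      and eq: "\<iota> u \<oplus>\<^bsub>K\<^esub> z \<otimes>\<^bsub>K\<^esub> \<iota> v = \<iota> u' \<oplus>\<^bsub>K\<^esub> z \<otimes>\<^bsub>K\<^esub> \<iota> v'"
    have "(a \<ominus>\<^bsub>K\<^esub> a') \<oplus>\<^bsub>K\<^esub> z \<otimes>\<^bsub>K\<^esub> (b \<ominus>\<^bsub>K\<^esub> b') = (a \<oplus>\<^bsub>K\<^esub> z \<otimes>\<^bsub>K\<^esub> b) \<ominus>\<^bsub>K\<^esub> (a' \<oplus>\<^bsub>K\<^esub> z \<otimes>\<^bsub>K\<^esub> b')"
      if "a \<in> carrier K" "b \<in> carrier K" "a' \<in> carrier K" "b' \<in> carrier K" for a b a' b'
      using that z(1) by algebra
    from this[of "\<iota> u" "\<iota> v" "\<iota> u'" "\<iota> v'"]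
    have "\<iota> (u \<ominus>\<^bsub>F\<^esub> u') \<oplus>\<^bsub>K\<^esub> z \<otimes>\<^bsub>K\<^esub> \<iota> (v \<ominus>\<^bsub>F\<^esub> v') = \<zero>\<^bsub>K\<^esub>"
      using c z(1) eq by (simp add: iota_minus)
    then have "u \<ominus>\<^bsub>F\<^esub> u' = \<zero>\<^bsub>F\<^esub> \<and> v \<ominus>\<^bsub>F\<^esub> v' = \<zero>\<^bsub>F\<^esub>"
      using c by (intro outside_image_independent[OF F.field_axioms K.field_axioms \<iota> z]) simp_all
    then show "u = u' \<and> v = v'" using c F.eq_diff0 by simp
  qed
  have sub: "?f ` (carrier F \<times> carrier F) \<subseteq> carrier K" using z(1) by auto
  have "card (?f ` (carrier F \<times> carrier F)) = card (carrier K)"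
    using card_image[OF inj] by (simp add: cardK card_cartesian_product power2_eq_square)
  then have "?f ` (carrier F \<times> carrier F) = carrier K"
    by (rule card_subset_eq[OF finK sub])
  moreover have "z \<otimes>\<^bsub>K\<^esub> z \<in> carrier K" using z(1) by simp
  ultimately have "z \<otimes>\<^bsub>K\<^esub> z \<in> ?f ` (carrier F \<times> carrier F)" by simp
  then show ?thesis using that by auto
qed

text \<open>The same \<open>a\<close> and \<open>b\<close> serve every root \<open>r\<close> of the
  quadratic equation. Facts about powers of one root thus pass to the other, which stands in for the
  conjugation automorphism.\<close>

lemma power_in_basis:
  assumes "u \<in> carrier F" "v \<in> carrier F"
  shows "\<exists>a\<in>carrier F. \<exists>b\<in>carrier F. \<forall>r\<in>carrier K. r \<otimes>\<^bsub>K\<^esub> r = \<iota> u \<oplus>\<^bsub>K\<^esub> r \<otimes>\<^bsub>K\<^esub> \<iota> v \<longrightarrow>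
    r [^]\<^bsub>K\<^esub> (n::nat) = \<iota> a \<oplus>\<^bsub>K\<^esub> r \<otimes>\<^bsub>K\<^esub> \<iota> b"
proof (induction n)
  case 0
  show ?case
    by (rule bexI[of _ "\<one>\<^bsub>F\<^esub>"], rule bexI[of _ "\<zero>\<^bsub>F\<^esub>"]) simp_all
next
  case (Suc n)
  then obtain a b where ab: "a \<in> carrier F" "b \<in> carrier F"
    "\<And>r. r \<in> carrier K \<Longrightarrow> r \<otimes>\<^bsub>K\<^esub> r = \<iota> u \<oplus>\<^bsub>K\<^esub> r \<otimes>\<^bsub>K\<^esub> \<iota> v \<Longrightarrow> r [^]\<^bsub>K\<^esub> n = \<iota> a \<oplus>\<^bsub>K\<^esub> r \<otimes>\<^bsub>K\<^esub> \<iota> b"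
    by blast
  have "r [^]\<^bsub>K\<^esub> Suc n = \<iota> (u \<otimes>\<^bsub>F\<^esub> b) \<oplus>\<^bsub>K\<^esub> r \<otimes>\<^bsub>K\<^esub> \<iota> (a \<oplus>\<^bsub>F\<^esub> v \<otimes>\<^bsub>F\<^esub> b)"
    if r: "r \<in> carrier K" "r \<otimes>\<^bsub>K\<^esub> r = \<iota> u \<oplus>\<^bsub>K\<^esub> r \<otimes>\<^bsub>K\<^esub> \<iota> v" for r
  proof -
    have "r [^]\<^bsub>K\<^esub> Suc n = \<iota> a \<otimes>\<^bsub>K\<^esub> r \<oplus>\<^bsub>K\<^esub> (r \<otimes>\<^bsub>K\<^esub> r) \<otimes>\<^bsub>K\<^esub> \<iota> b"
      using ab(3)[OF r] r(1) ab(1,2) by (simp add: K.l_distr K.r_distr K.m_ac)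
    also have "\<dots> = \<iota> (u \<otimes>\<^bsub>F\<^esub> b) \<oplus>\<^bsub>K\<^esub> r \<otimes>\<^bsub>K\<^esub> \<iota> (a \<oplus>\<^bsub>F\<^esub> v \<otimes>\<^bsub>F\<^esub> b)"
      unfolding r(2) using r(1) ab(1,2) assms by (simp add: K.l_distr K.r_distr K.m_ac K.a_ac)
    finally show ?thesis .
  qed
  then show ?case
    using ab(1,2) assms by (intro bexI[of _ "u \<otimes>\<^bsub>F\<^esub> b"] bexI[of _ "a \<oplus>\<^bsub>F\<^esub> v \<otimes>\<^bsub>F\<^esub> b"]) auto
qed

text \<open>A fifth root of unity \<open>z\<close> outside \<open>F\<close> and its conjugate have product \<open>N \<in> F\<close> with \<open>N\<^sup>5 = 1\<close>,
  so \<open>N = 1\<close> and \<open>z + z\<inverse>\<close> is the trace of \<open>z\<close>.\<close>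

lemma golden_in_base_minus:
  assumes five: "5 dvd card (carrier F) + 1"
  shows "\<exists>\<tau>\<in>carrier F. \<tau> \<otimes>\<^bsub>F\<^esub> \<tau> = \<one>\<^bsub>F\<^esub> \<ominus>\<^bsub>F\<^esub> \<tau>"
proof -
  have "5 dvd card (carrier K) - 1" unfolding cardK_factor using five by (rule dvd_mult2)
  then obtain z where z: "z \<in> carrier K" "z [^]\<^bsub>K\<^esub> (5::nat) = \<one>\<^bsub>K\<^esub>" "z \<noteq> \<one>\<^bsub>K\<^esub>"
    using K.prime_root_exists[OF finK, of 5] by auto
  have cop: "coprime 5 (card (carrier F) - 1)"
  proof -
    have "\<not> 5 dvd card (carrier F) - 1" using five cardF_ge by presburger
    moreover have "Factorial_Ring.prime (5::nat)" by (simp add: prime_nat_numeral_eq)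
    ultimately show ?thesis by (rule prime_imp_coprime[rotated])
  qed
  have triv: "u = \<one>\<^bsub>F\<^esub>" if "u \<in> carrier F" "u [^]\<^bsub>F\<^esub> (5::nat) = \<one>\<^bsub>F\<^esub>" for u
    using F.root_trivial[OF finF that cop] by simp
  have pow: "\<iota> (u [^]\<^bsub>F\<^esub> (n::nat)) = \<iota> u [^]\<^bsub>K\<^esub> n" if "u \<in> carrier F" for u n
    by (rule h.hom_nat_pow[OF that])
  have notF: "z \<notin> \<iota> ` carrier F"
  proof
    assume "z \<in> \<iota> ` carrier F"
    then obtain u where u: "u \<in> carrier F" "z = \<iota> u" by auto
    then have "\<iota> (u [^]\<^bsub>F\<^esub> (5::nat)) = \<iota> \<one>\<^bsub>F\<^esub>" using z(2) pow by simp
    then have "u [^]\<^bsub>F\<^esub> (5::nat) = \<one>\<^bsub>F\<^esub>" using inj_onD[OF inj] u by simp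
    then have "u = \<one>\<^bsub>F\<^esub>" by (rule triv[OF u(1)])
    then show False using u(2) z(3) by simp
  qed
  obtain u v where uv: "u \<in> carrier F" "v \<in> carrier F" "z \<otimes>\<^bsub>K\<^esub> z = \<iota> u \<oplus>\<^bsub>K\<^esub> z \<otimes>\<^bsub>K\<^esub> \<iota> v"
    using quadratic_relation[OF z(1) notF] .
  \<comment> \<open>The conjugate of \<open>z\<close>, that is the other root of
    \<open>T^2 = u + v T\<close>; the trace is \<open>v\<close> and the norm is
    \<open>- u\<close>.\<close>
  define w where "w = \<iota> v \<ominus>\<^bsub>K\<^esub> z"
  have w: "w \<in> carrier K" using uv z by (simp add: w_def)
  have "z \<otimes>\<^bsub>K\<^esub> w = z \<otimes>\<^bsub>K\<^esub> \<iota> v \<ominus>\<^bsub>K\<^esub> z \<otimes>\<^bsub>K\<^esub> z"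
    using z uv by (simp add: w_def K.minus_eq K.r_distr K.r_minus)
  also have "\<dots> = \<ominus>\<^bsub>K\<^esub> \<iota> u"
  proof -
    have "t \<ominus>\<^bsub>K\<^esub> (s \<oplus>\<^bsub>K\<^esub> t) = \<ominus>\<^bsub>K\<^esub> s" if "t \<in> carrier K" "s \<in> carrier K" for s t
      using that by algebra
    then show ?thesis unfolding uv(3) using uv z by simp
  qed
  finally have zw: "z \<otimes>\<^bsub>K\<^esub> w = \<ominus>\<^bsub>K\<^esub> \<iota> u" .
  have "w \<otimes>\<^bsub>K\<^esub> w = w \<otimes>\<^bsub>K\<^esub> \<iota> v \<ominus>\<^bsub>K\<^esub> z \<otimes>\<^bsub>K\<^esub> w"
    using w uv z by (subst (2) w_def) (simp add: K.minus_eq K.r_distr K.r_minus K.m_comm[of w z])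
  also have "\<dots> = \<iota> u \<oplus>\<^bsub>K\<^esub> w \<otimes>\<^bsub>K\<^esub> \<iota> v"
    unfolding zw using w uv by (simp add: K.minus_eq K.a_comm)
  finally have ww: "w \<otimes>\<^bsub>K\<^esub> w = \<iota> u \<oplus>\<^bsub>K\<^esub> w \<otimes>\<^bsub>K\<^esub> \<iota> v" .
  obtain a b where ab: "a \<in> carrier F" "b \<in> carrier F"
    "\<And>r. r \<in> carrier K \<Longrightarrow> r \<otimes>\<^bsub>K\<^esub> r = \<iota> u \<oplus>\<^bsub>K\<^esub> r \<otimes>\<^bsub>K\<^esub> \<iota> v \<Longrightarrow> r [^]\<^bsub>K\<^esub> (5::nat) = \<iota> a \<oplus>\<^bsub>K\<^esub> r \<otimes>\<^bsub>K\<^esub> \<iota> b"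
    using power_in_basis[OF uv(1,2), of 5] by blast
  \<comment> \<open>From \<open>z^5 = 1\<close> and the independence of 1 and \<open>z\<close> it
    follows that \<open>a = 1\<close> and \<open>b = 0\<close>; by the uniformity of
    \<open>a\<close> and \<open>b\<close> also \<open>w^5 = 1\<close>.\<close>
  have "\<iota> a \<oplus>\<^bsub>K\<^esub> z \<otimes>\<^bsub>K\<^esub> \<iota> b = \<one>\<^bsub>K\<^esub>" using ab(3)[OF z(1) uv(3)] z(2) by simp
  moreover have "s \<ominus>\<^bsub>K\<^esub> \<one>\<^bsub>K\<^esub> \<oplus>\<^bsub>K\<^esub> t = s \<oplus>\<^bsub>K\<^esub> t \<ominus>\<^bsub>K\<^esub> \<one>\<^bsub>K\<^esub>" if "t \<in> carrier K" "s \<in> carrier K" for s t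
    using that by algebra
  ultimately have "\<iota> (a \<ominus>\<^bsub>F\<^esub> \<one>\<^bsub>F\<^esub>) \<oplus>\<^bsub>K\<^esub> z \<otimes>\<^bsub>K\<^esub> \<iota> b = \<zero>\<^bsub>K\<^esub>"
    using ab(1,2) z(1) by (simp add: iota_minus)
  then have "a \<ominus>\<^bsub>F\<^esub> \<one>\<^bsub>F\<^esub> = \<zero>\<^bsub>F\<^esub> \<and> b = \<zero>\<^bsub>F\<^esub>"
    using ab by (intro outside_image_independent[OF F.field_axioms K.field_axioms \<iota> z(1) notF]) simp_all
  then have "w [^]\<^bsub>K\<^esub> (5::nat) = \<one>\<^bsub>K\<^esub>"
    using ab(3)[OF w ww] ab(1) w F.eq_diff0[OF ab(1) F.one_closed] by simp
  then have "(z \<otimes>\<^bsub>K\<^esub> w) [^]\<^bsub>K\<^esub> (5::nat) = \<one>\<^bsub>K\<^esub>" using z w by (simp add: K.nat_pow_distrib)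
  \<comment> \<open>The norm is a fifth root of unity in \<open>F\<close>, and as 5 does not divide
    \<open>q - 1\<close> it equals 1.\<close>
  then have "\<iota> ((\<ominus>\<^bsub>F\<^esub> u) [^]\<^bsub>F\<^esub> (5::nat)) = \<iota> \<one>\<^bsub>F\<^esub>" using zw uv(1) by (simp only: pow F.a_inv_closed h.hom_a_inv h.hom_one)
  then have "(\<ominus>\<^bsub>F\<^esub> u) [^]\<^bsub>F\<^esub> (5::nat) = \<one>\<^bsub>F\<^esub>" using inj_onD[OF inj] uv(1) by simp
  then have "\<ominus>\<^bsub>F\<^esub> u = \<one>\<^bsub>F\<^esub>" using triv uv(1) by simp
  then have zw1: "z \<otimes>\<^bsub>K\<^esub> w = \<one>\<^bsub>K\<^esub>" using zw uv(1) h.hom_a_inv[OF uv(1)] by simp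
  let ?z4 = "z \<otimes>\<^bsub>K\<^esub> (z \<otimes>\<^bsub>K\<^esub> (z \<otimes>\<^bsub>K\<^esub> z))"
  have z0: "z \<noteq> \<zero>\<^bsub>K\<^esub>" using zw1 w by auto
  have "z \<otimes>\<^bsub>K\<^esub> ?z4 = \<one>\<^bsub>K\<^esub>" using z by (simp add: numeral_eq_Suc K.m_assoc)
  \<comment> \<open>Both \<open>w\<close> and \<open>z^4\<close> invert \<open>z\<close>, so the
    trace \<open>v\<close> is \<open>z + z^4\<close>, a solution lying in \<open>F\<close>.\<close>
  then have "z \<otimes>\<^bsub>K\<^esub> ?z4 = z \<otimes>\<^bsub>K\<^esub> w" using zw1 by simp
  then have "?z4 = w" using z0 z(1) w K.m_lcancel by simp
  moreover have "z \<oplus>\<^bsub>K\<^esub> w = \<iota> v" 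
  proof -
    have "a \<oplus>\<^bsub>K\<^esub> (b \<ominus>\<^bsub>K\<^esub> a) = b" if "a \<in> carrier K" "b \<in> carrier K" for a b using that by algebra
    then show ?thesis using z(1) uv(2) unfolding w_def by simp
  qed
  ultimately have "\<iota> v \<otimes>\<^bsub>K\<^esub> \<iota> v = \<one>\<^bsub>K\<^esub> \<ominus>\<^bsub>K\<^esub> \<iota> v"
    using K.fifth_root_golden[OF z] by simp
  then have "\<iota> (v \<otimes>\<^bsub>F\<^esub> v) = \<iota> (\<one>\<^bsub>F\<^esub> \<ominus>\<^bsub>F\<^esub> v)" using uv(2) by (simp add: iota_minus)
  then have "v \<otimes>\<^bsub>F\<^esub> v = \<one>\<^bsub>F\<^esub> \<ominus>\<^bsub>F\<^esub> v" using inj_onD[OF inj] uv(2) by simp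
  then show ?thesis using uv(2) by blast
qed

lemma golden_in_base:
  assumes "5 dvd card (carrier F) - 1 \<or> 5 dvd card (carrier F) + 1"
  shows "\<exists>\<tau>\<in>carrier F. \<tau> \<otimes>\<^bsub>F\<^esub> \<tau> = \<one>\<^bsub>F\<^esub> \<ominus>\<^bsub>F\<^esub> \<tau>"
  using assms
proof
  assume "5 dvd card (carrier F) - 1"
  then obtain z where z: "z \<in> carrier F" "z [^]\<^bsub>F\<^esub> (5::nat) = \<one>\<^bsub>F\<^esub>" "z \<noteq> \<one>\<^bsub>F\<^esub>"
    using F.prime_root_exists[OF finF, of 5] by auto
  then show ?thesis using F.fifth_root_golden[OF z] by (meson F.add.m_closed F.m_closed)
qed (rule golden_in_base_minus)

text \<open>A nonzero element of \<open>F\<close> is \<open>a^i\<close> for a generator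
  \<open>a\<close> of the multiplicative group of \<open>K\<close>, and its order divides
  \<open>q - 1\<close>. Hence \<open>q + 1\<close> divides \<open>i\<close>, and
  \<open>q + 1\<close> is even.\<close>

lemma square_in_extension:
  assumes odd: "odd (card (carrier F))" and x: "x \<in> carrier F"
  obtains y where "y \<in> carrier K" "y \<otimes>\<^bsub>K\<^esub> y = \<iota> x"
proof (cases "x = \<zero>\<^bsub>F\<^esub>")
  case True
  then show ?thesis using that[of "\<zero>\<^bsub>K\<^esub>"] by simp
next
  case False
  let ?q = "card (carrier F)"
  have q1: "?q - 1 > 0" using cardF_ge by simp
  obtain a where a: "a \<in> carrier K" "\<And>x. x \<in> carrier K \<Longrightarrow> x \<noteq> \<zero>\<^bsub>K\<^esub> \<Longrightarrow> \<exists>i::nat. x = a [^]\<^bsub>K\<^esub> i"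
      and ord: "\<And>i::nat. a [^]\<^bsub>K\<^esub> i = \<one>\<^bsub>K\<^esub> \<longleftrightarrow> card (carrier K) - 1 dvd i"
    using K.generator_exists[OF finK] by metis
  have "\<iota> x \<noteq> \<zero>\<^bsub>K\<^esub>" using inj_onD[OF inj _ x, of "\<zero>\<^bsub>F\<^esub>"] False by auto
  then obtain i :: nat where i: "\<iota> x = a [^]\<^bsub>K\<^esub> i" using a(2)[OF h.hom_closed[OF x]] by auto
  have "\<iota> (x [^]\<^bsub>F\<^esub> (?q - 1)) = \<one>\<^bsub>K\<^esub>" using F.pow_card_minus_one[OF finF x False] by simp
  then have "a [^]\<^bsub>K\<^esub> (i * (?q - 1)) = \<one>\<^bsub>K\<^esub>" using i a(1) by (simp add: h.hom_nat_pow[OF x] K.nat_pow_pow)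
  then have "(?q + 1) * (?q - 1) dvd i * (?q - 1)" using ord cardK_factor by simp
  moreover have "?q - 1 \<noteq> 0" using q1 by simp
  ultimately have "?q + 1 dvd i" by (rule iffD1[OF dvd_times_right_cancel_iff, rotated])
  moreover have "2 dvd ?q + 1" using odd by simp
  ultimately have "2 dvd i" by (rule dvd_trans[rotated])
  then obtain m where "i = 2 * m" by (rule dvdE)
  then have "i = m + m" by simp
  then show ?thesis using that[of "a [^]\<^bsub>K\<^esub> m"] i a(1) by (simp add: K.nat_pow_mult)
qed

text \<open>The solution is \<open>\<tau> = (y - 1) / 2\<close> where \<open>y^2 = 5\<close>: then
  \<open>\<tau>^2 + \<tau> = (y^2 - 1) / 4 = 1\<close>.\<close>

lemma golden_in_extension:
  assumes odd: "odd (card (carrier F))" and two: "\<guillemotleft>2\<guillemotright>\<^bsub>F\<^esub> \<noteq> \<zero>\<^bsub>F\<^esub>"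
  shows "\<exists>\<tau>\<in>carrier K. \<tau> \<otimes>\<^bsub>K\<^esub> \<tau> = \<one>\<^bsub>K\<^esub> \<ominus>\<^bsub>K\<^esub> \<tau>"
proof -
  obtain y where y: "y \<in> carrier K" "y \<otimes>\<^bsub>K\<^esub> y = \<guillemotleft>5\<guillemotright>\<^bsub>K\<^esub>"
    using square_in_extension[OF odd, of "\<guillemotleft>5\<guillemotright>\<^bsub>F\<^esub>"] iota_of_int by auto
  have two': "\<guillemotleft>2\<guillemotright>\<^bsub>K\<^esub> \<noteq> \<zero>\<^bsub>K\<^esub>" using of_int_nonzero[OF two] .
  define e where "e = inv\<^bsub>K\<^esub> \<guillemotleft>2\<guillemotright>\<^bsub>K\<^esub>"
  have e: "e \<in> carrier K" "e \<otimes>\<^bsub>K\<^esub> \<guillemotleft>2\<guillemotright>\<^bsub>K\<^esub> = \<one>\<^bsub>K\<^esub>" using two' by (simp_all add: e_def)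
  have e2: "e \<oplus>\<^bsub>K\<^esub> e = \<one>\<^bsub>K\<^esub>" using e by (simp add: K.mult2 K.m_comm)
  let ?t = "e \<otimes>\<^bsub>K\<^esub> (y \<ominus>\<^bsub>K\<^esub> \<one>\<^bsub>K\<^esub>)"
  have t: "?t \<in> carrier K" using e y by simp
  have five: "\<guillemotleft>5\<guillemotright>\<^bsub>K\<^esub> \<ominus>\<^bsub>K\<^esub> \<one>\<^bsub>K\<^esub> = \<guillemotleft>2\<guillemotright>\<^bsub>K\<^esub> \<otimes>\<^bsub>K\<^esub> \<guillemotleft>2\<guillemotright>\<^bsub>K\<^esub>"
    using K.of_int_diff[of 5 1] K.of_int_mult[of 2 2] by simp
  \<comment> \<open>The factor \<open>e + e\<close> is 1, as \<open>e\<close> is one half; with it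
    inserted the equation is an identity of commutative rings.\<close>
  have "?t \<otimes>\<^bsub>K\<^esub> ?t \<oplus>\<^bsub>K\<^esub> (e \<oplus>\<^bsub>K\<^esub> e) \<otimes>\<^bsub>K\<^esub> ?t = (e \<otimes>\<^bsub>K\<^esub> e) \<otimes>\<^bsub>K\<^esub> (y \<otimes>\<^bsub>K\<^esub> y \<ominus>\<^bsub>K\<^esub> \<one>\<^bsub>K\<^esub>)"
    using e(1) y(1) by algebra
  also have "\<dots> = (e \<otimes>\<^bsub>K\<^esub> \<guillemotleft>2\<guillemotright>\<^bsub>K\<^esub>) \<otimes>\<^bsub>K\<^esub> (e \<otimes>\<^bsub>K\<^esub> \<guillemotleft>2\<guillemotright>\<^bsub>K\<^esub>)"
    unfolding y(2) five using e(1) by (simp add: K.m_ac)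
  finally have "?t \<otimes>\<^bsub>K\<^esub> ?t \<oplus>\<^bsub>K\<^esub> ?t = \<one>\<^bsub>K\<^esub>" using e t by (simp add: e2)
  then have "?t \<otimes>\<^bsub>K\<^esub> ?t = \<one>\<^bsub>K\<^esub> \<ominus>\<^bsub>K\<^esub> ?t"
  proof -
    have "a = a \<oplus>\<^bsub>K\<^esub> b \<ominus>\<^bsub>K\<^esub> b" if "a \<in> carrier K" "b \<in> carrier K" for a b using that by algebra
    from this[of "?t \<otimes>\<^bsub>K\<^esub> ?t" ?t] t \<open>?t \<otimes>\<^bsub>K\<^esub> ?t \<oplus>\<^bsub>K\<^esub> ?t = \<one>\<^bsub>K\<^esub>\<close> show ?thesis by simp
  qed
  then show ?thesis using t by blast
qed

text \<open>If \<tau> were in \<open>F\<close>, then \<open>\<tau>^2 - 4\<close> would be a square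
  in \<open>K\<close>, so \<open>z^2 = \<tau> z - 1\<close> would have a solution there. This
  \<open>z\<close> satisfies \<open>z^5 = 1\<close>, and as 5 does not divide the order of the
  multiplicative group of \<open>K\<close>, \<open>z = 1\<close>. Then \<tau> = 2, and the equation
  of \<tau> becomes \<open>5 = 0\<close>.\<close>

lemma golden_not_in_base:
  assumes odd: "odd (card (carrier F))" and two: "\<guillemotleft>2\<guillemotright>\<^bsub>F\<^esub> \<noteq> \<zero>\<^bsub>F\<^esub>" and five: "\<guillemotleft>5\<guillemotright>\<^bsub>F\<^esub> \<noteq> \<zero>\<^bsub>F\<^esub>"
    and nd: "\<not> 5 dvd card (carrier K) - 1"
    and \<tau>: "\<tau> \<in> carrier F" "\<tau> \<otimes>\<^bsub>F\<^esub> \<tau> = \<one>\<^bsub>F\<^esub> \<ominus>\<^bsub>F\<^esub> \<tau>"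
  shows False
proof -
  let ?t = "\<iota> \<tau>" and ?two = "\<guillemotleft>2\<guillemotright>\<^bsub>K\<^esub>"
  have t: "?t \<in> carrier K" "?t \<otimes>\<^bsub>K\<^esub> ?t = \<one>\<^bsub>K\<^esub> \<ominus>\<^bsub>K\<^esub> ?t"
    using \<tau> h.hom_mult[OF \<tau>(1) \<tau>(1)] by (simp_all add: iota_minus)
  obtain d where d: "d \<in> carrier K" "d \<otimes>\<^bsub>K\<^esub> d = ?t \<otimes>\<^bsub>K\<^esub> ?t \<ominus>\<^bsub>K\<^esub> ?two \<otimes>\<^bsub>K\<^esub> ?two"
    using square_in_extension[OF odd, of "\<tau> \<otimes>\<^bsub>F\<^esub> \<tau> \<ominus>\<^bsub>F\<^esub> \<guillemotleft>2\<guillemotright>\<^bsub>F\<^esub> \<otimes>\<^bsub>F\<^esub> \<guillemotleft>2\<guillemotright>\<^bsub>F\<^esub>"] \<tau>(1)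
      iota_of_int[of 2] by (auto simp: iota_minus)
  have two': "?two \<noteq> \<zero>\<^bsub>K\<^esub>" using of_int_nonzero[OF two] .
  define e where "e = inv\<^bsub>K\<^esub> ?two"
  have e: "e \<in> carrier K" "e \<otimes>\<^bsub>K\<^esub> ?two = \<one>\<^bsub>K\<^esub>" using two' by (simp_all add: e_def)
  have e2: "e \<oplus>\<^bsub>K\<^esub> e = \<one>\<^bsub>K\<^esub>" using e by (simp add: K.mult2 K.m_comm)
  \<comment> \<open>The quadratic formula for \<open>T^2 - \<tau> T + 1\<close>, with
    \<open>e\<close> for one half and \<open>d\<close> for the root of the discriminant.\<close>
  define z where "z = e \<otimes>\<^bsub>K\<^esub> (?t \<oplus>\<^bsub>K\<^esub> d)"
  have z: "z \<in> carrier K" using e d t by (simp add: z_def)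
  have "(e \<oplus>\<^bsub>K\<^esub> e) \<otimes>\<^bsub>K\<^esub> (?t \<otimes>\<^bsub>K\<^esub> z) \<ominus>\<^bsub>K\<^esub> z \<otimes>\<^bsub>K\<^esub> z = (e \<otimes>\<^bsub>K\<^esub> e) \<otimes>\<^bsub>K\<^esub> (?t \<otimes>\<^bsub>K\<^esub> ?t \<ominus>\<^bsub>K\<^esub> d \<otimes>\<^bsub>K\<^esub> d)"
    unfolding z_def using e(1) d(1) t(1) by algebra
  also have "?t \<otimes>\<^bsub>K\<^esub> ?t \<ominus>\<^bsub>K\<^esub> d \<otimes>\<^bsub>K\<^esub> d = ?two \<otimes>\<^bsub>K\<^esub> ?two"
  proof -
    have "a \<ominus>\<^bsub>K\<^esub> (a \<ominus>\<^bsub>K\<^esub> b) = b" if "a \<in> carrier K" "b \<in> carrier K" for a b using that by algebra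
    then show ?thesis unfolding d(2) using t(1) by simp
  qed
  also have "(e \<otimes>\<^bsub>K\<^esub> e) \<otimes>\<^bsub>K\<^esub> (?two \<otimes>\<^bsub>K\<^esub> ?two) = (e \<otimes>\<^bsub>K\<^esub> ?two) \<otimes>\<^bsub>K\<^esub> (e \<otimes>\<^bsub>K\<^esub> ?two)"
    using e(1) by (simp add: K.m_ac)
  finally have hz: "?t \<otimes>\<^bsub>K\<^esub> z \<ominus>\<^bsub>K\<^esub> z \<otimes>\<^bsub>K\<^esub> z = \<one>\<^bsub>K\<^esub>" using e e2 t z by simp
  have "b = a \<ominus>\<^bsub>K\<^esub> (a \<ominus>\<^bsub>K\<^esub> b)" if "a \<in> carrier K" "b \<in> carrier K" for a b using that by algebra
  from this[of "?t \<otimes>\<^bsub>K\<^esub> z" "z \<otimes>\<^bsub>K\<^esub> z"]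
  have zz: "z \<otimes>\<^bsub>K\<^esub> z = ?t \<otimes>\<^bsub>K\<^esub> z \<ominus>\<^bsub>K\<^esub> \<one>\<^bsub>K\<^esub>" using t(1) z unfolding hz by simp
  have tt: "?t \<otimes>\<^bsub>K\<^esub> (?t \<otimes>\<^bsub>K\<^esub> c) = c \<ominus>\<^bsub>K\<^esub> ?t \<otimes>\<^bsub>K\<^esub> c" if "c \<in> carrier K" for c
    using that t(1) by (simp add: K.m_assoc [symmetric] t(2)) (simp add: K.minus_eq K.l_distr K.l_minus)
  have z3: "z \<otimes>\<^bsub>K\<^esub> (z \<otimes>\<^bsub>K\<^esub> z) = \<ominus>\<^bsub>K\<^esub> (?t \<otimes>\<^bsub>K\<^esub> z) \<ominus>\<^bsub>K\<^esub> ?t"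
  proof -
    have "z \<otimes>\<^bsub>K\<^esub> (z \<otimes>\<^bsub>K\<^esub> z) = ?t \<otimes>\<^bsub>K\<^esub> (z \<otimes>\<^bsub>K\<^esub> z) \<ominus>\<^bsub>K\<^esub> z"
      using z t(1) by (subst zz) (simp add: K.minus_eq K.r_distr K.r_minus K.m_lcomm)
    also have "\<dots> = (z \<ominus>\<^bsub>K\<^esub> ?t \<otimes>\<^bsub>K\<^esub> z) \<ominus>\<^bsub>K\<^esub> ?t \<ominus>\<^bsub>K\<^esub> z"
      using z t(1) by (simp add: zz K.minus_eq K.r_distr K.r_minus tt)
    also have "\<dots> = \<ominus>\<^bsub>K\<^esub> (?t \<otimes>\<^bsub>K\<^esub> z) \<ominus>\<^bsub>K\<^esub> ?t"
    proof -
      have "(a \<ominus>\<^bsub>K\<^esub> b) \<ominus>\<^bsub>K\<^esub> c \<ominus>\<^bsub>K\<^esub> a = \<ominus>\<^bsub>K\<^esub> b \<ominus>\<^bsub>K\<^esub> c" if "a \<in> carrier K" "b \<in> carrier K" "c \<in> carrier K" for a b c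
        using that by algebra
      then show ?thesis using z t(1) by simp
    qed
    finally show ?thesis .
  qed
  \<comment> \<open>This is the inverse of \<open>z\<close>, since the equation of \<open>z\<close>
    says \<open>z (\<tau> - z) = 1\<close>.\<close>
  have z4: "z \<otimes>\<^bsub>K\<^esub> (z \<otimes>\<^bsub>K\<^esub> (z \<otimes>\<^bsub>K\<^esub> z)) = ?t \<ominus>\<^bsub>K\<^esub> z"
  proof -
    have "z \<otimes>\<^bsub>K\<^esub> (z \<otimes>\<^bsub>K\<^esub> (z \<otimes>\<^bsub>K\<^esub> z)) = \<ominus>\<^bsub>K\<^esub> (?t \<otimes>\<^bsub>K\<^esub> (z \<otimes>\<^bsub>K\<^esub> z)) \<ominus>\<^bsub>K\<^esub> ?t \<otimes>\<^bsub>K\<^esub> z"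
      unfolding z3 using z t(1) by (simp add: K.minus_eq K.r_distr K.r_minus K.m_lcomm K.m_comm)
    also have "\<dots> = \<ominus>\<^bsub>K\<^esub> ((z \<ominus>\<^bsub>K\<^esub> ?t \<otimes>\<^bsub>K\<^esub> z) \<ominus>\<^bsub>K\<^esub> ?t) \<ominus>\<^bsub>K\<^esub> ?t \<otimes>\<^bsub>K\<^esub> z"
      using z t(1) by (simp add: zz K.minus_eq K.r_distr K.r_minus tt)
    also have "\<dots> = ?t \<ominus>\<^bsub>K\<^esub> z"
    proof -
      have "\<ominus>\<^bsub>K\<^esub> ((a \<ominus>\<^bsub>K\<^esub> b) \<ominus>\<^bsub>K\<^esub> c) \<ominus>\<^bsub>K\<^esub> b = c \<ominus>\<^bsub>K\<^esub> a" if "a \<in> carrier K" "b \<in> carrier K" "c \<in> carrier K" for a b c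
        using that by algebra
      then show ?thesis using z t(1) by simp
    qed
    finally show ?thesis .
  qed
  have "z \<otimes>\<^bsub>K\<^esub> (z \<otimes>\<^bsub>K\<^esub> (z \<otimes>\<^bsub>K\<^esub> (z \<otimes>\<^bsub>K\<^esub> z))) = ?t \<otimes>\<^bsub>K\<^esub> z \<ominus>\<^bsub>K\<^esub> z \<otimes>\<^bsub>K\<^esub> z"
    unfolding z4 using z t(1) by (simp add: K.minus_eq K.r_distr K.r_minus K.m_comm)
  also have "\<dots> = \<one>\<^bsub>K\<^esub>" by (rule hz)
  finally have z5: "z [^]\<^bsub>K\<^esub> (5::nat) = \<one>\<^bsub>K\<^esub>" using z by (simp add: numeral_eq_Suc K.m_assoc)
  have "Factorial_Ring.prime (5::nat)" by (simp add: prime_nat_numeral_eq)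
  then have "coprime 5 (card (carrier K) - 1)" using nd by (rule prime_imp_coprime)
  then have z1: "z = \<one>\<^bsub>K\<^esub>" using K.root_trivial[OF finK z z5] by simp
  have t2: "?t = \<one>\<^bsub>K\<^esub> \<oplus>\<^bsub>K\<^esub> \<one>\<^bsub>K\<^esub>"
  proof -
    have "a = (a \<ominus>\<^bsub>K\<^esub> \<one>\<^bsub>K\<^esub>) \<oplus>\<^bsub>K\<^esub> \<one>\<^bsub>K\<^esub>" if "a \<in> carrier K" for a using that by algebra
    from this[OF t(1)] show ?thesis using zz t(1) unfolding z1 by simp
  qed
  have "(\<one>\<^bsub>K\<^esub> \<oplus>\<^bsub>K\<^esub> \<one>\<^bsub>K\<^esub>) \<otimes>\<^bsub>K\<^esub> (\<one>\<^bsub>K\<^esub> \<oplus>\<^bsub>K\<^esub> \<one>\<^bsub>K\<^esub>) \<ominus>\<^bsub>K\<^esub> (\<one>\<^bsub>K\<^esub> \<ominus>\<^bsub>K\<^esub> (\<one>\<^bsub>K\<^esub> \<oplus>\<^bsub>K\<^esub> \<one>\<^bsub>K\<^esub>)) = \<guillemotleft>5\<guillemotright>\<^bsub>K\<^esub>"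
    using K.of_int_2 K.of_int_mult[of 2 2] K.of_int_diff[of 1 2] K.of_int_diff[of 4 "-1"] by simp
  moreover have "?t \<otimes>\<^bsub>K\<^esub> ?t \<ominus>\<^bsub>K\<^esub> (\<one>\<^bsub>K\<^esub> \<ominus>\<^bsub>K\<^esub> ?t) = \<zero>\<^bsub>K\<^esub>" using t by simp
  ultimately have "\<guillemotleft>5\<guillemotright>\<^bsub>K\<^esub> = \<zero>\<^bsub>K\<^esub>" unfolding t2 by simp
  then show False using of_int_nonzero[OF five] by simp
qed

end


section \<open>Collecting the direct factors in the four splitting cases\<close>

lemma triple_DirProd_iso:
  "(A \<times>\<times> B) \<times>\<times> (A \<times>\<times> B) \<times>\<times> (A \<times>\<times> B) \<cong> (A \<times>\<times> A \<times>\<times> A) \<times>\<times> (B \<times>\<times> B \<times>\<times> B)"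
  by (rule iso_trans[OF DirProd_cong_iso[OF iso_refl DirProd_interchange_iso] DirProd_interchange_iso])

lemma power_triple_iso: "H \<^bold>^ m \<times>\<times> H \<^bold>^ m \<times>\<times> H \<^bold>^ m \<cong> H \<^bold>^ (3 * m)"
proof -
  have "H \<^bold>^ m \<times>\<times> H \<^bold>^ m \<times>\<times> H \<^bold>^ m \<cong> H \<^bold>^ (m + (m + m))"
    by (rule iso_trans[OF DirProd_cong_iso[OF iso_refl power_add_iso] power_add_iso])
  moreover have "m + (m + m) = 3 * m" by simp
  ultimately show ?thesis by (simp only:)
qed

lemma (in ring) add_monoid_elementary:
  assumes p: "Factorial_Ring.prime p" and char: "\<guillemotleft>int p\<guillemotright> = \<zero>"
    and fin: "finite (carrier R)" "card (carrier R) = p ^ n"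
  shows "add_monoid R \<cong> Cyc p \<^bold>^ n"
proof (rule comm_group.elementary_abelian_iso[OF a_comm_group _ p])
  fix x assume "x \<in> carrier (add_monoid R)"
  then have x: "x \<in> carrier R" by simp
  have "[m] \<cdot> x = \<guillemotleft>int m\<guillemotright> \<otimes> x" for m :: nat
    using x by (induction m) (simp_all add: l_distr a_comm)
  from this[of p] show "x [^]\<^bsub>add_monoid R\<^esub> p = \<one>\<^bsub>add_monoid R\<^esub>"
    using char x by (simp add: add_pow_def)
qed (use fin in simp_all)

lemma nat_power_10: "(n::nat) * n * n ^ 8 = n ^ 10"
  by (simp add: eval_nat_numeral)

context field
begin

lemma units_C2_algebra_odd_cyclic:
  assumes "finite (carrier R)" "\<guillemotleft>2\<guillemotright> \<noteq> \<zero>"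
  shows "units_of (C2_algebra R) \<cong> Cyc (card (carrier R) - 1) \<^bold>^ 2"
proof -
  have "units_of R \<times>\<times> units_of R \<cong> Cyc (card (carrier R) - 1) \<times>\<times> Cyc (card (carrier R) - 1)"
    using units_of_finite_field_iso[OF assms(1)] by (intro DirProd_cong_iso)
  then show ?thesis
    using iso_trans[OF iso_trans[OF units_C2_algebra_odd[OF assms]] power_two_iso] by blast
qed

lemma units_C2_algebra_char2_cyclic:
  assumes "finite (carrier R)" "card (carrier R) = 2 ^ n" "\<guillemotleft>2\<guillemotright> = \<zero>"
  shows "units_of (C2_algebra R) \<cong> Cyc 2 \<^bold>^ n \<times>\<times> Cyc (2 ^ n - 1)"
proof -
  have "\<one> \<oplus> \<one> = \<zero>" using assms(3) by (simp add: of_int_2)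
  moreover have "add_monoid R \<cong> Cyc 2 \<^bold>^ n"
    using assms by (intro add_monoid_elementary) (simp_all add: two_is_prime_nat)
  ultimately show ?thesis
    using iso_trans[OF units_C2_algebra_char2 DirProd_cong_iso[OF _ units_of_finite_field_iso[OF assms(1)]]]
    by (simp add: assms(2))
qed

lemma units_two_root_component:
  "units_of (C2_algebra R \<times>\<times> mat2_ring R \<times>\<times> mat2_ring R) \<cong> units_of (C2_algebra R) \<times>\<times> GL 2 R \<^bold>^ 2"
  unfolding units_of_DirProd units_of_mat2_ring by (rule DirProd_cong_iso[OF iso_refl power_two_iso])

lemma card_two_root_component:
  assumes "finite (carrier R)"
  shows "finite (carrier (C2_algebra R \<times>\<times> mat2_ring R \<times>\<times> mat2_ring R))"
    "card (carrier (C2_algebra R \<times>\<times> mat2_ring R \<times>\<times> mat2_ring R)) = card (carrier R) ^ 10"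
  using assms finite_mat2_ring[OF assms] card_mat2_ring[of R]
  by (simp_all add: card_cartesian_product nat_power_10 flip: power_add)

end

context quadratic_extension
begin

lemma card_nonroot_component:
  "finite (carrier (C2_algebra F \<times>\<times> mat2_ring K))"
  "card (carrier (C2_algebra F \<times>\<times> mat2_ring K)) = card (carrier F) ^ 10"
  using finF finite_mat2_ring[OF finK] card_mat2_ring[of K] cardK
  by (simp_all add: card_cartesian_product nat_power_10 flip: power_mult)

text \<open>In the case names the first digit is the degree over \<open>F\<close> of the field in
  which \<omega> lies, the second the same for \<tau>.\<close>

lemma units_split_case_11:
  assumes \<omega>: "\<omega> \<in> carrier F" "\<omega> [^]\<^bsub>F\<^esub> (3::nat) = \<one>\<^bsub>F\<^esub>" "\<omega> \<noteq> \<one>\<^bsub>F\<^esub>"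
    and \<tau>: "\<tau> \<in> carrier F" "\<tau> \<otimes>\<^bsub>F\<^esub> \<tau> = \<one>\<^bsub>F\<^esub> \<ominus>\<^bsub>F\<^esub> \<tau>" and five: "\<guillemotleft>5\<guillemotright>\<^bsub>F\<^esub> \<noteq> \<zero>\<^bsub>F\<^esub>"
  shows "units_of (group_algebra F C3D10) \<cong>
    (units_of (C2_algebra F) \<times>\<times> units_of (C2_algebra F) \<times>\<times> units_of (C2_algebra F)) \<times>\<times> GL 2 F \<^bold>^ 6"
proof -
  obtain \<tau>' where \<tau>': "\<tau>' \<in> carrier F" "\<tau>' \<otimes>\<^bsub>F\<^esub> \<tau>' = \<one>\<^bsub>F\<^esub> \<ominus>\<^bsub>F\<^esub> \<tau>'" "\<tau> \<noteq> \<tau>'"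
    using F.golden_conjugate[OF \<tau> five] .
  have id: "id \<in> ring_hom F F" by (simp add: ring_hom_def)
  let ?E = "C2_algebra F \<times>\<times> mat2_ring F \<times>\<times> mat2_ring F"
  have "units_of (group_algebra F C3D10) \<cong> units_of ?E \<times>\<times> units_of ?E \<times>\<times> units_of ?E"
    by (rule units_split_three[OF F.field_axioms finF \<omega> F.card_two_root_component[OF finF]])
       (rule component_two_roots[OF F.cring_axioms F.field_axioms id _ _ \<tau> \<tau>' five])
  also have "\<dots> \<cong> (units_of (C2_algebra F) \<times>\<times> GL 2 F \<^bold>^ 2) \<times>\<times> (units_of (C2_algebra F) \<times>\<times> GL 2 F \<^bold>^ 2) \<times>\<times> (units_of (C2_algebra F) \<times>\<times> GL 2 F \<^bold>^ 2)"
    by (intro DirProd_cong_iso F.units_two_root_component)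
  also have "\<dots> \<cong> (units_of (C2_algebra F) \<times>\<times> units_of (C2_algebra F) \<times>\<times> units_of (C2_algebra F)) \<times>\<times> (GL 2 F \<^bold>^ 2 \<times>\<times> GL 2 F \<^bold>^ 2 \<times>\<times> GL 2 F \<^bold>^ 2)"
    by (rule triple_DirProd_iso)
  also have "\<dots> \<cong> (units_of (C2_algebra F) \<times>\<times> units_of (C2_algebra F) \<times>\<times> units_of (C2_algebra F)) \<times>\<times> GL 2 F \<^bold>^ 6"
    using DirProd_cong_iso[OF iso_refl power_triple_iso[where H = "GL 2 F" and m = 2]] by simp
  finally show ?thesis .
qed

lemma units_split_case_12:
  assumes \<omega>: "\<omega> \<in> carrier F" "\<omega> [^]\<^bsub>F\<^esub> (3::nat) = \<one>\<^bsub>F\<^esub>" "\<omega> \<noteq> \<one>\<^bsub>F\<^esub>"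
    and \<tau>: "\<tau> \<in> carrier K" "\<tau> \<otimes>\<^bsub>K\<^esub> \<tau> = \<one>\<^bsub>K\<^esub> \<ominus>\<^bsub>K\<^esub> \<tau>" "\<tau> \<notin> \<iota> ` carrier F" and five: "\<guillemotleft>5\<guillemotright>\<^bsub>F\<^esub> \<noteq> \<zero>\<^bsub>F\<^esub>"
  shows "units_of (group_algebra F C3D10) \<cong>
    (units_of (C2_algebra F) \<times>\<times> units_of (C2_algebra F) \<times>\<times> units_of (C2_algebra F)) \<times>\<times> GL 2 K \<^bold>^ 3"
proof -
  have id: "id \<in> ring_hom F F" by (simp add: ring_hom_def)
  let ?E = "C2_algebra F \<times>\<times> mat2_ring K"
  have "units_of (group_algebra F C3D10) \<cong> units_of ?E \<times>\<times> units_of ?E \<times>\<times> units_of ?E"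
    by (rule units_split_three[OF F.field_axioms finF \<omega> card_nonroot_component])
       (rule component_nonroot[OF F.cring_axioms F.field_axioms K.field_axioms id _ _ \<iota> \<tau> five of_int_nonzero[OF five]])
  also have "\<dots> \<cong> (units_of (C2_algebra F) \<times>\<times> units_of (C2_algebra F) \<times>\<times> units_of (C2_algebra F)) \<times>\<times> (GL 2 K \<times>\<times> GL 2 K \<times>\<times> GL 2 K)"
    unfolding units_of_DirProd units_of_mat2_ring by (rule triple_DirProd_iso)
  also have "\<dots> \<cong> (units_of (C2_algebra F) \<times>\<times> units_of (C2_algebra F) \<times>\<times> units_of (C2_algebra F)) \<times>\<times> GL 2 K \<^bold>^ 3"
    by (rule DirProd_cong_iso[OF iso_refl power_three_iso])
  finally show ?thesis .
qed

text \<open>Both roots \<tau> lie in \<open>F\<close> and are carried into \<open>K\<close> by the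
  embedding, so the trivial character gives two factors over \<open>F\<close> and \<omega> gives two
  over \<open>K\<close>.\<close>

lemma units_split_case_21:
  assumes \<omega>: "\<omega> \<in> carrier K" "\<omega> [^]\<^bsub>K\<^esub> (3::nat) = \<one>\<^bsub>K\<^esub>" "\<omega> \<notin> \<iota> ` carrier F" and three: "\<guillemotleft>3\<guillemotright>\<^bsub>F\<^esub> \<noteq> \<zero>\<^bsub>F\<^esub>"
    and \<tau>: "\<tau> \<in> carrier F" "\<tau> \<otimes>\<^bsub>F\<^esub> \<tau> = \<one>\<^bsub>F\<^esub> \<ominus>\<^bsub>F\<^esub> \<tau>" and five: "\<guillemotleft>5\<guillemotright>\<^bsub>F\<^esub> \<noteq> \<zero>\<^bsub>F\<^esub>"
  shows "units_of (group_algebra F C3D10) \<cong>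
    (units_of (C2_algebra F) \<times>\<times> units_of (C2_algebra K)) \<times>\<times> (GL 2 F \<^bold>^ 2 \<times>\<times> GL 2 K \<^bold>^ 2)"
proof -
  obtain \<tau>' where \<tau>': "\<tau>' \<in> carrier F" "\<tau>' \<otimes>\<^bsub>F\<^esub> \<tau>' = \<one>\<^bsub>F\<^esub> \<ominus>\<^bsub>F\<^esub> \<tau>'" "\<tau> \<noteq> \<tau>'"
    using F.golden_conjugate[OF \<tau> five] .
  have golden: "\<iota> t \<otimes>\<^bsub>K\<^esub> \<iota> t = \<one>\<^bsub>K\<^esub> \<ominus>\<^bsub>K\<^esub> \<iota> t" if "t \<in> carrier F" "t \<otimes>\<^bsub>F\<^esub> t = \<one>\<^bsub>F\<^esub> \<ominus>\<^bsub>F\<^esub> t" for t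
    using that h.hom_mult[OF that(1) that(1)] by (simp add: iota_minus)
  have ne: "\<iota> \<tau> \<noteq> \<iota> \<tau>'" using inj_onD[OF inj _ \<tau>(1) \<tau>'(1)] \<tau>'(3) by blast
  have id: "id \<in> ring_hom F F" by (simp add: ring_hom_def)
  let ?E1 = "C2_algebra F \<times>\<times> mat2_ring F \<times>\<times> mat2_ring F" and ?E2 = "C2_algebra K \<times>\<times> mat2_ring K \<times>\<times> mat2_ring K"
  obtain \<Psi>1 where 1: "dihedral_component F F id \<one>\<^bsub>F\<^esub> ?E1 \<Psi>1"
    using component_two_roots[OF F.cring_axioms F.field_axioms id _ _ \<tau> \<tau>' five, of "\<one>\<^bsub>F\<^esub>"] by auto
  obtain \<Psi>2 where 2: "dihedral_component F K \<iota> \<omega> ?E2 \<Psi>2"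
    using component_two_roots[OF F.cring_axioms K.field_axioms \<iota> \<omega>(1,2) _ golden[OF \<tau>] _ golden[OF \<tau>'(1,2)] ne
        of_int_nonzero[OF five]] \<tau>(1) \<tau>'(1) by auto
  have card: "card (carrier ?E1) * card (carrier ?E2) = card (carrier F) ^ 30"
    unfolding F.card_two_root_component(2)[OF finF] K.card_two_root_component(2)[OF finK] cardK
    by (simp flip: power_add power_mult)
  have "units_of (group_algebra F C3D10) \<cong> units_of ?E1 \<times>\<times> units_of ?E2"
    by (rule units_split_two[OF F.field_axioms finF K.field_axioms \<iota> \<omega> three
        F.card_two_root_component(1)[OF finF] K.card_two_root_component(1)[OF finK] card 1 2])
  also have "\<dots> \<cong> (units_of (C2_algebra F) \<times>\<times> GL 2 F \<^bold>^ 2) \<times>\<times> (units_of (C2_algebra K) \<times>\<times> GL 2 K \<^bold>^ 2)"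
    by (intro DirProd_cong_iso F.units_two_root_component K.units_two_root_component)
  also have "\<dots> \<cong> (units_of (C2_algebra F) \<times>\<times> units_of (C2_algebra K)) \<times>\<times> (GL 2 F \<^bold>^ 2 \<times>\<times> GL 2 K \<^bold>^ 2)"
    by (rule DirProd_interchange_iso)
  finally show ?thesis .
qed

text \<open>Over \<open>F\<close> the trivial character yields a single matrix factor over
  \<open>K\<close>. At \<omega> the scalars are \<open>K\<close>, which contains both roots, and
  this yields two more.\<close>

lemma units_split_case_22:
  assumes \<omega>: "\<omega> \<in> carrier K" "\<omega> [^]\<^bsub>K\<^esub> (3::nat) = \<one>\<^bsub>K\<^esub>" "\<omega> \<notin> \<iota> ` carrier F" and three: "\<guillemotleft>3\<guillemotright>\<^bsub>F\<^esub> \<noteq> \<zero>\<^bsub>F\<^esub>"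
    and \<tau>: "\<tau> \<in> carrier K" "\<tau> \<otimes>\<^bsub>K\<^esub> \<tau> = \<one>\<^bsub>K\<^esub> \<ominus>\<^bsub>K\<^esub> \<tau>" "\<tau> \<notin> \<iota> ` carrier F" and five: "\<guillemotleft>5\<guillemotright>\<^bsub>F\<^esub> \<noteq> \<zero>\<^bsub>F\<^esub>"
  shows "units_of (group_algebra F C3D10) \<cong>
    (units_of (C2_algebra F) \<times>\<times> units_of (C2_algebra K)) \<times>\<times> GL 2 K \<^bold>^ 3"
proof -
  obtain \<tau>' where \<tau>': "\<tau>' \<in> carrier K" "\<tau>' \<otimes>\<^bsub>K\<^esub> \<tau>' = \<one>\<^bsub>K\<^esub> \<ominus>\<^bsub>K\<^esub> \<tau>'" "\<tau> \<noteq> \<tau>'"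
    using K.golden_conjugate[OF \<tau>(1,2) of_int_nonzero[OF five]] .
  have id: "id \<in> ring_hom F F" by (simp add: ring_hom_def)
  let ?E1 = "C2_algebra F \<times>\<times> mat2_ring K" and ?E2 = "C2_algebra K \<times>\<times> mat2_ring K \<times>\<times> mat2_ring K"
  obtain \<Psi>1 where 1: "dihedral_component F F id \<one>\<^bsub>F\<^esub> ?E1 \<Psi>1"
    using component_nonroot[OF F.cring_axioms F.field_axioms K.field_axioms id _ _ \<iota> \<tau> five of_int_nonzero[OF five], of "\<one>\<^bsub>F\<^esub>"] by auto
  obtain \<Psi>2 where 2: "dihedral_component F K \<iota> \<omega> ?E2 \<Psi>2"
    using component_two_roots[OF F.cring_axioms K.field_axioms \<iota> \<omega>(1,2) \<tau>(1,2) \<tau>' of_int_nonzero[OF five]] by auto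
  have card: "card (carrier ?E1) * card (carrier ?E2) = card (carrier F) ^ 30"
    unfolding card_nonroot_component(2) K.card_two_root_component(2)[OF finK] cardK
    by (simp flip: power_add power_mult)
  have "units_of (group_algebra F C3D10) \<cong> units_of ?E1 \<times>\<times> units_of ?E2"
    by (rule units_split_two[OF F.field_axioms finF K.field_axioms \<iota> \<omega> three
        card_nonroot_component(1) K.card_two_root_component(1)[OF finK] card 1 2])
  also have "\<dots> \<cong> (units_of (C2_algebra F) \<times>\<times> GL 2 K \<^bold>^ 1) \<times>\<times> (units_of (C2_algebra K) \<times>\<times> GL 2 K \<^bold>^ 2)"
    unfolding units_of_DirProd[of "C2_algebra F"] units_of_mat2_ring
    by (intro DirProd_cong_iso iso_refl power_one_iso K.units_two_root_component)
  also have "\<dots> \<cong> (units_of (C2_algebra F) \<times>\<times> units_of (C2_algebra K)) \<times>\<times> (GL 2 K \<^bold>^ 1 \<times>\<times> GL 2 K \<^bold>^ 2)"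
    by (rule DirProd_interchange_iso)
  also have "\<dots> \<cong> (units_of (C2_algebra F) \<times>\<times> units_of (C2_algebra K)) \<times>\<times> GL 2 K \<^bold>^ (1 + 2)"
    by (rule DirProd_cong_iso[OF iso_refl power_add_iso])
  finally show ?thesis by (simp only: one_plus_numeral semiring_norm)
qed

end

section \<open>Skew polynomials truncated at degree five\<close>

text \<open>Truncated skew polynomials \<open>\<Sum>\<^sub>i\<^sub><\<^sub>5 w\<^sup>i r\<^sub>i\<close> with \<open>r w = w \<sigma>(r)\<close> and \<open>w\<^sup>5 = 0\<close>.\<close>

definition skew_ring :: "('b, 'n) ring_scheme \<Rightarrow> ('b \<Rightarrow> 'b) \<Rightarrow> ('b \<times> 'b \<times> 'b \<times> 'b \<times> 'b) ring" where
  "skew_ring B \<sigma> = \<lparr>carrier = carrier B \<times> carrier B \<times> carrier B \<times> carrier B \<times> carrier B,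
     monoid.mult = (\<lambda>(r0, r1, r2, r3, r4) (s0, s1, s2, s3, s4).
       (r0 \<otimes>\<^bsub>B\<^esub> s0,
        \<sigma> r0 \<otimes>\<^bsub>B\<^esub> s1 \<oplus>\<^bsub>B\<^esub> r1 \<otimes>\<^bsub>B\<^esub> s0,
        r0 \<otimes>\<^bsub>B\<^esub> s2 \<oplus>\<^bsub>B\<^esub> (\<sigma> r1 \<otimes>\<^bsub>B\<^esub> s1 \<oplus>\<^bsub>B\<^esub> r2 \<otimes>\<^bsub>B\<^esub> s0),
        \<sigma> r0 \<otimes>\<^bsub>B\<^esub> s3 \<oplus>\<^bsub>B\<^esub> (r1 \<otimes>\<^bsub>B\<^esub> s2 \<oplus>\<^bsub>B\<^esub> (\<sigma> r2 \<otimes>\<^bsub>B\<^esub> s1 \<oplus>\<^bsub>B\<^esub> r3 \<otimes>\<^bsub>B\<^esub> s0)),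
        r0 \<otimes>\<^bsub>B\<^esub> s4 \<oplus>\<^bsub>B\<^esub> (\<sigma> r1 \<otimes>\<^bsub>B\<^esub> s3 \<oplus>\<^bsub>B\<^esub> (r2 \<otimes>\<^bsub>B\<^esub> s2 \<oplus>\<^bsub>B\<^esub> (\<sigma> r3 \<otimes>\<^bsub>B\<^esub> s1 \<oplus>\<^bsub>B\<^esub> r4 \<otimes>\<^bsub>B\<^esub> s0))))),
     one = (\<one>\<^bsub>B\<^esub>, \<zero>\<^bsub>B\<^esub>, \<zero>\<^bsub>B\<^esub>, \<zero>\<^bsub>B\<^esub>, \<zero>\<^bsub>B\<^esub>),
     ring.zero = (\<zero>\<^bsub>B\<^esub>, \<zero>\<^bsub>B\<^esub>, \<zero>\<^bsub>B\<^esub>, \<zero>\<^bsub>B\<^esub>, \<zero>\<^bsub>B\<^esub>),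
     ring.add = (\<lambda>(r0, r1, r2, r3, r4) (s0, s1, s2, s3, s4).
       (r0 \<oplus>\<^bsub>B\<^esub> s0, r1 \<oplus>\<^bsub>B\<^esub> s1, r2 \<oplus>\<^bsub>B\<^esub> s2, r3 \<oplus>\<^bsub>B\<^esub> s3, r4 \<oplus>\<^bsub>B\<^esub> s4))\<rparr>"

lemma skew_ring_simps [simp]:
  "carrier (skew_ring B \<sigma>) = carrier B \<times> carrier B \<times> carrier B \<times> carrier B \<times> carrier B"
  "(r0, r1, r2, r3, r4) \<otimes>\<^bsub>skew_ring B \<sigma>\<^esub> (s0, s1, s2, s3, s4) =
       (r0 \<otimes>\<^bsub>B\<^esub> s0,
        \<sigma> r0 \<otimes>\<^bsub>B\<^esub> s1 \<oplus>\<^bsub>B\<^esub> r1 \<otimes>\<^bsub>B\<^esub> s0,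
        r0 \<otimes>\<^bsub>B\<^esub> s2 \<oplus>\<^bsub>B\<^esub> (\<sigma> r1 \<otimes>\<^bsub>B\<^esub> s1 \<oplus>\<^bsub>B\<^esub> r2 \<otimes>\<^bsub>B\<^esub> s0),
        \<sigma> r0 \<otimes>\<^bsub>B\<^esub> s3 \<oplus>\<^bsub>B\<^esub> (r1 \<otimes>\<^bsub>B\<^esub> s2 \<oplus>\<^bsub>B\<^esub> (\<sigma> r2 \<otimes>\<^bsub>B\<^esub> s1 \<oplus>\<^bsub>B\<^esub> r3 \<otimes>\<^bsub>B\<^esub> s0)),
        r0 \<otimes>\<^bsub>B\<^esub> s4 \<oplus>\<^bsub>B\<^esub> (\<sigma> r1 \<otimes>\<^bsub>B\<^esub> s3 \<oplus>\<^bsub>B\<^esub> (r2 \<otimes>\<^bsub>B\<^esub> s2 \<oplus>\<^bsub>B\<^esub> (\<sigma> r3 \<otimes>\<^bsub>B\<^esub> s1 \<oplus>\<^bsub>B\<^esub> r4 \<otimes>\<^bsub>B\<^esub> s0))))"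
  "(r0, r1, r2, r3, r4) \<oplus>\<^bsub>skew_ring B \<sigma>\<^esub> (s0, s1, s2, s3, s4) =
       (r0 \<oplus>\<^bsub>B\<^esub> s0, r1 \<oplus>\<^bsub>B\<^esub> s1, r2 \<oplus>\<^bsub>B\<^esub> s2, r3 \<oplus>\<^bsub>B\<^esub> s3, r4 \<oplus>\<^bsub>B\<^esub> s4)"
  "\<one>\<^bsub>skew_ring B \<sigma>\<^esub> = (\<one>\<^bsub>B\<^esub>, \<zero>\<^bsub>B\<^esub>, \<zero>\<^bsub>B\<^esub>, \<zero>\<^bsub>B\<^esub>, \<zero>\<^bsub>B\<^esub>)"
  "\<zero>\<^bsub>skew_ring B \<sigma>\<^esub> = (\<zero>\<^bsub>B\<^esub>, \<zero>\<^bsub>B\<^esub>, \<zero>\<^bsub>B\<^esub>, \<zero>\<^bsub>B\<^esub>, \<zero>\<^bsub>B\<^esub>)"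
  by (simp_all add: skew_ring_def)

text \<open>As \<sigma> is an involution, a coefficient is changed only when it passes an odd power
  of \<open>w\<close>; this explains where \<sigma> stands in the product.\<close>

locale skew = B: cring B for B :: "('b, 'n) ring_scheme" +
  fixes \<sigma> :: "'b \<Rightarrow> 'b"
  assumes \<sigma>: "\<sigma> \<in> ring_hom B B" and \<sigma>\<sigma> [simp]: "\<And>b. b \<in> carrier B \<Longrightarrow> \<sigma> (\<sigma> b) = b"
begin

abbreviation T :: "('b \<times> 'b \<times> 'b \<times> 'b \<times> 'b) ring" where "T \<equiv> skew_ring B \<sigma>"

sublocale h: ring_hom_ring B B \<sigma>
  using \<sigma> by (intro ring_hom_ringI2 B.ring_axioms)

lemma T_ring: "ring T"
proof (intro ringI abelian_groupI monoidI)
  fix u v w assume "u \<in> carrier T" "v \<in> carrier T" "w \<in> carrier T"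
  then obtain r0 r1 r2 r3 r4 s0 s1 s2 s3 s4 t0 t1 t2 t3 t4 where
    eqs: "u = (r0, r1, r2, r3, r4)" "v = (s0, s1, s2, s3, s4)" "w = (t0, t1, t2, t3, t4)" and
    cl: "r0 \<in> carrier B" "r1 \<in> carrier B" "r2 \<in> carrier B" "r3 \<in> carrier B" "r4 \<in> carrier B"
    "s0 \<in> carrier B" "s1 \<in> carrier B" "s2 \<in> carrier B" "s3 \<in> carrier B" "s4 \<in> carrier B"
    "t0 \<in> carrier B" "t1 \<in> carrier B" "t2 \<in> carrier B" "t3 \<in> carrier B" "t4 \<in> carrier B"
    by auto
  show "(u \<otimes>\<^bsub>T\<^esub> v) \<otimes>\<^bsub>T\<^esub> w = u \<otimes>\<^bsub>T\<^esub> (v \<otimes>\<^bsub>T\<^esub> w)"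
    using cl unfolding eqs by (simp add: B.l_distr B.r_distr B.a_ac B.m_assoc)
  show "(u \<oplus>\<^bsub>T\<^esub> v) \<otimes>\<^bsub>T\<^esub> w = u \<otimes>\<^bsub>T\<^esub> w \<oplus>\<^bsub>T\<^esub> v \<otimes>\<^bsub>T\<^esub> w"
    using cl unfolding eqs by (simp add: B.l_distr B.a_ac)
  show "w \<otimes>\<^bsub>T\<^esub> (u \<oplus>\<^bsub>T\<^esub> v) = w \<otimes>\<^bsub>T\<^esub> u \<oplus>\<^bsub>T\<^esub> w \<otimes>\<^bsub>T\<^esub> v"
    using cl unfolding eqs by (simp add: B.r_distr B.a_ac)
  show "(u \<oplus>\<^bsub>T\<^esub> v) \<oplus>\<^bsub>T\<^esub> w = u \<oplus>\<^bsub>T\<^esub> (v \<oplus>\<^bsub>T\<^esub> w)"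
    using cl unfolding eqs by (simp add: B.a_assoc)
next
  fix u v assume "u \<in> carrier T" "v \<in> carrier T"
  then obtain r0 r1 r2 r3 r4 s0 s1 s2 s3 s4 where
    eqs: "u = (r0, r1, r2, r3, r4)" "v = (s0, s1, s2, s3, s4)" and
    cl: "r0 \<in> carrier B" "r1 \<in> carrier B" "r2 \<in> carrier B" "r3 \<in> carrier B" "r4 \<in> carrier B"
    "s0 \<in> carrier B" "s1 \<in> carrier B" "s2 \<in> carrier B" "s3 \<in> carrier B" "s4 \<in> carrier B"
    by auto
  show "u \<otimes>\<^bsub>T\<^esub> v \<in> carrier T" "u \<oplus>\<^bsub>T\<^esub> v \<in> carrier T" "u \<oplus>\<^bsub>T\<^esub> v = v \<oplus>\<^bsub>T\<^esub> u"
    using cl unfolding eqs by (simp_all add: B.a_comm)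
next
  fix u assume "u \<in> carrier T"
  then obtain r0 r1 r2 r3 r4 where
    eqs: "u = (r0, r1, r2, r3, r4)" and
    cl: "r0 \<in> carrier B" "r1 \<in> carrier B" "r2 \<in> carrier B" "r3 \<in> carrier B" "r4 \<in> carrier B"
    by auto
  show "\<zero>\<^bsub>T\<^esub> \<oplus>\<^bsub>T\<^esub> u = u" "\<one>\<^bsub>T\<^esub> \<otimes>\<^bsub>T\<^esub> u = u" "u \<otimes>\<^bsub>T\<^esub> \<one>\<^bsub>T\<^esub> = u"
    using cl unfolding eqs by simp_all
  show "\<exists>v\<in>carrier T. v \<oplus>\<^bsub>T\<^esub> u = \<zero>\<^bsub>T\<^esub>"
    using cl unfolding eqs
    by (intro bexI[of _ "(\<ominus>\<^bsub>B\<^esub> r0, \<ominus>\<^bsub>B\<^esub> r1, \<ominus>\<^bsub>B\<^esub> r2, \<ominus>\<^bsub>B\<^esub> r3, \<ominus>\<^bsub>B\<^esub> r4)"]) (simp_all add: B.l_neg)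
qed simp_all

sublocale T: ring T by (rule T_ring)

lemma const_hom: "(\<lambda>b. (b, \<zero>\<^bsub>B\<^esub>, \<zero>\<^bsub>B\<^esub>, \<zero>\<^bsub>B\<^esub>, \<zero>\<^bsub>B\<^esub>)) \<in> ring_hom B T"
  by (rule ring_hom_memI) simp_all

lemma proj_hom: "fst \<in> ring_hom T B"
  by (rule ring_hom_memI) auto

text \<open>With constant term 1 the coefficients of the inverse are found successively, each from
  the preceding ones.\<close>

lemma right_inverse:
  assumes "u \<in> carrier T" "fst u = \<one>\<^bsub>B\<^esub>"
  shows "\<exists>v\<in>carrier T. fst v = \<one>\<^bsub>B\<^esub> \<and> u \<otimes>\<^bsub>T\<^esub> v = \<one>\<^bsub>T\<^esub>"
proof -
  obtain r1 r2 r3 r4 where u: "u = (\<one>\<^bsub>B\<^esub>, r1, r2, r3, r4)" and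
    cl: "r1 \<in> carrier B" "r2 \<in> carrier B" "r3 \<in> carrier B" "r4 \<in> carrier B"
    using assms by (cases u) auto
  define s1 where "s1 = \<ominus>\<^bsub>B\<^esub> r1"
  have s1: "s1 \<in> carrier B" using cl by (simp add: s1_def)
  define s2 where "s2 = \<ominus>\<^bsub>B\<^esub> (\<sigma> r1 \<otimes>\<^bsub>B\<^esub> s1 \<oplus>\<^bsub>B\<^esub> r2)"
  have s2: "s2 \<in> carrier B" using cl s1 by (simp add: s2_def)
  define s3 where "s3 = \<ominus>\<^bsub>B\<^esub> (r1 \<otimes>\<^bsub>B\<^esub> s2 \<oplus>\<^bsub>B\<^esub> (\<sigma> r2 \<otimes>\<^bsub>B\<^esub> s1 \<oplus>\<^bsub>B\<^esub> r3))"
  have s3: "s3 \<in> carrier B" using cl s1 s2 by (simp add: s3_def)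
  define s4 where "s4 = \<ominus>\<^bsub>B\<^esub> (\<sigma> r1 \<otimes>\<^bsub>B\<^esub> s3 \<oplus>\<^bsub>B\<^esub> (r2 \<otimes>\<^bsub>B\<^esub> s2 \<oplus>\<^bsub>B\<^esub> (\<sigma> r3 \<otimes>\<^bsub>B\<^esub> s1 \<oplus>\<^bsub>B\<^esub> r4)))"
  have s4: "s4 \<in> carrier B" using cl s1 s2 s3 by (simp add: s4_def)
  have "u \<otimes>\<^bsub>T\<^esub> (\<one>\<^bsub>B\<^esub>, s1, s2, s3, s4) = \<one>\<^bsub>T\<^esub>"
    using cl s1 s2 s3 s4 unfolding u
    by (simp add: B.l_neg s1_def[symmetric] s2_def[symmetric])
       (simp add: s1_def s2_def s3_def s4_def B.l_neg)
  then show ?thesis using s1 s2 s3 s4 by (intro bexI[of _ "(\<one>\<^bsub>B\<^esub>, s1, s2, s3, s4)"]) simp_all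
qed

text \<open>The right inverse \<open>v\<close> has constant term 1 as well, hence a right inverse
  \<open>w\<close> of its own. Then \<open>u = u v w = w\<close>, so \<open>v\<close> is a two-sided
  inverse.\<close>

lemma unipotent_unit:
  assumes u: "u \<in> carrier T" "fst u = \<one>\<^bsub>B\<^esub>"
  shows "u \<in> Units T"
proof -
  obtain v where v: "v \<in> carrier T" "fst v = \<one>\<^bsub>B\<^esub>" "u \<otimes>\<^bsub>T\<^esub> v = \<one>\<^bsub>T\<^esub>" using right_inverse[OF u] by blast
  obtain w where w: "w \<in> carrier T" "v \<otimes>\<^bsub>T\<^esub> w = \<one>\<^bsub>T\<^esub>" using right_inverse[OF v(1,2)] by blast
  have "u = w" using T.inv_unique[of u v w] u v w by simp
  then have "v \<otimes>\<^bsub>T\<^esub> u = \<one>\<^bsub>T\<^esub>" using w(2) by (simp only:)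
  then show ?thesis unfolding Units_def using u(1) v(1,3) by (intro CollectI conjI bexI[of _ v])
qed

text \<open>Modulo 5 the inverses of 2, 6 and 24 are 3, 1 and -1, which are the constants in degrees
  2, 3 and 4.\<close>

definition exp_w :: "int \<Rightarrow> 'b \<times> 'b \<times> 'b \<times> 'b \<times> 'b" where
  "exp_w n = (\<one>\<^bsub>B\<^esub>, \<guillemotleft>n\<guillemotright>\<^bsub>B\<^esub>, \<guillemotleft>3 * n ^ 2\<guillemotright>\<^bsub>B\<^esub>, \<guillemotleft>n ^ 3\<guillemotright>\<^bsub>B\<^esub>, \<guillemotleft>- (n ^ 4)\<guillemotright>\<^bsub>B\<^esub>)"

end

lemma (in ring) of_int_cong5:
  assumes "\<guillemotleft>5\<guillemotright> = \<zero>" "i mod 5 = j mod 5"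
  shows "\<guillemotleft>i\<guillemotright> = \<guillemotleft>j\<guillemotright>"
proof -
  have "\<guillemotleft>n\<guillemotright> = \<guillemotleft>n mod 5\<guillemotright>" for n
  proof -
    have "\<guillemotleft>5 * (n div 5) + n mod 5\<guillemotright> = \<guillemotleft>n mod 5\<guillemotright>" by (simp only: of_int_add of_int_mult assms(1)) simp
    then show ?thesis by simp
  qed
  from this[of i] this[of j] assms(2) show ?thesis by simp
qed

locale skew5 = skew +
  assumes five: "\<guillemotleft>5\<guillemotright>\<^bsub>B\<^esub> = \<zero>\<^bsub>B\<^esub>"
begin

lemma sigma_of_int [simp]: "\<sigma> \<guillemotleft>i\<guillemotright>\<^bsub>B\<^esub> = \<guillemotleft>i\<guillemotright>\<^bsub>B\<^esub>"
  by (rule ring_hom_of_int[OF B.ring_axioms B.ring_axioms \<sigma>])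

text \<open>\<open>exp_w n\<close> is the truncated exponential series of \<open>n w\<close>, with the denominators inverted modulo \<open>5\<close>.\<close>

lemma exp_w_mult: "exp_w i \<otimes>\<^bsub>T\<^esub> exp_w j = exp_w (i + j)"
proof -
  have c: "\<guillemotleft>a\<guillemotright>\<^bsub>B\<^esub> = \<guillemotleft>b\<guillemotright>\<^bsub>B\<^esub>" if "5 dvd a - b" for a b
    using B.of_int_cong5[OF five] that by (simp add: mod_eq_dvd_iff)
  have 2: "\<guillemotleft>3 * j ^ 2 + (i * j + 3 * i ^ 2)\<guillemotright>\<^bsub>B\<^esub> = \<guillemotleft>3 * (i + j) ^ 2\<guillemotright>\<^bsub>B\<^esub>"
  proof (rule c)
    have "3 * j ^ 2 + (i * j + 3 * i ^ 2) - 3 * (i + j) ^ 2 = 5 * (- i * j)"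
      by (simp add: power2_eq_square algebra_simps)
    then show "5 dvd 3 * j ^ 2 + (i * j + 3 * i ^ 2) - 3 * (i + j) ^ 2" by (metis dvd_triv_left)
  qed
  \<comment> \<open>Only in degree 3 does the functional equation hold over the integers; in degrees
    2 and 4 the two sides differ by the exhibited multiple of 5.\<close>
  have 3: "j ^ 3 + (i * (3 * j ^ 2) + (3 * i ^ 2 * j + i ^ 3)) = (i + j) ^ 3"
    by (simp add: power3_eq_cube power2_eq_square algebra_simps)
  have 4: "\<guillemotleft>- (j ^ 4) + (i * j ^ 3 + (3 * i ^ 2 * (3 * j ^ 2) + (i ^ 3 * j + - (i ^ 4))))\<guillemotright>\<^bsub>B\<^esub> = \<guillemotleft>- ((i + j) ^ 4)\<guillemotright>\<^bsub>B\<^esub>"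
  proof (rule c)
    have "- (j ^ 4) + (i * j ^ 3 + (3 * i ^ 2 * (3 * j ^ 2) + (i ^ 3 * j + - (i ^ 4)))) - - ((i + j) ^ 4) =
        5 * (i * j ^ 3 + 3 * i ^ 2 * j ^ 2 + i ^ 3 * j)"
      by (simp add: eval_nat_numeral algebra_simps)
    then show "5 dvd - (j ^ 4) + (i * j ^ 3 + (3 * i ^ 2 * (3 * j ^ 2) + (i ^ 3 * j + - (i ^ 4)))) - - ((i + j) ^ 4)"
      by (metis dvd_triv_left)
  qed
  show ?thesis
    unfolding exp_w_def
    by (simp only: skew_ring_simps sigma_of_int h.hom_one B.l_one B.r_one B.one_closed B.of_int_closed
        flip: B.of_int_mult B.of_int_add) (simp only: 2 3 4 add.commute[of j i])
qed

lemma exp_w_pow: "exp_w 1 [^]\<^bsub>T\<^esub> (n::nat) = exp_w (int n)"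
proof (induction n)
  case 0
  show ?case by (simp add: exp_w_def)
next
  case (Suc n)
  then show ?case by (simp add: exp_w_mult add.commute del: skew_ring_simps)
qed

lemma exp_w_cong: "i mod 5 = j mod 5 \<Longrightarrow> exp_w i = exp_w j"
  unfolding exp_w_def
  by (intro arg_cong2[where f = Pair] refl B.of_int_cong5[OF five])
     (auto intro!: mod_mult_cong mod_minus_cong simp: power_mod[symmetric, of i] power_mod[symmetric, of j])

end


context ring
begin

text \<open>Residues are represented by 0, 1, 2, -2, -1 and written with sums and signs, so that the
  moment equations become free of numerals.\<close>

lemma of_int_mod5_cases:
  assumes five: "\<guillemotleft>5\<guillemotright> = \<zero>" and a: "a \<in> carrier R"
  shows "n mod 5 = 0 \<Longrightarrow> \<guillemotleft>n\<guillemotright> \<otimes> a = \<zero>" "n mod 5 = 1 \<Longrightarrow> \<guillemotleft>n\<guillemotright> \<otimes> a = a" "n mod 5 = 2 \<Longrightarrow> \<guillemotleft>n\<guillemotright> \<otimes> a = a \<oplus> a"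
    "n mod 5 = 3 \<Longrightarrow> \<guillemotleft>n\<guillemotright> \<otimes> a = \<ominus> (a \<oplus> a)" "n mod 5 = 4 \<Longrightarrow> \<guillemotleft>n\<guillemotright> \<otimes> a = \<ominus> a"
proof -
  show "\<guillemotleft>n\<guillemotright> \<otimes> a = \<zero>" if "n mod 5 = 0" using of_int_cong5[OF five, of n 0] that a by simp
  show "\<guillemotleft>n\<guillemotright> \<otimes> a = a" if "n mod 5 = 1" using of_int_cong5[OF five, of n 1] that a by simp
  show "\<guillemotleft>n\<guillemotright> \<otimes> a = a \<oplus> a" if "n mod 5 = 2" using of_int_cong5[OF five, of n 2] that a by (simp add: mult2)
  show "\<guillemotleft>n\<guillemotright> \<otimes> a = \<ominus> (a \<oplus> a)" if "n mod 5 = 3" using of_int_cong5[OF five, of n "-2"] that a by (simp add: mult2 l_minus)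
  show "\<guillemotleft>n\<guillemotright> \<otimes> a = \<ominus> a" if "n mod 5 = 4" using of_int_cong5[OF five, of n "-1"] that a by (simp add: l_minus)
qed

text \<open>Three times \<open>2 a\<close> is \<open>6 a\<close>, which equals
  \<open>a\<close>.\<close>

lemma double_eq_zero:
  assumes five: "\<guillemotleft>5\<guillemotright> = \<zero>" and a: "a \<in> carrier R" "a \<oplus> a = \<zero>"
  shows "a = \<zero>"
proof -
  have "\<guillemotleft>2\<guillemotright> \<otimes> a = \<zero>" using a by (simp flip: mult2)
  then have "\<guillemotleft>3\<guillemotright> \<otimes> (\<guillemotleft>2\<guillemotright> \<otimes> a) = \<zero>" by simp
  then have "\<guillemotleft>6\<guillemotright> \<otimes> a = \<zero>" using of_int_comb(2)[OF a(1), of 3 2] by simp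
  then show ?thesis using of_int_mod5_cases(2)[OF five a(1), of 6] by simp
qed

end

text \<open>A Vandermonde system: the power moments of \<open>\<beta>\<close> at the five points \<open>0, \<dots>, 4\<close> of the prime field.\<close>

lemma (in cring) moments_zero:
  assumes five: "\<guillemotleft>5\<guillemotright> = \<zero>"
    and cl: "b0 \<in> carrier R" "b1 \<in> carrier R" "b2 \<in> carrier R" "b3 \<in> carrier R" "b4 \<in> carrier R"
    and e0: "b0 \<oplus> (b1 \<oplus> (b2 \<oplus> (b3 \<oplus> b4))) = \<zero>"
    and e1: "b1 \<oplus> ((b2 \<oplus> b2) \<oplus> (\<ominus> (b3 \<oplus> b3) \<oplus> \<ominus> b4)) = \<zero>"
    and e2: "\<ominus> (b1 \<oplus> b1) \<oplus> ((b2 \<oplus> b2) \<oplus> ((b3 \<oplus> b3) \<oplus> \<ominus> (b4 \<oplus> b4))) = \<zero>"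
    and e3: "b1 \<oplus> (\<ominus> (b2 \<oplus> b2) \<oplus> ((b3 \<oplus> b3) \<oplus> \<ominus> b4)) = \<zero>"
    and e4: "\<ominus> b1 \<oplus> (\<ominus> b2 \<oplus> (\<ominus> b3 \<oplus> \<ominus> b4)) = \<zero>"
  shows "b0 = \<zero> \<and> b1 = \<zero> \<and> b2 = \<zero> \<and> b3 = \<zero> \<and> b4 = \<zero>"
proof -
  note dbl = double_eq_zero[OF five]
  \<comment> \<open>The first and third moments give \<open>2 (b1 - b4) = 0\<close> by their sum and
    \<open>4 (b2 - b3) = 0\<close> by their difference. Then the second moment is
    \<open>4 (b3 - b4)\<close>, the fourth is \<open>-4 b4\<close>, and the zeroth leaves
    \<open>b0\<close>.\<close>
  have "(b1 \<oplus> ((b2 \<oplus> b2) \<oplus> (\<ominus> (b3 \<oplus> b3) \<oplus> \<ominus> b4))) \<oplus> (b1 \<oplus> (\<ominus> (b2 \<oplus> b2) \<oplus> ((b3 \<oplus> b3) \<oplus> \<ominus> b4)))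
      = (b1 \<ominus> b4) \<oplus> (b1 \<ominus> b4)" using cl by algebra
  then have "(b1 \<ominus> b4) \<oplus> (b1 \<ominus> b4) = \<zero>" unfolding e1 e3 by simp
  then have 14: "b1 = b4" using dbl[of "b1 \<ominus> b4"] cl eq_diff0 by simp
  have "(b1 \<oplus> ((b2 \<oplus> b2) \<oplus> (\<ominus> (b3 \<oplus> b3) \<oplus> \<ominus> b4))) \<ominus> (b1 \<oplus> (\<ominus> (b2 \<oplus> b2) \<oplus> ((b3 \<oplus> b3) \<oplus> \<ominus> b4)))
      = ((b2 \<ominus> b3) \<oplus> (b2 \<ominus> b3)) \<oplus> ((b2 \<ominus> b3) \<oplus> (b2 \<ominus> b3))" using cl by algebra
  then have "((b2 \<ominus> b3) \<oplus> (b2 \<ominus> b3)) \<oplus> ((b2 \<ominus> b3) \<oplus> (b2 \<ominus> b3)) = \<zero>" unfolding e1 e3 by simp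
  then have 23: "b2 = b3" using dbl[of "b2 \<ominus> b3"] dbl[of "(b2 \<ominus> b3) \<oplus> (b2 \<ominus> b3)"] cl eq_diff0 by simp
  have "\<ominus> (b4 \<oplus> b4) \<oplus> ((b3 \<oplus> b3) \<oplus> ((b3 \<oplus> b3) \<oplus> \<ominus> (b4 \<oplus> b4)))
      = ((b3 \<ominus> b4) \<oplus> (b3 \<ominus> b4)) \<oplus> ((b3 \<ominus> b4) \<oplus> (b3 \<ominus> b4))" using cl by algebra
  then have "((b3 \<ominus> b4) \<oplus> (b3 \<ominus> b4)) \<oplus> ((b3 \<ominus> b4) \<oplus> (b3 \<ominus> b4)) = \<zero>" using e2 unfolding 14 23 by simp
  then have 34: "b3 = b4" using dbl[of "b3 \<ominus> b4"] dbl[of "(b3 \<ominus> b4) \<oplus> (b3 \<ominus> b4)"] cl eq_diff0 by simp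
  have "\<ominus> b4 \<oplus> (\<ominus> b4 \<oplus> (\<ominus> b4 \<oplus> \<ominus> b4)) = (\<ominus> b4 \<oplus> \<ominus> b4) \<oplus> (\<ominus> b4 \<oplus> \<ominus> b4)" using cl by (simp add: a_assoc)
  then have "(\<ominus> b4 \<oplus> \<ominus> b4) \<oplus> (\<ominus> b4 \<oplus> \<ominus> b4) = \<zero>" using e4 unfolding 14 23 34 by simp
  then have "\<ominus> b4 = \<zero>" using dbl[of "\<ominus> b4"] dbl[of "\<ominus> b4 \<oplus> \<ominus> b4"] cl by simp
  then have b4: "b4 = \<zero>" using cl by (metis minus_minus minus_zero)
  then show ?thesis using e0 cl 14 23 34 by simp
qed

text \<open>The element \<xi> represents the reflection: passing \<open>w\<close> turns it into its
  negative, so conjugation by it sends the exponential of \<open>w\<close> to that of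
  \<open>- w\<close>. The scalars \<open>\<delta> r\<close> are fixed by \<sigma> and therefore
  central in \<open>T\<close>.\<close>

locale skew5_rep = skew5 + R: cring R for R :: "('r, 'k) ring_scheme" +
  fixes \<delta> \<xi>
  assumes \<delta>: "\<delta> \<in> ring_hom R B" and \<delta>_inj: "inj_on \<delta> (carrier R)"
    and \<sigma>\<delta> [simp]: "\<And>r. r \<in> carrier R \<Longrightarrow> \<sigma> (\<delta> r) = \<delta> r"
    and \<xi> [simp]: "\<xi> \<in> carrier B" and \<xi>\<xi>: "\<xi> \<otimes>\<^bsub>B\<^esub> \<xi> = \<one>\<^bsub>B\<^esub>" and \<sigma>\<xi> [simp]: "\<sigma> \<xi> = \<ominus>\<^bsub>B\<^esub> \<xi>"
begin

definition scal :: "'r \<Rightarrow> 'a \<times> 'a \<times> 'a \<times> 'a \<times> 'a" where "scal r = (\<delta> r, \<zero>\<^bsub>B\<^esub>, \<zero>\<^bsub>B\<^esub>, \<zero>\<^bsub>B\<^esub>, \<zero>\<^bsub>B\<^esub>)"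

definition refl :: "'a \<times> 'a \<times> 'a \<times> 'a \<times> 'a" where "refl = (\<xi>, \<zero>\<^bsub>B\<^esub>, \<zero>\<^bsub>B\<^esub>, \<zero>\<^bsub>B\<^esub>, \<zero>\<^bsub>B\<^esub>)"

lemma \<delta>_closed [simp]: "r \<in> carrier R \<Longrightarrow> \<delta> r \<in> carrier B"
  using \<delta> by (simp add: ring_hom_closed)

lemma exp_w_closed: "exp_w n \<in> carrier T"
  by (simp add: exp_w_def del: B.of_int_mult B.of_int_power B.of_int_minus)

lemma rep:
  assumes "cring F" "\<iota> \<in> ring_hom F R" "\<zeta> \<in> carrier R" "\<zeta> [^]\<^bsub>R\<^esub> (3::nat) = \<one>\<^bsub>R\<^esub>"
  shows "dihedral_rep F R T \<iota> \<zeta> scal (exp_w 1) refl"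
proof -
  interpret F: cring F by fact
  show ?thesis
  proof
    show "scal \<in> ring_hom R T"
      by (rule ring_hom_memI)
         (simp_all add: scal_def ring_hom_add[OF \<delta>] ring_hom_mult[OF \<delta>] ring_hom_one[OF \<delta>])
    fix l a assume "l \<in> carrier R" "a \<in> carrier T"
    then show "a \<otimes>\<^bsub>T\<^esub> scal l = scal l \<otimes>\<^bsub>T\<^esub> a"
      by (cases a) (simp add: scal_def B.m_comm)
  next
    show "exp_w 1 \<in> carrier T" by (rule exp_w_closed)
    show "refl \<in> carrier T" by (simp add: refl_def)
    show "exp_w 1 [^]\<^bsub>T\<^esub> (5::nat) = \<one>\<^bsub>T\<^esub>"
      unfolding exp_w_pow using exp_w_cong[of 5 0] by (simp add: exp_w_def)
    show "refl \<otimes>\<^bsub>T\<^esub> refl = \<one>\<^bsub>T\<^esub>" by (simp add: refl_def \<xi>\<xi>)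
    have "exp_w 1 [^]\<^bsub>T\<^esub> (4::nat) = exp_w (- 1)"
      unfolding exp_w_pow by (rule exp_w_cong) simp
    then show "refl \<otimes>\<^bsub>T\<^esub> exp_w 1 = exp_w 1 [^]\<^bsub>T\<^esub> (4::nat) \<otimes>\<^bsub>T\<^esub> refl"
      by (simp add: refl_def exp_w_def B.l_minus B.r_minus B.m_comm)
  qed (use assms in simp_all)
qed

text \<open>Put \<open>\<beta> j = a + b \<xi>\<close>, where \<open>a\<close> and \<open>b\<close>
  are the coefficients of \<open>y^j\<close> and \<open>y^j x\<close>. The five coefficients of the
  image are, up to unit factors, the power moments of \<beta>, so every \<open>\<beta> j\<close>
  vanishes.\<close>

lemma rep_kernel:
  assumes "cring F" "\<iota> \<in> ring_hom F R" "\<zeta> \<in> carrier R" "\<zeta> [^]\<^bsub>R\<^esub> (3::nat) = \<one>\<^bsub>R\<^esub>"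
    and f: "f \<in> carrier (group_algebra F C3D10)"
    and zero: "group_algebra_rep.lift C3D10 T (scal \<circ> \<iota>) (dihedral_rep.\<rho> R T \<zeta> scal (exp_w 1) refl) f = \<zero>\<^bsub>T\<^esub>"
    and j: "j \<in> {0, 1, 2, 3, 4}" and k: "k \<in> {0, 1}"
  shows "twist R \<iota> \<zeta> f j k = \<zero>\<^bsub>R\<^esub>"
proof -
  interpret F: cring F by fact
  interpret D: dihedral_rep F R T \<iota> \<zeta> scal "exp_w 1" refl using assms by (intro rep)
  define \<beta> where "\<beta> j = \<delta> (twist R \<iota> \<zeta> f j 0) \<oplus>\<^bsub>B\<^esub> \<delta> (twist R \<iota> \<zeta> f j 1) \<otimes>\<^bsub>B\<^esub> \<xi>" for j
  have tc: "twist R \<iota> \<zeta> f j k \<in> carrier R" if "j \<in> {0, 1, 2, 3, 4}" "k \<in> {0, 1}" for j k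
    using D.twist_closed[OF f that] .
  have \<beta>c: "\<beta> j \<in> carrier B" if "j \<in> {0, 1, 2, 3, 4}" for j
    unfolding \<beta>_def using tc[OF that, of 0] tc[OF that, of 1] by simp
  have term_j: "scal (twist R \<iota> \<zeta> f j 0) \<otimes>\<^bsub>T\<^esub> exp_w 1 [^]\<^bsub>T\<^esub> nat j \<oplus>\<^bsub>T\<^esub>
      scal (twist R \<iota> \<zeta> f j 1) \<otimes>\<^bsub>T\<^esub> (exp_w 1 [^]\<^bsub>T\<^esub> nat j \<otimes>\<^bsub>T\<^esub> refl) =
      (\<guillemotleft>1\<guillemotright>\<^bsub>B\<^esub> \<otimes>\<^bsub>B\<^esub> \<beta> j, \<guillemotleft>j\<guillemotright>\<^bsub>B\<^esub> \<otimes>\<^bsub>B\<^esub> \<beta> j, \<guillemotleft>3 * j ^ 2\<guillemotright>\<^bsub>B\<^esub> \<otimes>\<^bsub>B\<^esub> \<beta> j, \<guillemotleft>j ^ 3\<guillemotright>\<^bsub>B\<^esub> \<otimes>\<^bsub>B\<^esub> \<beta> j, \<guillemotleft>- (j ^ 4)\<guillemotright>\<^bsub>B\<^esub> \<otimes>\<^bsub>B\<^esub> \<beta> j)"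
    if j: "j \<in> {0, 1, 2, 3, 4}" for j
  proof -
    note c = tc[OF j, of 0, simplified] tc[OF j, of 1, simplified]
    have nj: "int (nat j) = j" using j by auto
    have dist: "\<delta> (twist R \<iota> \<zeta> f j 0) \<otimes>\<^bsub>B\<^esub> n \<oplus>\<^bsub>B\<^esub> \<delta> (twist R \<iota> \<zeta> f j 1) \<otimes>\<^bsub>B\<^esub> (n \<otimes>\<^bsub>B\<^esub> \<xi>) = n \<otimes>\<^bsub>B\<^esub> \<beta> j"
      if "n \<in> carrier B" for n
      unfolding \<beta>_def using that c by (simp add: B.r_distr B.m_ac)
    show ?thesis
      unfolding exp_w_pow nj using c
      by (simp add: scal_def exp_w_def refl_def dist del: B.of_int_mult B.of_int_power B.of_int_minus)
         (simp add: \<beta>_def)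
  qed
  have "D.rep.lift f = \<zero>\<^bsub>T\<^esub>" by (rule zero)
  then have sys: "\<guillemotleft>1\<guillemotright>\<^bsub>B\<^esub> \<otimes>\<^bsub>B\<^esub> \<beta> 0 \<oplus>\<^bsub>B\<^esub> (\<guillemotleft>1\<guillemotright>\<^bsub>B\<^esub> \<otimes>\<^bsub>B\<^esub> \<beta> 1 \<oplus>\<^bsub>B\<^esub> (\<guillemotleft>1\<guillemotright>\<^bsub>B\<^esub> \<otimes>\<^bsub>B\<^esub> \<beta> 2 \<oplus>\<^bsub>B\<^esub> (\<guillemotleft>1\<guillemotright>\<^bsub>B\<^esub> \<otimes>\<^bsub>B\<^esub> \<beta> 3 \<oplus>\<^bsub>B\<^esub> \<guillemotleft>1\<guillemotright>\<^bsub>B\<^esub> \<otimes>\<^bsub>B\<^esub> \<beta> 4))) = \<zero>\<^bsub>B\<^esub>"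
    "\<guillemotleft>0\<guillemotright>\<^bsub>B\<^esub> \<otimes>\<^bsub>B\<^esub> \<beta> 0 \<oplus>\<^bsub>B\<^esub> (\<guillemotleft>1\<guillemotright>\<^bsub>B\<^esub> \<otimes>\<^bsub>B\<^esub> \<beta> 1 \<oplus>\<^bsub>B\<^esub> (\<guillemotleft>2\<guillemotright>\<^bsub>B\<^esub> \<otimes>\<^bsub>B\<^esub> \<beta> 2 \<oplus>\<^bsub>B\<^esub> (\<guillemotleft>3\<guillemotright>\<^bsub>B\<^esub> \<otimes>\<^bsub>B\<^esub> \<beta> 3 \<oplus>\<^bsub>B\<^esub> \<guillemotleft>4\<guillemotright>\<^bsub>B\<^esub> \<otimes>\<^bsub>B\<^esub> \<beta> 4))) = \<zero>\<^bsub>B\<^esub>"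
    "\<guillemotleft>3 * 0 ^ 2\<guillemotright>\<^bsub>B\<^esub> \<otimes>\<^bsub>B\<^esub> \<beta> 0 \<oplus>\<^bsub>B\<^esub> (\<guillemotleft>3 * 1 ^ 2\<guillemotright>\<^bsub>B\<^esub> \<otimes>\<^bsub>B\<^esub> \<beta> 1 \<oplus>\<^bsub>B\<^esub> (\<guillemotleft>3 * 2 ^ 2\<guillemotright>\<^bsub>B\<^esub> \<otimes>\<^bsub>B\<^esub> \<beta> 2 \<oplus>\<^bsub>B\<^esub> (\<guillemotleft>3 * 3 ^ 2\<guillemotright>\<^bsub>B\<^esub> \<otimes>\<^bsub>B\<^esub> \<beta> 3 \<oplus>\<^bsub>B\<^esub> \<guillemotleft>3 * 4 ^ 2\<guillemotright>\<^bsub>B\<^esub> \<otimes>\<^bsub>B\<^esub> \<beta> 4))) = \<zero>\<^bsub>B\<^esub>"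
    "\<guillemotleft>0 ^ 3\<guillemotright>\<^bsub>B\<^esub> \<otimes>\<^bsub>B\<^esub> \<beta> 0 \<oplus>\<^bsub>B\<^esub> (\<guillemotleft>1 ^ 3\<guillemotright>\<^bsub>B\<^esub> \<otimes>\<^bsub>B\<^esub> \<beta> 1 \<oplus>\<^bsub>B\<^esub> (\<guillemotleft>2 ^ 3\<guillemotright>\<^bsub>B\<^esub> \<otimes>\<^bsub>B\<^esub> \<beta> 2 \<oplus>\<^bsub>B\<^esub> (\<guillemotleft>3 ^ 3\<guillemotright>\<^bsub>B\<^esub> \<otimes>\<^bsub>B\<^esub> \<beta> 3 \<oplus>\<^bsub>B\<^esub> \<guillemotleft>4 ^ 3\<guillemotright>\<^bsub>B\<^esub> \<otimes>\<^bsub>B\<^esub> \<beta> 4))) = \<zero>\<^bsub>B\<^esub>"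
    "\<guillemotleft>- (0 ^ 4)\<guillemotright>\<^bsub>B\<^esub> \<otimes>\<^bsub>B\<^esub> \<beta> 0 \<oplus>\<^bsub>B\<^esub> (\<guillemotleft>- (1 ^ 4)\<guillemotright>\<^bsub>B\<^esub> \<otimes>\<^bsub>B\<^esub> \<beta> 1 \<oplus>\<^bsub>B\<^esub> (\<guillemotleft>- (2 ^ 4)\<guillemotright>\<^bsub>B\<^esub> \<otimes>\<^bsub>B\<^esub> \<beta> 2 \<oplus>\<^bsub>B\<^esub> (\<guillemotleft>- (3 ^ 4)\<guillemotright>\<^bsub>B\<^esub> \<otimes>\<^bsub>B\<^esub> \<beta> 3 \<oplus>\<^bsub>B\<^esub> \<guillemotleft>- (4 ^ 4)\<guillemotright>\<^bsub>B\<^esub> \<otimes>\<^bsub>B\<^esub> \<beta> 4))) = \<zero>\<^bsub>B\<^esub>"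
    unfolding D.lift_eq_twist[OF f]
    using term_j[of 0] term_j[of 1] term_j[of 2] term_j[of 3] term_j[of 4]
    by (simp_all only: insert_iff simp_thms skew_ring_simps prod.inject)
  have b: "\<beta> 0 \<in> carrier B" "\<beta> 1 \<in> carrier B" "\<beta> 2 \<in> carrier B" "\<beta> 3 \<in> carrier B" "\<beta> 4 \<in> carrier B"
    by (simp_all add: \<beta>c)
  note m = B.of_int_mod5_cases[OF five]
  have "\<beta> 0 = \<zero>\<^bsub>B\<^esub> \<and> \<beta> 1 = \<zero>\<^bsub>B\<^esub> \<and> \<beta> 2 = \<zero>\<^bsub>B\<^esub> \<and> \<beta> 3 = \<zero>\<^bsub>B\<^esub> \<and> \<beta> 4 = \<zero>\<^bsub>B\<^esub>"
    using sys b by (intro B.moments_zero[OF five b])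
      (simp_all add: m del: B.of_int_mult B.of_int_power B.of_int_minus B.of_int_0 B.of_int_1)
  then have \<beta>j: "\<beta> j = \<zero>\<^bsub>B\<^esub>" using j by auto
  note c = tc[OF j, of 0, simplified] tc[OF j, of 1, simplified]
  let ?a = "\<delta> (twist R \<iota> \<zeta> f j 0)" and ?b = "\<delta> (twist R \<iota> \<zeta> f j 1)"
  \<comment> \<open>Applying \<sigma> changes the sign of \<xi> only, so \<open>a + b \<xi>\<close>
    and \<open>a - b \<xi>\<close> are both zero; 2 is invertible, which separates \<open>a\<close>
    from \<open>b\<close>.\<close>
  have "\<sigma> (\<beta> j) = \<zero>\<^bsub>B\<^esub>" unfolding \<beta>j by simp
  then have m1: "?a \<ominus>\<^bsub>B\<^esub> ?b \<otimes>\<^bsub>B\<^esub> \<xi> = \<zero>\<^bsub>B\<^esub>" unfolding \<beta>_def using c by (simp add: B.minus_eq B.r_minus)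
  have p1: "?a \<oplus>\<^bsub>B\<^esub> ?b \<otimes>\<^bsub>B\<^esub> \<xi> = \<zero>\<^bsub>B\<^esub>" using \<beta>j by (simp add: \<beta>_def)
  have "?a \<oplus>\<^bsub>B\<^esub> ?a = (?a \<ominus>\<^bsub>B\<^esub> ?b \<otimes>\<^bsub>B\<^esub> \<xi>) \<oplus>\<^bsub>B\<^esub> (?a \<oplus>\<^bsub>B\<^esub> ?b \<otimes>\<^bsub>B\<^esub> \<xi>)"
  proof -
    have "a \<oplus>\<^bsub>B\<^esub> a = (a \<ominus>\<^bsub>B\<^esub> t) \<oplus>\<^bsub>B\<^esub> (a \<oplus>\<^bsub>B\<^esub> t)" if "a \<in> carrier B" "t \<in> carrier B" for a t
      using that by algebra
    then show ?thesis using c by simp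
  qed
  then have "?a \<oplus>\<^bsub>B\<^esub> ?a = \<zero>\<^bsub>B\<^esub>" unfolding m1 p1 by simp
  then have a0: "?a = \<zero>\<^bsub>B\<^esub>" by (rule B.double_eq_zero[OF five \<delta>_closed[OF c(1)]])
  then have "?b \<otimes>\<^bsub>B\<^esub> \<xi> = \<zero>\<^bsub>B\<^esub>" using p1 c by simp
  then have "(?b \<otimes>\<^bsub>B\<^esub> \<xi>) \<otimes>\<^bsub>B\<^esub> \<xi> = \<zero>\<^bsub>B\<^esub>" by simp
  then have b0: "?b = \<zero>\<^bsub>B\<^esub>" using c by (simp add: B.m_assoc \<xi>\<xi>)
  have \<delta>0: "\<delta> \<zero>\<^bsub>R\<^esub> = \<zero>\<^bsub>B\<^esub>" using ring_hom_zero[OF \<delta> R.ring_axioms B.ring_axioms] .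
  have "\<delta> (twist R \<iota> \<zeta> f j k) = \<delta> \<zero>\<^bsub>R\<^esub>" using a0 b0 \<delta>0 k by auto
  then show ?thesis using inj_onD[OF \<delta>_inj _ tc[OF j k] R.zero_closed] by simp
qed

end

section \<open>One-units of the truncated skew polynomial ring\<close>

text \<open>The image of the section is a complement to the kernel. The index is counted by the
  factorisation of \<open>g\<close> as \<open>g c(\<pi> g)^(-1)\<close> times
  \<open>c(\<pi> g)\<close>.\<close>

lemma split_extension_iso_semidirect:
  assumes G: "group G" "finite (carrier G)" and Q: "group Q"
    and \<pi>: "\<pi> \<in> hom G Q" and c: "c \<in> hom Q G" and sec: "\<And>q. q \<in> carrier Q \<Longrightarrow> \<pi> (c q) = q"
  shows "iso_semidirect G (G\<lparr>carrier := {g \<in> carrier G. \<pi> g = \<one>\<^bsub>Q\<^esub>}\<rparr>) Q"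
proof -
  interpret G: group G by fact
  interpret Q: group Q by fact
  interpret p: group_hom G Q \<pi> using \<pi> by unfold_locales
  interpret c: group_hom Q G c using c by unfold_locales
  let ?N = "{g \<in> carrier G. \<pi> g = \<one>\<^bsub>Q\<^esub>}" and ?H = "c ` carrier Q"
  have N: "?N \<lhd> G" using p.normal_kernel by (simp add: kernel_def)
  have H: "subgroup ?H G" using c.img_is_subgroup .
  have NH: "?N \<inter> ?H \<subseteq> {\<one>\<^bsub>G\<^esub>}" using sec c.hom_one by auto
  have inj: "inj_on c (carrier Q)" by (rule inj_on_inverseI[where g = \<pi>]) (rule sec)
  have fQ: "finite (carrier Q)"
    using finite_imageD[OF finite_subset[OF _ G(2)] inj] c.hom_closed by blast
  have "bij_betw (\<lambda>g. (g \<otimes>\<^bsub>G\<^esub> inv\<^bsub>G\<^esub> c (\<pi> g), \<pi> g)) (carrier G) (?N \<times> carrier Q)"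
  proof (rule bij_betw_byWitness[where f' = "\<lambda>(n, q). n \<otimes>\<^bsub>G\<^esub> c q"])
    show "\<forall>g\<in>carrier G. (\<lambda>(n, q). n \<otimes>\<^bsub>G\<^esub> c q) (g \<otimes>\<^bsub>G\<^esub> inv\<^bsub>G\<^esub> c (\<pi> g), \<pi> g) = g"
      by (simp add: G.m_assoc)
    show "\<forall>a\<in>?N \<times> carrier Q. (\<lambda>g. (g \<otimes>\<^bsub>G\<^esub> inv\<^bsub>G\<^esub> c (\<pi> g), \<pi> g)) ((\<lambda>(n, q). n \<otimes>\<^bsub>G\<^esub> c q) a) = a"
      using sec by (auto simp: G.m_assoc)
    show "(\<lambda>g. (g \<otimes>\<^bsub>G\<^esub> inv\<^bsub>G\<^esub> c (\<pi> g), \<pi> g)) ` carrier G \<subseteq> ?N \<times> carrier Q"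
      using sec by auto
    show "(\<lambda>(n, q). n \<otimes>\<^bsub>G\<^esub> c q) ` (?N \<times> carrier Q) \<subseteq> carrier G" by auto
  qed
  then have "card (carrier G) = card (?N \<times> carrier Q)" by (rule bij_betw_same_card)
  then have card: "card (carrier G) = card ?N * card ?H"
    using card_image[OF inj] by (simp add: card_cartesian_product)
  have "c \<in> iso Q (G\<lparr>carrier := ?H\<rparr>)"
    using inj c by (auto simp: iso_def hom_def bij_betw_def)
  then have "Q \<cong> G\<lparr>carrier := ?H\<rparr>" by (rule is_isoI)
  then have iso: "G\<lparr>carrier := ?H\<rparr> \<cong> Q" by (rule Q.iso_sym)
  show ?thesis
    by (rule iso_semidirect_cong[OF G.iso_semidirect_internal[OF G(2) N H NH card] _ _ iso_refl iso])
       (use N H G(1) in \<open>simp_all add: normal_imp_subgroup subgroup.subgroup_is_group\<close>)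
qed

section \<open>Product rings and coordinates on the group of one-units\<close>

lemma RDirProd_simps [simp]:
  "carrier (RDirProd R S) = carrier R \<times> carrier S"
  "(a, b) \<otimes>\<^bsub>RDirProd R S\<^esub> (c, d) = (a \<otimes>\<^bsub>R\<^esub> c, b \<otimes>\<^bsub>S\<^esub> d)"
  "(a, b) \<oplus>\<^bsub>RDirProd R S\<^esub> (c, d) = (a \<oplus>\<^bsub>R\<^esub> c, b \<oplus>\<^bsub>S\<^esub> d)"
  "\<one>\<^bsub>RDirProd R S\<^esub> = (\<one>\<^bsub>R\<^esub>, \<one>\<^bsub>S\<^esub>)" "\<zero>\<^bsub>RDirProd R S\<^esub> = (\<zero>\<^bsub>R\<^esub>, \<zero>\<^bsub>S\<^esub>)"
  by (simp_all add: RDirProd_def DirProd_def monoid.defs)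

lemma RDirProd_cring:
  assumes "cring R" "cring S"
  shows "cring (RDirProd R S)"
proof -
  interpret R: cring R by fact
  interpret S: cring S by fact
  interpret P: ring "RDirProd R S" by (rule RDirProd_ring[OF R.ring_axioms S.ring_axioms])
  show ?thesis by unfold_locales (auto simp: R.m_comm S.m_comm)
qed

lemma units_of_RDirProd: "units_of (RDirProd R S) = units_of R \<times>\<times> units_of S"
proof -
  have "units_of (RDirProd R S) = units_of (R \<times>\<times> S)"
    by (simp add: units_of_def Units_def RDirProd_def monoid.defs)
  then show ?thesis by (simp add: units_of_DirProd)
qed

lemma RDirProd_of_int:
  assumes "ring R" "ring S"
  shows "\<guillemotleft>i\<guillemotright>\<^bsub>RDirProd R S\<^esub> = (\<guillemotleft>i\<guillemotright>\<^bsub>R\<^esub>, \<guillemotleft>i\<guillemotright>\<^bsub>S\<^esub>)"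
proof -
  have "fst \<in> ring_hom (RDirProd R S) R" "snd \<in> ring_hom (RDirProd R S) S"
    by (rule ring_hom_memI; auto)+
  then have "fst \<guillemotleft>i\<guillemotright>\<^bsub>RDirProd R S\<^esub> = \<guillemotleft>i\<guillemotright>\<^bsub>R\<^esub>" "snd \<guillemotleft>i\<guillemotright>\<^bsub>RDirProd R S\<^esub> = \<guillemotleft>i\<guillemotright>\<^bsub>S\<^esub>"
    using ring_hom_of_int[OF RDirProd_ring[OF assms]] assms by blast+
  then show ?thesis by (simp add: prod_eq_iff)
qed

lemma center_group_iff:
  "z \<in> carrier (center_group G) \<longleftrightarrow> z \<in> carrier G \<and> (\<forall>g\<in>carrier G. z \<otimes>\<^bsub>G\<^esub> g = g \<otimes>\<^bsub>G\<^esub> z)"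
  by (simp add: center_group_def)

text \<open>The structure of the one-units depends only on \<open>R\<close> being a finite
  commutative ring with \<open>5 = 0\<close>. The fields composing \<open>R\<close> matter later,
  for its Jacobson radical and its units.\<close>

locale char5 = R: cring R for R :: "('r, 'k) ring_scheme" +
  assumes five: "\<guillemotleft>5\<guillemotright>\<^bsub>R\<^esub> = \<zero>\<^bsub>R\<^esub>" and fin: "finite (carrier R)"
begin

abbreviation B :: "('r \<times> 'r) ring" where "B \<equiv> RDirProd R R"

lemma B_five: "\<guillemotleft>5\<guillemotright>\<^bsub>B\<^esub> = \<zero>\<^bsub>B\<^esub>"
  using five by (simp add: RDirProd_of_int R.ring_axioms)

sublocale B: skew5 B prod.swap
proof -
  interpret B: cring B by (rule RDirProd_cring) (rule R.cring_axioms)+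
  show "skew5 B prod.swap"
  proof
    show "prod.swap \<in> ring_hom B B" by (rule ring_hom_memI) auto
  qed (auto simp: B_five)
qed

abbreviation T where "T \<equiv> skew_ring B prod.swap"

text \<open>The one-units of \<open>T\<close>; under the isomorphism from the group algebra this is
  the image of \<open>V\<close>.\<close>

definition W :: "(('r \<times> 'r) \<times> ('r \<times> 'r) \<times> ('r \<times> 'r) \<times> ('r \<times> 'r) \<times> ('r \<times> 'r)) monoid" where
  "W = \<lparr>carrier = {u \<in> carrier T. fst u = \<one>\<^bsub>B\<^esub>}, monoid.mult = monoid.mult T, one = \<one>\<^bsub>T\<^esub>\<rparr>"

lemma W_eq: "W = (units_of T)\<lparr>carrier := {u \<in> carrier T. fst u = \<one>\<^bsub>B\<^esub>}\<rparr>"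
  by (simp add: W_def units_of_def)

text \<open>The pair \<open>(a\<^sub>i, b\<^sub>i)\<close> is the coefficient of \<open>w\<^sup>i\<close>.\<close>

definition wvec where
  "wvec a1 b1 a2 b2 a3 b3 a4 b4 = ((\<one>\<^bsub>R\<^esub>, \<one>\<^bsub>R\<^esub>), (a1, b1), (a2, b2), (a3, b3), (a4, b4))"

lemma wvec_in [simp]:
  "wvec a1 b1 a2 b2 a3 b3 a4 b4 \<in> carrier W \<longleftrightarrow> a1 \<in> carrier R \<and> b1 \<in> carrier R \<and> a2 \<in> carrier R \<and> b2 \<in> carrier R \<and>
     a3 \<in> carrier R \<and> b3 \<in> carrier R \<and> a4 \<in> carrier R \<and> b4 \<in> carrier R"
  by (auto simp: W_def wvec_def)

lemma wvec_eq_iff [simp]: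
  "wvec a1 b1 a2 b2 a3 b3 a4 b4 = wvec c1 d1 c2 d2 c3 d3 c4 d4 \<longleftrightarrow>
     a1 = c1 \<and> b1 = d1 \<and> a2 = c2 \<and> b2 = d2 \<and> a3 = c3 \<and> b3 = d3 \<and> a4 = c4 \<and> b4 = d4"
  by (auto simp: wvec_def)

lemma W_cases:
  assumes "u \<in> carrier W"
  obtains a1 b1 a2 b2 a3 b3 a4 b4 where "u = wvec a1 b1 a2 b2 a3 b3 a4 b4"
    "a1 \<in> carrier R" "b1 \<in> carrier R" "a2 \<in> carrier R" "b2 \<in> carrier R"
    "a3 \<in> carrier R" "b3 \<in> carrier R" "a4 \<in> carrier R" "b4 \<in> carrier R"
proof -
  obtain r0 r1 r2 r3 r4 where u: "u = (r0, r1, r2, r3, r4)" by (cases u) auto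
  then have "u = wvec (fst r1) (snd r1) (fst r2) (snd r2) (fst r3) (snd r3) (fst r4) (snd r4)"
    "fst r1 \<in> carrier R" "snd r1 \<in> carrier R" "fst r2 \<in> carrier R" "snd r2 \<in> carrier R"
    "fst r3 \<in> carrier R" "snd r3 \<in> carrier R" "fst r4 \<in> carrier R" "snd r4 \<in> carrier R"
    using assms by (auto simp: W_def wvec_def)
  then show ?thesis by (rule that)
qed

lemma wvec_mult [simp]:
  assumes "a1 \<in> carrier R" "b1 \<in> carrier R" "a2 \<in> carrier R" "b2 \<in> carrier R"
    "a3 \<in> carrier R" "b3 \<in> carrier R" "a4 \<in> carrier R" "b4 \<in> carrier R"
    "c1 \<in> carrier R" "d1 \<in> carrier R" "c2 \<in> carrier R" "d2 \<in> carrier R"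
    "c3 \<in> carrier R" "d3 \<in> carrier R" "c4 \<in> carrier R" "d4 \<in> carrier R"
  shows "wvec a1 b1 a2 b2 a3 b3 a4 b4 \<otimes>\<^bsub>W\<^esub> wvec c1 d1 c2 d2 c3 d3 c4 d4 =
    wvec (c1 \<oplus>\<^bsub>R\<^esub> a1) (d1 \<oplus>\<^bsub>R\<^esub> b1)
      (c2 \<oplus>\<^bsub>R\<^esub> (b1 \<otimes>\<^bsub>R\<^esub> c1 \<oplus>\<^bsub>R\<^esub> a2)) (d2 \<oplus>\<^bsub>R\<^esub> (a1 \<otimes>\<^bsub>R\<^esub> d1 \<oplus>\<^bsub>R\<^esub> b2))
      (c3 \<oplus>\<^bsub>R\<^esub> (a1 \<otimes>\<^bsub>R\<^esub> c2 \<oplus>\<^bsub>R\<^esub> (b2 \<otimes>\<^bsub>R\<^esub> c1 \<oplus>\<^bsub>R\<^esub> a3))) (d3 \<oplus>\<^bsub>R\<^esub> (b1 \<otimes>\<^bsub>R\<^esub> d2 \<oplus>\<^bsub>R\<^esub> (a2 \<otimes>\<^bsub>R\<^esub> d1 \<oplus>\<^bsub>R\<^esub> b3)))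
      (c4 \<oplus>\<^bsub>R\<^esub> (b1 \<otimes>\<^bsub>R\<^esub> c3 \<oplus>\<^bsub>R\<^esub> (a2 \<otimes>\<^bsub>R\<^esub> c2 \<oplus>\<^bsub>R\<^esub> (b3 \<otimes>\<^bsub>R\<^esub> c1 \<oplus>\<^bsub>R\<^esub> a4))))
      (d4 \<oplus>\<^bsub>R\<^esub> (a1 \<otimes>\<^bsub>R\<^esub> d3 \<oplus>\<^bsub>R\<^esub> (b2 \<otimes>\<^bsub>R\<^esub> d2 \<oplus>\<^bsub>R\<^esub> (a3 \<otimes>\<^bsub>R\<^esub> d1 \<oplus>\<^bsub>R\<^esub> b4))))"
  using assms by (simp add: W_def wvec_def)

lemma W_one: "\<one>\<^bsub>W\<^esub> = wvec \<zero>\<^bsub>R\<^esub> \<zero>\<^bsub>R\<^esub> \<zero>\<^bsub>R\<^esub> \<zero>\<^bsub>R\<^esub> \<zero>\<^bsub>R\<^esub> \<zero>\<^bsub>R\<^esub> \<zero>\<^bsub>R\<^esub> \<zero>\<^bsub>R\<^esub>"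
  by (simp add: W_def wvec_def)

lemma W_group: "group W"
proof (rule groupI)
  fix u assume u: "u \<in> carrier W"
  then have u': "u \<in> carrier T" "fst u = \<one>\<^bsub>B\<^esub>" by (auto simp: W_def)
  obtain v where v: "v \<in> carrier T" "fst v = \<one>\<^bsub>B\<^esub>" "u \<otimes>\<^bsub>T\<^esub> v = \<one>\<^bsub>T\<^esub>" using B.right_inverse[OF u'] by blast
  obtain w where w: "w \<in> carrier T" "v \<otimes>\<^bsub>T\<^esub> w = \<one>\<^bsub>T\<^esub>" using B.right_inverse[OF v(1,2)] by blast
  have "u = w" using B.T.inv_unique[of u v w] u' v w by simp
  then have "v \<otimes>\<^bsub>W\<^esub> u = \<one>\<^bsub>W\<^esub>" using w(2) by (simp add: W_def del: skew_ring_simps)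
  moreover have "v \<in> carrier W" using v by (simp add: W_def)
  ultimately show "\<exists>v\<in>carrier W. v \<otimes>\<^bsub>W\<^esub> u = \<one>\<^bsub>W\<^esub>" by blast
next
  fix u v w assume "u \<in> carrier W" "v \<in> carrier W" "w \<in> carrier W"
  then show "u \<otimes>\<^bsub>W\<^esub> v \<otimes>\<^bsub>W\<^esub> w = u \<otimes>\<^bsub>W\<^esub> (v \<otimes>\<^bsub>W\<^esub> w)"
    using B.T.m_assoc[of u v w] by (simp add: W_def del: skew_ring_simps)
next
  fix u v assume "u \<in> carrier W" "v \<in> carrier W"
  then show "u \<otimes>\<^bsub>W\<^esub> v \<in> carrier W" by (elim W_cases) simp
next
  fix u assume "u \<in> carrier W"
  then show "\<one>\<^bsub>W\<^esub> \<otimes>\<^bsub>W\<^esub> u = u" by (elim W_cases) (simp add: W_one)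
qed (simp add: W_one)

lemma T_finite: "finite (carrier T)"
  using fin by simp

lemma W_finite: "finite (carrier W)"
  using T_finite by (simp add: W_def)

text \<open>Taking the constant term maps the units of \<open>T\<close> to those of
  \<open>B\<close>, the constants are a section, and the kernel is all of \<open>W\<close> because
  every one-unit is invertible.\<close>

lemma units_T_iso_semidirect: "iso_semidirect (units_of T) W (units_of R \<times>\<times> units_of R)"
proof -
  have UT: "Units T \<subseteq> carrier T" by (auto simp: Units_def)
  have p: "fst u \<in> Units B" if "u \<in> Units T" for u
  proof -
    obtain v where v: "v \<in> carrier T" "v \<otimes>\<^bsub>T\<^esub> u = \<one>\<^bsub>T\<^esub>" "u \<otimes>\<^bsub>T\<^esub> v = \<one>\<^bsub>T\<^esub>" "u \<in> carrier T"
      using \<open>u \<in> Units T\<close> unfolding Units_def by blast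
    have "fst v \<otimes>\<^bsub>B\<^esub> fst u = \<one>\<^bsub>B\<^esub>" "fst u \<otimes>\<^bsub>B\<^esub> fst v = \<one>\<^bsub>B\<^esub>"
      using ring_hom_mult[OF B.proj_hom v(1,4)] ring_hom_mult[OF B.proj_hom v(4,1)] ring_hom_one[OF B.proj_hom] v(2,3) by simp_all
    then show ?thesis unfolding Units_def
      using ring_hom_closed[OF B.proj_hom v(1)] ring_hom_closed[OF B.proj_hom v(4)] by blast
  qed
  let ?c = "\<lambda>b. (b, \<zero>\<^bsub>B\<^esub>, \<zero>\<^bsub>B\<^esub>, \<zero>\<^bsub>B\<^esub>, \<zero>\<^bsub>B\<^esub>)"
  have c: "?c b \<in> Units T" if "b \<in> Units B" for b
  proof -
    obtain d where d: "d \<in> carrier B" "d \<otimes>\<^bsub>B\<^esub> b = \<one>\<^bsub>B\<^esub>" "b \<otimes>\<^bsub>B\<^esub> d = \<one>\<^bsub>B\<^esub>" "b \<in> carrier B"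
      using \<open>b \<in> Units B\<close> unfolding Units_def by blast
    have "?c d \<otimes>\<^bsub>T\<^esub> ?c b = \<one>\<^bsub>T\<^esub>" "?c b \<otimes>\<^bsub>T\<^esub> ?c d = \<one>\<^bsub>T\<^esub>"
      using ring_hom_mult[OF B.const_hom d(1,4)] ring_hom_mult[OF B.const_hom d(4,1)] ring_hom_one[OF B.const_hom] d(2,3)
      by (simp_all del: skew_ring_simps RDirProd_simps)
    then show ?thesis unfolding Units_def
      using ring_hom_closed[OF B.const_hom d(1)] ring_hom_closed[OF B.const_hom d(4)] by blast
  qed
  have ker: "{u \<in> Units T. fst u = \<one>\<^bsub>B\<^esub>} = {u \<in> carrier T. fst u = \<one>\<^bsub>B\<^esub>}"
    using UT B.unipotent_unit by blast
  have "iso_semidirect (units_of T) ((units_of T)\<lparr>carrier := {u \<in> carrier (units_of T). fst u = \<one>\<^bsub>units_of B\<^esub>}\<rparr>) (units_of B)"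
  proof (rule split_extension_iso_semidirect[where c = ?c])
    show "finite (carrier (units_of T))" using finite_subset[OF UT T_finite] by (simp add: units_of_def)
    show "fst \<in> hom (units_of T) (units_of B)"
    proof (rule homI)
      fix x y assume "x \<in> carrier (units_of T)" "y \<in> carrier (units_of T)"
      then have xy: "x \<in> Units T" "y \<in> Units T" by (simp_all add: units_of_def)
      then have "x \<in> carrier T" "y \<in> carrier T" unfolding Units_def by blast+
      from ring_hom_mult[OF B.proj_hom this]
      show "fst (x \<otimes>\<^bsub>units_of T\<^esub> y) = fst x \<otimes>\<^bsub>units_of B\<^esub> fst y"
        by (simp add: units_of_def del: skew_ring_simps RDirProd_simps)
      show "fst x \<in> carrier (units_of B)" using p[OF xy(1)] by (simp add: units_of_def)
    qed
    show "?c \<in> hom (units_of B) (units_of T)"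
    proof (rule homI)
      fix x y assume "x \<in> carrier (units_of B)" "y \<in> carrier (units_of B)"
      then have xy: "x \<in> Units B" "y \<in> Units B" by (simp_all add: units_of_def)
      then have "x \<in> carrier B" "y \<in> carrier B" unfolding Units_def by blast+
      from ring_hom_mult[OF B.const_hom this]
      show "?c (x \<otimes>\<^bsub>units_of B\<^esub> y) = ?c x \<otimes>\<^bsub>units_of T\<^esub> ?c y" by (simp add: units_of_def del: skew_ring_simps RDirProd_simps)
      show "?c x \<in> carrier (units_of T)" using c[OF xy(1)] by (simp add: units_of_def)
    qed
  qed (simp_all add: B.T.units_group B.B.units_group)
  moreover have "{u \<in> carrier (units_of T). fst u = \<one>\<^bsub>units_of B\<^esub>} = {u \<in> carrier T. fst u = \<one>\<^bsub>B\<^esub>}"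
    using ker by (simp only: units_of_carrier units_of_one)
  ultimately show ?thesis by (simp only: W_eq units_of_RDirProd)
qed

text \<open>The coefficient of \<open>w\<close> is additive on one-units, so its first component
  \<open>a1\<close> is a homomorphism, and \<open>N\<close> is the kernel.\<close>

definition N where "N = W\<lparr>carrier := {u \<in> carrier W. fst (fst (snd u)) = \<zero>\<^bsub>R\<^esub>}\<rparr>"

text \<open>Once \<open>a1 = 0\<close>, the cross term in the second component of degree 2 is gone
  and \<open>(b1, b2)\<close> is additive as well. Five coordinates remain in the kernel of this
  homomorphism.\<close>

definition N5 where
  "N5 = N\<lparr>carrier := {u \<in> carrier N. (snd (fst (snd u)), snd (fst (snd (snd u)))) = (\<zero>\<^bsub>R\<^esub>, \<zero>\<^bsub>R\<^esub>)}\<rparr>"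

lemma wvec_sel [simp]:
  "fst (fst (snd (wvec a1 b1 a2 b2 a3 b3 a4 b4))) = a1" "snd (fst (snd (wvec a1 b1 a2 b2 a3 b3 a4 b4))) = b1"
  "fst (fst (snd (snd (wvec a1 b1 a2 b2 a3 b3 a4 b4)))) = a2" "snd (fst (snd (snd (wvec a1 b1 a2 b2 a3 b3 a4 b4)))) = b2"
  by (simp_all add: wvec_def)

lemma group_add_R: "group (add_monoid R)" and group_add_B: "group (add_monoid B)"
  using R.a_group B.B.a_group by auto

lemma W_hom: "(\<lambda>u. fst (fst (snd u))) \<in> hom W (add_monoid R)"
proof (rule homI)
  fix u v assume "u \<in> carrier W" "v \<in> carrier W"
  then show "fst (fst (snd (u \<otimes>\<^bsub>W\<^esub> v))) = fst (fst (snd u)) \<otimes>\<^bsub>add_monoid R\<^esub> fst (fst (snd v))"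
    by (elim W_cases) (simp add: R.a_comm)
next
  fix u assume "u \<in> carrier W"
  then show "fst (fst (snd u)) \<in> carrier (add_monoid R)" by (elim W_cases) simp
qed

lemma W_iso_semidirect: "iso_semidirect W N (add_monoid R)"
proof -
  have "iso_semidirect W (W\<lparr>carrier := {u \<in> carrier W. fst (fst (snd u)) = \<one>\<^bsub>add_monoid R\<^esub>}\<rparr>) (add_monoid R)"
  proof (rule split_extension_iso_semidirect[OF W_group W_finite group_add_R W_hom])
    \<comment> \<open>The section is \<open>1 + w (a, 0)\<close>. It is additive in
      \<open>a\<close>, because passing \<open>w\<close> moves \<open>a\<close> to the other factor
      of \<open>B\<close> and \<open>(0, a) (c, 0) = 0\<close>.\<close>
    let ?c = "\<lambda>a. wvec a \<zero>\<^bsub>R\<^esub> \<zero>\<^bsub>R\<^esub> \<zero>\<^bsub>R\<^esub> \<zero>\<^bsub>R\<^esub> \<zero>\<^bsub>R\<^esub> \<zero>\<^bsub>R\<^esub> \<zero>\<^bsub>R\<^esub>"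
    show "?c \<in> hom (add_monoid R) W"
      by (rule homI) (simp_all add: R.a_comm)
    show "fst (fst (snd (?c a))) = a" if "a \<in> carrier (add_monoid R)" for a by simp
  qed
  then show ?thesis by (simp add: N_def)
qed

lemma N_cases:
  assumes "u \<in> carrier N"
  obtains b1 a2 b2 a3 b3 a4 b4 where "u = wvec \<zero>\<^bsub>R\<^esub> b1 a2 b2 a3 b3 a4 b4"
    "b1 \<in> carrier R" "a2 \<in> carrier R" "b2 \<in> carrier R"
    "a3 \<in> carrier R" "b3 \<in> carrier R" "a4 \<in> carrier R" "b4 \<in> carrier R"
proof -
  have u: "u \<in> carrier W" "fst (fst (snd u)) = \<zero>\<^bsub>R\<^esub>" using assms by (simp_all add: N_def)
  from u(1) obtain a1 b1 a2 b2 a3 b3 a4 b4 where e: "u = wvec a1 b1 a2 b2 a3 b3 a4 b4"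
    and cl: "b1 \<in> carrier R" "a2 \<in> carrier R" "b2 \<in> carrier R"
    "a3 \<in> carrier R" "b3 \<in> carrier R" "a4 \<in> carrier R" "b4 \<in> carrier R" by (rule W_cases)
  have "u = wvec \<zero>\<^bsub>R\<^esub> b1 a2 b2 a3 b3 a4 b4" using e u(2) by simp
  then show ?thesis using cl by (rule that)
qed

lemma N_mult [simp]: "u \<otimes>\<^bsub>N\<^esub> v = u \<otimes>\<^bsub>W\<^esub> v" and N5_mult [simp]: "u \<otimes>\<^bsub>N5\<^esub> v = u \<otimes>\<^bsub>W\<^esub> v"
  and N_one: "\<one>\<^bsub>N\<^esub> = \<one>\<^bsub>W\<^esub>" and N5_one: "\<one>\<^bsub>N5\<^esub> = \<one>\<^bsub>W\<^esub>"
  by (simp_all add: N_def N5_def)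

lemma N_in [simp]: "wvec a1 b1 a2 b2 a3 b3 a4 b4 \<in> carrier N \<longleftrightarrow> a1 = \<zero>\<^bsub>R\<^esub> \<and> wvec a1 b1 a2 b2 a3 b3 a4 b4 \<in> carrier W"
  by (auto simp: N_def)

lemma N_group: "group N"
proof -
  interpret group_hom W "add_monoid R" "\<lambda>u. fst (fst (snd u))"
    using W_group group_add_R W_hom by (simp add: group_hom_def group_hom_axioms_def)
  show ?thesis
    using subgroup.subgroup_is_group[OF subgroup_kernel W_group] by (simp add: kernel_def N_def)
qed

lemma N_finite: "finite (carrier N)"
  using W_finite by (simp add: N_def)

lemma N_hom: "(\<lambda>u. (snd (fst (snd u)), snd (fst (snd (snd u))))) \<in> hom N (add_monoid B)"
proof (rule homI)
  fix u v assume "u \<in> carrier N" "v \<in> carrier N"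
  then show "(snd (fst (snd (u \<otimes>\<^bsub>N\<^esub> v))), snd (fst (snd (snd (u \<otimes>\<^bsub>N\<^esub> v))))) =
      (snd (fst (snd u)), snd (fst (snd (snd u)))) \<otimes>\<^bsub>add_monoid B\<^esub> (snd (fst (snd v)), snd (fst (snd (snd v))))"
    by (elim N_cases) (simp add: R.a_comm)
next
  fix u assume "u \<in> carrier N"
  then show "(snd (fst (snd u)), snd (fst (snd (snd u)))) \<in> carrier (add_monoid B)" by (elim N_cases) simp
qed

text \<open>The section is \<open>(b, \<alpha>) \<mapsto> (1 + w b) exp (w\<^sup>2 \<alpha>)\<close>; note \<open>1/2 = 3\<close>.\<close>

lemma N_iso_semidirect: "iso_semidirect N N5 (add_monoid B)"
proof -
  define h where "h t = \<guillemotleft>3\<guillemotright>\<^bsub>R\<^esub> \<otimes>\<^bsub>R\<^esub> (t \<otimes>\<^bsub>R\<^esub> t)" for t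
  have hc [simp]: "h t \<in> carrier R" if "t \<in> carrier R" for t using that by (simp add: h_def)
  have h_add: "h (a \<oplus>\<^bsub>R\<^esub> b) = h b \<oplus>\<^bsub>R\<^esub> (a \<otimes>\<^bsub>R\<^esub> b \<oplus>\<^bsub>R\<^esub> h a)" if ab: "a \<in> carrier R" "b \<in> carrier R" for a b
  proof -
    let ?t = "a \<otimes>\<^bsub>R\<^esub> b"
    have t: "?t \<in> carrier R" using ab by simp
    \<comment> \<open>Here \<open>6 = 1\<close> turns the mixed term of \<open>3 (a + b)^2\<close>
      into \<open>a b\<close>.\<close>
    have "\<guillemotleft>3\<guillemotright>\<^bsub>R\<^esub> \<otimes>\<^bsub>R\<^esub> (?t \<oplus>\<^bsub>R\<^esub> ?t) = \<guillemotleft>6\<guillemotright>\<^bsub>R\<^esub> \<otimes>\<^bsub>R\<^esub> ?t"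
      using R.of_int_comb(2)[OF t, of 3 2] t by (simp add: R.mult2)
    then have e: "\<guillemotleft>3\<guillemotright>\<^bsub>R\<^esub> \<otimes>\<^bsub>R\<^esub> (?t \<oplus>\<^bsub>R\<^esub> ?t) = ?t" using R.of_int_mod5_cases(2)[OF five t, of 6] by simp
    have "h (a \<oplus>\<^bsub>R\<^esub> b) = h b \<oplus>\<^bsub>R\<^esub> (\<guillemotleft>3\<guillemotright>\<^bsub>R\<^esub> \<otimes>\<^bsub>R\<^esub> (?t \<oplus>\<^bsub>R\<^esub> ?t) \<oplus>\<^bsub>R\<^esub> h a)"
      unfolding h_def using ab by (simp add: R.l_distr R.r_distr R.a_ac R.m_ac)
    then show ?thesis unfolding e .
  qed
  \<comment> \<open>Equal entries \<alpha> are fixed by the swap, so \<open>w^2 \<alpha>\<close> is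
    central. Its exponential commutes with \<open>1 + w b\<close>, which makes the product of the
    two factors a homomorphism in \<open>(b, \<alpha>)\<close>.\<close>
  let ?c = "\<lambda>(b, \<alpha>). wvec \<zero>\<^bsub>R\<^esub> b \<alpha> \<alpha> \<zero>\<^bsub>R\<^esub> (b \<otimes>\<^bsub>R\<^esub> \<alpha>) (h \<alpha>) (h \<alpha>)"
  have "iso_semidirect N (N\<lparr>carrier := {u \<in> carrier N. (snd (fst (snd u)), snd (fst (snd (snd u)))) = \<one>\<^bsub>add_monoid B\<^esub>}\<rparr>) (add_monoid B)"
  proof (rule split_extension_iso_semidirect[OF N_group N_finite group_add_B N_hom])
    show "?c \<in> hom (add_monoid B) N"
    proof (rule homI)
      fix u v assume "u \<in> carrier (add_monoid B)" "v \<in> carrier (add_monoid B)"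
      then obtain a b c d where uv: "u = (a, b)" "v = (c, d)"
        and cl: "a \<in> carrier R" "b \<in> carrier R" "c \<in> carrier R" "d \<in> carrier R" by auto
      show "?c u \<in> carrier N" using uv cl by simp
      have "(a \<oplus>\<^bsub>R\<^esub> c) \<otimes>\<^bsub>R\<^esub> (b \<oplus>\<^bsub>R\<^esub> d) = c \<otimes>\<^bsub>R\<^esub> d \<oplus>\<^bsub>R\<^esub> (a \<otimes>\<^bsub>R\<^esub> d \<oplus>\<^bsub>R\<^esub> (b \<otimes>\<^bsub>R\<^esub> c \<oplus>\<^bsub>R\<^esub> a \<otimes>\<^bsub>R\<^esub> b))"
        using cl by algebra
      then show "?c (u \<otimes>\<^bsub>add_monoid B\<^esub> v) = ?c u \<otimes>\<^bsub>N\<^esub> ?c v"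
        using uv cl by (simp add: h_add R.a_comm)
    qed
    fix q assume "q \<in> carrier (add_monoid B)"
    then show "(snd (fst (snd (?c q))), snd (fst (snd (snd (?c q))))) = q" by (cases q) simp
  qed
  then show ?thesis by (simp add: N5_def)
qed

lemma N5_group: "group N5"
proof -
  interpret group_hom N "add_monoid B" "\<lambda>u. (snd (fst (snd u)), snd (fst (snd (snd u))))"
    using N_group group_add_B N_hom by (simp add: group_hom_def group_hom_axioms_def)
  show ?thesis
    using subgroup.subgroup_is_group[OF subgroup_kernel N_group] by (simp add: kernel_def N5_def)
qed

lemma N5_carrier: "carrier N5 = (\<lambda>(a2, a3, b3, a4, b4). wvec \<zero>\<^bsub>R\<^esub> \<zero>\<^bsub>R\<^esub> a2 \<zero>\<^bsub>R\<^esub> a3 b3 a4 b4) `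
    (carrier R \<times> carrier R \<times> carrier R \<times> carrier R \<times> carrier R)" (is "_ = ?f ` ?X")
proof (intro equalityI subsetI)
  fix u assume "u \<in> carrier N5"
  then have u: "u \<in> carrier N" "snd (fst (snd u)) = \<zero>\<^bsub>R\<^esub>" "snd (fst (snd (snd u))) = \<zero>\<^bsub>R\<^esub>" by (simp_all add: N5_def)
  from u(1) obtain b1 a2 b2 a3 b3 a4 b4 where e: "u = wvec \<zero>\<^bsub>R\<^esub> b1 a2 b2 a3 b3 a4 b4"
    and cl: "b1 \<in> carrier R" "a2 \<in> carrier R" "b2 \<in> carrier R"
    "a3 \<in> carrier R" "b3 \<in> carrier R" "a4 \<in> carrier R" "b4 \<in> carrier R" by (rule N_cases)
  show "u \<in> ?f ` ?X" using u(2,3) cl unfolding e by (intro image_eqI[of _ _ "(a2, a3, b3, a4, b4)"]) simp_all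
qed (auto simp: N5_def)

text \<open>Without a linear term the only product that survives truncation is the square of the
  degree 2 coefficient, in degree 4. It occurs with the binomial factor
  \<open>n (n - 1) / 2\<close>, written as the sum of all \<open>i < n\<close>.\<close>

lemma abelian_part_pow:
  assumes "a2 \<in> carrier R" "b2 \<in> carrier R" "a3 \<in> carrier R" "b3 \<in> carrier R" "a4 \<in> carrier R" "b4 \<in> carrier R"
  shows "wvec \<zero>\<^bsub>R\<^esub> \<zero>\<^bsub>R\<^esub> a2 b2 a3 b3 a4 b4 [^]\<^bsub>W\<^esub> (n::nat) =
    wvec \<zero>\<^bsub>R\<^esub> \<zero>\<^bsub>R\<^esub> (\<guillemotleft>int n\<guillemotright>\<^bsub>R\<^esub> \<otimes>\<^bsub>R\<^esub> a2) (\<guillemotleft>int n\<guillemotright>\<^bsub>R\<^esub> \<otimes>\<^bsub>R\<^esub> b2) (\<guillemotleft>int n\<guillemotright>\<^bsub>R\<^esub> \<otimes>\<^bsub>R\<^esub> a3) (\<guillemotleft>int n\<guillemotright>\<^bsub>R\<^esub> \<otimes>\<^bsub>R\<^esub> b3)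
      (\<guillemotleft>int n\<guillemotright>\<^bsub>R\<^esub> \<otimes>\<^bsub>R\<^esub> a4 \<oplus>\<^bsub>R\<^esub> \<guillemotleft>\<Sum>i<n. int i\<guillemotright>\<^bsub>R\<^esub> \<otimes>\<^bsub>R\<^esub> (a2 \<otimes>\<^bsub>R\<^esub> a2)) (\<guillemotleft>int n\<guillemotright>\<^bsub>R\<^esub> \<otimes>\<^bsub>R\<^esub> b4 \<oplus>\<^bsub>R\<^esub> \<guillemotleft>\<Sum>i<n. int i\<guillemotright>\<^bsub>R\<^esub> \<otimes>\<^bsub>R\<^esub> (b2 \<otimes>\<^bsub>R\<^esub> b2))"
proof -
  interpret W: group W by (rule W_group)
  show ?thesis
  proof (induction n)
    case 0
    then show ?case using assms by (simp add: W_one)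
  next
    case (Suc n)
    have "\<guillemotleft>int (Suc n)\<guillemotright>\<^bsub>R\<^esub> = \<one>\<^bsub>R\<^esub> \<oplus>\<^bsub>R\<^esub> \<guillemotleft>int n\<guillemotright>\<^bsub>R\<^esub>" using R.of_int_add[of 1 "int n"] by simp
    moreover have "\<guillemotleft>\<Sum>i<Suc n. int i\<guillemotright>\<^bsub>R\<^esub> = \<guillemotleft>\<Sum>i<n. int i\<guillemotright>\<^bsub>R\<^esub> \<oplus>\<^bsub>R\<^esub> \<guillemotleft>int n\<guillemotright>\<^bsub>R\<^esub>" by simp
    ultimately show ?case
      using assms unfolding W.nat_pow_Suc Suc by (simp add: R.l_distr R.a_ac R.m_assoc)
  qed
qed

text \<open>Both multipliers for \<open>n = 5\<close>, namely 5 and 10, vanish in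
  \<open>R\<close>.\<close>

lemma abelian_part_pow5:
  assumes "a2 \<in> carrier R" "b2 \<in> carrier R" "a3 \<in> carrier R" "b3 \<in> carrier R" "a4 \<in> carrier R" "b4 \<in> carrier R"
  shows "wvec \<zero>\<^bsub>R\<^esub> \<zero>\<^bsub>R\<^esub> a2 b2 a3 b3 a4 b4 [^]\<^bsub>W\<^esub> (5::nat) = \<one>\<^bsub>W\<^esub>"
proof -
  have "(\<Sum>i<5. int i) = 10" by (simp add: eval_nat_numeral)
  then have "\<guillemotleft>\<Sum>i<5. int i\<guillemotright>\<^bsub>R\<^esub> = \<zero>\<^bsub>R\<^esub>" using R.of_int_cong5[OF five, of 10 0] by simp
  then show ?thesis unfolding abelian_part_pow[OF assms] W_one using assms five by simp
qed

lemma five_prime: "Factorial_Ring.prime (5::nat)"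
  by (simp add: prime_nat_numeral_eq)

lemma N5_iso:
  assumes card: "card (carrier R) = 5 ^ n"
  shows "N5 \<cong> Cyc 5 \<^bold>^ (5 * n)"
proof -
  interpret N5: group N5 by (rule N5_group)
  have "comm_group N5"
  proof (rule N5.group_comm_groupI)
    \<comment> \<open>The only cross terms in a product are those of the degree 2 coefficients in
      degree 4, and they commute.\<close>
    fix u v assume "u \<in> carrier N5" "v \<in> carrier N5"
    then show "u \<otimes>\<^bsub>N5\<^esub> v = v \<otimes>\<^bsub>N5\<^esub> u"
      unfolding N5_carrier by (auto simp: R.a_ac R.m_comm)
  qed
  then show ?thesis
  proof (rule comm_group.elementary_abelian_iso[OF _ _ five_prime])
    let ?f = "\<lambda>(a2, a3, b3, a4, b4). wvec \<zero>\<^bsub>R\<^esub> \<zero>\<^bsub>R\<^esub> a2 \<zero>\<^bsub>R\<^esub> a3 b3 a4 b4"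
    show "finite (carrier N5)" using fin by (simp add: N5_carrier)
    have "inj_on ?f (carrier R \<times> carrier R \<times> carrier R \<times> carrier R \<times> carrier R)" by (auto simp: inj_on_def)
    then have "card (carrier N5) = card (carrier R) * (card (carrier R) * (card (carrier R) * (card (carrier R) * card (carrier R))))"
      unfolding N5_carrier by (simp add: card_image card_cartesian_product)
    then show "card (carrier N5) = 5 ^ (5 * n)" by (simp add: card flip: power_add)
    fix u assume "u \<in> carrier N5"
    moreover have "u [^]\<^bsub>N5\<^esub> (5::nat) = u [^]\<^bsub>W\<^esub> (5::nat)" by (simp add: N5_def N_def nat_pow_def)
    ultimately show "u [^]\<^bsub>N5\<^esub> (5::nat) = \<one>\<^bsub>N5\<^esub>"
      unfolding N5_carrier N5_one by (auto simp: abelian_part_pow5)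
  qed
qed

text \<open>The eight coordinates of \<open>W\<close> are distributed as 5 + 2 + 1 over the three
  factors.\<close>

lemma W_structure:
  assumes card: "card (carrier R) = 5 ^ n"
  shows "\<exists>\<phi> \<in> hom (Cyc 5 \<^bold>^ (2 * n)) (AutoGroup (Cyc 5 \<^bold>^ (5 * n))).
    iso_semidirect W (semidirect_product (Cyc 5 \<^bold>^ (5 * n)) (Cyc 5 \<^bold>^ (2 * n)) \<phi>) (Cyc 5 \<^bold>^ n)"
proof -
  have Riso: "add_monoid R \<cong> Cyc 5 \<^bold>^ n"
    using five by (intro R.add_monoid_elementary[OF five_prime _ fin card]) simp
  have Biso: "add_monoid B \<cong> Cyc 5 \<^bold>^ (2 * n)"
    using B_five fin by (intro B.B.add_monoid_elementary[OF five_prime]) (simp_all add: card card_cartesian_product flip: power_add mult_2)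
  have "iso_semidirect N (Cyc 5 \<^bold>^ (5 * n)) (Cyc 5 \<^bold>^ (2 * n))"
    by (rule iso_semidirect_cong[OF N_iso_semidirect N5_group group_add_B N5_iso[OF card] Biso])
  then obtain \<phi> where \<phi>: "\<phi> \<in> hom (Cyc 5 \<^bold>^ (2 * n)) (AutoGroup (Cyc 5 \<^bold>^ (5 * n)))"
    "N \<cong> semidirect_product (Cyc 5 \<^bold>^ (5 * n)) (Cyc 5 \<^bold>^ (2 * n)) \<phi>"
    unfolding iso_semidirect_def by blast
  have "iso_semidirect W (semidirect_product (Cyc 5 \<^bold>^ (5 * n)) (Cyc 5 \<^bold>^ (2 * n)) \<phi>) (Cyc 5 \<^bold>^ n)"
    by (rule iso_semidirect_cong[OF W_iso_semidirect N_group group_add_R \<phi>(2) Riso])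
  then show ?thesis using \<phi>(1) by blast
qed

text \<open>An element \<open>1 + w^2 (a, a) + w^4 (c, d)\<close> is central because equal entries
  are fixed by the swap and \<open>w^4\<close> is killed by every further \<open>w\<close>.
  Conversely, two test elements rule out everything else.\<close>

lemma center_W_carrier: "carrier (center_group W) = (\<lambda>(a, c, d). wvec \<zero>\<^bsub>R\<^esub> \<zero>\<^bsub>R\<^esub> a a \<zero>\<^bsub>R\<^esub> \<zero>\<^bsub>R\<^esub> c d) `
    (carrier R \<times> carrier R \<times> carrier R)" (is "_ = ?f ` ?X")
proof (intro equalityI subsetI)
  fix u assume u: "u \<in> carrier (center_group W)"
  have uW: "u \<in> carrier W" using u unfolding center_group_iff by (rule conjunct1)
  have com: "u \<otimes>\<^bsub>W\<^esub> v = v \<otimes>\<^bsub>W\<^esub> u" if "v \<in> carrier W" for v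
    using bspec[OF conjunct2[OF u[unfolded center_group_iff]] that] .
  let ?o = "\<one>\<^bsub>R\<^esub>" and ?z = "\<zero>\<^bsub>R\<^esub>"
  \<comment> \<open>The test elements are \<open>1 + w (1, 0)\<close> and, next,
    \<open>1 + w (0, 1)\<close>; comparing coefficients in degrees 2 to 4 gives linear conditions on
    \<open>u\<close>.\<close>
  have 1: "u \<otimes>\<^bsub>W\<^esub> wvec ?o ?z ?z ?z ?z ?z ?z ?z = wvec ?o ?z ?z ?z ?z ?z ?z ?z \<otimes>\<^bsub>W\<^esub> u"
    by (rule com) simp
  have 2: "u \<otimes>\<^bsub>W\<^esub> wvec ?z ?o ?z ?z ?z ?z ?z ?z = wvec ?z ?o ?z ?z ?z ?z ?z ?z \<otimes>\<^bsub>W\<^esub> u"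
    by (rule com) simp
  from uW show "u \<in> ?f ` ?X"
  proof (cases rule: W_cases)
    case u8: (1 a1 b1 a2 b2 a3 b3 a4 b4)
    note cl = u8(2-)
    have "b1 \<oplus>\<^bsub>R\<^esub> a2 = a2" "b2 \<oplus>\<^bsub>R\<^esub> a3 = a3 \<oplus>\<^bsub>R\<^esub> a2" "b3 \<oplus>\<^bsub>R\<^esub> a4 = a4"
      using 1 cl unfolding u8(1) by simp_all
    moreover have "a1 \<oplus>\<^bsub>R\<^esub> b2 = b2" "a3 \<oplus>\<^bsub>R\<^esub> b4 = b4"
      using 2 cl unfolding u8(1) by simp_all
    ultimately have z: "b1 = ?z" "b2 = a2" "b3 = ?z" "a1 = ?z" "a3 = ?z"
      using cl by (simp_all add: R.a_comm)
    have "u = ?f (a2, a4, b4)" unfolding u8(1) z by simp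
    then show ?thesis using cl by (intro image_eqI[of _ _ "(a2, a4, b4)"]) simp_all
  qed
next
  fix u assume "u \<in> ?f ` ?X"
  then obtain a c d where u: "u = wvec \<zero>\<^bsub>R\<^esub> \<zero>\<^bsub>R\<^esub> a a \<zero>\<^bsub>R\<^esub> \<zero>\<^bsub>R\<^esub> c d" and cl: "a \<in> carrier R" "c \<in> carrier R" "d \<in> carrier R" by auto
  have "u \<otimes>\<^bsub>W\<^esub> v = v \<otimes>\<^bsub>W\<^esub> u" if "v \<in> carrier W" for v
    using that cl unfolding u by (elim W_cases) (simp add: R.a_ac R.m_comm)
  moreover have "u \<in> carrier W" using u cl by simp
  ultimately show "u \<in> carrier (center_group W)" unfolding center_group_iff by blast
qed

lemma center_W_iso:
  assumes card: "card (carrier R) = 5 ^ n"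
  shows "center_group W \<cong> Cyc 5 \<^bold>^ (3 * n)"
proof -
  interpret W: group W by (rule W_group)
  have mult: "u \<otimes>\<^bsub>center_group W\<^esub> v = u \<otimes>\<^bsub>W\<^esub> v" "\<one>\<^bsub>center_group W\<^esub> = \<one>\<^bsub>W\<^esub>" for u v by (simp_all add: center_group_def)
  have "comm_group (center_group W)"
  proof (rule comm_groupI)
    fix u v w assume u: "u \<in> carrier (center_group W)" and v: "v \<in> carrier (center_group W)" and w: "w \<in> carrier (center_group W)"
    show "u \<otimes>\<^bsub>center_group W\<^esub> v \<in> carrier (center_group W)"
    proof -
      obtain a c d a' c' d' where e: "u = wvec \<zero>\<^bsub>R\<^esub> \<zero>\<^bsub>R\<^esub> a a \<zero>\<^bsub>R\<^esub> \<zero>\<^bsub>R\<^esub> c d" "v = wvec \<zero>\<^bsub>R\<^esub> \<zero>\<^bsub>R\<^esub> a' a' \<zero>\<^bsub>R\<^esub> \<zero>\<^bsub>R\<^esub> c' d'"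
        and cl: "a \<in> carrier R" "c \<in> carrier R" "d \<in> carrier R" "a' \<in> carrier R" "c' \<in> carrier R" "d' \<in> carrier R"
        using u v unfolding center_W_carrier by auto
      show ?thesis
        unfolding mult center_W_carrier e using cl
        by (intro image_eqI[of _ _ "(a' \<oplus>\<^bsub>R\<^esub> a, c' \<oplus>\<^bsub>R\<^esub> (a \<otimes>\<^bsub>R\<^esub> a' \<oplus>\<^bsub>R\<^esub> c), d' \<oplus>\<^bsub>R\<^esub> (a \<otimes>\<^bsub>R\<^esub> a' \<oplus>\<^bsub>R\<^esub> d))"]) simp_all
    qed
    have c: "u \<in> carrier W" "v \<in> carrier W" "w \<in> carrier W" using u v w unfolding center_group_iff by blast+
    show "u \<otimes>\<^bsub>center_group W\<^esub> v = v \<otimes>\<^bsub>center_group W\<^esub> u" using u c(2) unfolding center_group_iff mult by blast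
    show "u \<otimes>\<^bsub>center_group W\<^esub> v \<otimes>\<^bsub>center_group W\<^esub> w = u \<otimes>\<^bsub>center_group W\<^esub> (v \<otimes>\<^bsub>center_group W\<^esub> w)"
      unfolding mult using c by (rule W.m_assoc)
    show "\<one>\<^bsub>center_group W\<^esub> \<otimes>\<^bsub>center_group W\<^esub> u = u" unfolding mult using c(1) by (rule W.l_one)
    have inv: "inv\<^bsub>W\<^esub> u \<in> carrier (center_group W)"
    proof -
      have uW: "u \<in> carrier W" and com: "\<And>x. x \<in> carrier W \<Longrightarrow> u \<otimes>\<^bsub>W\<^esub> x = x \<otimes>\<^bsub>W\<^esub> u" using u unfolding center_group_iff by blast+
      have "inv\<^bsub>W\<^esub> u \<otimes>\<^bsub>W\<^esub> x = x \<otimes>\<^bsub>W\<^esub> inv\<^bsub>W\<^esub> u" if x: "x \<in> carrier W" for x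
      proof -
        have "inv\<^bsub>W\<^esub> u \<otimes>\<^bsub>W\<^esub> x = inv\<^bsub>W\<^esub> u \<otimes>\<^bsub>W\<^esub> (x \<otimes>\<^bsub>W\<^esub> u) \<otimes>\<^bsub>W\<^esub> inv\<^bsub>W\<^esub> u" using uW x by (simp add: W.m_assoc)
        also have "\<dots> = (inv\<^bsub>W\<^esub> u \<otimes>\<^bsub>W\<^esub> u) \<otimes>\<^bsub>W\<^esub> x \<otimes>\<^bsub>W\<^esub> inv\<^bsub>W\<^esub> u"
          unfolding com[OF x, symmetric] using uW x by (simp only: W.m_assoc W.inv_closed W.m_closed)
        finally show ?thesis using uW x by simp
      qed
      then show ?thesis using W.inv_closed[OF uW] unfolding center_group_iff by blast
    qed
    show "\<exists>y\<in>carrier (center_group W). y \<otimes>\<^bsub>center_group W\<^esub> u = \<one>\<^bsub>center_group W\<^esub>"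
      using inv u by (intro bexI[of _ "inv\<^bsub>W\<^esub> u"]) (simp_all only: mult W.l_inv[OF c(1)])
  next
    show "\<one>\<^bsub>center_group W\<^esub> \<in> carrier (center_group W)" unfolding mult center_group_iff by simp
  qed
  then show ?thesis
  proof (rule comm_group.elementary_abelian_iso[OF _ _ five_prime])
    let ?f = "\<lambda>(a, c, d). wvec \<zero>\<^bsub>R\<^esub> \<zero>\<^bsub>R\<^esub> a a \<zero>\<^bsub>R\<^esub> \<zero>\<^bsub>R\<^esub> c d"
    show "finite (carrier (center_group W))" using fin by (simp add: center_W_carrier)
    have "inj_on ?f (carrier R \<times> carrier R \<times> carrier R)" by (auto simp: inj_on_def)
    then have "card (carrier (center_group W)) = card (carrier R) * (card (carrier R) * card (carrier R))"
      unfolding center_W_carrier by (simp add: card_image card_cartesian_product)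
    then show "card (carrier (center_group W)) = 5 ^ (3 * n)" by (simp add: card flip: power_add)
    fix u assume "u \<in> carrier (center_group W)"
    moreover have "u [^]\<^bsub>center_group W\<^esub> (5::nat) = u [^]\<^bsub>W\<^esub> (5::nat)" by (simp add: center_group_def nat_pow_def)
    ultimately show "u [^]\<^bsub>center_group W\<^esub> (5::nat) = \<one>\<^bsub>center_group W\<^esub>"
      unfolding center_W_carrier mult by (auto simp: abelian_part_pow5)
  qed
qed

end

section \<open>Jacobson radicals and the modular case\<close>

lemma left_idealD:
  assumes "left_ideal I A"
  shows "additive_subgroup I A" "\<And>x a. x \<in> carrier A \<Longrightarrow> a \<in> I \<Longrightarrow> x \<otimes>\<^bsub>A\<^esub> a \<in> I"
  using assms by (auto simp: left_ideal_def)

lemma (in ring) left_ideal_one_imp_carrier: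
  assumes "left_ideal I R" "\<one> \<in> I"
  shows "I = carrier R"
  using left_idealD[OF assms(1)] assms(2) additive_subgroup.a_subset[of I R]
  by (metis r_one subsetI subset_antisym)

lemma (in ring) left_idealI:
  assumes "I \<subseteq> carrier R" "\<zero> \<in> I" "\<And>a b. a \<in> I \<Longrightarrow> b \<in> I \<Longrightarrow> a \<oplus> b \<in> I"
    "\<And>x a. x \<in> carrier R \<Longrightarrow> a \<in> I \<Longrightarrow> x \<otimes> a \<in> I"
  shows "left_ideal I R"
proof -
  have "\<ominus> a \<in> I" if a: "a \<in> I" for a
    using assms(4)[of "\<ominus> \<one>", OF _ a] a assms(1) by (simp add: subset_iff l_minus)
  then have "additive_subgroup I R"
    using assms(1-3) by (intro additive_subgroupI subgroup.intro) (simp_all add: a_inv_def)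
  then show ?thesis using assms(4) by (simp add: left_ideal_def)
qed

text \<open>A left ideal containing the preimage of \<open>M\<close> contains the kernel of
  \<open>h\<close>, so it is recovered from its image; the image is again a left ideal because
  \<open>h\<close> is onto.\<close>

lemma maximal_left_ideal_preimage:
  assumes A: "ring A" and Q: "ring Q" and h: "h \<in> ring_hom A Q" and surj: "h ` carrier A = carrier Q"
    and M: "maximal_left_ideal M Q"
  shows "maximal_left_ideal {a \<in> carrier A. h a \<in> M} A" (is "maximal_left_ideal ?P A")
proof -
  interpret A: ring A by fact
  interpret Q: ring Q by fact
  interpret h: ring_hom_ring A Q h using h by (intro ring_hom_ringI2 A Q)
  have M': "left_ideal M Q" "M \<noteq> carrier Q" and max: "\<And>L. left_ideal L Q \<Longrightarrow> M \<subseteq> L \<Longrightarrow> L = M \<or> L = carrier Q"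
    using M by (auto simp: maximal_left_ideal_def)
  interpret M: additive_subgroup M Q by (rule left_idealD(1)[OF M'(1)])
  have P: "left_ideal ?P A"
    by (rule A.left_idealI) (auto simp: left_idealD(2)[OF M'(1)] M.a_closed)
  moreover have "?P \<noteq> carrier A"
  proof
    assume "?P = carrier A"
    then have "h \<one>\<^bsub>A\<^esub> \<in> M" by blast
    then show False using Q.left_ideal_one_imp_carrier[OF M'(1)] M'(2) by simp
  qed
  moreover have "L = ?P \<or> L = carrier A" if L: "left_ideal L A" and PL: "?P \<subseteq> L" for L
  proof -
    interpret L: additive_subgroup L A by (rule left_idealD(1)[OF L])
    have hL: "left_ideal (h ` L) Q"
    proof (rule Q.left_idealI)
      show "h ` L \<subseteq> carrier Q" using L.a_subset by auto
      show "\<zero>\<^bsub>Q\<^esub> \<in> h ` L" using imageI[OF L.zero_closed, of h] by simp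
      fix a b assume "a \<in> h ` L" "b \<in> h ` L"
      then obtain a' b' where ab: "a = h a'" "b = h b'" "a' \<in> L" "b' \<in> L" by blast
      then have "a \<oplus>\<^bsub>Q\<^esub> b = h (a' \<oplus>\<^bsub>A\<^esub> b')" by simp
      then show "a \<oplus>\<^bsub>Q\<^esub> b \<in> h ` L" using L.a_closed[OF ab(3,4)] by blast
    next
      fix x a assume "x \<in> carrier Q" "a \<in> h ` L"
      then obtain x' a' where xa: "x = h x'" "x' \<in> carrier A" "a = h a'" "a' \<in> L" using surj by blast
      then have "x \<otimes>\<^bsub>Q\<^esub> a = h (x' \<otimes>\<^bsub>A\<^esub> a')" by simp
      then show "x \<otimes>\<^bsub>Q\<^esub> a \<in> h ` L" using left_idealD(2)[OF L xa(2,4)] by blast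
    qed
    have "M \<subseteq> h ` L"
    proof
      fix m assume m: "m \<in> M"
      then have "m \<in> h ` carrier A" unfolding surj by (rule M.a_Hcarr)
      then show "m \<in> h ` L" using m PL by blast
    qed
    then consider "h ` L = M" | "h ` L = carrier Q" using max[OF hL] by blast
    then show ?thesis
    proof cases
      case 1
      then have "L \<subseteq> ?P" using L.a_subset by blast
      then show ?thesis using PL by blast
    next
      case 2
      have "x \<in> L" if x: "x \<in> carrier A" for x
      proof -
        obtain a where a: "a \<in> L" "h x = h a" using 2 h.hom_closed[OF x] by (metis imageE)
        have aA: "a \<in> carrier A" by (rule L.a_Hcarr[OF a(1)])
        have "h (x \<ominus>\<^bsub>A\<^esub> a) = \<zero>\<^bsub>Q\<^esub>" using x aA a(2) by (simp add: A.minus_eq Q.r_neg)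
        then have "x \<ominus>\<^bsub>A\<^esub> a \<in> L" using PL x aA M.zero_closed by auto
        then have "x \<ominus>\<^bsub>A\<^esub> a \<oplus>\<^bsub>A\<^esub> a \<in> L" using L.a_closed[OF _ a(1)] by blast
        then show ?thesis using x aA by (simp add: A.minus_eq A.a_assoc A.l_neg)
      qed
      then show ?thesis using L.a_subset by blast
    qed
  qed
  ultimately show ?thesis by (simp add: maximal_left_ideal_def)
qed

lemma jacobson_radical_hom:
  assumes "ring A" "ring Q" "h \<in> ring_hom A Q" "h ` carrier A = carrier Q" and a: "a \<in> jacobson_radical A"
  shows "h a \<in> jacobson_radical Q"
  using a maximal_left_ideal_preimage[OF assms(1-4)] ring_hom_closed[OF assms(3)]
  unfolding jacobson_radical_def by blast

lemma (in field) jacobson_radical_field: "jacobson_radical R \<subseteq> {\<zero>}"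
proof -
  have "left_ideal {\<zero>} R" by (rule left_idealI) auto
  moreover have "L = {\<zero>} \<or> L = carrier R" if L: "left_ideal L R" for L
  proof (rule disjCI)
    assume ne: "L \<noteq> carrier R"
    interpret L: additive_subgroup L R by (rule left_idealD(1)[OF L])
    have "a = \<zero>" if a: "a \<in> L" for a
    proof (rule ccontr)
      assume "a \<noteq> \<zero>"
      then have "a \<in> Units R" using L.a_Hcarr[OF a] field_Units by blast
      then have "\<one> \<in> L" using left_idealD(2)[OF L _ a, of "inv a"] by simp
      then show False using left_ideal_one_imp_carrier[OF L] ne by blast
    qed
    then show "L = {\<zero>}" using L.zero_closed by blast
  qed
  moreover have "{\<zero>} \<noteq> carrier R" using one_closed one_not_zero by blast
  ultimately have "maximal_left_ideal {\<zero>} R" by (auto simp: maximal_left_ideal_def)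
  then show ?thesis unfolding jacobson_radical_def by blast
qed

text \<open>Both projections are onto and carry the radical into the radicals of the
  factors.\<close>

lemma jacobson_radical_RDirProd:
  assumes R: "ring R" and S: "ring S" and J: "jacobson_radical R \<subseteq> {\<zero>\<^bsub>R\<^esub>}" "jacobson_radical S \<subseteq> {\<zero>\<^bsub>S\<^esub>}"
  shows "jacobson_radical (RDirProd R S) \<subseteq> {\<zero>\<^bsub>RDirProd R S\<^esub>}"
proof
  interpret R: ring R by fact
  interpret S: ring S by fact
  fix a assume a: "a \<in> jacobson_radical (RDirProd R S)"
  have "fst \<in> ring_hom (RDirProd R S) R" "snd \<in> ring_hom (RDirProd R S) S"
    by (rule ring_hom_memI; auto)+
  moreover have "fst ` carrier (RDirProd R S) = carrier R" "snd ` carrier (RDirProd R S) = carrier S"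
    using R.zero_closed S.zero_closed by (force simp: image_iff)+
  ultimately have "fst a \<in> jacobson_radical R" "snd a \<in> jacobson_radical S"
    using jacobson_radical_hom[OF RDirProd_ring[OF R S] R _ _ a] jacobson_radical_hom[OF RDirProd_ring[OF R S] S _ _ a] by blast+
  then show "a \<in> {\<zero>\<^bsub>RDirProd R S\<^esub>}" using J by (cases a) auto
qed

text \<open>If some \<open>n\<close> avoided a maximal left ideal \<open>M\<close>, then
  \<open>M + R n\<close> would be everything and \<open>1 = m + x n\<close> with \<open>m\<close> in
  \<open>M\<close>. But \<open>m = 1 - x n\<close> is a unit, because \<open>x n\<close> lies in
  \<open>N\<close> again.\<close>

lemma (in ring) quasi_regular_subset_jacobson_radical:
  assumes N: "N \<subseteq> carrier R" and abs: "\<And>x n. x \<in> carrier R \<Longrightarrow> n \<in> N \<Longrightarrow> x \<otimes> n \<in> N"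
    and reg: "\<And>n. n \<in> N \<Longrightarrow> \<one> \<ominus> n \<in> Units R"
  shows "N \<subseteq> jacobson_radical R"
proof -
  have "n \<in> M" if n: "n \<in> N" and M: "maximal_left_ideal M R" for n M
  proof (rule ccontr)
    assume nM: "n \<notin> M"
    have M': "left_ideal M R" "M \<noteq> carrier R" and max: "\<And>L. left_ideal L R \<Longrightarrow> M \<subseteq> L \<Longrightarrow> L = M \<or> L = carrier R"
      using M by (auto simp: maximal_left_ideal_def)
    interpret M: additive_subgroup M R by (rule left_idealD(1)[OF M'(1)])
    have nc: "n \<in> carrier R" using n N by blast
    let ?L = "{m \<oplus> x \<otimes> n | m x. m \<in> M \<and> x \<in> carrier R}"
    have "left_ideal ?L R"
    proof (rule left_idealI)
      show "?L \<subseteq> carrier R" using nc by auto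
      have "\<zero> = \<zero> \<oplus> \<zero> \<otimes> n" using nc by simp
      then show "\<zero> \<in> ?L" using M.zero_closed by blast
    next
      fix a b assume "a \<in> ?L" "b \<in> ?L"
      then obtain m x m' x' where e: "a = m \<oplus> x \<otimes> n" "b = m' \<oplus> x' \<otimes> n" and c: "m \<in> M" "m' \<in> M" "x \<in> carrier R" "x' \<in> carrier R" by blast
      have "a \<oplus> b = (m \<oplus> m') \<oplus> (x \<oplus> x') \<otimes> n" unfolding e using c nc by (simp add: l_distr a_ac)
      then show "a \<oplus> b \<in> ?L" using c M.a_closed by blast
    next
      fix y a assume y: "y \<in> carrier R" and "a \<in> ?L"
      then obtain m x where e: "a = m \<oplus> x \<otimes> n" and c: "m \<in> M" "x \<in> carrier R" by blast
      have "y \<otimes> a = y \<otimes> m \<oplus> (y \<otimes> x) \<otimes> n" unfolding e using c nc y by (simp add: r_distr m_assoc)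
      then show "y \<otimes> a \<in> ?L" using left_idealD(2)[OF M'(1) y c(1)] c(2) y by blast
    qed
    moreover have "M \<subseteq> ?L"
    proof
      fix m assume m: "m \<in> M"
      then have "m = m \<oplus> \<zero> \<otimes> n" using nc by simp
      then show "m \<in> ?L" using m by blast
    qed
    moreover have "n = \<zero> \<oplus> \<one> \<otimes> n" using nc by simp
    then have "n \<in> ?L" using M.zero_closed by blast
    ultimately have "\<one> \<in> ?L" using max[of ?L] nM by auto
    then obtain m x where e: "\<one> = m \<oplus> x \<otimes> n" and m: "m \<in> M" "x \<in> carrier R" by blast
    have "m = (m \<oplus> x \<otimes> n) \<ominus> x \<otimes> n" using m nc by (simp add: minus_eq a_assoc r_neg)
    then have "m \<in> Units R" using reg[OF abs[OF m(2) n]] e by simp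
    then have "\<one> \<in> M" using left_idealD(2)[OF M'(1) _ m(1), of "inv m"] by simp
    then show False using left_ideal_one_imp_carrier[OF M'(1)] M'(2) by blast
  qed
  then show ?thesis using N unfolding jacobson_radical_def by blast
qed

lemma RDirProd_minus:
  assumes "ring R" "ring S" "a \<in> carrier R" "b \<in> carrier S"
  shows "\<ominus>\<^bsub>RDirProd R S\<^esub> (a, b) = (\<ominus>\<^bsub>R\<^esub> a, \<ominus>\<^bsub>S\<^esub> b)"
proof -
  interpret R: ring R by fact
  interpret S: ring S by fact
  interpret P: ring "RDirProd R S" by (rule RDirProd_ring) fact+
  show ?thesis using assms(3,4) by (intro P.minus_equality) (simp_all add: R.l_neg S.l_neg)
qed

context char5
begin

text \<open>The diagonal is fixed by the swap, and \<open>(1, -1)\<close> is a square root of 1 that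
  the swap negates.\<close>

lemma skew_representation: "skew5_rep B prod.swap R (\<lambda>r. (r, r)) (\<one>\<^bsub>R\<^esub>, \<ominus>\<^bsub>R\<^esub> \<one>\<^bsub>R\<^esub>)"
proof
  show "(\<lambda>r. (r, r)) \<in> ring_hom R B" by (rule ring_hom_memI) simp_all
qed (auto simp: inj_on_def RDirProd_minus R.ring_axioms R.l_minus R.r_minus)

lemma card_T: "card (carrier T) = card (carrier R) ^ 10"
  by (simp add: card_cartesian_product power_numeral_reduce)

text \<open>The premise \<open>indep\<close> says that 1, \<zeta>, \<zeta>^2 are independent over
  \<open>F\<close>. With the cardinality of \<open>R\<close> this makes \<open>R\<close> a copy of
  the group algebra of \<open>C_3\<close>, and the whole kernel vanishes.\<close>

lemma group_algebra_ring_iso: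
  fixes F (structure)
  assumes F: "cring F" "finite (carrier F)" and \<iota>: "\<iota> \<in> ring_hom F R"
    and \<zeta>: "\<zeta> \<in> carrier R" "\<zeta> [^]\<^bsub>R\<^esub> (3::nat) = \<one>\<^bsub>R\<^esub>"
    and card: "card (carrier R) = card (carrier F) ^ 3"
    and indep: "\<And>x0 x1 x2. x0 \<in> carrier F \<Longrightarrow> x1 \<in> carrier F \<Longrightarrow> x2 \<in> carrier F \<Longrightarrow>
      \<iota> x0 \<oplus>\<^bsub>R\<^esub> (\<iota> x1 \<otimes>\<^bsub>R\<^esub> \<zeta> \<oplus>\<^bsub>R\<^esub> \<iota> x2 \<otimes>\<^bsub>R\<^esub> (\<zeta> \<otimes>\<^bsub>R\<^esub> \<zeta>)) = \<zero>\<^bsub>R\<^esub> \<Longrightarrow> x0 = \<zero> \<and> x1 = \<zero> \<and> x2 = \<zero>"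
  obtains \<Theta> where "\<Theta> \<in> ring_iso (group_algebra F C3D10) T" "ring (group_algebra F C3D10)"
    "\<Theta> \<in> iso (units_of (group_algebra F C3D10)) (units_of T)"
proof -
  interpret F: cring F by fact
  interpret S: skew5_rep B prod.swap R "\<lambda>r. (r, r)" "(\<one>\<^bsub>R\<^esub>, \<ominus>\<^bsub>R\<^esub> \<one>\<^bsub>R\<^esub>)" by (rule skew_representation)
  interpret D: dihedral_rep F R T \<iota> \<zeta> S.scal "B.exp_w 1" S.refl
    by (rule S.rep[OF F(1) \<iota> \<zeta>])
  let ?FG = "group_algebra F C3D10"
  interpret RG: abelian_group ?FG by (rule D.rep.RG_abelian_group)
  have hom: "D.rep.lift \<in> hom ?FG T"
    by (rule D.rep.lift_hom)
  have ker: "\<forall>j \<in> {0, 1, 2, 3, 4}. \<forall>k \<in> {0, 1}. \<forall>i \<in> {0, 1, 2}. (f \<ominus>\<^bsub>?FG\<^esub> g) (i, j, k) = \<zero>"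
    if f: "f \<in> carrier ?FG" and g: "g \<in> carrier ?FG" and eq: "D.rep.lift f = D.rep.lift g" for f g
  proof (intro ballI)
    fix j k i :: int
    assume j: "j \<in> {0, 1, 2, 3, 4}" and k: "k \<in> {0, 1}" and i: "i \<in> {0, 1, 2}"
    let ?d = "f \<ominus>\<^bsub>?FG\<^esub> g"
    have d: "?d \<in> carrier ?FG" using f g by simp
    have "twist R \<iota> \<zeta> ?d j k = \<zero>\<^bsub>R\<^esub>"
      by (rule S.rep_kernel[OF F(1) \<iota> \<zeta> d D.rep.lift_minus_eq_zero[OF f g eq] j k])
    moreover have "?d (i, j, k) \<in> carrier F" if "i \<in> {0, 1, 2}" for i
      using D.rep.RG_val[OF d, of "(i, j, k)"] that j k by (simp only: carrier_C3D10 mem_Sigma_iff)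
    from this[of 0] this[of 1] this[of 2] have "?d (0, j, k) \<in> carrier F" "?d (1, j, k) \<in> carrier F" "?d (2, j, k) \<in> carrier F"
      by simp_all
    ultimately have "?d (0, j, k) = \<zero> \<and> ?d (1, j, k) = \<zero> \<and> ?d (2, j, k) = \<zero>"
      unfolding twist_def by (intro indep)
    then show "?d (i, j, k) = \<zero>" using i by auto
  qed
  have cT: "card (carrier T) = card (carrier F) ^ 30"
    unfolding card_T card by (simp flip: power_mult)
  have iso: "D.rep.lift \<in> iso (units_of ?FG) (units_of T)" "bij_betw D.rep.lift (carrier ?FG) (carrier T)"
    by (rule group_algebra_units_iso[OF F hom D.rep.lift_one _ T_finite cT]; rule ker; assumption)+
  have \<Theta>: "D.rep.lift \<in> ring_iso ?FG T"
    by (rule ring_iso_memI) (rule D.rep.lift_closed D.rep.lift_mult D.rep.lift_add D.rep.lift_one iso(2); assumption)+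
  \<comment> \<open>The ring axioms of the group algebra are obtained from \<open>T\<close>:
    \<open>lift\<close> is a bijection respecting both operations, so its inverse carries the ring
    structure over.\<close>
  have ring: "ring ?FG"
  proof -
    let ?h = "inv_into (carrier ?FG) D.rep.lift"
    have inv: "?h (D.rep.lift f) = f" if "f \<in> carrier ?FG" for f
      by (rule bij_betw_inv_into_left[OF iso(2) that])
    have b: "bij_betw ?h (carrier T) (carrier ?FG)" by (rule bij_betw_inv_into[OF iso(2)])
    have surj: "t = D.rep.lift (?h t)" "?h t \<in> carrier ?FG" if "t \<in> carrier T" for t
      using bij_betw_inv_into_right[OF iso(2) that] bij_betw_apply[OF b that] by (simp_all only:)
    have h: "?h \<in> ring_iso T ?FG"
    proof (rule ring_iso_memI)
      fix s t assume s: "s \<in> carrier T" and t: "t \<in> carrier T"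
      note st = surj(2)[OF s] surj(2)[OF t]
      show "?h s \<in> carrier ?FG" by (rule st)
      have "?h (D.rep.lift (?h s \<otimes>\<^bsub>?FG\<^esub> ?h t)) = ?h s \<otimes>\<^bsub>?FG\<^esub> ?h t"
        by (rule inv[OF D.rep.RG_mult_closed[OF st]])
      then show "?h (s \<otimes>\<^bsub>T\<^esub> t) = ?h s \<otimes>\<^bsub>?FG\<^esub> ?h t"
        unfolding D.rep.lift_mult[OF st] surj(1)[OF s, symmetric] surj(1)[OF t, symmetric] .
      have "?h (D.rep.lift (?h s \<oplus>\<^bsub>?FG\<^esub> ?h t)) = ?h s \<oplus>\<^bsub>?FG\<^esub> ?h t"
        by (rule inv[OF RG.a_closed[OF st]])
      then show "?h (s \<oplus>\<^bsub>T\<^esub> t) = ?h s \<oplus>\<^bsub>?FG\<^esub> ?h t"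
        unfolding D.rep.lift_add[OF st] surj(1)[OF s, symmetric] surj(1)[OF t, symmetric] .
    next
      show "?h \<one>\<^bsub>T\<^esub> = \<one>\<^bsub>?FG\<^esub>" using inv[OF D.rep.RG_one_closed] unfolding D.rep.lift_one .
    qed (rule b)
    \<comment> \<open>Preservation of zero follows from additivity, by cancelling in
      \<open>T\<close>.\<close>
    have "D.rep.lift \<zero>\<^bsub>?FG\<^esub> \<oplus>\<^bsub>T\<^esub> D.rep.lift \<zero>\<^bsub>?FG\<^esub> = D.rep.lift \<zero>\<^bsub>?FG\<^esub>"
      using D.rep.lift_add[OF RG.zero_closed RG.zero_closed] by simp
    then have "D.rep.lift \<zero>\<^bsub>?FG\<^esub> = \<zero>\<^bsub>T\<^esub>"
      using B.T.add.r_cancel_one[OF D.rep.lift_closed[OF RG.zero_closed] D.rep.lift_closed[OF RG.zero_closed]] by blast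
    then have z: "?h \<zero>\<^bsub>T\<^esub> = \<zero>\<^bsub>?FG\<^esub>" using inv[OF RG.zero_closed] by simp
    have o: "?h \<one>\<^bsub>T\<^esub> = \<one>\<^bsub>?FG\<^esub>" using inv[OF D.rep.RG_one_closed] unfolding D.rep.lift_one .
    show ?thesis using ring.ring_iso_imp_img_ring[OF B.T.ring_axioms h] unfolding z o by simp
  qed
  show ?thesis by (rule that[OF \<Theta> ring iso(1)])
qed

text \<open>The constant term is a surjection onto \<open>B\<close>, whose radical is zero; this
  bounds the radical from above. Conversely, subtracting an element with zero constant term from 1
  leaves a one-unit, and such elements form a left ideal.\<close>

lemma jacobson_radical_pullback:
  assumes A: "ring A" and \<Theta>: "\<Theta> \<in> ring_iso A T" and J: "jacobson_radical R \<subseteq> {\<zero>\<^bsub>R\<^esub>}"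
  shows "jacobson_radical A = {a \<in> carrier A. fst (\<Theta> a) = \<zero>\<^bsub>B\<^esub>}" (is "_ = ?N")
proof (intro equalityI subsetI)
  interpret A: ring A by fact
  have h: "\<Theta> \<in> ring_hom A T" and bij: "bij_betw \<Theta> (carrier A) (carrier T)"
    using \<Theta> by (auto simp: ring_iso_def)
  interpret h: ring_hom_ring A T \<Theta> using h by (intro ring_hom_ringI2 A B.T.ring_axioms)
  interpret p: ring_hom_ring T B fst using B.proj_hom by (intro ring_hom_ringI2 B.T.ring_axioms B.B.ring_axioms)
  {
    fix a assume a: "a \<in> jacobson_radical A"
    have aA: "a \<in> carrier A" using a by (simp add: jacobson_radical_def)
    have "fst \<circ> \<Theta> \<in> ring_hom A B" using ring_hom_trans[OF h B.proj_hom] .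
    moreover have "fst ` carrier T = carrier B" by force
    then have "(fst \<circ> \<Theta>) ` carrier A = carrier B" using bij by (simp only: image_comp[symmetric] bij_betw_imp_surj_on)
    ultimately have "(fst \<circ> \<Theta>) a \<in> jacobson_radical B" using jacobson_radical_hom[OF A B.B.ring_axioms _ _ a] by blast
    then have "(fst \<circ> \<Theta>) a = \<zero>\<^bsub>B\<^esub>" using jacobson_radical_RDirProd[OF R.ring_axioms R.ring_axioms J J] by blast
    then show "a \<in> ?N" using aA by (simp del: RDirProd_simps)
  next
    have reg: "\<one>\<^bsub>A\<^esub> \<ominus>\<^bsub>A\<^esub> n \<in> Units A" if n: "n \<in> ?N" for n
    proof -
      have nA: "n \<in> carrier A" and n0: "fst (\<Theta> n) = \<zero>\<^bsub>B\<^esub>" using n by blast+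
      have "fst (\<Theta> (\<one>\<^bsub>A\<^esub> \<ominus>\<^bsub>A\<^esub> n)) = \<one>\<^bsub>B\<^esub> \<ominus>\<^bsub>B\<^esub> fst (\<Theta> n)"
        using nA by (simp add: A.minus_eq B.B.minus_eq del: RDirProd_simps skew_ring_simps)
      then have "fst (\<Theta> (\<one>\<^bsub>A\<^esub> \<ominus>\<^bsub>A\<^esub> n)) = \<one>\<^bsub>B\<^esub>" unfolding n0 by (simp add: B.B.minus_eq del: RDirProd_simps)
      then have "\<Theta> (\<one>\<^bsub>A\<^esub> \<ominus>\<^bsub>A\<^esub> n) \<in> Units T" using nA by (intro B.unipotent_unit) (simp_all del: RDirProd_simps skew_ring_simps)
      moreover have "\<Theta> ` Units A = Units T"
        using units_of_iso(2)[of \<Theta> A T] h bij h.hom_one A.one_closed A.m_closed by (simp add: ring_hom_def hom_def)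
      ultimately obtain u where u: "u \<in> Units A" "\<Theta> (\<one>\<^bsub>A\<^esub> \<ominus>\<^bsub>A\<^esub> n) = \<Theta> u" by (metis imageE)
      then have "\<one>\<^bsub>A\<^esub> \<ominus>\<^bsub>A\<^esub> n = u" using bij nA A.Units_closed by (intro inj_onD[of \<Theta> "carrier A"]) (simp_all add: bij_betw_def)
      then show ?thesis using u(1) by simp
    qed
    have "?N \<subseteq> jacobson_radical A"
    proof (rule A.quasi_regular_subset_jacobson_radical)
      fix x n assume x: "x \<in> carrier A" and n: "n \<in> ?N"
      then have nA: "n \<in> carrier A" and n0: "fst (\<Theta> n) = \<zero>\<^bsub>B\<^esub>" by blast+
      have "fst (\<Theta> (x \<otimes>\<^bsub>A\<^esub> n)) = fst (\<Theta> x) \<otimes>\<^bsub>B\<^esub> fst (\<Theta> n)"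
        using x nA by (simp del: RDirProd_simps skew_ring_simps)
      then show "x \<otimes>\<^bsub>A\<^esub> n \<in> ?N" unfolding n0 using x nA by (simp del: RDirProd_simps skew_ring_simps)
    qed (use reg in auto)
    then show "a \<in> jacobson_radical A" if "a \<in> ?N" for a using that by blast
  }
qed

text \<open>Adding 1 turns zero constant term into constant term 1. Closure under multiplication is
  recorded as well, since it allows the isomorphism to be inverted and centres to be compared before
  \<open>V\<close> is known to be a group.\<close>

lemma one_plus_radical_iso:
  assumes A: "ring A" and \<Theta>: "\<Theta> \<in> ring_iso A T" and J: "jacobson_radical R \<subseteq> {\<zero>\<^bsub>R\<^esub>}"
  shows "\<Theta> \<in> iso ((units_of A)\<lparr>carrier := \<one>\<^bsub>A\<^esub> <+\<^bsub>A\<^esub> jacobson_radical A\<rparr>) W"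
    "\<And>a b. a \<in> \<one>\<^bsub>A\<^esub> <+\<^bsub>A\<^esub> jacobson_radical A \<Longrightarrow> b \<in> \<one>\<^bsub>A\<^esub> <+\<^bsub>A\<^esub> jacobson_radical A \<Longrightarrow>
      a \<otimes>\<^bsub>A\<^esub> b \<in> \<one>\<^bsub>A\<^esub> <+\<^bsub>A\<^esub> jacobson_radical A"
proof -
  interpret A: ring A by fact
  have h: "\<Theta> \<in> ring_hom A T" and bij: "bij_betw \<Theta> (carrier A) (carrier T)"
    using \<Theta> by (auto simp: ring_iso_def)
  interpret h: ring_hom_ring A T \<Theta> using h by (intro ring_hom_ringI2 A B.T.ring_axioms)
  interpret p: ring_hom_ring T B fst using B.proj_hom by (intro ring_hom_ringI2 B.T.ring_axioms B.B.ring_axioms)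
  let ?V = "{a \<in> carrier A. fst (\<Theta> a) = \<one>\<^bsub>B\<^esub>}"
  have V: "\<one>\<^bsub>A\<^esub> <+\<^bsub>A\<^esub> jacobson_radical A = ?V"
  proof (intro equalityI subsetI)
    fix a assume "a \<in> \<one>\<^bsub>A\<^esub> <+\<^bsub>A\<^esub> jacobson_radical A"
    then obtain n where n: "a = \<one>\<^bsub>A\<^esub> \<oplus>\<^bsub>A\<^esub> n" "n \<in> carrier A" "fst (\<Theta> n) = \<zero>\<^bsub>B\<^esub>"
      unfolding jacobson_radical_pullback[OF assms] a_l_coset_def' by blast
    have "fst (\<Theta> a) = \<one>\<^bsub>B\<^esub> \<oplus>\<^bsub>B\<^esub> fst (\<Theta> n)" unfolding n(1) using n(2) by (simp del: RDirProd_simps skew_ring_simps)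
    then have "fst (\<Theta> a) = \<one>\<^bsub>B\<^esub>" unfolding n(3) by (simp del: RDirProd_simps)
    then show "a \<in> ?V" using n(1,2) by simp
  next
    fix a assume "a \<in> ?V"
    then have a: "a \<in> carrier A" "fst (\<Theta> a) = \<one>\<^bsub>B\<^esub>" by blast+
    have "fst (\<Theta> (a \<ominus>\<^bsub>A\<^esub> \<one>\<^bsub>A\<^esub>)) = fst (\<Theta> a) \<ominus>\<^bsub>B\<^esub> \<one>\<^bsub>B\<^esub>"
      using a(1) by (simp add: A.minus_eq B.B.minus_eq del: RDirProd_simps skew_ring_simps)
    then have "fst (\<Theta> (a \<ominus>\<^bsub>A\<^esub> \<one>\<^bsub>A\<^esub>)) = \<zero>\<^bsub>B\<^esub>" unfolding a(2) by (simp add: B.B.minus_eq B.B.r_neg del: RDirProd_simps)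
    then have "a \<ominus>\<^bsub>A\<^esub> \<one>\<^bsub>A\<^esub> \<in> jacobson_radical A" unfolding jacobson_radical_pullback[OF assms] using a(1) by simp
    moreover have "a = \<one>\<^bsub>A\<^esub> \<oplus>\<^bsub>A\<^esub> (a \<ominus>\<^bsub>A\<^esub> \<one>\<^bsub>A\<^esub>)"
      using a(1) A.a_lcomm[of "\<one>\<^bsub>A\<^esub>" a "\<ominus>\<^bsub>A\<^esub> \<one>\<^bsub>A\<^esub>"] by (simp add: A.minus_eq A.r_neg)
    ultimately show "a \<in> \<one>\<^bsub>A\<^esub> <+\<^bsub>A\<^esub> jacobson_radical A" unfolding a_l_coset_def' by blast
  qed
  have img: "\<Theta> ` ?V = carrier W"
  proof (intro equalityI subsetI)
    fix u assume "u \<in> carrier W"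
    then have u: "u \<in> carrier T" "fst u = \<one>\<^bsub>B\<^esub>" by (simp_all add: W_def del: RDirProd_simps skew_ring_simps)
    then obtain a where "a \<in> carrier A" "u = \<Theta> a" using bij unfolding bij_betw_def by blast
    then show "u \<in> \<Theta> ` ?V" using u(2) by blast
  qed (auto simp: W_def simp del: RDirProd_simps skew_ring_simps)
  have "bij_betw \<Theta> ?V (carrier W)"
    using bij_betw_subset[OF bij _ img] by blast
  moreover have "\<Theta> \<in> hom ((units_of A)\<lparr>carrier := ?V\<rparr>) W"
    using img by (intro homI) (auto simp: units_of_def W_def simp del: RDirProd_simps skew_ring_simps)
  ultimately show "\<Theta> \<in> iso ((units_of A)\<lparr>carrier := \<one>\<^bsub>A\<^esub> <+\<^bsub>A\<^esub> jacobson_radical A\<rparr>) W"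
    unfolding V by (simp add: iso_def)
  fix a b assume "a \<in> \<one>\<^bsub>A\<^esub> <+\<^bsub>A\<^esub> jacobson_radical A" "b \<in> \<one>\<^bsub>A\<^esub> <+\<^bsub>A\<^esub> jacobson_radical A"
  then have a: "a \<in> carrier A" "fst (\<Theta> a) = \<one>\<^bsub>B\<^esub>" and b: "b \<in> carrier A" "fst (\<Theta> b) = \<one>\<^bsub>B\<^esub>" unfolding V by blast+
  have "fst (\<Theta> (a \<otimes>\<^bsub>A\<^esub> b)) = fst (\<Theta> a) \<otimes>\<^bsub>B\<^esub> fst (\<Theta> b)"
    using a b by (simp del: RDirProd_simps skew_ring_simps)
  then show "a \<otimes>\<^bsub>A\<^esub> b \<in> \<one>\<^bsub>A\<^esub> <+\<^bsub>A\<^esub> jacobson_radical A"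
    unfolding V a(2) b(2) using a b by (simp del: RDirProd_simps skew_ring_simps)
qed

end

section \<open>The unit groups over a quadratic extension\<close>

text \<open>Inverts an isomorphism whose source is only known to be closed under
  multiplication.\<close>

lemma is_iso_sym_closed:
  assumes h: "h \<in> iso G H" and cl: "\<And>x y. x \<in> carrier G \<Longrightarrow> y \<in> carrier G \<Longrightarrow> x \<otimes>\<^bsub>G\<^esub> y \<in> carrier G"
  shows "H \<cong> G"
proof (rule is_isoI, rule isoI)
  let ?g = "inv_into (carrier G) h"
  have bij: "bij_betw h (carrier G) (carrier H)" and hm: "\<And>x y. x \<in> carrier G \<Longrightarrow> y \<in> carrier G \<Longrightarrow> h (x \<otimes>\<^bsub>G\<^esub> y) = h x \<otimes>\<^bsub>H\<^esub> h y"
    using h by (auto simp: iso_def hom_def)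
  show g: "bij_betw ?g (carrier H) (carrier G)" by (rule bij_betw_inv_into[OF bij])
  show "?g \<in> hom H G"
  proof (rule homI)
    fix x y assume xy: "x \<in> carrier H" "y \<in> carrier H"
    note c = bij_betw_apply[OF g xy(1)] bij_betw_apply[OF g xy(2)]
    show "?g x \<in> carrier G" by (rule c(1))
    show "?g (x \<otimes>\<^bsub>H\<^esub> y) = ?g x \<otimes>\<^bsub>G\<^esub> ?g y"
      using bij_betw_inv_into_left[OF bij cl[OF c]]
      by (simp only: hm[OF c] bij_betw_inv_into_right[OF bij xy(1)] bij_betw_inv_into_right[OF bij xy(2)])
  qed
qed

lemma (in char5) group_algebra_structure:
  fixes F (structure)
  assumes F: "cring F" "finite (carrier F)" and \<iota>: "\<iota> \<in> ring_hom F R"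
    and \<zeta>: "\<zeta> \<in> carrier R" "\<zeta> [^]\<^bsub>R\<^esub> (3::nat) = \<one>\<^bsub>R\<^esub>"
    and card: "card (carrier R) = card (carrier F) ^ 3"
    and indep: "\<And>x0 x1 x2. x0 \<in> carrier F \<Longrightarrow> x1 \<in> carrier F \<Longrightarrow> x2 \<in> carrier F \<Longrightarrow>
      \<iota> x0 \<oplus>\<^bsub>R\<^esub> (\<iota> x1 \<otimes>\<^bsub>R\<^esub> \<zeta> \<oplus>\<^bsub>R\<^esub> \<iota> x2 \<otimes>\<^bsub>R\<^esub> (\<zeta> \<otimes>\<^bsub>R\<^esub> \<zeta>)) = \<zero>\<^bsub>R\<^esub> \<Longrightarrow> x0 = \<zero> \<and> x1 = \<zero> \<and> x2 = \<zero>"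
    and J: "jacobson_radical R \<subseteq> {\<zero>\<^bsub>R\<^esub>}" and q: "card (carrier F) = 5 ^ k"
    and H: "units_of R \<times>\<times> units_of R \<cong> H"
  defines "V \<equiv> (units_of (group_algebra F C3D10))\<lparr>carrier :=
    \<one>\<^bsub>group_algebra F C3D10\<^esub> <+\<^bsub>group_algebra F C3D10\<^esub> jacobson_radical (group_algebra F C3D10)\<rparr>"
  shows "iso_semidirect (units_of (group_algebra F C3D10)) V H"
    and "\<exists>\<phi> \<in> hom (Cyc 5 \<^bold>^ (6 * k)) (AutoGroup (Cyc 5 \<^bold>^ (15 * k))).
      iso_semidirect V (semidirect_product (Cyc 5 \<^bold>^ (15 * k)) (Cyc 5 \<^bold>^ (6 * k)) \<phi>) (Cyc 5 \<^bold>^ (3 * k))"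
    and "center_group V \<cong> Cyc 5 \<^bold>^ (9 * k)"
proof -
  obtain \<Theta> where \<Theta>: "\<Theta> \<in> ring_iso (group_algebra F C3D10) T" and ring: "ring (group_algebra F C3D10)"
    and U: "\<Theta> \<in> iso (units_of (group_algebra F C3D10)) (units_of T)"
    by (rule group_algebra_ring_iso[OF F \<iota> \<zeta> card indep])
  have V: "\<Theta> \<in> iso V W" unfolding V_def by (rule one_plus_radical_iso(1)[OF ring \<Theta> J])
  have cl: "x \<otimes>\<^bsub>V\<^esub> y \<in> carrier V" if "x \<in> carrier V" "y \<in> carrier V" for x y
    using one_plus_radical_iso(2)[OF ring \<Theta> J, of x y] that by (simp add: V_def units_of_def)
  have n: "card (carrier R) = 5 ^ (3 * k)" unfolding card q by (simp add: mult.commute flip: power_mult)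
  have W: "W \<cong> V" by (rule is_iso_sym_closed[OF V cl])
  show "iso_semidirect (units_of (group_algebra F C3D10)) V H"
    by (rule iso_semidirect_trans[OF is_isoI[OF U] iso_semidirect_cong[OF units_T_iso_semidirect W_group _ W H]])
       (rule DirProd_group R.units_group)+
  \<comment> \<open>Since \<open>R\<close> has \<open>5^(3 k)\<close> elements, the exponents 5, 2,
    1 of \<open>W\<close> and 3 of its centre are multiplied by \<open>3 k\<close>.\<close>
  have "5 * (3 * k) = 15 * k" "2 * (3 * k) = 6 * k" "3 * (3 * k) = 9 * k" by simp_all
  note W_structure[OF n, unfolded this] center_W_iso[OF n, unfolded this]
  note s = this
  show "\<exists>\<phi> \<in> hom (Cyc 5 \<^bold>^ (6 * k)) (AutoGroup (Cyc 5 \<^bold>^ (15 * k))).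
      iso_semidirect V (semidirect_product (Cyc 5 \<^bold>^ (15 * k)) (Cyc 5 \<^bold>^ (6 * k)) \<phi>) (Cyc 5 \<^bold>^ (3 * k))"
    using s(1) iso_semidirect_trans[OF is_isoI[OF V]] by blast
  show "center_group V \<cong> Cyc 5 \<^bold>^ (9 * k)"
    by (rule iso_trans[OF is_isoI[OF center_group_iso[OF V cl]] s(2)])
qed

lemma char5_RDirProd:
  assumes "char5 R" "char5 S"
  shows "char5 (RDirProd R S)"
proof -
  interpret R: char5 R by fact
  interpret S: char5 S by fact
  interpret P: cring "RDirProd R S" by (rule RDirProd_cring[OF R.R.cring_axioms S.R.cring_axioms])
  show ?thesis
    by unfold_locales (simp_all add: RDirProd_of_int R.R.ring_axioms S.R.ring_axioms R.five S.five R.fin S.fin)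
qed

context quadratic_extension
begin

text \<open>The root exists in \<open>K\<close> because 3 divides \<open>(q + 1) (q - 1)\<close>; it
  is not in \<open>F\<close> because 3 is then prime to \<open>q - 1\<close>.\<close>

lemma cube_root_outside_base:
  assumes three: "3 dvd card (carrier F) + 1"
  obtains \<omega> where "\<omega> \<in> carrier K" "\<omega> [^]\<^bsub>K\<^esub> (3::nat) = \<one>\<^bsub>K\<^esub>" "\<omega> \<noteq> \<one>\<^bsub>K\<^esub>" "\<omega> \<notin> \<iota> ` carrier F"
proof -
  have "3 dvd card (carrier K) - 1" unfolding cardK_factor using three by (rule dvd_mult2)
  then obtain \<omega> where \<omega>: "\<omega> \<in> carrier K" "\<omega> [^]\<^bsub>K\<^esub> (3::nat) = \<one>\<^bsub>K\<^esub>" "\<omega> \<noteq> \<one>\<^bsub>K\<^esub>"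
    by (rule K.prime_root_exists[OF finK]) simp
  have "\<not> 3 dvd card (carrier F) - 1" using three cardF_ge by presburger
  then have cop: "coprime 3 (card (carrier F) - 1)" by (intro prime_imp_coprime) simp_all
  have "\<omega> \<notin> \<iota> ` carrier F"
  proof
    assume "\<omega> \<in> \<iota> ` carrier F"
    then obtain a where a: "a \<in> carrier F" "\<omega> = \<iota> a" by blast
    have "\<iota> (a [^]\<^bsub>F\<^esub> (3::nat)) = \<iota> \<one>\<^bsub>F\<^esub>" using \<omega>(2) a by (simp add: numeral_3_eq_3)
    then have "a [^]\<^bsub>F\<^esub> (3::nat) = \<one>\<^bsub>F\<^esub>" using a(1) by (intro inj_onD[OF inj]) simp_all
    then have "a = \<one>\<^bsub>F\<^esub>" using F.root_trivial[OF finF a(1) _ cop] by simp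
    then show False using \<omega>(3) a(2) by simp
  qed
  then show ?thesis using \<omega> that by blast
qed

lemma golden_outside_base:
  assumes "odd (card (carrier F))" "\<guillemotleft>2\<guillemotright>\<^bsub>F\<^esub> \<noteq> \<zero>\<^bsub>F\<^esub>" "\<guillemotleft>5\<guillemotright>\<^bsub>F\<^esub> \<noteq> \<zero>\<^bsub>F\<^esub>" "\<not> 5 dvd card (carrier K) - 1"
  obtains \<tau> where "\<tau> \<in> carrier K" "\<tau> \<otimes>\<^bsub>K\<^esub> \<tau> = \<one>\<^bsub>K\<^esub> \<ominus>\<^bsub>K\<^esub> \<tau>" "\<tau> \<notin> \<iota> ` carrier F"
proof -
  obtain \<tau> where \<tau>: "\<tau> \<in> carrier K" "\<tau> \<otimes>\<^bsub>K\<^esub> \<tau> = \<one>\<^bsub>K\<^esub> \<ominus>\<^bsub>K\<^esub> \<tau>" using golden_in_extension[OF assms(1,2)] by blast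
  have "\<tau> \<notin> \<iota> ` carrier F"
  proof
    assume "\<tau> \<in> \<iota> ` carrier F"
    then obtain t where t: "t \<in> carrier F" "\<tau> = \<iota> t" by blast
    then have "\<iota> (t \<otimes>\<^bsub>F\<^esub> t) = \<iota> (\<one>\<^bsub>F\<^esub> \<ominus>\<^bsub>F\<^esub> t)" using \<tau>(2) by (simp add: iota_minus)
    then have "t \<otimes>\<^bsub>F\<^esub> t = \<one>\<^bsub>F\<^esub> \<ominus>\<^bsub>F\<^esub> t" using t(1) by (intro inj_onD[OF inj]) simp_all
    then show False using golden_not_in_base[OF assms t(1)] by blast
  qed
  then show ?thesis using \<tau> that by blast
qed

text \<open>With \<omega> in \<open>F\<close>, evaluation at
  \<open>(1, \<omega>, \<omega>^2)\<close> identifies the group algebra of \<open>C_3\<close> with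
  three copies of \<open>F\<close>; the units of \<open>R\<close> taken twice give six cyclic
  factors.\<close>

lemma char5_case_1:
  assumes five: "\<guillemotleft>5\<guillemotright>\<^bsub>F\<^esub> = \<zero>\<^bsub>F\<^esub>" and three: "3 dvd card (carrier F) - 1" and q: "card (carrier F) = 5 ^ k"
  defines "V \<equiv> (units_of (group_algebra F C3D10))\<lparr>carrier :=
    \<one>\<^bsub>group_algebra F C3D10\<^esub> <+\<^bsub>group_algebra F C3D10\<^esub> jacobson_radical (group_algebra F C3D10)\<rparr>"
  shows "iso_semidirect (units_of (group_algebra F C3D10)) V (Cyc (5 ^ k - 1) \<^bold>^ 6)"
    and "\<exists>\<phi> \<in> hom (Cyc 5 \<^bold>^ (6 * k)) (AutoGroup (Cyc 5 \<^bold>^ (15 * k))).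
      iso_semidirect V (semidirect_product (Cyc 5 \<^bold>^ (15 * k)) (Cyc 5 \<^bold>^ (6 * k)) \<phi>) (Cyc 5 \<^bold>^ (3 * k))"
    and "center_group V \<cong> Cyc 5 \<^bold>^ (9 * k)"
proof -
  obtain \<omega> where \<omega>: "\<omega> \<in> carrier F" "\<omega> [^]\<^bsub>F\<^esub> (3::nat) = \<one>\<^bsub>F\<^esub>" "\<omega> \<noteq> \<one>\<^bsub>F\<^esub>"
    by (rule F.prime_root_exists[OF finF three]) simp
  let ?R = "RDirProd F (RDirProd F F)"
  let ?\<zeta> = "(\<one>\<^bsub>F\<^esub>, \<omega>, \<omega> \<otimes>\<^bsub>F\<^esub> \<omega>)"
  have c: "char5 F" by unfold_locales (rule five finF)+
  interpret R: char5 ?R by (intro char5_RDirProd c)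
  have \<omega>3: "\<omega> \<otimes>\<^bsub>F\<^esub> \<omega> \<otimes>\<^bsub>F\<^esub> \<omega> = \<one>\<^bsub>F\<^esub>" using \<omega>(1,2) by (simp add: numeral_3_eq_3)
  have "(\<omega> \<otimes>\<^bsub>F\<^esub> \<omega>) \<otimes>\<^bsub>F\<^esub> (\<omega> \<otimes>\<^bsub>F\<^esub> \<omega>) \<otimes>\<^bsub>F\<^esub> (\<omega> \<otimes>\<^bsub>F\<^esub> \<omega>) = (\<omega> \<otimes>\<^bsub>F\<^esub> \<omega> \<otimes>\<^bsub>F\<^esub> \<omega>) \<otimes>\<^bsub>F\<^esub> (\<omega> \<otimes>\<^bsub>F\<^esub> \<omega> \<otimes>\<^bsub>F\<^esub> \<omega>)"
    using \<omega>(1) by (simp add: F.m_assoc)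
  then have \<zeta>3: "?\<zeta> [^]\<^bsub>?R\<^esub> (3::nat) = \<one>\<^bsub>?R\<^esub>" using \<omega>(1) by (simp add: numeral_3_eq_3 \<omega>3)
  have \<iota>': "(\<lambda>a. (a, a, a)) \<in> ring_hom F ?R" by (rule ring_hom_memI) simp_all
  have J: "jacobson_radical ?R \<subseteq> {\<zero>\<^bsub>?R\<^esub>}"
    by (intro jacobson_radical_RDirProd RDirProd_ring F.ring_axioms F.jacobson_radical_field)
  have cR: "card (carrier ?R) = card (carrier F) ^ 3" by (simp add: card_cartesian_product power3_eq_cube)
  have \<zeta>: "?\<zeta> \<in> carrier ?R" using \<omega>(1) by simp
  have indep: "x0 = \<zero>\<^bsub>F\<^esub> \<and> x1 = \<zero>\<^bsub>F\<^esub> \<and> x2 = \<zero>\<^bsub>F\<^esub>"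
    if x: "x0 \<in> carrier F" "x1 \<in> carrier F" "x2 \<in> carrier F"
      and eq: "(x0, x0, x0) \<oplus>\<^bsub>?R\<^esub> ((x1, x1, x1) \<otimes>\<^bsub>?R\<^esub> ?\<zeta> \<oplus>\<^bsub>?R\<^esub> (x2, x2, x2) \<otimes>\<^bsub>?R\<^esub> (?\<zeta> \<otimes>\<^bsub>?R\<^esub> ?\<zeta>)) = \<zero>\<^bsub>?R\<^esub>" for x0 x1 x2
    by (rule F.three_characters[OF \<omega> x]) (use eq in \<open>simp_all only: RDirProd_simps prod.inject\<close>)
  have "units_of ?R \<cong> Cyc (5 ^ k - 1) \<^bold>^ 3"
    unfolding units_of_RDirProd using F.units_of_finite_field_iso[OF finF] unfolding q
    by (intro iso_trans[OF _ power_three_iso] DirProd_cong_iso)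
  then have "units_of ?R \<times>\<times> units_of ?R \<cong> Cyc (5 ^ k - 1) \<^bold>^ (3 + 3)"
    by (intro iso_trans[OF _ power_add_iso] DirProd_cong_iso)
  then have H: "units_of ?R \<times>\<times> units_of ?R \<cong> Cyc (5 ^ k - 1) \<^bold>^ 6" by simp
  note s = R.group_algebra_structure[OF F.cring_axioms finF \<iota>' _ \<zeta>3 cR _ J q H, folded V_def]
  show "iso_semidirect (units_of (group_algebra F C3D10)) V (Cyc (5 ^ k - 1) \<^bold>^ 6)"
    by (rule s(1)[OF \<zeta> indep])
  show "\<exists>\<phi> \<in> hom (Cyc 5 \<^bold>^ (6 * k)) (AutoGroup (Cyc 5 \<^bold>^ (15 * k))).
      iso_semidirect V (semidirect_product (Cyc 5 \<^bold>^ (15 * k)) (Cyc 5 \<^bold>^ (6 * k)) \<phi>) (Cyc 5 \<^bold>^ (3 * k))"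
    by (rule s(2)[OF \<zeta> indep])
  show "center_group V \<cong> Cyc 5 \<^bold>^ (9 * k)" by (rule s(3)[OF \<zeta> indep])
qed

text \<open>With \<omega> only in \<open>K\<close>, evaluation at \<open>(1, \<omega>)\<close>
  identifies the group algebra of \<open>C_3\<close> with the product of \<open>F\<close> and
  \<open>K\<close>.\<close>

lemma char5_case_2:
  assumes five: "\<guillemotleft>5\<guillemotright>\<^bsub>F\<^esub> = \<zero>\<^bsub>F\<^esub>" and three: "\<guillemotleft>3\<guillemotright>\<^bsub>F\<^esub> \<noteq> \<zero>\<^bsub>F\<^esub>" "3 dvd card (carrier F) + 1"
    and q: "card (carrier F) = 5 ^ k"
  defines "V \<equiv> (units_of (group_algebra F C3D10))\<lparr>carrier :=
    \<one>\<^bsub>group_algebra F C3D10\<^esub> <+\<^bsub>group_algebra F C3D10\<^esub> jacobson_radical (group_algebra F C3D10)\<rparr>"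
  shows "iso_semidirect (units_of (group_algebra F C3D10)) V (Cyc (5 ^ k - 1) \<^bold>^ 2 \<times>\<times> Cyc (5 ^ (2 * k) - 1) \<^bold>^ 2)"
    and "\<exists>\<phi> \<in> hom (Cyc 5 \<^bold>^ (6 * k)) (AutoGroup (Cyc 5 \<^bold>^ (15 * k))).
      iso_semidirect V (semidirect_product (Cyc 5 \<^bold>^ (15 * k)) (Cyc 5 \<^bold>^ (6 * k)) \<phi>) (Cyc 5 \<^bold>^ (3 * k))"
    and "center_group V \<cong> Cyc 5 \<^bold>^ (9 * k)"
proof -
  obtain \<omega> where \<omega>: "\<omega> \<in> carrier K" "\<omega> [^]\<^bsub>K\<^esub> (3::nat) = \<one>\<^bsub>K\<^esub>" "\<omega> \<notin> \<iota> ` carrier F"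
    by (rule cube_root_outside_base[OF three(2)])
  let ?R = "RDirProd F K"
  let ?\<zeta> = "(\<one>\<^bsub>F\<^esub>, \<omega>)"
  have "char5 F" by unfold_locales (rule five finF)+
  moreover have "\<guillemotleft>5\<guillemotright>\<^bsub>K\<^esub> = \<zero>\<^bsub>K\<^esub>" using iota_of_int[of 5] by (simp add: five)
  then have "char5 K" by unfold_locales (assumption | rule finK)+
  ultimately interpret R: char5 ?R by (rule char5_RDirProd)
  have \<omega>3: "\<omega> \<otimes>\<^bsub>K\<^esub> \<omega> \<otimes>\<^bsub>K\<^esub> \<omega> = \<one>\<^bsub>K\<^esub>" using \<omega>(1,2) by (simp add: numeral_3_eq_3)
  then have \<zeta>3: "?\<zeta> [^]\<^bsub>?R\<^esub> (3::nat) = \<one>\<^bsub>?R\<^esub>" using \<omega>(1) by (simp add: numeral_3_eq_3)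
  have \<iota>': "(\<lambda>a. (a, \<iota> a)) \<in> ring_hom F ?R" by (rule ring_hom_memI) simp_all
  have J: "jacobson_radical ?R \<subseteq> {\<zero>\<^bsub>?R\<^esub>}"
    by (rule jacobson_radical_RDirProd F.ring_axioms K.ring_axioms F.jacobson_radical_field K.jacobson_radical_field)+
  have cR: "card (carrier ?R) = card (carrier F) ^ 3"
    by (simp add: card_cartesian_product cardK power3_eq_cube power2_eq_square)
  have \<zeta>: "?\<zeta> \<in> carrier ?R" using \<omega>(1) by simp
  have indep: "x0 = \<zero>\<^bsub>F\<^esub> \<and> x1 = \<zero>\<^bsub>F\<^esub> \<and> x2 = \<zero>\<^bsub>F\<^esub>"
    if x: "x0 \<in> carrier F" "x1 \<in> carrier F" "x2 \<in> carrier F"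
      and eq: "(x0, \<iota> x0) \<oplus>\<^bsub>?R\<^esub> ((x1, \<iota> x1) \<otimes>\<^bsub>?R\<^esub> ?\<zeta> \<oplus>\<^bsub>?R\<^esub> (x2, \<iota> x2) \<otimes>\<^bsub>?R\<^esub> (?\<zeta> \<otimes>\<^bsub>?R\<^esub> ?\<zeta>)) = \<zero>\<^bsub>?R\<^esub>" for x0 x1 x2
    by (rule character_pair[OF F.field_axioms K.field_axioms \<iota> \<omega> three(1) x]) (use eq in \<open>simp_all only: RDirProd_simps prod.inject\<close>)
  have "card (carrier K) = 5 ^ (2 * k)" unfolding cardK q by (simp add: mult.commute flip: power_mult)
  then have "units_of ?R \<cong> Cyc (5 ^ k - 1) \<times>\<times> Cyc (5 ^ (2 * k) - 1)"
    unfolding units_of_RDirProd using F.units_of_finite_field_iso[OF finF] K.units_of_finite_field_iso[OF finK] unfolding q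
    by (intro DirProd_cong_iso) simp_all
  from DirProd_cong_iso[OF this this]
  have H: "units_of ?R \<times>\<times> units_of ?R \<cong> Cyc (5 ^ k - 1) \<^bold>^ 2 \<times>\<times> Cyc (5 ^ (2 * k) - 1) \<^bold>^ 2"
    by (rule iso_trans[OF _ iso_trans[OF DirProd_interchange_iso DirProd_cong_iso[OF power_two_iso power_two_iso]]])
  note s = R.group_algebra_structure[OF F.cring_axioms finF \<iota>' _ \<zeta>3 cR _ J q H, folded V_def]
  show "iso_semidirect (units_of (group_algebra F C3D10)) V (Cyc (5 ^ k - 1) \<^bold>^ 2 \<times>\<times> Cyc (5 ^ (2 * k) - 1) \<^bold>^ 2)"
    by (rule s(1)[OF \<zeta> indep])
  show "\<exists>\<phi> \<in> hom (Cyc 5 \<^bold>^ (6 * k)) (AutoGroup (Cyc 5 \<^bold>^ (15 * k))).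
      iso_semidirect V (semidirect_product (Cyc 5 \<^bold>^ (15 * k)) (Cyc 5 \<^bold>^ (6 * k)) \<phi>) (Cyc 5 \<^bold>^ (3 * k))"
    by (rule s(2)[OF \<zeta> indep])
  show "center_group V \<cong> Cyc 5 \<^bold>^ (9 * k)" by (rule s(3)[OF \<zeta> indep])
qed

text \<open>The congruences become membership: 3 dividing \<open>q - 1\<close> puts \<omega> into
  \<open>F\<close>, and 5 dividing \<open>q - 1\<close> or \<open>q + 1\<close> puts \<tau>
  there.\<close>

lemma units_iso_odd_11:
  assumes two: "\<guillemotleft>2\<guillemotright>\<^bsub>F\<^esub> \<noteq> \<zero>\<^bsub>F\<^esub>" and five: "\<guillemotleft>5\<guillemotright>\<^bsub>F\<^esub> \<noteq> \<zero>\<^bsub>F\<^esub>"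
    and three: "3 dvd card (carrier F) - 1" and pm: "5 dvd card (carrier F) - 1 \<or> 5 dvd card (carrier F) + 1"
  shows "units_of (group_algebra F C3D10) \<cong> Cyc (card (carrier F) - 1) \<^bold>^ 6 \<times>\<times> GL 2 F \<^bold>^ 6"
proof -
  obtain \<omega> where \<omega>: "\<omega> \<in> carrier F" "\<omega> [^]\<^bsub>F\<^esub> (3::nat) = \<one>\<^bsub>F\<^esub>" "\<omega> \<noteq> \<one>\<^bsub>F\<^esub>"
    by (rule F.prime_root_exists[OF finF three]) simp
  obtain \<tau> where \<tau>: "\<tau> \<in> carrier F" "\<tau> \<otimes>\<^bsub>F\<^esub> \<tau> = \<one>\<^bsub>F\<^esub> \<ominus>\<^bsub>F\<^esub> \<tau>" using golden_in_base[OF pm] by blast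
  let ?A = "units_of (C2_algebra F)"
  note A = F.units_C2_algebra_odd_cyclic[OF finF two]
  have "?A \<times>\<times> ?A \<times>\<times> ?A \<cong> Cyc (card (carrier F) - 1) \<^bold>^ (3 * 2)"
    by (rule iso_trans[OF DirProd_cong_iso[OF A DirProd_cong_iso[OF A A]] power_triple_iso])
  then have "?A \<times>\<times> ?A \<times>\<times> ?A \<cong> Cyc (card (carrier F) - 1) \<^bold>^ 6" by simp
  then show ?thesis
    by (intro iso_trans[OF units_split_case_11[OF \<omega> \<tau> five] DirProd_cong_iso[OF _ iso_refl]])
qed

lemma units_iso_odd_12:
  assumes odd: "odd (card (carrier F))" and two: "\<guillemotleft>2\<guillemotright>\<^bsub>F\<^esub> \<noteq> \<zero>\<^bsub>F\<^esub>" and five: "\<guillemotleft>5\<guillemotright>\<^bsub>F\<^esub> \<noteq> \<zero>\<^bsub>F\<^esub>"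
    and three: "3 dvd card (carrier F) - 1" and pm: "\<not> 5 dvd card (carrier K) - 1"
  shows "units_of (group_algebra F C3D10) \<cong> Cyc (card (carrier F) - 1) \<^bold>^ 6 \<times>\<times> GL 2 K \<^bold>^ 3"
proof -
  obtain \<omega> where \<omega>: "\<omega> \<in> carrier F" "\<omega> [^]\<^bsub>F\<^esub> (3::nat) = \<one>\<^bsub>F\<^esub>" "\<omega> \<noteq> \<one>\<^bsub>F\<^esub>"
    by (rule F.prime_root_exists[OF finF three]) simp
  obtain \<tau> where \<tau>: "\<tau> \<in> carrier K" "\<tau> \<otimes>\<^bsub>K\<^esub> \<tau> = \<one>\<^bsub>K\<^esub> \<ominus>\<^bsub>K\<^esub> \<tau>" "\<tau> \<notin> \<iota> ` carrier F"
    using golden_outside_base[OF odd two five pm] .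
  let ?A = "units_of (C2_algebra F)"
  note A = F.units_C2_algebra_odd_cyclic[OF finF two]
  have "?A \<times>\<times> ?A \<times>\<times> ?A \<cong> Cyc (card (carrier F) - 1) \<^bold>^ (3 * 2)"
    by (rule iso_trans[OF DirProd_cong_iso[OF A DirProd_cong_iso[OF A A]] power_triple_iso])
  then have "?A \<times>\<times> ?A \<times>\<times> ?A \<cong> Cyc (card (carrier F) - 1) \<^bold>^ 6" by simp
  then show ?thesis
    by (intro iso_trans[OF units_split_case_12[OF \<omega> \<tau> five] DirProd_cong_iso[OF _ iso_refl]])
qed

lemma units_iso_odd_21:
  assumes two: "\<guillemotleft>2\<guillemotright>\<^bsub>F\<^esub> \<noteq> \<zero>\<^bsub>F\<^esub>" and three: "\<guillemotleft>3\<guillemotright>\<^bsub>F\<^esub> \<noteq> \<zero>\<^bsub>F\<^esub>" and five: "\<guillemotleft>5\<guillemotright>\<^bsub>F\<^esub> \<noteq> \<zero>\<^bsub>F\<^esub>"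
    and three': "3 dvd card (carrier F) + 1" and pm: "5 dvd card (carrier F) - 1 \<or> 5 dvd card (carrier F) + 1"
  shows "units_of (group_algebra F C3D10) \<cong>
    Cyc (card (carrier F) - 1) \<^bold>^ 2 \<times>\<times> Cyc (card (carrier K) - 1) \<^bold>^ 2 \<times>\<times> GL 2 F \<^bold>^ 2 \<times>\<times> GL 2 K \<^bold>^ 2"
proof -
  obtain \<omega> where \<omega>: "\<omega> \<in> carrier K" "\<omega> [^]\<^bsub>K\<^esub> (3::nat) = \<one>\<^bsub>K\<^esub>" "\<omega> \<notin> \<iota> ` carrier F"
    by (rule cube_root_outside_base[OF three'])
  obtain \<tau> where \<tau>: "\<tau> \<in> carrier F" "\<tau> \<otimes>\<^bsub>F\<^esub> \<tau> = \<one>\<^bsub>F\<^esub> \<ominus>\<^bsub>F\<^esub> \<tau>" using golden_in_base[OF pm] by blast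
  show ?thesis
    by (rule iso_trans[OF units_split_case_21[OF \<omega> three \<tau> five] iso_trans[OF DirProd_cong_iso[OF DirProd_cong_iso[OF
          F.units_C2_algebra_odd_cyclic[OF finF two] K.units_C2_algebra_odd_cyclic[OF finK of_int_nonzero[OF two]]] iso_refl]
          DirProd_assoc_iso]])
qed

lemma units_iso_odd_22:
  assumes odd: "odd (card (carrier F))" and two: "\<guillemotleft>2\<guillemotright>\<^bsub>F\<^esub> \<noteq> \<zero>\<^bsub>F\<^esub>" and three: "\<guillemotleft>3\<guillemotright>\<^bsub>F\<^esub> \<noteq> \<zero>\<^bsub>F\<^esub>"
    and five: "\<guillemotleft>5\<guillemotright>\<^bsub>F\<^esub> \<noteq> \<zero>\<^bsub>F\<^esub>"
    and three': "3 dvd card (carrier F) + 1" and pm: "\<not> 5 dvd card (carrier K) - 1"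
  shows "units_of (group_algebra F C3D10) \<cong>
    Cyc (card (carrier F) - 1) \<^bold>^ 2 \<times>\<times> Cyc (card (carrier K) - 1) \<^bold>^ 2 \<times>\<times> GL 2 K \<^bold>^ 3"
proof -
  obtain \<omega> where \<omega>: "\<omega> \<in> carrier K" "\<omega> [^]\<^bsub>K\<^esub> (3::nat) = \<one>\<^bsub>K\<^esub>" "\<omega> \<notin> \<iota> ` carrier F"
    by (rule cube_root_outside_base[OF three'])
  obtain \<tau> where \<tau>: "\<tau> \<in> carrier K" "\<tau> \<otimes>\<^bsub>K\<^esub> \<tau> = \<one>\<^bsub>K\<^esub> \<ominus>\<^bsub>K\<^esub> \<tau>" "\<tau> \<notin> \<iota> ` carrier F"
    using golden_outside_base[OF odd two five pm] .
  show ?thesis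
    by (rule iso_trans[OF units_split_case_22[OF \<omega> three \<tau> five] iso_trans[OF DirProd_cong_iso[OF DirProd_cong_iso[OF
          F.units_C2_algebra_odd_cyclic[OF finF two] K.units_C2_algebra_odd_cyclic[OF finK of_int_nonzero[OF two]]] iso_refl]
          DirProd_assoc_iso]])
qed

lemma units_iso_char2_11:
  assumes two: "\<guillemotleft>2\<guillemotright>\<^bsub>F\<^esub> = \<zero>\<^bsub>F\<^esub>" and five: "\<guillemotleft>5\<guillemotright>\<^bsub>F\<^esub> \<noteq> \<zero>\<^bsub>F\<^esub>"
    and q: "card (carrier F) = 2 ^ k" and three: "3 dvd card (carrier F) - 1"
  shows "units_of (group_algebra F C3D10) \<cong> Cyc 2 \<^bold>^ (3 * k) \<times>\<times> (Cyc (2 ^ k - 1) \<^bold>^ 3 \<times>\<times> GL 2 F \<^bold>^ 6)"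
proof -
  obtain \<omega> where \<omega>: "\<omega> \<in> carrier F" "\<omega> [^]\<^bsub>F\<^esub> (3::nat) = \<one>\<^bsub>F\<^esub>" "\<omega> \<noteq> \<one>\<^bsub>F\<^esub>"
    by (rule F.prime_root_exists[OF finF three]) simp
  have "\<one>\<^bsub>F\<^esub> \<oplus>\<^bsub>F\<^esub> \<one>\<^bsub>F\<^esub> = \<zero>\<^bsub>F\<^esub>" using two by (simp add: F.of_int_2)
  note \<tau> = F.cube_root_golden_char2[OF this \<omega>]
  let ?A = "units_of (C2_algebra F)"
  note A = F.units_C2_algebra_char2_cyclic[OF finF q two]
  from DirProd_cong_iso[OF A DirProd_cong_iso[OF A A]]
  have "?A \<times>\<times> ?A \<times>\<times> ?A \<cong> Cyc 2 \<^bold>^ (3 * k) \<times>\<times> Cyc (2 ^ k - 1) \<^bold>^ 3"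
    by (rule iso_trans[OF _ iso_trans[OF triple_DirProd_iso DirProd_cong_iso[OF power_triple_iso power_three_iso]]])
  then show ?thesis
    by (intro iso_trans[OF units_split_case_11[OF \<omega> \<omega>(1) \<tau> five]] iso_trans[OF DirProd_cong_iso[OF _ iso_refl] DirProd_assoc_iso])
qed

text \<open>The cube root \<omega> outside \<open>F\<close> is used twice, as the character value
  and as \<tau>.\<close>

lemma units_iso_char2_22:
  assumes two: "\<guillemotleft>2\<guillemotright>\<^bsub>F\<^esub> = \<zero>\<^bsub>F\<^esub>" and three: "\<guillemotleft>3\<guillemotright>\<^bsub>F\<^esub> \<noteq> \<zero>\<^bsub>F\<^esub>" and five: "\<guillemotleft>5\<guillemotright>\<^bsub>F\<^esub> \<noteq> \<zero>\<^bsub>F\<^esub>"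
    and q: "card (carrier F) = 2 ^ k" and three': "3 dvd card (carrier F) + 1"
  shows "units_of (group_algebra F C3D10) \<cong>
    Cyc 2 \<^bold>^ (3 * k) \<times>\<times> (Cyc (2 ^ k - 1) \<times>\<times> Cyc (2 ^ (2 * k) - 1) \<times>\<times> GL 2 K \<^bold>^ 3)"
proof -
  obtain \<omega> where \<omega>: "\<omega> \<in> carrier K" "\<omega> [^]\<^bsub>K\<^esub> (3::nat) = \<one>\<^bsub>K\<^esub>" "\<omega> \<noteq> \<one>\<^bsub>K\<^esub>" "\<omega> \<notin> \<iota> ` carrier F"
    by (rule cube_root_outside_base[OF three'])
  have two': "\<guillemotleft>2\<guillemotright>\<^bsub>K\<^esub> = \<zero>\<^bsub>K\<^esub>" using iota_of_int[of 2] by (simp add: two)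
  then have "\<one>\<^bsub>K\<^esub> \<oplus>\<^bsub>K\<^esub> \<one>\<^bsub>K\<^esub> = \<zero>\<^bsub>K\<^esub>" by (simp add: K.of_int_2)
  note \<tau> = K.cube_root_golden_char2[OF this \<omega>(1-3)]
  let ?A = "units_of (C2_algebra F)" and ?B = "units_of (C2_algebra K)"
  have q': "card (carrier K) = 2 ^ (2 * k)" unfolding cardK q by (simp add: mult.commute flip: power_mult)
  from DirProd_cong_iso[OF F.units_C2_algebra_char2_cyclic[OF finF q two] K.units_C2_algebra_char2_cyclic[OF finK q' two']]
  have "?A \<times>\<times> ?B \<cong> Cyc 2 \<^bold>^ (k + 2 * k) \<times>\<times> (Cyc (2 ^ k - 1) \<times>\<times> Cyc (2 ^ (2 * k) - 1))"
    by (rule iso_trans[OF _ iso_trans[OF DirProd_interchange_iso DirProd_cong_iso[OF power_add_iso iso_refl]]])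
  moreover have "k + 2 * k = 3 * k" by simp
  ultimately have "?A \<times>\<times> ?B \<cong> Cyc 2 \<^bold>^ (3 * k) \<times>\<times> (Cyc (2 ^ k - 1) \<times>\<times> Cyc (2 ^ (2 * k) - 1))" by (simp only:)
  from DirProd_cong_iso[OF this iso_refl]
  have "units_of (group_algebra F C3D10) \<cong> (Cyc 2 \<^bold>^ (3 * k) \<times>\<times> (Cyc (2 ^ k - 1) \<times>\<times> Cyc (2 ^ (2 * k) - 1))) \<times>\<times> GL 2 K \<^bold>^ 3"
    by (rule iso_trans[OF units_split_case_22[OF \<omega>(1,2,4) three \<omega>(1) \<tau> \<omega>(4) five]])
  then show ?thesis
    by (rule iso_trans[OF _ iso_trans[OF DirProd_assoc_iso DirProd_cong_iso[OF iso_refl DirProd_assoc_iso]]])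
qed

end

lemma (in cring) GL2_group: "group (GL 2 R)"
  using monoid.units_group[OF ring.is_monoid[OF mat2_ring_ring]] by (simp only: units_of_mat2_ring)

theorem theorem2p1:
  fixes F :: "('a, 'm) ring_scheme"
    and F2 :: "('b, 'n) ring_scheme"
    and G :: "(int \<times> int \<times> int) monoid"
    and FG :: "(int \<times> int \<times> int \<Rightarrow> 'a) ring"
    and U V :: "(int \<times> int \<times> int \<Rightarrow> 'a) monoid"
    and p k q :: nat
  assumes "field F" and "finite (carrier F)"
    and "ring_char F = p" and "card (carrier F) = q" and "q = p ^ k"
    and "field_extension_of_degree 2 F F2"
    and "G = Cyc 3 \<times>\<times> dihedral_group 5"
    and "FG = group_algebra F G"
    and "U = units_of FG"
    and "V = U\<lparr>carrier := \<one>\<^bsub>FG\<^esub> <+\<^bsub>FG\<^esub> jacobson_radical FG\<rparr>"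
  shows
    "(p = 2 \<longrightarrow>
        ([int q = 1] (mod 15) \<or> [int q = 4] (mod 15) \<longrightarrow>
           iso_semidirect U (Cyc 2 \<^bold>^ (3 * k))
             (Cyc (2 ^ k - 1) \<^bold>^ 3 \<times>\<times> GL 2 F \<^bold>^ 6)) \<and>
        ([int q = 2] (mod 15) \<or> [int q = - 7] (mod 15) \<longrightarrow>
           iso_semidirect U (Cyc 2 \<^bold>^ (3 * k))
             (Cyc (2 ^ k - 1) \<times>\<times> Cyc (2 ^ (2 * k) - 1) \<times>\<times> GL 2 F2 \<^bold>^ 3))) \<and>
     (p = 5 \<longrightarrow>
        ([int q = 1] (mod 6) \<longrightarrow>
           iso_semidirect U V (Cyc (5 ^ k - 1) \<^bold>^ 6)) \<and>
        ([int q = - 1] (mod 6) \<longrightarrow>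
           iso_semidirect U V (Cyc (5 ^ k - 1) \<^bold>^ 2 \<times>\<times> Cyc (5 ^ (2 * k) - 1) \<^bold>^ 2)) \<and>
        (\<exists>\<phi> \<in> hom (Cyc 5 \<^bold>^ (6 * k)) (AutoGroup (Cyc 5 \<^bold>^ (15 * k))).
           iso_semidirect V
             (semidirect_product (Cyc 5 \<^bold>^ (15 * k)) (Cyc 5 \<^bold>^ (6 * k)) \<phi>)
             (Cyc 5 \<^bold>^ (3 * k))) \<and>
        center_group V \<cong> Cyc 5 \<^bold>^ (9 * k)) \<and>
     (p > 5 \<longrightarrow>
        ([int q = 1] (mod 30) \<or> [int q = - 11] (mod 30) \<longrightarrow>
           U \<cong> Cyc (p ^ k - 1) \<^bold>^ 6 \<times>\<times> GL 2 F \<^bold>^ 6) \<and>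
        ([int q = - 1] (mod 30) \<or> [int q = 11] (mod 30) \<longrightarrow>
           U \<cong> Cyc (p ^ k - 1) \<^bold>^ 2 \<times>\<times> Cyc (p ^ (2 * k) - 1) \<^bold>^ 2 \<times>\<times>
                 GL 2 F \<^bold>^ 2 \<times>\<times> GL 2 F2 \<^bold>^ 2) \<and>
        ([int q = 7] (mod 30) \<or> [int q = 13] (mod 30) \<longrightarrow>
           U \<cong> Cyc (p ^ k - 1) \<^bold>^ 6 \<times>\<times> GL 2 F2 \<^bold>^ 3) \<and>
        ([int q = - 7] (mod 30) \<or> [int q = - 13] (mod 30) \<longrightarrow>
           U \<cong> Cyc (p ^ k - 1) \<^bold>^ 2 \<times>\<times> Cyc (p ^ (2 * k) - 1) \<^bold>^ 2 \<times>\<times>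
                 GL 2 F2 \<^bold>^ 3))"
proof -
  interpret F: field F by fact
  obtain \<iota> where "\<iota> \<in> ring_hom F F2" "finite (carrier F2)" "card (carrier F2) = card (carrier F) ^ 2"
    by (rule quadratic_extension_card[OF assms(2,6)])
  moreover have "field F2" using assms(6) by (simp add: field_extension_of_degree_def)
  ultimately interpret E: quadratic_extension F F2 \<iota>
    using assms(1,2) by (intro quadratic_extension.intro quadratic_extension_axioms.intro)
  have char: "\<guillemotleft>int n\<guillemotright>\<^bsub>F\<^esub> = \<zero>\<^bsub>F\<^esub> \<longleftrightarrow> p dvd n" for n
    using F.of_int_eq_zero_iff[of n] assms(3) by simp
  have c2: "\<guillemotleft>2\<guillemotright>\<^bsub>F\<^esub> = \<zero>\<^bsub>F\<^esub> \<longleftrightarrow> p dvd 2" and c3: "\<guillemotleft>3\<guillemotright>\<^bsub>F\<^esub> = \<zero>\<^bsub>F\<^esub> \<longleftrightarrow> p dvd 3" and c5: "\<guillemotleft>5\<guillemotright>\<^bsub>F\<^esub> = \<zero>\<^bsub>F\<^esub> \<longleftrightarrow> p dvd 5"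
    using char[of 2] char[of 3] char[of 5] by simp_all
  have q: "card (carrier F) = p ^ k" and q2: "card (carrier F2) = p ^ (2 * k)" and qq: "p ^ k = q"
    using assms(4,5) E.cardK by (simp_all add: mult.commute flip: power_mult)
  have m: "int q mod 6 = int (q mod 6)" "int q mod 15 = int (q mod 15)" "int q mod 30 = int (q mod 30)"
    by (simp_all add: zmod_int)
  have q_ge: "q \<ge> 2" using E.cardF_ge q qq by simp
  have U: "U = units_of (group_algebra F C3D10)"
    and V: "V = (units_of (group_algebra F C3D10))\<lparr>carrier :=
      \<one>\<^bsub>group_algebra F C3D10\<^esub> <+\<^bsub>group_algebra F C3D10\<^esub> jacobson_radical (group_algebra F C3D10)\<rparr>"
    using assms(7-10) by simp_all
  have one: "iso_semidirect U (Cyc 2 \<^bold>^ (3 * k)) (Cyc (2 ^ k - 1) \<^bold>^ 3 \<times>\<times> GL 2 F \<^bold>^ 6)"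
    if p: "p = 2" and mod: "[int q = 1] (mod 15) \<or> [int q = 4] (mod 15)"
  proof -
    \<comment> \<open>The powers of 2 have residues 1, 2, 4, 8 modulo 15. Those treated here are
      congruent to 1 modulo 3; 2 and 8, the residue of -7, are congruent to 2.\<close>
    have r: "q mod 15 = 1 \<or> q mod 15 = 4" using mod by (auto simp: cong_def m)
    have "3 dvd q - 1" using r q_ge by presburger
    then have "U \<cong> Cyc 2 \<^bold>^ (3 * k) \<times>\<times> (Cyc (2 ^ k - 1) \<^bold>^ 3 \<times>\<times> GL 2 F \<^bold>^ 6)"
      unfolding U using p q qq c2 c5 by (intro E.units_iso_char2_11) simp_all
    then show ?thesis
      by (rule iso_semidirect_trans)
         (intro iso_semidirect_DirProd DirProd_group product_group group_integer_mod_group F.GL2_group)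
  qed
  have two: "iso_semidirect U (Cyc 2 \<^bold>^ (3 * k)) (Cyc (2 ^ k - 1) \<times>\<times> Cyc (2 ^ (2 * k) - 1) \<times>\<times> GL 2 F2 \<^bold>^ 3)"
    if p: "p = 2" and mod: "[int q = 2] (mod 15) \<or> [int q = - 7] (mod 15)"
  proof -
    have r: "q mod 15 = 2 \<or> q mod 15 = 8" using mod by (auto simp: cong_def m)
    have "3 dvd q + 1" using r q_ge by presburger
    then have "U \<cong> Cyc 2 \<^bold>^ (3 * k) \<times>\<times> (Cyc (2 ^ k - 1) \<times>\<times> Cyc (2 ^ (2 * k) - 1) \<times>\<times> GL 2 F2 \<^bold>^ 3)"
      unfolding U using p q qq c2 c3 c5 by (intro E.units_iso_char2_22) simp_all
    then show ?thesis
      by (rule iso_semidirect_trans)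
         (intro iso_semidirect_DirProd DirProd_group product_group group_integer_mod_group E.K.GL2_group)
  qed
  have five: "p = 5 \<longrightarrow>
        ([int q = 1] (mod 6) \<longrightarrow>
           iso_semidirect U V (Cyc (5 ^ k - 1) \<^bold>^ 6)) \<and>
        ([int q = - 1] (mod 6) \<longrightarrow>
           iso_semidirect U V (Cyc (5 ^ k - 1) \<^bold>^ 2 \<times>\<times> Cyc (5 ^ (2 * k) - 1) \<^bold>^ 2)) \<and>
        (\<exists>\<phi> \<in> hom (Cyc 5 \<^bold>^ (6 * k)) (AutoGroup (Cyc 5 \<^bold>^ (15 * k))).
           iso_semidirect V
             (semidirect_product (Cyc 5 \<^bold>^ (15 * k)) (Cyc 5 \<^bold>^ (6 * k)) \<phi>)
             (Cyc 5 \<^bold>^ (3 * k))) \<and>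
        center_group V \<cong> Cyc 5 \<^bold>^ (9 * k)"
  proof
    assume p: "p = 5"
    have ch: "\<guillemotleft>5\<guillemotright>\<^bsub>F\<^esub> = \<zero>\<^bsub>F\<^esub>" "\<guillemotleft>3\<guillemotright>\<^bsub>F\<^esub> \<noteq> \<zero>\<^bsub>F\<^esub>" and cF: "card (carrier F) = 5 ^ k" and q5: "q = 5 ^ k"
      using c5 c3 p q qq by simp_all
    \<comment> \<open>Powers of 5 are 1 or -1 modulo 6, so the two cases are exhaustive. This is why
      the claims about \<open>V\<close> and its centre can be stated without a congruence.\<close>
    have "5 ^ k mod 6 = (1::nat) \<or> 5 ^ k mod 6 = (5::nat)"
    proof (induction k)
      case (Suc k)
      then show ?case unfolding power_Suc by presburger
    qed simp
    then consider "q mod 6 = 1" | "q mod 6 = 5" using q5 by blast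
    then show "([int q = 1] (mod 6) \<longrightarrow> iso_semidirect U V (Cyc (5 ^ k - 1) \<^bold>^ 6)) \<and>
        ([int q = - 1] (mod 6) \<longrightarrow> iso_semidirect U V (Cyc (5 ^ k - 1) \<^bold>^ 2 \<times>\<times> Cyc (5 ^ (2 * k) - 1) \<^bold>^ 2)) \<and>
        (\<exists>\<phi> \<in> hom (Cyc 5 \<^bold>^ (6 * k)) (AutoGroup (Cyc 5 \<^bold>^ (15 * k))).
           iso_semidirect V (semidirect_product (Cyc 5 \<^bold>^ (15 * k)) (Cyc 5 \<^bold>^ (6 * k)) \<phi>) (Cyc 5 \<^bold>^ (3 * k))) \<and>
        center_group V \<cong> Cyc 5 \<^bold>^ (9 * k)"
    proof cases
      case 1
      then have "3 dvd q - 1" by presburger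
      have no: "\<not> [int q = - 1] (mod 6)" using 1 by (simp add: cong_def m)
      have "3 dvd card (carrier F) - 1" using \<open>3 dvd q - 1\<close> q5 cF by simp
      note s = E.char5_case_1[OF ch(1) this cF, folded V, folded U]
      show ?thesis by (intro conjI impI s) (rule notE[OF no])
    next
      case 2
      then have "3 dvd q + 1" by presburger
      have no: "\<not> [int q = 1] (mod 6)" using 2 by (simp add: cong_def m)
      have "3 dvd card (carrier F) + 1" using \<open>3 dvd q + 1\<close> q5 cF by simp
      note s = E.char5_case_2[OF ch this cF, folded V, folded U]
      show ?thesis by (intro conjI impI s) (rule notE[OF no])
    qed
  qed
  have big: "\<guillemotleft>2\<guillemotright>\<^bsub>F\<^esub> \<noteq> \<zero>\<^bsub>F\<^esub>" "\<guillemotleft>3\<guillemotright>\<^bsub>F\<^esub> \<noteq> \<zero>\<^bsub>F\<^esub>" "\<guillemotleft>5\<guillemotright>\<^bsub>F\<^esub> \<noteq> \<zero>\<^bsub>F\<^esub>" if "p > 5"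
    using that c2 c3 c5 by (auto dest: dvd_imp_le)
  \<comment> \<open>The order of the multiplicative group of \<open>F2\<close> is
    \<open>(q + 1) (q - 1)\<close>, and 5 is prime.\<close>
  have nd: "\<not> 5 dvd p ^ (2 * k) - 1" if "\<not> 5 dvd q - 1" "\<not> 5 dvd q + 1"
    using that prime_dvd_mult_nat[of 5 "q + 1" "q - 1"] E.cardK_factor unfolding q q2 qq by simp
  \<comment> \<open>The residues modulo 30 encode a residue modulo 3 and a square class modulo 5: 1
    and 19 are 1 modulo 3 and 1 or -1 modulo 5; 29 and 11 are -1 modulo 3 and again 1 or -1 modulo
    5; 7, 13 and then 23, 17 repeat this with 2 or -2 modulo 5.\<close>
  have b11: "U \<cong> Cyc (p ^ k - 1) \<^bold>^ 6 \<times>\<times> GL 2 F \<^bold>^ 6"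
    if p: "p > 5" and mod: "[int q = 1] (mod 30) \<or> [int q = - 11] (mod 30)"
  proof -
    have r: "q mod 30 = 1 \<or> q mod 30 = 19" using mod by (auto simp: cong_def m)
    have "3 dvd q - 1" "5 dvd q - 1 \<or> 5 dvd q + 1" using r q_ge by presburger+
    then show ?thesis unfolding U qq by (rule E.units_iso_odd_11[unfolded q q2 qq, OF big(1,3)[OF p]])
  qed
  have b21: "U \<cong> Cyc (p ^ k - 1) \<^bold>^ 2 \<times>\<times> Cyc (p ^ (2 * k) - 1) \<^bold>^ 2 \<times>\<times> GL 2 F \<^bold>^ 2 \<times>\<times> GL 2 F2 \<^bold>^ 2"
    if p: "p > 5" and mod: "[int q = - 1] (mod 30) \<or> [int q = 11] (mod 30)"
  proof -
    have r: "q mod 30 = 29 \<or> q mod 30 = 11" using mod by (auto simp: cong_def m)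
    have "3 dvd q + 1" "5 dvd q - 1 \<or> 5 dvd q + 1" using r q_ge by presburger+
    then show ?thesis unfolding U qq by (rule E.units_iso_odd_21[unfolded q q2 qq, OF big[OF p]])
  qed
  have b12: "U \<cong> Cyc (p ^ k - 1) \<^bold>^ 6 \<times>\<times> GL 2 F2 \<^bold>^ 3"
    if p: "p > 5" and mod: "[int q = 7] (mod 30) \<or> [int q = 13] (mod 30)"
  proof -
    have r: "q mod 30 = 7 \<or> q mod 30 = 13" using mod by (auto simp: cong_def m)
    have "odd q" "3 dvd q - 1" "\<not> 5 dvd q - 1" "\<not> 5 dvd q + 1" using r q_ge by presburger+
    from this(1,2) nd[OF this(3,4)] show ?thesis
      unfolding U qq by (rule E.units_iso_odd_12[unfolded q q2 qq, OF _ big(1,3)[OF p]])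
  qed
  have b22: "U \<cong> Cyc (p ^ k - 1) \<^bold>^ 2 \<times>\<times> Cyc (p ^ (2 * k) - 1) \<^bold>^ 2 \<times>\<times> GL 2 F2 \<^bold>^ 3"
    if p: "p > 5" and mod: "[int q = - 7] (mod 30) \<or> [int q = - 13] (mod 30)"
  proof -
    have r: "q mod 30 = 23 \<or> q mod 30 = 17" using mod by (auto simp: cong_def m)
    have "odd q" "3 dvd q + 1" "\<not> 5 dvd q - 1" "\<not> 5 dvd q + 1" using r q_ge by presburger+
    from this(1,2) nd[OF this(3,4)] show ?thesis
      unfolding U qq by (rule E.units_iso_odd_22[unfolded q q2 qq, OF _ big[OF p]])
  qed
  show ?thesis
    by (intro conjI impI one two five[rule_format] b11 b21 b12 b22)
qed

end
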